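(* Let $p\ne q$ be primes with $p\equiv q\equiv1\pmod8$ and $\left(\frac qp\right)=1$. Set $$U=\left[\frac pq\right]_4,\quad V=\left[\frac qp\right]_4,\quad R=[2,p,q]_{\mathrm R},\quad e_p=\frac{p-1}8\bmod2,\quad e_q=\frac{q-1}8\bmod2 .$$ Then $u=U$, $v=V$, $\delta=R$, and in $\mathbb F_2$ $$\Pi(p,q)=c_pc_q+c_pU+c_qV+R(U+V),\qquad \Pi_2(p,q)=R+e_pe_q+e_pU+e_qV .$$ Both formulas are independent of auxiliary solutions of norm equations.
   Context: For odd positive $m$ and $(A,m)=1$, $\left[\frac Am\right]\in\mathbb F_2$ is defined by $(-1)^{[A/m]}=\left(\frac Am\right)$ (Jacobi symbol). For a prime $\ell\equiv1\pmod4$ and $(a/\ell)=1$, the additive rational quartic symbol $\left[\frac a\ell\right]_4\in\mathbb F_2$ is defined by $(-1)^{[a/\ell]_4}\equiv a^{(\ell-1)/4}\pmod\ell$. For a prime $\ell\equiv1\pmod8$, $c_\ell=\left[\frac{r_\ell+1}{\ell}\right]$ where $r_\ell^2\equiv2\pmod\ell$ (independent of the root). Rédei symbol (Stevenhagen's additive Rédei symbol, in the case needed): let $K=\mathbb Q(\sqrt2,\sqrt p)$. There is a unique quadratic extension $F/K$, Galois over $\mathbb Q$ with dihedral Galois group of order $8$, cyclic of degree $4$ over $\mathbb Q(\sqrt{2p})$, and unramified over $K$ at all finite primes. The prime $q$ splits completely in $K$, and $[2,p,q]_{\mathrm R}\in\mathbb F_2$ is $0$ if $q$ splits completely in $F$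 and $1$ otherwise. A primitive positive solution means positive integers with greatest common divisor $1$; all solutions below exist. Choose primitive positive solutions of $p\alpha^2+q\beta^2=4\gamma^2$, $p\alpha'^2-q\beta'^2=4\gamma'^2$, $p\alpha''^2-2q\beta''^2=4\gamma''^2$, set $u=\left[\frac{\gamma}{q}\right]$, $v=\left[\frac{\gamma}{p}\right]$, $\delta=\left[\frac{\gamma'\gamma''}{q}\right]$, and $$\Pi(p,q)=c_pc_q+c_pu+c_qv+\delta(u+v)\in\mathbb F_2.$$ Choose primitive positive solutions of $p\alpha_p^2+2q\beta_p^2=4\gamma_p^2$, $q\alpha_q^2+2p\beta_q^2=4\gamma_q^2$, $p\alpha_p'^2-2q\beta_p'^2=4\gamma_p'^2$, $q\alpha_q'^2-2p\beta_q'^2=4\gamma_q'^2$, $p\alpha_p''^2-4q\beta_p''^2=4\gamma_p''^2$, set $u_{\mathrm e}=\left[\frac{\gamma_p}{q}\right]$, $v_{\mathrm e}=\left[\frac{\gamma_p'}{q}\right]$, $\delta_{\mathrm e}=\left[\frac{\gamma_p'\gamma_p''}{q}\right]$, $w_p=c_p+\left[\frac{\gamma_p'}{p}\right]$, $w_q=c_q+\left[\frac{\gamma_q'}{q}\right]$, and $$\Pi_2(p,q)=\delta_{\mathrm e}(u_{\mathrm e}+v_{\mathrm e})+w_pw_q+u_{\mathrm e}v_{\mathrm e}\in\mathbb F_2.$$ ($\Pi$ and $\Pi_2$ are the Pfaffians of the Cassels pairings on the pure $2$-Selmer groups of $y^2=x^3-N^2x$ for $N=pq$ and $N=2pq$,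 respectively.) *)

theory Defs
  imports
    "HOL-Library.Z2"
    "HOL-Algebra.Bij"
    "HOL-Algebra.Elementary_Groups"
    "HOL-Algebra.Embedded_Algebras"
    "HOL-Algebra.Generated_Fields"
    "HOL-Algebra.Ideal_Product"
    "HOL-Algebra.Algebraic_Closure_Type"
    "HOL-Number_Theory.Number_Theory"
    Complex_Main
begin

section \<open>Additive quadratic and quartic residue symbols\<close>

definition Jacobi :: "int \<Rightarrow> nat \<Rightarrow> int" where
  "Jacobi a m = prod_mset (image_mset (\<lambda>r. Legendre a (int r)) (prime_factorization m))"

text \<open>For odd \<open>m\<close> and \<open>a\<close> prime to \<open>m\<close>, the Jacobi symbol is \<open>1\<close> or \<open>-1\<close>, and the additive symbol
  is its exponent. The value is meaningless for other arguments.\<close>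

definition add_Jacobi :: "int \<Rightarrow> nat \<Rightarrow> bit" where
  "add_Jacobi a m = (if Jacobi a m = 1 then 0 else 1)"

text \<open>Likewise meaningful only for a prime \<open>l\<close> congruent to \<open>1\<close> modulo \<open>4\<close> and a quadratic
  residue \<open>a\<close> prime to \<open>l\<close>, when the power below is \<open>1\<close> or \<open>-1\<close> modulo \<open>l\<close>.\<close>

definition add_quartic :: "int \<Rightarrow> nat \<Rightarrow> bit" where
  "add_quartic a l = (if [a ^ ((l - 1) div 4) = 1] (mod int l) then 0 else 1)"

text \<open>For a prime \<open>l\<close> congruent to \<open>1\<close> modulo \<open>8\<close> the choice of the root \<open>r\<close> is immaterial, because
  \<open>(r + 1) (- r + 1)\<close> is \<open>-1\<close> modulo \<open>l\<close>.\<close>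

definition c_sym :: "nat \<Rightarrow> bit" where
  "c_sym l = add_Jacobi ((SOME r::int. [r\<^sup>2 = 2] (mod int l)) + 1) l"


section \<open>Number fields inside the complex numbers\<close>

abbreviation CC :: "complex ring" where
  "CC \<equiv> ring_of_type_algebra"

definition integers_of :: "complex set \<Rightarrow> complex ring" where
  "integers_of F = CC\<lparr>carrier := {x \<in> F. algebraic_int x}\<rparr>"

definition galois_group :: "complex set \<Rightarrow> complex set \<Rightarrow> (complex \<Rightarrow> complex) monoid" where
  "galois_group K F = (BijGroup F)
     \<lparr>carrier := {\<sigma> \<in> Bij F. \<sigma> \<in> ring_hom (CC\<lparr>carrier := F\<rparr>) (CC\<lparr>carrier := F\<rparr>) \<and>
                           (\<forall>x\<in>K. \<sigma> x = x)}\<rparr>"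

definition galois_extension :: "complex set \<Rightarrow> complex set \<Rightarrow> bool" where
  "galois_extension K F \<longleftrightarrow>
     subfield K CC \<and> subfield F CC \<and> K \<subseteq> F \<and> ring.finite_dimension CC K F \<and>
     {x \<in> F. \<forall>\<sigma>\<in>carrier (galois_group K F). \<sigma> x = x} = K"

text \<open>The pair \<open>(i, b)\<close> stands for \<open>r\<^sup>i s\<^sup>b\<close>, where \<open>r\<close> is a rotation of order \<open>n\<close> and \<open>s\<close> a
  reflection, so \<open>s r s = r\<^sup>-\<^sup>1\<close>. The group has order \<open>2 n\<close>.\<close>

definition dihedral_group :: "nat \<Rightarrow> (int \<times> bool) monoid" where
  "dihedral_group n =
     \<lparr>carrier = {0..<int n} \<times> UNIV,
      monoid.mult = (\<lambda>(i, a) (j, b). ((if a then i - j else i + j) mod int n, a \<noteq> b)),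
      one = (0, False)\<rparr>"

text \<open>For a prime ideal \<open>P\<close> of the integers of \<open>F\<close>, the set \<open>P \<inter> K\<close> is the prime of \<open>K\<close> below \<open>P\<close>.\<close>

definition ramification_index :: "complex set \<Rightarrow> complex set \<Rightarrow> complex set \<Rightarrow> nat" where
  "ramification_index K F P =
     (GREATEST e. genideal (integers_of F) (P \<inter> K) \<subseteq> P [^]\<^bsub>ideals_set (integers_of F)\<^esub> e)"

definition unramified_at_finite_primes :: "complex set \<Rightarrow> complex set \<Rightarrow> bool" where
  "unramified_at_finite_primes K F \<longleftrightarrow>
     (\<forall>P. primeideal P (integers_of F) \<and> P \<noteq> {0} \<longrightarrow> ramification_index K F P = 1)"

text \<open>A rational prime splits completely if the number of primes above it equals the degree.\<close>

definition splits_completely :: "nat \<Rightarrow> complex set \<Rightarrow> bool" where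
  "splits_completely q F \<longleftrightarrow>
     ring.dimension CC (card {P. primeideal P (integers_of F) \<and> of_nat q \<in> P}) \<rat> F"


section \<open>The Redei symbol with first entry 2\<close>

abbreviation csq :: "nat \<Rightarrow> complex" where
  "csq n \<equiv> complex_of_real (sqrt (real n))"

definition redei_extension :: "nat \<Rightarrow> complex set \<Rightarrow> bool" where
  "redei_extension p F \<longleftrightarrow>
     (let K = generate_field CC {csq 2, csq p}; E = generate_field CC {csq (2 * p)} in
        subfield F CC \<and> K \<subseteq> F \<and> ring.dimension CC 2 K F \<and>
        galois_extension \<rat> F \<and> galois_group \<rat> F \<cong> dihedral_group 4 \<and>
        galois_extension E F \<and> cyclic_group (galois_group E F) \<and> Coset.order (galois_group E F) = 4 \<and>
        unramified_at_finite_primes K F)"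

text \<open>An extension that is Galois over the rationals is determined as a subset of the complex
  numbers by its isomorphism class, so uniqueness of the extension justifies the description.\<close>

definition redei_field :: "nat \<Rightarrow> complex set" where
  "redei_field p = (THE F. redei_extension p F)"

definition redei2 :: "nat \<Rightarrow> nat \<Rightarrow> bit" where
  "redei2 p q = (if splits_completely q (redei_field p) then 0 else 1)"


section \<open>Norm equations and the Pfaffians\<close>

definition primitive_solution :: "int \<Rightarrow> int \<Rightarrow> int \<Rightarrow> int \<Rightarrow> int \<Rightarrow> bool" where
  "primitive_solution A B \<alpha> \<beta> \<gamma> \<longleftrightarrow>
     \<alpha> > 0 \<and> \<beta> > 0 \<and> \<gamma> > 0 \<and> Gcd {\<alpha>, \<beta>, \<gamma>} = 1 \<and> A * \<alpha>\<^sup>2 + B * \<beta>\<^sup>2 = 4 * \<gamma>\<^sup>2"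

text \<open>The arguments are those components of the chosen solutions on which the value depends; in the
  second definition the solution of \<open>q \<alpha>\<^sup>2 + 2 p \<beta>\<^sup>2 = 4 \<gamma>\<^sup>2\<close> does not enter.\<close>

definition Pf :: "nat \<Rightarrow> nat \<Rightarrow> int \<Rightarrow> int \<Rightarrow> int \<Rightarrow> bit" where
  "Pf p q \<gamma> \<gamma>' \<gamma>'' =
     (let u = add_Jacobi \<gamma> q; v = add_Jacobi \<gamma> p; \<delta> = add_Jacobi (\<gamma>' * \<gamma>'') q in
        c_sym p * c_sym q + c_sym p * u + c_sym q * v + \<delta> * (u + v))"

definition Pf2 :: "nat \<Rightarrow> nat \<Rightarrow> int \<Rightarrow> int \<Rightarrow> int \<Rightarrow> int \<Rightarrow> bit" where
  "Pf2 p q \<gamma>p \<gamma>p' \<gamma>q' \<gamma>p'' =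
     (let u = add_Jacobi \<gamma>p q; v = add_Jacobi \<gamma>p' q; \<delta> = add_Jacobi (\<gamma>p' * \<gamma>p'') q;
          wp = c_sym p + add_Jacobi \<gamma>p' p; wq = c_sym q + add_Jacobi \<gamma>q' q in
        \<delta> * (u + v) + wp * wq + u * v)"

end

theory Submission
  imports Defs
begin

text \<open>Write \<open>(a/l)\<close> for Legendre symbols, \<open>(a/l)\<^sub>4\<close> for the rational quartic symbol, and
  let \<open>p = a\<^sup>2 - 2 b\<^sup>2\<close> and \<open>r\<^sup>2 = 2\<close> modulo \<open>q\<close>.
  Everything is compared with the single symbol \<open>\<rho> = ((a + b r)/q)\<close>.

  Arithmetic of the norm equations. All equations have the form
  \<open>p \<alpha>\<^sup>2 + e q \<beta>\<^sup>2 = 4 \<gamma>\<^sup>2\<close> with \<open>e\<close> among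
  \<open>1, -1, 2, -2, -4\<close>. Modulo \<open>q\<close> the equation says
  \<open>(2 \<gamma>)\<^sup>2 = p \<alpha>\<^sup>2\<close>, so
  \<open>(\<gamma>/q) = (p/q)\<^sub>4 (\<alpha>/q)\<close>; modulo \<open>p\<close> it gives
  \<open>(\<gamma>/p) = (e q/p)\<^sub>4 (\<beta>/p)\<close>; and modulo an odd prime \<open>l\<close> that
  divides one of the three unknowns it says that an explicit product of \<open>e, p, q\<close> is a square modulo
  \<open>l\<close>. Quadratic reciprocity turns the last remark into \<open>(\<alpha>/q) = (e/\<alpha>)\<close>,
  \<open>(\<beta>/p) = 1\<close> and \<open>(\<gamma>/p) (\<gamma>/q) = (-e/\<gamma>)\<close>, where the right
  hand sides are Jacobi symbols over odd parts (lemmas \<open>Legendre_alpha\<close>, \<open>Legendre_beta\<close>,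
  \<open>Legendre_gamma_pq\<close>). This settles \<open>e = 1, -1, -4\<close>. For
  \<open>e = \<plusminus>2\<close> the symbol \<open>\<rho>\<close> enters: writing
  \<open>\<alpha> = 2 A\<close>, the congruence (for a suitable sign of \<open>\<gamma>\<close>)
  \<open>2 A (a A + \<gamma>) (a + b r) = (A (a + b r) + \<gamma>)\<^sup>2\<close> modulo
  \<open>q\<close> expresses \<open>\<rho>\<close> by \<open>(A/q)\<close> and
  \<open>((a A + \<gamma>)/q)\<close>, and the factorisation of \<open>(a A)\<^sup>2 - \<gamma>\<^sup>2\<close>
  determines the latter (\<open>Legendre_gamma_q_two\<close>, \<open>Legendre_gamma_q_minus_two\<close>). With the
  evaluation of \<open>c\<^sub>p\<close> by a primitive eighth root of unity (\<open>eighth_root_Legendre\<close>)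
  both Pfaffians take the stated form, with the exponent of \<open>\<rho>\<close> in place of \<open>R\<close>
  (\<open>Pf_identities\<close>, \<open>Pf2_identity\<close>).

  The Redei symbol. It remains to see that the exponent of \<open>\<rho>\<close> is \<open>[2, p, q]\<close>.
  Multiplying \<open>a + b \<surd>2\<close> by \<open>-1\<close> and by units of norm \<open>1\<close> one may
  assume \<open>a = 1\<close> and \<open>b = 0\<close> modulo \<open>4\<close>. Then \<open>F = K(t)\<close>
  with \<open>t\<^sup>2 = \<pi> = a + b \<surd>2\<close> is the Redei field. Its Galois group is dihedral
  because \<open>\<pi>\<close> times its conjugate is \<open>p\<close>, so that conjugation sends \<open>t\<close> to
  \<open>\<plusminus>\<surd>p / t\<close>; it is unramified over \<open>K\<close> since every prime of
  \<open>F\<close> admits an integer \<open>g\<close> with \<open>g - \<sigma> g\<close> a unit at that prime,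
  \<open>\<sigma>\<close> being the conjugation of \<open>F\<close> over \<open>K\<close>
  (\<open>redei_extension_F\<close>).

  Conversely, descent along the dihedral group and Hilbert 90 for \<open>\<rat>(\<surd>2)\<close> show that any Redei
  extension is \<open>K(\<surd>(d \<pi>))\<close> with a squarefree integer \<open>d\<close> prime to
  \<open>2 p\<close>; a prime factor of \<open>d\<close>, or \<open>d = -1\<close>, causes ramification
  (\<open>ramified_odd\<close>, \<open>ramified_minus_1\<close>), so \<open>d = 1\<close> and the field is unique
  (\<open>redei_extension_unique\<close>). Ideals are handled without discriminants or unique factorisation: the
  tools are Nakayama's lemma, a Krull type bound, and the lemma \<open>unramified_step\<close>, by which the
  inclusion of \<open>P \<inter> L\<close> in \<open>P\<^sup>2\<close> passes from \<open>L\<close> to a quadratic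
  extension \<open>M\<close> that is unramified at \<open>P\<close>.

  Finally a prime of \<open>F\<close> above \<open>q\<close> is determined by the residues of
  \<open>\<surd>2\<close>, \<open>\<surd>p\<close> and \<open>t\<close>. If \<open>a + b r\<close> is a square
  modulo \<open>q\<close> these are three independent signs, giving the eight primes of a completely split prime;
  otherwise two signs suffice and there are at most four (\<open>splits_completely_iff_Legendre\<close>).\<close>

section \<open>Quadratic and quartic residue symbols\<close>

lemma Legendre_eq_0_iff: "Legendre a (int l) = 0 \<longleftrightarrow> int l dvd a"
  by (auto simp: Legendre_def cong_0_iff)

lemma Legendre_cases: "Legendre a l = 0 \<or> Legendre a l = 1 \<or> Legendre a l = -1"
  by (auto simp: Legendre_def)

lemma Legendre_unit: "\<not> int l dvd a \<Longrightarrow> Legendre a (int l) = 1 \<or> Legendre a (int l) = -1"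
  by (auto simp: Legendre_def cong_0_iff)

lemma Legendre_cong:
  assumes "[a = b] (mod l)"
  shows "Legendre a l = Legendre b l"
  using assms by (simp add: Legendre_def QuadRes_def cong_def)

lemma small_cong_imp_eq:
  fixes x y :: int
  assumes "2 < l" "[x = y] (mod int l)" "x \<in> {-1,0,1}" "y \<in> {-1,0,1}"
  shows "x = y"
proof (rule ccontr)
  assume "x \<noteq> y"
  have "int l dvd x - y" using assms(2) by (simp add: cong_iff_dvd_diff)
  moreover have "x - y \<noteq> 0" using \<open>x \<noteq> y\<close> by simp
  ultimately have "int l \<le> \<bar>x - y\<bar>" using dvd_imp_le_int[of "x - y" "int l"] by simp
  with assms show False by auto
qed

lemma Legendre_eqI:
  assumes "prime l" "2 < l" "[a ^ ((l - 1) div 2) = e] (mod int l)" "e \<in> {-1,0,1}"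
  shows "Legendre a (int l) = e"
  using small_cong_imp_eq[OF assms(2) cong_trans[OF euler_criterion[OF assms(1,2)] assms(3)]]
    Legendre_cases[of a "int l"] assms(4) by blast

lemma Legendre_mult:
  assumes "prime l" "2 < l"
  shows "Legendre (a * b) (int l) = Legendre a (int l) * Legendre b (int l)"
proof (rule Legendre_eqI[OF assms])
  show "[(a * b) ^ ((l - 1) div 2) = Legendre a (int l) * Legendre b (int l)] (mod int l)"
    unfolding power_mult_distrib
    by (intro cong_mult cong_sym[OF euler_criterion] assms)
qed (use Legendre_cases[of a l] Legendre_cases[of b l] in auto)

lemma Legendre_square:
  assumes "\<not> int l dvd x" "prime l"
  shows "Legendre (x\<^sup>2) (int l) = 1"
proof -
  have "QuadRes (int l) (x\<^sup>2)" unfolding QuadRes_def by (rule exI[of _ x]) (rule cong_refl)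
  moreover have "\<not> int l dvd x\<^sup>2" using assms by (simp add: prime_dvd_power_iff)
  ultimately show ?thesis by (simp add: Legendre_def cong_0_iff)
qed

lemma Legendre_neg1:
  assumes "prime l" "2 < l"
  shows "Legendre (-1) (int l) = (if l mod 4 = 1 then 1 else -1)"
proof (rule Legendre_eqI[OF assms])
  have "odd l" using assms by (simp add: prime_odd_nat)
  hence "even ((l - 1) div 2) \<longleftrightarrow> l mod 4 = 1" by presburger
  thus "[(-1) ^ ((l - 1) div 2) = (if l mod 4 = 1 then 1 else (-1::int))] (mod int l)"
    by auto
qed auto

lemma Legendre_two:
  assumes l: "prime l" "2 < l"
  shows "Legendre 2 (int l) = (if l mod 8 = 1 \<or> l mod 8 = 7 then 1 else -1)"
proof -
  have odd: "odd l" using assms by (simp add: prime_odd_nat)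
  interpret G: GAUSS l 2
    using l by unfold_locales (auto simp: cong_0_iff dest: zdvd_imp_le)
  define h where "h = (int l - 1) div 2"
  have h: "int l = 2 * h + 1" using odd unfolding h_def by presburger
  have "G.C = (\<lambda>k. 2 * k) ` {0<..h}"
    unfolding G.C_def G.B_def G.A_def image_image h_def[symmetric]
    by (rule image_cong) (use h in \<open>auto intro!: mod_pos_pos_trivial\<close>)
  hence "G.E = (\<lambda>k. 2 * k) ` {h div 2<..h}"
    unfolding G.E_def h_def[symmetric] by (auto simp: image_iff) 
  hence "card G.E = nat (h - h div 2)"
    by (simp add: card_image inj_on_def)
  hence L: "Legendre 2 (int l) = (-1) ^ nat (h - h div 2)"
    using G.gauss_lemma by simp
  define k where "k = int (l div 8)"
  have "l mod 8 = 1 \<or> l mod 8 = 3 \<or> l mod 8 = 5 \<or> l mod 8 = 7"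
    using odd by presburger
  moreover have "int l = 8 * k + int (l mod 8)" unfolding k_def by presburger
  ultimately consider "l mod 8 = 1" "h = 4 * k" | "l mod 8 = 3" "h = 4 * k + 1"
    | "l mod 8 = 5" "h = 4 * k + 2" | "l mod 8 = 7" "h = 4 * k + 3"
    using h by force
  moreover have "k \<ge> 0" by (simp add: k_def)
  moreover have "(4 * k + 1) div 2 = 2 * k" "(4 * k + 2) div 2 = 2 * k + 1" "(4 * k + 3) div 2 = 2 * k + 1"
    by presburger+
  ultimately show ?thesis
    by cases (simp_all add: L even_nat_iff)
qed

lemma quadratic_reciprocity_1_mod_4:
  assumes "prime p" "2 < p" "prime q" "2 < q" "p \<noteq> q" "q mod 4 = 1"
  shows "Legendre (int p) (int q) = Legendre (int q) (int p)"
proof -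
  have "even ((q - 1) div 2)" using assms(6) by presburger
  hence "Legendre (int p) (int q) * Legendre (int q) (int p) = 1"
    using Quadratic_Reciprocity[OF assms(1-5)] by simp
  thus ?thesis using Legendre_cases[of p q] Legendre_cases[of q p] by auto
qed

lemma Jacobi_prime: "prime l \<Longrightarrow> Jacobi a l = Legendre a (int l)"
  by (simp add: Jacobi_def prime_factorization_prime)

text \<open>The Jacobi symbol of \<open>e\<close> over the odd part of \<open>n\<close>. The prime \<open>2\<close> contributes \<open>1\<close>, which is
  also its symbol modulo a prime congruent to \<open>1\<close> modulo \<open>8\<close>; this is why comparisons with
  \<open>(n/q)\<close> below can ignore the parity of \<open>n\<close>.\<close>

definition odd_Jacobi :: "int \<Rightarrow> nat \<Rightarrow> int" where
  "odd_Jacobi e n = prod_mset (image_mset (\<lambda>l. if l = 2 then 1 else Legendre e (int l)) (prime_factorization n))"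

lemma odd_Jacobi_mult: "m \<noteq> 0 \<Longrightarrow> n \<noteq> 0 \<Longrightarrow> odd_Jacobi e (m * n) = odd_Jacobi e m * odd_Jacobi e n"
  by (simp add: odd_Jacobi_def prime_factorization_mult)

lemma odd_Jacobi_1 [simp]: "odd_Jacobi e 1 = 1" "odd_Jacobi e (Suc 0) = 1"
  by (simp_all add: odd_Jacobi_def)

lemma odd_Jacobi_prime: "prime l \<Longrightarrow> odd_Jacobi e l = (if l = 2 then 1 else Legendre e (int l))"
  by (simp add: odd_Jacobi_def prime_factorization_prime)

lemma prime_nat_induct [consumes 1, case_names 1 step]:
  fixes n :: nat
  assumes "n > 0" "P 1" "\<And>l m. prime l \<Longrightarrow> m > 0 \<Longrightarrow> P m \<Longrightarrow> P (l * m)"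
  shows "P n"
  using assms(1)
proof (induction n rule: less_induct)
  case (less n)
  show ?case
  proof (cases "n = 1")
    case False
    then obtain l m where lm: "prime l" "n = l * m"
      by (metis dvdE prime_factor_nat)
    hence "m > 0" "m < n" using less.prems prime_gt_1_nat[OF lm(1)] by auto
    thus ?thesis using less.IH assms(3) lm by blast
  qed (use assms in simp)
qed

text \<open>Primes of even multiplicity contribute squares of signs to both sides, so two multiplicative
  sign functions agree at \<open>n\<close> as soon as they agree at the primes of odd multiplicity. This matters
  because a value of a binary quadratic form restricts only its prime divisors of odd multiplicity.\<close>

lemma multiplicative_eqI:
  fixes f g :: "nat \<Rightarrow> int"
  assumes n: "n > 0"
    and f1: "f 1 = 1" and g1: "g 1 = 1"
    and fm: "\<And>i j. i > 0 \<Longrightarrow> j > 0 \<Longrightarrow> f (i * j) = f i * f j"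
    and gm: "\<And>i j. i > 0 \<Longrightarrow> j > 0 \<Longrightarrow> g (i * j) = g i * g j"
    and fu: "\<And>l. prime l \<Longrightarrow> l dvd n \<Longrightarrow> f l \<in> {1,-1}"
    and gu: "\<And>l. prime l \<Longrightarrow> l dvd n \<Longrightarrow> g l \<in> {1,-1}"
    and eq: "\<And>l. prime l \<Longrightarrow> l dvd n \<Longrightarrow> odd (multiplicity l n) \<Longrightarrow> f l = g l"
  shows "f n = g n"
proof -
  have pw: "F (x ^ k) = F x ^ k" if "F 1 = 1" "\<And>i j. i > 0 \<Longrightarrow> j > 0 \<Longrightarrow> F (i * j) = F i * F j" "x > 0"
    for F :: "nat \<Rightarrow> int" and x k
    using that by (induction k) auto
  have pr: "F (\<Prod>l\<in>S. h l) = (\<Prod>l\<in>S. F (h l))"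
    if "F 1 = 1" "\<And>i j. i > 0 \<Longrightarrow> j > 0 \<Longrightarrow> F (i * j) = F i * F j" "finite S" "\<forall>l\<in>S. h l > 0"
    for F :: "nat \<Rightarrow> int" and h and S :: "nat set"
    using that(3,4) 
  proof (induction S rule: finite_induct)
    case (insert x S)
    have "(\<Prod>l\<in>S. h l) > 0" using insert.prems by (intro prod_pos) auto
    thus ?case using insert that(2) by simp
  qed (use that in simp)
  have n_eq: "n = (\<Prod>l\<in>prime_factors n. l ^ multiplicity l n)"
    using prime_factorization_nat[OF n] .
  have pos: "\<forall>l\<in>prime_factors n. l ^ multiplicity l n > 0"
    by (auto simp: prime_factors_multiplicity prime_gt_0_nat)
  have "f n = (\<Prod>l\<in>prime_factors n. f (l ^ multiplicity l n))"
    by (subst n_eq, rule pr) (use f1 fm pos in auto)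
  also have "\<dots> = (\<Prod>l\<in>prime_factors n. g (l ^ multiplicity l n))"
  proof (rule prod.cong[OF refl])
    fix l assume "l \<in> prime_factors n"
    hence l: "prime l" "l dvd n" by auto
    have "l > 0" using l prime_gt_0_nat by blast
    have e: "f (l ^ multiplicity l n) = f l ^ multiplicity l n"
      "g (l ^ multiplicity l n) = g l ^ multiplicity l n"
      using pw[OF f1 fm \<open>l > 0\<close>] pw[OF g1 gm \<open>l > 0\<close>] by blast+
    show "f (l ^ multiplicity l n) = g (l ^ multiplicity l n)"
    proof (cases "odd (multiplicity l n)")
      case True
      thus ?thesis using eq l e by simp
    next
      case False
      then obtain k where "multiplicity l n = 2 * k" by auto
      moreover have "(f l)\<^sup>2 = 1" "(g l)\<^sup>2 = 1" using fu[OF l] gu[OF l] by auto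
      ultimately show ?thesis using e by (simp add: power_mult)
    qed
  qed
  also have "\<dots> = g n"
    by (subst (3) n_eq, rule pr[symmetric]) (use g1 gm pos in auto)
  finally show ?thesis .
qed

lemma odd_Jacobi_mult_left: "n > 0 \<Longrightarrow> odd_Jacobi (d * e) n = odd_Jacobi d n * odd_Jacobi e n"
proof (induction n rule: prime_nat_induct)
  case (step l m)
  have "2 < l" if "l \<noteq> 2" using that step(1) prime_ge_2_nat[of l] by linarith
  hence "odd_Jacobi (d * e) l = odd_Jacobi d l * odd_Jacobi e l"
    using step(1) by (simp add: odd_Jacobi_prime Legendre_mult)
  thus ?case using step prime_gt_0_nat[of l] by (simp add: odd_Jacobi_mult)
qed simp_all

lemma odd_Jacobi_one [simp]: "odd_Jacobi 1 n = 1"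
proof (cases "n = 0")
  case False
  hence "n > 0" by simp
  thus ?thesis
  proof (induction n rule: prime_nat_induct)
    case (step l m)
    have "\<not> int l dvd 1" using prime_gt_1_nat[OF step(1)] by (simp add: zdvd1_eq)
    hence "Legendre 1 (int l) = 1" using Legendre_square[of l 1] step(1) by simp
    thus ?case using step prime_gt_0_nat[of l] by (simp add: odd_Jacobi_mult odd_Jacobi_prime)
  qed simp_all
qed (simp add: odd_Jacobi_def)

lemma odd_Jacobi_two_mult [simp]: "n > 0 \<Longrightarrow> odd_Jacobi e (2 * n) = odd_Jacobi e n"
  by (simp add: odd_Jacobi_mult odd_Jacobi_prime)

lemma odd_Jacobi_two_power_mult [simp]: "n > 0 \<Longrightarrow> odd_Jacobi e (2 ^ k * n) = odd_Jacobi e n"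
  by (induction k) (simp_all add: mult.assoc)

lemma odd_Jacobi_neg1: "odd n \<Longrightarrow> odd_Jacobi (-1) n = (if n mod 4 = 1 then 1 else -1)"
proof -
  assume "odd n"
  hence "n > 0" by (simp add: odd_pos)
  thus ?thesis using \<open>odd n\<close>
  proof (induction n rule: prime_nat_induct)
    case (step l m)
    hence l: "odd l" "l > 0" "odd m" by (auto simp: odd_pos)
    hence "2 < l" using step(1) prime_ge_2_nat[of l] by (cases "l = 2") auto
    have "l mod 4 = 1 \<or> l mod 4 = 3" "m mod 4 = 1 \<or> m mod 4 = 3" using l by presburger+
    hence "(l * m) mod 4 = 1 \<longleftrightarrow> (l mod 4 = 1 \<longleftrightarrow> m mod 4 = 1)"
      by (auto simp: mod_mult_eq[of l 4 m, symmetric])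
    thus ?case using step l \<open>2 < l\<close> by (simp add: odd_Jacobi_mult odd_Jacobi_prime Legendre_neg1)
  qed simp_all
qed

lemma odd_Jacobi_two: "odd n \<Longrightarrow> odd_Jacobi 2 n = (if n mod 8 = 1 \<or> n mod 8 = 7 then 1 else -1)"
proof -
  assume "odd n"
  hence "n > 0" by (simp add: odd_pos)
  thus ?thesis using \<open>odd n\<close>
  proof (induction n rule: prime_nat_induct)
    case (step l m)
    hence l: "odd l" "l > 0" "odd m" by (auto simp: odd_pos)
    hence "2 < l" using step(1) prime_ge_2_nat[of l] by (cases "l = 2") auto
    have "l mod 8 = 1 \<or> l mod 8 = 3 \<or> l mod 8 = 5 \<or> l mod 8 = 7"
      "m mod 8 = 1 \<or> m mod 8 = 3 \<or> m mod 8 = 5 \<or> m mod 8 = 7" using l by presburger+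
    hence "(l * m) mod 8 = 1 \<or> (l * m) mod 8 = 7 \<longleftrightarrow>
      ((l mod 8 = 1 \<or> l mod 8 = 7) \<longleftrightarrow> (m mod 8 = 1 \<or> m mod 8 = 7))"
      by (elim disjE) (simp_all add: mod_mult_eq[of l 8 m, symmetric])
    thus ?case using step l \<open>2 < l\<close> by (auto simp add: odd_Jacobi_mult odd_Jacobi_prime Legendre_two)
  qed simp_all
qed

lemma odd_Jacobi_cases:
  assumes "n > 0" "\<And>l. prime l \<Longrightarrow> l \<noteq> 2 \<Longrightarrow> \<not> int l dvd e"
  shows "odd_Jacobi e n = 1 \<or> odd_Jacobi e n = -1"
  using assms(1)
proof (induction n rule: prime_nat_induct)
  case (step l m)
  hence "odd_Jacobi e l = 1 \<or> odd_Jacobi e l = -1" using assms(2) Legendre_unit by (auto simp: odd_Jacobi_prime)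
  thus ?case using step prime_gt_0_nat[of l] by (auto simp: odd_Jacobi_mult)
qed simp_all

text \<open>The multiplicative form of the rational quartic symbol.\<close>

definition quartic_sign :: "int \<Rightarrow> nat \<Rightarrow> int" where
  "quartic_sign a l = (if [a ^ ((l - 1) div 4) = 1] (mod int l) then 1 else -1)"

lemma power_quarter_cong:
  assumes l: "prime l" "2 < l" "l mod 4 = 1" and a: "Legendre a (int l) = 1"
  shows "[a ^ ((l - 1) div 4) = quartic_sign a l] (mod int l)"
proof -
  define k where "k = (l - 1) div 4"
  have "(l - 1) div 2 = k * 2" using l unfolding k_def by presburger
  hence "[(a ^ k)\<^sup>2 = 1] (mod int l)"
    using euler_criterion[OF l(1,2), of a] a by (simp add: power_mult cong_sym)
  hence "int l dvd (a ^ k - 1) * (a ^ k + 1)"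
    by (simp add: cong_iff_dvd_diff power2_eq_square algebra_simps)
  hence "int l dvd a ^ k - 1 \<or> int l dvd a ^ k - (-1)"
    using l(1) by (simp add: prime_dvd_mult_iff)
  thus ?thesis unfolding quartic_sign_def k_def[symmetric] by (auto simp: cong_iff_dvd_diff)
qed

lemma quartic_sign_eqI:
  assumes "2 < l" "[a ^ ((l - 1) div 4) = e] (mod int l)" "e = 1 \<or> e = -1"
  shows "quartic_sign a l = e"
proof -
  have "\<not> [- 1 = 1] (mod int l)" using small_cong_imp_eq[OF assms(1), of "-1" 1] by auto
  moreover have "[a ^ ((l - 1) div 4) = 1] (mod int l) \<longleftrightarrow> [e = 1] (mod int l)"
    using assms(2) by (simp add: cong_def)
  ultimately show ?thesis using assms(3) by (auto simp: quartic_sign_def)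
qed

lemma quartic_sign_mult:
  assumes l: "prime l" "2 < l" "l mod 4 = 1" and a: "Legendre a (int l) = 1" "Legendre b (int l) = 1"
  shows "quartic_sign (a * b) l = quartic_sign a l * quartic_sign b l"
proof (rule quartic_sign_eqI[OF l(2)])
  show "[(a * b) ^ ((l - 1) div 4) = quartic_sign a l * quartic_sign b l] (mod int l)"
    unfolding power_mult_distrib by (intro cong_mult power_quarter_cong l a)
qed (simp add: quartic_sign_def)

text \<open>Raise the congruence to the power \<open>(l - 1) / 4\<close> and apply Euler's criterion to \<open>x\<close> and \<open>y\<close>.\<close>

lemma Legendre_eq_quartic_sign:
  assumes l: "prime l" "2 < l" "l mod 4 = 1" and a: "Legendre a (int l) = 1"
    and xy: "[x\<^sup>2 = a * y\<^sup>2] (mod int l)"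
  shows "Legendre x (int l) = quartic_sign a l * Legendre y (int l)"
proof (rule Legendre_eqI[OF l(1,2)])
  define k where "k = (l - 1) div 4"
  have k: "(l - 1) div 2 = 2 * k" using l unfolding k_def by presburger
  have "[(x\<^sup>2) ^ k = a ^ k * y ^ (2 * k)] (mod int l)"
    using cong_pow[OF xy, of k] by (simp add: power_mult_distrib power_mult)
  also have "[a ^ k * y ^ (2 * k) = quartic_sign a l * Legendre y (int l)] (mod int l)"
    unfolding k[symmetric] unfolding k_def
    by (intro cong_mult power_quarter_cong l a cong_sym[OF euler_criterion])
  finally show "[x ^ ((l - 1) div 2) = quartic_sign a l * Legendre y (int l)] (mod int l)"
    by (simp add: k[simplified] power_mult)
qed (use Legendre_cases[of y "int l"] in \<open>auto simp: quartic_sign_def\<close>)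

text \<open>Modulo \<open>l\<close> the number \<open>- d\<close> is the square of \<open>x / y\<close>.\<close>

lemma Legendre_of_form:
  assumes l: "prime l" "2 < l" and "\<not> int l dvd d" "\<not> int l dvd y" "int l dvd x\<^sup>2 + d * y\<^sup>2"
  shows "Legendre (- d) (int l) = 1"
proof -
  have pl: "prime (int l)" using l by simp
  have "\<not> int l dvd x"
  proof
    assume "int l dvd x"
    hence "int l dvd x\<^sup>2" by (simp add: power2_eq_square)
    hence "int l dvd d * y\<^sup>2" using assms(5) dvd_add_right_iff by blast
    thus False using assms(3,4) pl by (simp add: prime_dvd_mult_iff prime_dvd_power_iff)
  qed
  have "[x\<^sup>2 = - d * y\<^sup>2] (mod int l)" using assms(5) by (simp add: cong_iff_dvd_diff)
  hence "Legendre (x\<^sup>2) (int l) = Legendre (- d) (int l) * Legendre (y\<^sup>2) (int l)"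
    by (simp only: Legendre_cong Legendre_mult[OF l])
  thus ?thesis using Legendre_square assms \<open>\<not> int l dvd x\<close> by simp
qed

text \<open>If \<open>l\<close> divides \<open>y\<close> it divides \<open>x\<close>, and removing the common factor lowers the
  multiplicity by \<open>2\<close>; an odd multiplicity therefore leads by descent to the previous lemma.\<close>

lemma Legendre_of_form_odd_multiplicity:
  assumes l: "prime l" "2 < l" and d: "\<not> int l dvd d" and nz: "x\<^sup>2 + d * y\<^sup>2 \<noteq> 0"
    and odd: "odd (multiplicity (int l) (x\<^sup>2 + d * y\<^sup>2))"
  shows "Legendre (- d) (int l) = 1"
  using nz odd
proof (induction "nat (\<bar>x\<bar> + \<bar>y\<bar>)" arbitrary: x y rule: less_induct)
  case (less x y)
  have pl: "prime (int l)" using l by simp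
  have dv: "int l dvd x\<^sup>2 + d * y\<^sup>2"
    using less.prems not_dvd_imp_multiplicity_0 by force
  show ?case
  proof (cases "int l dvd y")
    case False
    thus ?thesis using Legendre_of_form[OF l d _ dv] by blast
  next
    case True
    then obtain y' where y: "y = int l * y'" by blast
    have "int l dvd d * y\<^sup>2" using True by (simp add: power2_eq_square)
    hence "int l dvd x\<^sup>2" using dv dvd_add_left_iff by blast
    hence "int l dvd x" using pl prime_dvd_power by blast
    then obtain x' where x: "x = int l * x'" by blast
    have eq: "x\<^sup>2 + d * y\<^sup>2 = (int l)\<^sup>2 * (x'\<^sup>2 + d * y'\<^sup>2)"
      unfolding x y by (simp add: power2_eq_square algebra_simps)
    have nz': "x'\<^sup>2 + d * y'\<^sup>2 \<noteq> 0" using less.prems(1) eq by auto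
    have "multiplicity (int l) (x\<^sup>2 + d * y\<^sup>2) = 2 + multiplicity (int l) (x'\<^sup>2 + d * y'\<^sup>2)"
      unfolding eq using pl nz' l
      by (subst prime_elem_multiplicity_mult_distrib) (auto simp: prime_elem_multiplicity_power_distrib)
    moreover have "\<bar>x'\<bar> + \<bar>y'\<bar> < \<bar>x\<bar> + \<bar>y\<bar>"
    proof -
      have "x' \<noteq> 0 \<or> y' \<noteq> 0" using nz' by auto
      hence "\<bar>x'\<bar> + \<bar>y'\<bar> > 0" by linarith
      moreover have "\<bar>x\<bar> + \<bar>y\<bar> = int l * (\<bar>x'\<bar> + \<bar>y'\<bar>)"
        unfolding x y by (simp add: abs_mult algebra_simps)
      moreover have "1 * (\<bar>x'\<bar> + \<bar>y'\<bar>) < int l * (\<bar>x'\<bar> + \<bar>y'\<bar>)"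
        by (rule mult_strict_right_mono) (use calculation l in auto)
      ultimately show ?thesis by simp
    qed
    ultimately show ?thesis using less.hyps[of x' y'] less.prems nz' by simp
  qed
qed

text \<open>Reciprocity modulo \<open>q\<close> has no sign because \<open>q = 1\<close> modulo \<open>4\<close>, and \<open>(2/q) = 1\<close> because
  \<open>q = 1\<close> modulo \<open>8\<close>. Thus \<open>(n/q)\<close> is determined by the symbols \<open>(q/l)\<close> at the odd primes \<open>l\<close>
  of odd multiplicity in \<open>n\<close>.\<close>

lemma Legendre_eq_odd_Jacobi:
  assumes q: "prime q" "q mod 8 = 1" and n: "n > 0" "\<not> q dvd n"
    and e: "\<And>l. prime l \<Longrightarrow> l \<noteq> 2 \<Longrightarrow> \<not> int l dvd e"
    and eq: "\<And>l. prime l \<Longrightarrow> 2 < l \<Longrightarrow> l dvd n \<Longrightarrow> odd (multiplicity l n) \<Longrightarrow>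
               Legendre (int q) (int l) = Legendre e (int l)"
  shows "Legendre (int n) (int q) = odd_Jacobi e n"
proof (rule multiplicative_eqI[where f = "\<lambda>n. Legendre (int n) (int q)"])
  have q2: "2 < q" using q prime_ge_2_nat[of q] by (cases "q = 2") auto
  show "Legendre (int 1) (int q) = 1" 
    using Legendre_square[of q 1] q q2 by (simp add: zdvd1_eq)
  show "Legendre (int (i * j)) (int q) = Legendre (int i) (int q) * Legendre (int j) (int q)" for i j
    by (simp add: Legendre_mult[OF q(1) q2])
  fix l assume l: "prime l" "l dvd n"
  have "\<not> q dvd l" using l n(2) dvd_trans by blast
  thus "Legendre (int l) (int q) \<in> {1,-1}" using Legendre_unit[of q "int l"] by auto
  show "odd_Jacobi e l \<in> {1,-1}" using l e Legendre_unit by (auto simp: odd_Jacobi_prime)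
  show "Legendre (int l) (int q) = odd_Jacobi e l" if "odd (multiplicity l n)"
  proof (cases "l = 2")
    case True
    thus ?thesis using Legendre_two[OF q(1) q2] q(2) by (simp add: odd_Jacobi_prime)
  next
    case False
    hence "2 < l" using l prime_ge_2_nat[of l] by linarith
    moreover have "l \<noteq> q" using \<open>\<not> q dvd l\<close> by auto
    moreover have "q mod 4 = 1" using q(2) by presburger
    ultimately have "Legendre (int l) (int q) = Legendre (int q) (int l)"
      using quadratic_reciprocity_1_mod_4 l q q2 by blast
    thus ?thesis using eq[OF l(1) \<open>2 < l\<close> l(2) that] False l by (simp add: odd_Jacobi_prime)
  qed
qed (use n in \<open>simp_all add: odd_Jacobi_mult\<close>)

section \<open>Primitive solutions of the norm equations\<close>

lemma multiplicity_int:
  assumes "prime l" "n > 0"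
  shows "multiplicity (int l) (int n) = multiplicity l n"
proof -
  have "k \<le> multiplicity (int l) (int n) \<longleftrightarrow> k \<le> multiplicity l n" for k
  proof -
    have "k \<le> multiplicity (int l) (int n) \<longleftrightarrow> int l ^ k dvd int n"
      using assms by (intro power_dvd_iff_le_multiplicity[symmetric]) (auto simp: zdvd1_eq)
    also have "\<dots> \<longleftrightarrow> l ^ k dvd n" by (simp flip: of_nat_power)
    also have "\<dots> \<longleftrightarrow> k \<le> multiplicity l n"
      using assms by (intro power_dvd_iff_le_multiplicity) auto
    finally show ?thesis .
  qed
  thus ?thesis by (meson order_antisym order_refl)
qed

locale two_primes =
  fixes p q :: nat
  assumes p: "prime p" and q: "prime q" and pq: "p \<noteq> q"
    and p8: "p mod 8 = 1" and q8: "q mod 8 = 1"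
    and leg_qp: "Legendre (int q) (int p) = 1"
begin

lemma p_gt_2: "2 < p" and q_gt_2: "2 < q"
  using prime_ge_2_nat[OF p] prime_ge_2_nat[OF q] p8 q8 by (cases "p = 2"; cases "q = 2"; simp)+

lemma p4: "p mod 4 = 1" and q_mod_4: "q mod 4 = 1"
  using p8 q8 by presburger+

lemma leg_pq: "Legendre (int p) (int q) = 1"
  using quadratic_reciprocity_1_mod_4[OF p p_gt_2 q q_gt_2 pq q_mod_4] leg_qp by simp

lemma swap: "two_primes q p"
  using p q pq p8 q8 leg_pq by unfold_locales auto

lemma not_p_dvd_q: "\<not> int p dvd int q" and not_q_dvd_p: "\<not> int q dvd int p"
  using p q pq primes_dvd_imp_eq by (metis of_nat_dvd_iff)+

lemma Legendre_neg1_p: "Legendre (-1) (int p) = 1"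
  using Legendre_neg1[OF p p_gt_2] p4 by simp

lemma Legendre_2_p: "Legendre 2 (int p) = 1"
  using Legendre_two[OF p p_gt_2] p8 by simp

lemma Legendre_mult_p: "Legendre (a * b) (int p) = Legendre a (int p) * Legendre b (int p)"
  using Legendre_mult[OF p p_gt_2] .

end

text \<open>The factors \<open>e\<close> for which \<open>p \<alpha>\<^sup>2 + e q \<beta>\<^sup>2 = 4 \<gamma>\<^sup>2\<close> occurs in the two Pfaffians. Up to squares
  they are generated by \<open>-1\<close> and \<open>2\<close>, so they are units at odd primes and squares modulo \<open>p\<close> and
  \<open>q\<close>.\<close>

definition twists :: "int set" where "twists = {1, -1, 2, -2, -4}"

lemma not_dvd_twist:
  assumes "e \<in> twists" "prime l" "l \<noteq> 2"
  shows "\<not> int l dvd e" "\<not> int l dvd - e"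
proof -
  have "2 < l" using assms prime_ge_2_nat[of l] by linarith
  moreover have "l \<noteq> 4" using assms(2) by auto
  moreover have "e = 1 \<or> e = -1 \<or> e = 2 \<or> e = - 2 \<or> e = -4" using assms(1) by (auto simp: twists_def)
  moreover have "\<not> int l dvd 2" "\<not> int l dvd 1" using \<open>2 < l\<close> by (auto dest!: zdvd_imp_le)
  moreover have "\<not> int l dvd 4"
    using assms(2) \<open>\<not> int l dvd 2\<close> prime_dvd_mult_iff[of "int l" 2 2] by simp
  ultimately show "\<not> int l dvd e" "\<not> int l dvd - e" by auto
qed

lemma prime_square_dvd_imp_dvd:
  fixes l :: nat
  assumes l: "prime l" and q: "prime q" and e: "\<not> int l dvd e" and d: "int l * int l dvd e * int q * x\<^sup>2"
  shows "int l dvd x"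
proof (rule ccontr)
  assume x: "\<not> int l dvd x"
  have pl: "prime (int l)" using l by simp
  have "coprime (int l) (e * x\<^sup>2)"
    using pl x e by (intro prime_imp_coprime) (auto simp: prime_dvd_mult_iff prime_dvd_power_iff)
  hence c: "coprime (int l * int l) (e * x\<^sup>2)" by simp
  have "int l * int l dvd int q * (e * x\<^sup>2)" using d by (simp add: ac_simps)
  hence "int l * int l dvd int q" using c by (simp add: coprime_dvd_mult_left_iff)
  hence "l * l dvd q" by (simp flip: of_nat_mult)
  moreover have "l dvd q" using calculation dvd_mult_left by blast
  ultimately have "l = q" using l q primes_dvd_imp_eq by blast
  with \<open>l * l dvd q\<close> have "q * q \<le> q" using q by (simp add: dvd_imp_le prime_gt_0_nat)
  thus False using prime_gt_1_nat[OF q] by simp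
qed

locale norm_solution = two_primes +
  fixes e :: int and \<alpha> \<beta> \<gamma> :: nat
  assumes e: "e \<in> twists" and sol: "primitive_solution (int p) (e * int q) (int \<alpha>) (int \<beta>) (int \<gamma>)"
begin

lemma pos: "\<alpha> > 0" "\<beta> > 0" "\<gamma> > 0"
  using sol by (auto simp: primitive_solution_def)

lemma eqn: "int p * (int \<alpha>)\<^sup>2 + e * int q * (int \<beta>)\<^sup>2 = (2 * int \<gamma>)\<^sup>2"
  using sol by (simp add: primitive_solution_def power_mult_distrib)

lemma no_common_divisor:
  assumes "prime l" "int l dvd int \<alpha>" "int l dvd int \<beta>" "int l dvd int \<gamma>"
  shows False
proof -
  have "int l dvd Gcd {int \<alpha>, int \<beta>, int \<gamma>}" using assms by (intro Gcd_greatest) auto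
  moreover have "Gcd {int \<alpha>, int \<beta>, int \<gamma>} = 1" using sol unfolding primitive_solution_def by blast
  ultimately have "int l dvd 1" by (simp only:)
  thus False using prime_gt_1_nat[OF assms(1)] by (simp add: zdvd1_eq)
qed

text \<open>The coefficients \<open>p\<close> and \<open>e q\<close> are not divisible by the square of an odd prime, so an odd
  prime dividing two of the unknowns divides all three, against primitivity.\<close>

lemma pairwise:
  assumes l: "prime l" "l \<noteq> 2"
  shows "\<not> (int l dvd int \<alpha> \<and> int l dvd int \<beta>)" "\<not> (int l dvd int \<alpha> \<and> int l dvd int \<gamma>)"
    "\<not> (int l dvd int \<beta> \<and> int l dvd int \<gamma>)"
proof -
  have pl: "prime (int l)" using l by simp
  have l2: "\<not> int l dvd 2" "\<not> int l dvd 4"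
    using not_dvd_twist[of 2 l] not_dvd_twist[of "-4" l] l by (simp_all add: twists_def)
  have sq: "int l * int l dvd c * x\<^sup>2" if "int l dvd x" for c x :: int
    using that by (simp add: power2_eq_square mult_dvd_mono)
  show "\<not> (int l dvd int \<alpha> \<and> int l dvd int \<beta>)"
  proof safe
    assume a: "int l dvd int \<alpha>" "int l dvd int \<beta>"
    have "int l dvd int p * (int \<alpha>)\<^sup>2 + e * int q * (int \<beta>)\<^sup>2"
      using dvd_mult_left[OF sq[OF a(1)]] dvd_mult_left[OF sq[OF a(2)]] by (intro dvd_add)
    hence "int l dvd int \<gamma>" unfolding eqn using pl l2 by (auto simp: prime_dvd_power_iff prime_dvd_mult_iff)
    thus False using no_common_divisor[OF l(1)] a by blast
  qed
  show "\<not> (int l dvd int \<alpha> \<and> int l dvd int \<gamma>)"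
  proof safe
    assume a: "int l dvd int \<alpha>" "int l dvd int \<gamma>"
    have "int l * int l dvd 4 * (int \<gamma>)\<^sup>2 - int p * (int \<alpha>)\<^sup>2"
      using sq[OF a(1)] sq[OF a(2)] by (intro dvd_diff)
    moreover have "4 * (int \<gamma>)\<^sup>2 - int p * (int \<alpha>)\<^sup>2 = e * int q * (int \<beta>)\<^sup>2"
      using eqn by (simp add: power_mult_distrib)
    ultimately have "int l * int l dvd e * int q * (int \<beta>)\<^sup>2" by simp
    thus False using prime_square_dvd_imp_dvd[OF l(1) q not_dvd_twist(1)[OF e l]] no_common_divisor[OF l(1)] a by blast
  qed
  show "\<not> (int l dvd int \<beta> \<and> int l dvd int \<gamma>)"
  proof safe
    assume a: "int l dvd int \<beta>" "int l dvd int \<gamma>"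
    have "int l * int l dvd 4 * (int \<gamma>)\<^sup>2 - e * int q * (int \<beta>)\<^sup>2"
      using sq[OF a(1)] sq[OF a(2)] by (intro dvd_diff)
    moreover have "4 * (int \<gamma>)\<^sup>2 - e * int q * (int \<beta>)\<^sup>2 = 1 * int p * (int \<alpha>)\<^sup>2"
      using eqn by (simp add: power_mult_distrib)
    ultimately have "int l * int l dvd 1 * int p * (int \<alpha>)\<^sup>2" by simp
    moreover have "\<not> int l dvd 1" using prime_gt_1_nat[OF l(1)] by (simp add: zdvd1_eq)
    ultimately show False using prime_square_dvd_imp_dvd[OF l(1) p] no_common_divisor[OF l(1)] a by blast
  qed
qed

lemma not_q_dvd: "\<not> int q dvd int \<alpha>" "\<not> int q dvd int \<gamma>"
proof -
  have q2: "q \<noteq> 2" using q_gt_2 by simp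
  have pq': "prime (int q)" using q by simp
  have l2: "\<not> int q dvd 2" "\<not> int q dvd 4"
    using not_dvd_twist[of 2 q] not_dvd_twist[of "-4" q] q q2 by (simp_all add: twists_def)
  have "int q dvd int p * (int \<alpha>)\<^sup>2 \<longleftrightarrow> int q dvd (2 * int \<gamma>)\<^sup>2"
    unfolding eqn[symmetric] by (simp add: dvd_add_left_iff)
  hence "int q dvd int \<alpha> \<longleftrightarrow> int q dvd int \<gamma>"
    using pq' l2 not_q_dvd_p by (simp add: prime_dvd_power_iff prime_dvd_mult_iff)
  thus "\<not> int q dvd int \<alpha>" "\<not> int q dvd int \<gamma>" using pairwise(2)[OF q q2] by auto
qed

lemma not_p_dvd: "\<not> int p dvd int \<beta>" "\<not> int p dvd int \<gamma>"
proof -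
  have p2: "p \<noteq> 2" using p_gt_2 by simp
  have pp': "prime (int p)" using p by simp
  have l2: "\<not> int p dvd 2" "\<not> int p dvd 4"
    using not_dvd_twist[of 2 p] not_dvd_twist[of "-4" p] p p2 by (simp_all add: twists_def)
  have "int p dvd e * int q * (int \<beta>)\<^sup>2 \<longleftrightarrow> int p dvd (2 * int \<gamma>)\<^sup>2"
    unfolding eqn[symmetric] by (simp add: dvd_add_right_iff)
  hence "int p dvd int \<beta> \<longleftrightarrow> int p dvd int \<gamma>"
    using pp' l2 not_p_dvd_q not_dvd_twist[OF e p p2] by (simp add: prime_dvd_power_iff prime_dvd_mult_iff)
  thus "\<not> int p dvd int \<beta>" "\<not> int p dvd int \<gamma>" using pairwise(3)[OF p p2] by auto
qed

text \<open>At an odd prime \<open>l\<close> dividing \<open>\<alpha>\<close> the equation reads \<open>e q \<beta>\<^sup>2 = (2 \<gamma>)\<^sup>2\<close>, whence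
  \<open>(q/l) = (e/l)\<close>.\<close>

lemma Legendre_alpha: "Legendre (int \<alpha>) (int q) = odd_Jacobi e \<alpha>"
proof (rule Legendre_eq_odd_Jacobi[OF q q8])
  fix l assume l: "prime l" "2 < l" "l dvd \<alpha>"
  have l2: "l \<noteq> 2" using l by simp
  have "l \<noteq> q" using l(3) not_q_dvd(1) by auto
  hence nq: "\<not> int l dvd int q" using l(1) q by (auto simp: primes_dvd_imp_eq)
  have "int l dvd int \<alpha>" using l by simp
  hence "\<not> int l dvd int \<beta>" using pairwise(1)[OF l(1) l2] by blast
  moreover have "(2 * int \<gamma>)\<^sup>2 + (- (e * int q)) * (int \<beta>)\<^sup>2 = int p * (int \<alpha>)\<^sup>2" using eqn by simp
  moreover have "int l dvd int p * (int \<alpha>)\<^sup>2" using \<open>int l dvd int \<alpha>\<close> by (simp add: power2_eq_square)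
  moreover have "\<not> int l dvd - (e * int q)"
    using nq not_dvd_twist[OF e l(1) l2] l(1) by (simp add: prime_dvd_mult_iff)
  ultimately have "Legendre (- (- (e * int q))) (int l) = 1"
    by (intro Legendre_of_form[OF l(1,2), of _ "int \<beta>" "2 * int \<gamma>"]) auto
  hence "Legendre e (int l) * Legendre (int q) (int l) = 1" by (simp add: Legendre_mult[OF l(1,2)])
  thus "Legendre (int q) (int l) = Legendre e (int l)"
    using Legendre_cases[of e "int l"] Legendre_cases[of "int q" "int l"] by auto
qed (use pos not_q_dvd not_dvd_twist[OF e] in auto)

lemma Legendre_gamma_q: "Legendre (int \<gamma>) (int q) = quartic_sign (int p) q * odd_Jacobi e \<alpha>"
proof -
  interpret S: two_primes q p by (rule swap)
  have "[(2 * int \<gamma>)\<^sup>2 = int p * (int \<alpha>)\<^sup>2] (mod int q)"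
    unfolding eqn[symmetric] by (simp add: cong_iff_dvd_diff)
  from Legendre_eq_quartic_sign[OF q q_gt_2 q_mod_4 leg_pq this] show ?thesis
    by (simp add: S.Legendre_mult_p S.Legendre_2_p Legendre_alpha)
qed

lemma Legendre_beta: "Legendre (int \<beta>) (int p) = 1"
proof -
  have "Legendre (int \<beta>) (int p) = odd_Jacobi 1 \<beta>"
  proof (rule Legendre_eq_odd_Jacobi[OF p p8])
    fix l assume l: "prime l" "2 < l" "l dvd \<beta>"
    have l2: "l \<noteq> 2" using l by simp
    have n1: "\<not> int l dvd 1" using prime_gt_1_nat[OF l(1)] by (simp add: zdvd1_eq)
    have "l \<noteq> p" using l(3) not_p_dvd(1) by auto
    hence np: "\<not> int l dvd int p" using l(1) p by (auto simp: primes_dvd_imp_eq)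
    have lb: "int l dvd int \<beta>" using l by simp
    hence "\<not> int l dvd int \<alpha>" using pairwise(1)[OF l(1) l2] by blast
    moreover have "(2 * int \<gamma>)\<^sup>2 + (- int p) * (int \<alpha>)\<^sup>2 = e * int q * (int \<beta>)\<^sup>2" using eqn by simp
    moreover have "int l dvd e * int q * (int \<beta>)\<^sup>2" using lb by (simp add: power2_eq_square)
    ultimately have "Legendre (- (- int p)) (int l) = 1"
      using np by (intro Legendre_of_form[OF l(1,2), of _ "int \<alpha>" "2 * int \<gamma>"]) auto
    thus "Legendre (int p) (int l) = Legendre 1 (int l)"
      using Legendre_square[OF n1 l(1)] by simp
  qed (use pos not_p_dvd in \<open>auto simp: zdvd1_eq\<close>)
  thus ?thesis by simp
qed

lemma Legendre_twist: "Legendre e (int p) = 1" "Legendre (e * int q) (int p) = 1"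
proof -
  have "Legendre 1 (int p) = 1" using Legendre_square[of p 1] p p_gt_2 by (simp add: zdvd1_eq)
  hence *: "Legendre (c * d) (int p) = 1" if "c \<in> {1,-1}" "d \<in> {1,2}" for c d
    using that Legendre_neg1_p Legendre_2_p by (auto simp: Legendre_mult_p simp del: mult_minus_left)
  have "Legendre 4 (int p) = 1" using Legendre_mult_p[of 2 2] Legendre_2_p by simp
  hence "Legendre (- 4) (int p) = 1" using Legendre_mult_p[of "-1" 4] Legendre_neg1_p by simp
  thus "Legendre e (int p) = 1"
    using e *[of 1 1] *[of "-1" 1] *[of 1 2] *[of "-1" 2] by (auto simp: twists_def)
  thus "Legendre (e * int q) (int p) = 1" by (simp add: Legendre_mult_p leg_qp)
qed

lemma Legendre_gamma_p: "Legendre (int \<gamma>) (int p) = quartic_sign e p * quartic_sign (int q) p"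
proof -
  have "[(2 * int \<gamma>)\<^sup>2 = e * int q * (int \<beta>)\<^sup>2] (mod int p)"
    unfolding eqn[symmetric] by (simp add: cong_iff_dvd_diff)
  from Legendre_eq_quartic_sign[OF p p_gt_2 p4 Legendre_twist(2) this] show ?thesis
    by (simp add: Legendre_mult_p Legendre_2_p Legendre_beta quartic_sign_mult[OF p p_gt_2 p4 Legendre_twist(1) leg_qp])
qed

text \<open>At an odd prime \<open>l\<close> dividing \<open>\<gamma>\<close> the equation times \<open>p\<close> reads
  \<open>(p \<alpha>)\<^sup>2 = - e p q \<beta>\<^sup>2\<close>, whence \<open>(p/l) (q/l) = (- e/l)\<close>.\<close>

lemma Legendre_gamma_pq: "Legendre (int \<gamma>) (int p) * Legendre (int \<gamma>) (int q) = odd_Jacobi (- e) \<gamma>"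
proof -
  interpret S: two_primes q p by (rule swap)
  show ?thesis
  proof (rule multiplicative_eqI[where f = "\<lambda>n. Legendre (int n) (int p) * Legendre (int n) (int q)"])
    have "Legendre 1 (int p) = 1" "Legendre 1 (int q) = 1"
      using Legendre_square[of p 1] p p_gt_2 Legendre_square[of q 1] q q_gt_2 by (simp_all add: zdvd1_eq)
    thus "Legendre (int 1) (int p) * Legendre (int 1) (int q) = 1" by simp
    fix l assume l: "prime l" "l dvd \<gamma>"
    have "\<not> int p dvd int l" "\<not> int q dvd int l" using l not_p_dvd(2) not_q_dvd(2) dvd_trans
      by (metis of_nat_dvd_iff)+
    thus "Legendre (int l) (int p) * Legendre (int l) (int q) \<in> {1, - 1}"
      using Legendre_unit[of p "int l"] Legendre_unit[of q "int l"] by auto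
    show "odd_Jacobi (- e) l \<in> {1, - 1}"
      using Legendre_unit[of l "- e"] not_dvd_twist(2)[OF e l(1)] by (auto simp: odd_Jacobi_prime l(1))
    show "Legendre (int l) (int p) * Legendre (int l) (int q) = odd_Jacobi (- e) l"
    proof (cases "l = 2")
      case True
      thus ?thesis by (simp add: odd_Jacobi_prime Legendre_2_p S.Legendre_2_p)
    next
      case False
      hence l2: "2 < l" using l prime_ge_2_nat[of l] by linarith
      have "l \<noteq> p" "l \<noteq> q" using \<open>\<not> int p dvd int l\<close> \<open>\<not> int q dvd int l\<close> by auto
      hence r: "Legendre (int l) (int p) = Legendre (int p) (int l)" 
        "Legendre (int l) (int q) = Legendre (int q) (int l)"
        using quadratic_reciprocity_1_mod_4[OF l(1) l2 p p_gt_2 _ p4]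
          quadratic_reciprocity_1_mod_4[OF l(1) l2 q q_gt_2 _ q_mod_4] by auto
      have nn: "\<not> int l dvd int p" "\<not> int l dvd int q"
        using l(1) p q \<open>l \<noteq> p\<close> \<open>l \<noteq> q\<close> by (auto simp: primes_dvd_imp_eq)
      have lg: "int l dvd int \<gamma>" using l by simp
      hence "\<not> int l dvd int \<beta>" using pairwise(3)[OF l(1) False] by blast
      moreover have "(int p * int \<alpha>)\<^sup>2 + (e * int p * int q) * (int \<beta>)\<^sup>2 = int p * (2 * int \<gamma>)\<^sup>2"
        unfolding eqn[symmetric] by (simp add: power2_eq_square algebra_simps)
      moreover have "int l dvd int p * (2 * int \<gamma>)\<^sup>2" using lg by (simp add: power2_eq_square)
      moreover have "\<not> int l dvd e * int p * int q"
        using nn not_dvd_twist[OF e l(1) False] l(1) by (simp add: prime_dvd_mult_iff)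
      ultimately have "Legendre (- (e * int p * int q)) (int l) = 1"
        by (intro Legendre_of_form[OF l(1) l2, of _ "int \<beta>" "int p * int \<alpha>"]) auto
      moreover have "- (e * int p * int q) = - e * int p * int q" by simp
      ultimately have "Legendre (- e) (int l) * Legendre (int p) (int l) * Legendre (int q) (int l) = 1"
        by (simp only: Legendre_mult[OF l(1) l2])
      thus ?thesis unfolding r using Legendre_cases[of "- e" "int l"] Legendre_cases[of "int q" "int l"]
        Legendre_cases[of "int p" "int l"] False by (auto simp: odd_Jacobi_prime l(1))
    qed
  qed (use pos in \<open>auto simp: odd_Jacobi_mult Legendre_mult_p S.Legendre_mult_p\<close>)
qed

end

section \<open>The quartic symbol of 2\<close>

text \<open>With a primitive eighth root of unity \<open>z\<close> modulo \<open>p\<close> one has \<open>r = z + z\<^sup>-\<^sup>1\<close> and hence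
  \<open>(2 + r) z = (1 + z)\<^sup>2\<close>, while \<open>2 + r = r (r + 1)\<close>. So \<open>((r + 1)/p) (r/p) = (z/p)\<close>; here
  \<open>(r/p) = (2/p)\<^sub>4\<close> and \<open>(z/p) = z\<^bsup>(p - 1)/2\<^esup>\<close>.\<close>

lemma eighth_root_Legendre:
  assumes p: "prime p" "p mod 8 = 1" and r: "[r\<^sup>2 = 2] (mod int p)"
  shows "Legendre (r + 1) (int p) * quartic_sign 2 p = (-1) ^ ((p - 1) div 8)"
proof -
  have p2: "2 < p" using p prime_ge_2_nat[of p] by (cases "p = 2") auto
  have p4: "p mod 4 = 1" using p(2) by presburger
  note mult = Legendre_mult[OF p(1) p2]
  have n2: "\<not> int p dvd 2" using p2 by (auto dest!: zdvd_imp_le)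
  have L2: "Legendre 2 (int p) = 1" using Legendre_two[OF p(1) p2] p(2) by simp
  have L1: "Legendre 1 (int p) = 1" using Legendre_square[of p 1] p p2 by (simp add: zdvd1_eq)
  have "Legendre (-1) (int p) = 1" using Legendre_neg1[OF p(1) p2] p4 by simp
  then obtain i where i: "[i\<^sup>2 = -1] (mod int p)"
    by (auto simp: Legendre_def QuadRes_def split: if_splits)
  have "even (int p + 1)" using p4 by presburger
  then obtain h where h: "2 * h = int p + 1" by (metis evenE)
  define s where "s = r * h"
  have "r * s = r\<^sup>2 * h" by (simp add: s_def power2_eq_square)
  also have "[r\<^sup>2 * h = 2 * h] (mod int p)" by (intro cong_mult r) simp
  also have "[2 * h = 1] (mod int p)" by (simp add: h cong_iff_dvd_diff)
  finally have rs: "[r * s = 1] (mod int p)" .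
  have "[2 * s\<^sup>2 = r\<^sup>2 * s\<^sup>2] (mod int p)" by (intro cong_mult cong_sym[OF r]) simp
  also have "r\<^sup>2 * s\<^sup>2 = (r * s)\<^sup>2" by (simp add: power_mult_distrib)
  also have "[(r * s)\<^sup>2 = 1\<^sup>2] (mod int p)" by (intro cong_pow rs)
  finally have s2: "[2 * s\<^sup>2 = 1] (mod int p)" by simp
  \<comment> \<open>\<open>s\<close> is \<open>1 / r\<close>, so \<open>z = (1 + i) / \<surd>2\<close>\<close>
  define z where "z = (1 + i) * s"
  have "z\<^sup>2 = i * (2 * s\<^sup>2) + (i\<^sup>2 + 1) * s\<^sup>2"
    by (simp add: z_def power2_eq_square algebra_simps)
  also have "[i * (2 * s\<^sup>2) + (i\<^sup>2 + 1) * s\<^sup>2 = i * 1 + (-1 + 1) * s\<^sup>2] (mod int p)"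
    by (intro cong_add cong_mult s2 i) auto
  finally have z2: "[z\<^sup>2 = i] (mod int p)" by simp
  have "(2 + r) * z = 2 * z + (1 + i) * (r * s)" by (simp add: z_def algebra_simps)
  also have "[2 * z + (1 + i) * (r * s) = 2 * z + (1 + i) * 1] (mod int p)"
    by (intro cong_add cong_mult rs) auto
  also have "2 * z + (1 + i) * 1 = 1 + 2 * z + i" by simp
  also have "[1 + 2 * z + i = 1 + 2 * z + z\<^sup>2] (mod int p)"
    by (intro cong_add cong_sym[OF z2]) auto
  also have "1 + 2 * z + z\<^sup>2 = (1 + z)\<^sup>2" by (simp add: power2_eq_square algebra_simps)
  finally have A: "[(2 + r) * z = (1 + z)\<^sup>2] (mod int p)" .
  have z4: "[z ^ 4 = -1] (mod int p)"
  proof -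
    have "z ^ 4 = (z\<^sup>2)\<^sup>2" by simp
    also have "[(z\<^sup>2)\<^sup>2 = i\<^sup>2] (mod int p)" by (intro cong_pow z2)
    finally show ?thesis using i cong_trans by blast
  qed
  have "\<not> int p dvd 1 + z"
  proof
    assume "int p dvd 1 + z"
    hence "[z = -1] (mod int p)" by (simp add: cong_iff_dvd_diff add.commute)
    hence "[z ^ 4 = (-1) ^ 4] (mod int p)" by (rule cong_pow)
    hence "[-1 = 1] (mod int p)" using z4 cong_sym cong_trans by (metis power_minus_even even_numeral power_one)
    thus False using n2 by (simp add: cong_iff_dvd_diff)
  qed
  hence "Legendre ((1 + z)\<^sup>2) (int p) = 1" using Legendre_square p by blast
  hence B: "Legendre (2 + r) (int p) * Legendre z (int p) = 1"
    using Legendre_cong[OF A] by (simp add: mult)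
  have "Legendre z (int p) = (-1) ^ ((p - 1) div 8)"
  proof (rule Legendre_eqI[OF p(1) p2])
    have "p = 8 * (p div 8) + 1" using p(2) by (metis mult_div_mod_eq)
    then obtain k where "p = 8 * k + 1" by blast
    hence "(p - 1) div 2 = 4 * ((p - 1) div 8)" by simp
    thus "[z ^ ((p - 1) div 2) = (-1) ^ ((p - 1) div 8)] (mod int p)"
      using cong_pow[OF z4, of "(p - 1) div 8"] by (simp only: power_mult)
  qed (cases "even ((p - 1) div 8)"; simp)
  moreover have "Legendre (2 + r) (int p) = Legendre (r * (r + 1)) (int p)"
  proof (rule Legendre_cong)
    have "r * (r + 1) = r\<^sup>2 + r" by (simp add: power2_eq_square algebra_simps)
    thus "[2 + r = r * (r + 1)] (mod int p)" using cong_add[OF cong_sym[OF r] cong_refl[of r]] by simp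
  qed
  moreover have "Legendre r (int p) = quartic_sign 2 p"
    using Legendre_eq_quartic_sign[OF p(1) p2 p4 L2, of r 1] r by (simp add: L1)
  moreover have "(-1) ^ ((p - 1) div 8) * (-1) ^ ((p - 1) div 8) = (1::int)"
    by (simp flip: power_mult_distrib)
  moreover define XX Z where "XX = Legendre (r + 1) (int p) * quartic_sign 2 p" and "Z = (-1::int) ^ ((p - 1) div 8)"
  ultimately have "XX * Z = 1" "Z * Z = 1" using B unfolding mult by (simp_all add: mult.commute)
  hence "XX = Z" by (metis mult.assoc mult_1_left mult_1_right)
  thus ?thesis by (simp add: XX_def Z_def)
qed

text \<open>From \<open>a\<^sup>2 = 2 b\<^sup>2\<close> modulo \<open>p\<close> one gets \<open>(a/p) = (2/p)\<^sub>4 (b/p)\<close>. A prime divisor of \<open>b\<close> sees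
  \<open>p = a\<^sup>2\<close>, so \<open>(b/p) = 1\<close>; a prime divisor of \<open>a\<close> sees \<open>- 2 p = (2 b)\<^sup>2\<close>, so
  \<open>(a/p) = (-2/a)\<close>.\<close>

lemma quartic_sign_2_eq_odd_Jacobi:
  assumes p: "prime p" "p mod 8 = 1" and ab: "a\<^sup>2 - 2 * b\<^sup>2 = int p" "a > 0"
  shows "quartic_sign 2 p = odd_Jacobi (-2) (nat a)"
proof -
  have p2: "2 < p" using p prime_ge_2_nat[of p] by (cases "p = 2") auto
  have p4: "p mod 4 = 1" using p(2) by presburger
  have pp: "prime (int p)" using p by simp
  have L2: "Legendre 2 (int p) = 1" using Legendre_two[OF p(1) p2] p(2) by simp
  have n2: "\<not> int p dvd 2" using p2 by (auto dest!: zdvd_imp_le)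
  have "\<not> (int p dvd a \<and> int p dvd b)"
  proof safe
    assume d: "int p dvd a" "int p dvd b"
    hence "int p * int p dvd a\<^sup>2" "int p * int p dvd b\<^sup>2" unfolding power2_eq_square by (auto intro: mult_dvd_mono)
    hence "int p * int p dvd int p" using ab(1) by (metis dvd_diff dvd_mult)
    hence "int p * int p \<le> int p" using p2 by (intro zdvd_imp_le) auto
    thus False using p2 by simp
  qed
  moreover have "int p dvd a \<longleftrightarrow> int p dvd b"
  proof -
    have "int p dvd a\<^sup>2 \<longleftrightarrow> int p dvd 2 * b\<^sup>2"
      using ab(1) by (metis diff_add_cancel dvd_add_right_iff dvd_refl)
    thus ?thesis using pp n2 by (simp add: prime_dvd_mult_iff prime_dvd_power_iff)
  qed
  ultimately have nd: "\<not> int p dvd a" "\<not> int p dvd b" by auto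
  hence "b \<noteq> 0" by auto
  have "int (nat a) = a" using ab(2) by simp
  hence na: "\<not> p dvd nat a" using nd(1) of_nat_dvd_iff by metis
  have n1: "\<not> int l dvd 1" if "prime l" for l using prime_gt_1_nat[OF that] by (simp add: zdvd1_eq)
  have l2: "\<not> int l dvd 2" if "prime l" "l \<noteq> 2" for l using not_dvd_twist[of 2 l] that by (simp add: twists_def)
  have "Legendre (int (nat \<bar>b\<bar>)) (int p) = odd_Jacobi 1 (nat \<bar>b\<bar>)"
  proof (rule Legendre_eq_odd_Jacobi[OF p])
    fix l assume l: "prime l" "2 < l" "l dvd nat \<bar>b\<bar>"
    have "int l dvd int (nat \<bar>b\<bar>)" using l(3) of_nat_dvd_iff by blast
    hence lb: "int l dvd b" by simp
    hence "l \<noteq> p" using nd by auto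
    hence "\<not> l dvd p" using l(1) p(1) primes_dvd_imp_eq by blast
    hence "\<not> int l dvd - int p" by simp
    moreover have "a\<^sup>2 + (- int p) * 1\<^sup>2 = b * (2 * b)" using ab(1) by (simp add: power2_eq_square)
    moreover have "int l dvd b * (2 * b)" using lb by simp
    ultimately have "Legendre (- (- int p)) (int l) = 1"
      using Legendre_of_form[OF l(1,2), of "- int p" 1 a] n1[OF l(1)] by metis
    thus "Legendre (int p) (int l) = Legendre 1 (int l)"
      using Legendre_square[OF n1 l(1)] l by simp
  qed (use nd \<open>b \<noteq> 0\<close> n1 in \<open>auto simp: dvd_nat_abs_iff\<close>)
  hence "Legendre \<bar>b\<bar> (int p) = 1" by simp
  moreover have "Legendre (-1 * b) (int p) = Legendre b (int p)"
    using Legendre_neg1[OF p(1) p2] p4 by (simp only: Legendre_mult[OF p(1) p2]) simp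
  ultimately have Lb: "Legendre b (int p) = 1" by (auto simp: abs_if split: if_splits)
  have "[a\<^sup>2 = 2 * b\<^sup>2] (mod int p)" using ab(1) by (simp add: cong_iff_dvd_diff)
  from Legendre_eq_quartic_sign[OF p(1) p2 p4 L2 this] have La: "Legendre a (int p) = quartic_sign 2 p" using Lb by simp
  have "Legendre (int (nat a)) (int p) = odd_Jacobi (-2) (nat a)"
  proof (rule Legendre_eq_odd_Jacobi[OF p])
    fix l assume l: "prime l" "2 < l" "l dvd nat a"
    have "int l dvd int (nat a)" using l(3) of_nat_dvd_iff by blast
    hence la: "int l dvd a" using ab(2) by simp
    hence "l \<noteq> p" using nd by auto
    hence "\<not> l dvd p" using l(1) p(1) primes_dvd_imp_eq by blast
    hence "\<not> int l dvd int p" by simp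
    hence "\<not> int l dvd 2 * int p" using l l2[OF l(1)] by (simp add: prime_dvd_mult_iff)
    moreover have "(2 * b)\<^sup>2 + (2 * int p) * 1\<^sup>2 = 2 * a\<^sup>2" using ab(1) by (simp add: power_mult_distrib)
    moreover have "int l dvd 2 * a\<^sup>2" using la by (simp add: power2_eq_square)
    ultimately have "Legendre (- (2 * int p)) (int l) = 1"
      using Legendre_of_form[OF l(1,2), of "2 * int p" 1 "2 * b"] n1[OF l(1)] by metis
    moreover have "- (2 * int p) = - 2 * int p" by simp
    ultimately have "Legendre (- 2) (int l) * Legendre (int p) (int l) = 1" 
      by (simp only: Legendre_mult[OF l(1,2)])
    thus "Legendre (int p) (int l) = Legendre (-2) (int l)"
      using Legendre_cases[of "- 2" "int l"] Legendre_cases[of "int p" "int l"] by auto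
  qed (use na ab(2) l2 in auto)
  thus ?thesis using La ab(2) by simp
qed

section \<open>A comparison of residues modulo 8\<close>

lemma four_mult_plus_1_mod_4: "(4 * t + 1) mod 4 = (1::int)"
  by presburger

text \<open>After removing common factors \<open>2\<close> the form is congruent to \<open>1\<close> modulo \<open>4\<close>, or to \<open>2\<close> modulo
  \<open>8\<close> when both arguments are odd.\<close>

lemma odd_part_form:
  fixes x y q :: int
  assumes q: "q mod 8 = 1" and nz: "x \<noteq> 0 \<or> y \<noteq> 0"
  shows "\<exists>k m. x\<^sup>2 + q * y\<^sup>2 = 2 ^ k * m \<and> m mod 4 = 1"
  using nz
proof (induction "nat (\<bar>x\<bar> + \<bar>y\<bar>)" arbitrary: x y rule: less_induct)
  case (less x y)
  obtain j where j: "q = 8 * j + 1" using q by (metis mult_div_mod_eq)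
  show ?case
  proof (cases "even x \<and> even y")
    case True
    then obtain x' y' where xy: "x = 2 * x'" "y = 2 * y'" by (auto elim!: evenE)
    hence "nat (\<bar>x'\<bar> + \<bar>y'\<bar>) < nat (\<bar>x\<bar> + \<bar>y\<bar>)" "x' \<noteq> 0 \<or> y' \<noteq> 0" using less.prems by auto
    from less.hyps[OF this] obtain k m where "x'\<^sup>2 + q * y'\<^sup>2 = 2 ^ k * m" "m mod 4 = 1" by blast
    hence "x\<^sup>2 + q * y\<^sup>2 = 2 ^ (k + 2) * m \<and> m mod 4 = 1"
      unfolding xy by (simp add: power_mult_distrib power_add algebra_simps)
    thus ?thesis by blast
  next
    case False
    then consider x' y' where "x = 2 * x' + 1" "y = 2 * y'" | x' y' where "x = 2 * x'" "y = 2 * y' + 1"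
      | x' y' where "x = 2 * x' + 1" "y = 2 * y' + 1" by (metis evenE oddE)
    thus ?thesis
    proof cases
      case 1
      have "x\<^sup>2 + q * y\<^sup>2 = 4 * (x' * x' + x' + q * y' * y') + 1"
        unfolding 1 by (simp add: power2_eq_square algebra_simps)
      hence e: "x\<^sup>2 + q * y\<^sup>2 = 2 ^ 0 * (4 * (x' * x' + x' + q * y' * y') + 1)" by simp
      show ?thesis by (rule exI[of _ 0], rule exI[of _ "4 * (x' * x' + x' + q * y' * y') + 1"]) (simp only: e four_mult_plus_1_mod_4 simp_thms)
    next
      case 2
      have "x\<^sup>2 + q * y\<^sup>2 = 4 * (x' * x' + q * (y' * y' + y') + 2 * j) + 1"
        unfolding 2 by (simp add: j power2_eq_square algebra_simps)
      hence e: "x\<^sup>2 + q * y\<^sup>2 = 2 ^ 0 * (4 * (x' * x' + q * (y' * y' + y') + 2 * j) + 1)" by simp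
      show ?thesis by (rule exI[of _ 0], rule exI[of _ "4 * (x' * x' + q * (y' * y' + y') + 2 * j) + 1"]) (simp only: e four_mult_plus_1_mod_4 simp_thms)
    next
      case 3
      have "x\<^sup>2 + q * y\<^sup>2 = 2 * (2 * (x' * x' + x') + 2 * q * (y' * y' + y') + 4 * j + 1)"
        unfolding 3 by (simp add: j power2_eq_square algebra_simps)
      moreover have "even (x' * x' + x')" "even (y' * y' + y')" by auto
      then obtain s t where "x' * x' + x' = 2 * s" "y' * y' + y' = 2 * t" by (metis evenE)
      ultimately have "x\<^sup>2 + q * y\<^sup>2 = 2 * (2 * (2 * s) + 2 * q * (2 * t) + 4 * j + 1)" by (simp only:)
      also have "\<dots> = 2 ^ 1 * (4 * (s + q * t + j) + 1)" by (simp add: algebra_simps)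
      finally have e: "x\<^sup>2 + q * y\<^sup>2 = 2 ^ 1 * (4 * (s + q * t + j) + 1)" .
      show ?thesis by (rule exI[of _ 1], rule exI[of _ "4 * (s + q * t + j) + 1"]) (simp only: e four_mult_plus_1_mod_4 simp_thms)
    qed
  qed
qed

lemma abs_mod_8:
  fixes g u :: nat
  assumes "int g = \<bar>int u + 8 * z\<bar>" "odd u"
  shows "g mod 8 = u mod 8 \<or> g mod 8 = 8 - u mod 8"
proof -
    have u8: "u mod 8 = 1 \<or> u mod 8 = 3 \<or> u mod 8 = 5 \<or> u mod 8 = 7" using assms(2) by presburger
    from assms(1) consider "int g = int u + 8 * z" | "int g + int u = 8 * (- z)" by linarith
    thus ?thesis
    proof cases
      case 1
      hence "int g mod 8 = int u mod 8" by simp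
      thus ?thesis by (metis of_nat_eq_iff of_nat_mod of_nat_numeral)
    next
      case 2
      hence "8 dvd int (g + u)" by simp
      hence "(g + u) mod 8 = 0" by presburger
      hence "(g mod 8 + u mod 8) mod 8 = 0" by (simp add: mod_add_eq)
      moreover have "g mod 8 < 8" "u mod 8 < 8" "u mod 8 > 0" using u8 by auto
      moreover have aux: "x = 8 - y" if "(x + y) mod 8 = 0" "x < 8" "y < 8" "y > 0" for x y :: nat
      proof -
        have "8 dvd x + y" using that(1) by (simp add: dvd_eq_mod_eq_0)
        then obtain k where "x + y = 8 * k" by (rule dvdE)
        moreover from this that have "k = 1" by linarith
        ultimately show ?thesis by simp
      qed
      ultimately show ?thesis using aux[of "g mod 8" "u mod 8"] by simp
    qed
  qed

text \<open>For \<open>k \<ge> 2\<close> one has \<open>g = \<plusminus>c\<close> modulo \<open>8\<close> and \<open>u = c\<close> modulo \<open>4\<close>. For \<open>k = 1\<close> the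
  congruence of \<open>u\<close> and \<open>u'\<close> gives \<open>g = \<plusminus>u\<close> and \<open>c = 3 u\<close> modulo \<open>8\<close>, and
  \<open>(-1/u) (2/u) = (-2/u) = (-2/(3 u))\<close>.\<close>

lemma two_adic_comparison:
  fixes u u' c g :: nat
  assumes odd: "odd u" "odd u'" and uu: "u mod 4 = u' mod 4" and k: "k \<ge> 1"
    and c: "c = u + 2 ^ k * u'" and g: "int g = \<bar>int u - 2 ^ k * int u'\<bar>"
  shows "odd_Jacobi (-1) u * odd_Jacobi 2 g = odd_Jacobi (-1) c * odd_Jacobi 2 c"
proof (cases "k = 1")
  case True
  have u8: "u mod 8 = 1 \<or> u mod 8 = 3 \<or> u mod 8 = 5 \<or> u mod 8 = 7" using odd by presburger
  have "(2 * u') mod 8 = (2 * u) mod 8"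
    using uu mod_mult_mult1[of 2 u' 4] mod_mult_mult1[of 2 u 4] by simp
  hence "(u + 2 * u') mod 8 = (u + 2 * u) mod 8" by (rule mod_add_cong[OF refl])
  hence "c mod 8 = (3 * u) mod 8" using c True by simp
  hence c8: "c mod 8 = (3 * (u mod 8)) mod 8" by (simp add: mod_mult_right_eq)
  have g8: "g mod 8 = u mod 8 \<or> g mod 8 = 8 - u mod 8"
  proof -
    have "int u mod 4 = int u' mod 4" using uu by (metis of_nat_mod of_nat_numeral)
    then obtain z where z: "int u' = int u + 4 * z" by (metis add.commute mod_eqE mult.commute) 
    have "int g = \<bar>int u + 8 * z\<bar>" using g True z by simp
    thus ?thesis using odd(1) by (rule abs_mod_8)
  qed
  have "odd (int g)" unfolding g using odd by (simp add: True)
  hence "odd g" by simp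
  moreover have "odd c" using odd by (simp add: c True)
  moreover have "odd_Jacobi (-1) n = (if n mod 8 = 1 \<or> n mod 8 = 5 then 1 else -1)" if "odd n" for n
  proof -
    have "n mod 4 = 1 \<longleftrightarrow> n mod 8 = 1 \<or> n mod 8 = 5" by presburger
    thus ?thesis using odd_Jacobi_neg1[OF that] by simp
  qed
  ultimately show ?thesis using u8 c8 g8 odd
    by (elim disjE) (simp_all add: odd_Jacobi_two)
next
  case False
  hence "k = (k - 2) + 2" using k by simp
  hence "(2::nat) ^ k = 2 ^ (k - 2) * 2 ^ 2" by (simp only: flip: power_add)
  then obtain w where "(2::nat) ^ k = 4 * w" by simp
  hence w: "2 ^ k = (4::int) * int w" by (metis of_nat_mult of_nat_numeral of_nat_power)
  define v where "v = w * u'"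
  have c': "c = u + 4 * v" using c \<open>2 ^ k = 4 * w\<close> by (simp add: v_def)
  have g': "int g = \<bar>int u - 4 * int v\<bar>" using g w by (simp add: v_def)
  have "odd c" using odd c' by simp
  moreover have "int g = \<bar>int c + 8 * (- int v)\<bar>" using g' c' by simp
  hence "g mod 8 = c mod 8 \<or> g mod 8 = 8 - c mod 8" using \<open>odd c\<close> by (rule abs_mod_8)
  moreover have "odd (int g)" unfolding g' using odd by simp
  hence "odd g" by simp
  moreover have "c mod 8 = 1 \<or> c mod 8 = 3 \<or> c mod 8 = 5 \<or> c mod 8 = 7" using \<open>odd c\<close> by presburger
  moreover have "u mod 4 = c mod 4" using c' by simp
  ultimately show ?thesis using odd by (elim disjE) (simp_all add: odd_Jacobi_neg1 odd_Jacobi_two)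
qed

section \<open>The equations with middle coefficient 2q and -2q\<close>

context norm_solution
begin

lemma halves:
  assumes "e = 2 \<or> e = -2"
  obtains A B where "\<alpha> = 2 * A" "\<beta> = 2 * B" "odd A" "odd \<gamma>"
    "int p * (int A)\<^sup>2 + e * int q * (int B)\<^sup>2 = (int \<gamma>)\<^sup>2"
proof -
  obtain c where c: "e = 2 * c" using assms by (metis mult_1_right mult_minus_right)
  have op: "odd p" "odd q" using p8 q8 by presburger+
  have "even (int p * (int \<alpha>)\<^sup>2)" using eqn c by (metis dvd_add_left_iff dvd_mult2 dvd_triv_left power2_eq_square)
  hence "even \<alpha>" using op by simp
  then obtain A where A: "\<alpha> = 2 * A" by blast
  have "2 * int p * (int A)\<^sup>2 + c * int q * (int \<beta>)\<^sup>2 = 2 * (int \<gamma>)\<^sup>2"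
    using eqn by (simp add: A c power_mult_distrib)
  hence e1: "c * int q * (int \<beta>)\<^sup>2 = 2 * ((int \<gamma>)\<^sup>2 - int p * (int A)\<^sup>2)" by (simp add: algebra_simps)
  have "odd c" using c assms by auto
  hence "even ((int \<beta>)\<^sup>2)" using e1 op by (metis dvd_triv_left even_mult_iff even_of_nat)
  hence "even \<beta>" by simp
  then obtain B where B: "\<beta> = 2 * B" by blast
  have e2: "int p * (int A)\<^sup>2 + e * int q * (int B)\<^sup>2 = (int \<gamma>)\<^sup>2"
    using eqn by (simp add: A B power_mult_distrib)
  have og: "odd \<gamma>" 
  proof
    assume "even \<gamma>"
    hence "int 2 dvd int \<gamma>" by simp
    thus False using no_common_divisor[of 2] A B by simp
  qed
  have "odd A"
  proof
    assume "even A"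
    hence "even (int p * (int A)\<^sup>2 + e * int q * (int B)\<^sup>2)" using assms by auto
    thus False unfolding e2 using og by simp
  qed
  thus thesis using that A B og e2 by blast
qed

text \<open>The reason is the identity
  \<open>(A \<theta> + g)\<^sup>2 = 2 A \<theta> (a A + g) + (g\<^sup>2 - p A\<^sup>2)\<close>, valid for \<open>\<theta> = a + b \<surd>2\<close> and \<open>g = \<plusminus>\<gamma>\<close>, in which the
  last term is a multiple of \<open>q\<close>. The sign of \<open>g\<close> is chosen such that \<open>a A + g\<close> is prime to \<open>q\<close>.
  The prime factors of \<open>a A + g\<close> are controlled by
  \<open>(a A + g) (a A - g) = 2 ((b A)\<^sup>2 - \<epsilon> q B\<^sup>2)\<close>.\<close>

lemma Legendre_norm_form_product:
  assumes ee: "e = 2 * \<epsilon>" "\<epsilon> = 1 \<or> \<epsilon> = -1"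
    and A: "\<alpha> = 2 * A" "\<beta> = 2 * B" "odd \<gamma>" "int p * (int A)\<^sup>2 + e * int q * (int B)\<^sup>2 = (int \<gamma>)\<^sup>2"
    and ab: "a\<^sup>2 - 2 * b\<^sup>2 = int p" and r: "[r\<^sup>2 = 2] (mod int q)"
  obtains g where "g = int \<gamma> \<or> g = - int \<gamma>" "\<not> int q dvd a * int A + g"
    "Legendre (a + b * r) (int q) = Legendre (int A) (int q) * Legendre (a * int A + g) (int q)"
    "\<And>l. prime l \<Longrightarrow> 2 < l \<Longrightarrow> int l dvd a * int A + g \<Longrightarrow> odd (multiplicity (int l) (a * int A + g)) \<Longrightarrow>
       Legendre (\<epsilon> * int q) (int l) = 1"
proof -
  interpret S: two_primes q p by (rule swap)
  have pq': "prime (int q)" using q by simp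
  have q2: "\<not> int q dvd 2" using q_gt_2 by (auto dest!: zdvd_imp_le)
  have nA: "\<not> int q dvd int A" using not_q_dvd(1) A(1) by auto
  have prod: "(a * int A + int \<gamma>) * (a * int A - int \<gamma>) = 2 * ((b * int A)\<^sup>2 + (- \<epsilon> * int q) * (int B)\<^sup>2)"
  proof -
    have "(a * int A + int \<gamma>) * (a * int A - int \<gamma>) = a\<^sup>2 * (int A)\<^sup>2 - (int \<gamma>)\<^sup>2"
      by (simp add: power2_eq_square algebra_simps)
    also have "\<dots> = (int p + 2 * b\<^sup>2) * (int A)\<^sup>2 - (int p * (int A)\<^sup>2 + e * int q * (int B)\<^sup>2)"
      using ab A(4) by (simp add: algebra_simps)
    finally show ?thesis by (simp add: ee(1) power_mult_distrib algebra_simps)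
  qed
  have "\<not> (int q dvd a * int A + int \<gamma> \<and> int q dvd a * int A - int \<gamma>)"
  proof safe
    assume d: "int q dvd a * int A + int \<gamma>" "int q dvd a * int A - int \<gamma>"
    hence "int q dvd (a * int A + int \<gamma>) - (a * int A - int \<gamma>)" by (rule dvd_diff)
    hence "int q dvd 2 * int \<gamma>" by simp
    thus False using pq' q2 not_q_dvd(2) by (simp add: prime_dvd_mult_iff)
  qed
  then obtain g where g: "g = int \<gamma> \<or> g = - int \<gamma>" "\<not> int q dvd a * int A + g" by force
  have prodg: "(a * int A + g) * (a * int A - g) = 2 * ((b * int A)\<^sup>2 + (- \<epsilon> * int q) * (int B)\<^sup>2)"
    using g(1) prod by (auto simp: mult.commute)
  have gg: "g\<^sup>2 = int p * (int A)\<^sup>2 + e * int q * (int B)\<^sup>2" using g(1) A(4) by auto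
  define t where "t = a + b * r"
  have nt: "\<not> int q dvd t"
  proof
    assume "int q dvd t"
    hence "int q dvd t * (a - b * r) + b\<^sup>2 * (r\<^sup>2 - 2)"
      using r by (intro dvd_add) (auto simp: cong_iff_dvd_diff)
    also have "t * (a - b * r) + b\<^sup>2 * (r\<^sup>2 - 2) = int p"
      unfolding ab[symmetric] t_def by (simp add: power2_eq_square algebra_simps)
    finally show False using not_q_dvd_p by simp
  qed
  have id: "(int A * t + g)\<^sup>2 = 2 * int A * t * (a * int A + g) + (int A)\<^sup>2 * b\<^sup>2 * (r\<^sup>2 - 2) + (g\<^sup>2 - int p * (int A)\<^sup>2)"
    unfolding ab[symmetric] t_def by (simp add: power2_eq_square algebra_simps)
  have c: "[2 * int A * t * (a * int A + g) = (int A * t + g)\<^sup>2] (mod int q)"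
  proof -
    define w where "w = (int A)\<^sup>2 * b\<^sup>2 * (r\<^sup>2 - 2) + (g\<^sup>2 - int p * (int A)\<^sup>2)"
    have "int q dvd w" unfolding w_def
      using r by (intro dvd_add) (auto simp: cong_iff_dvd_diff gg)
    moreover have "(int A * t + g)\<^sup>2 = 2 * int A * t * (a * int A + g) + w"
      unfolding id w_def by simp
    ultimately show ?thesis by (simp add: cong_iff_dvd_diff)
  qed
  have np: "\<not> int q dvd 2 * int A * t * (a * int A + g)"
    using pq' q2 nA nt g(2) by (simp add: prime_dvd_mult_iff)
  hence "\<not> int q dvd (int A * t + g)\<^sup>2" using c cong_dvd_iff by blast
  hence "\<not> int q dvd int A * t + g" by (auto simp: power2_eq_square)
  hence "Legendre ((int A * t + g)\<^sup>2) (int q) = 1" using Legendre_square q by blast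
  hence "Legendre (int A) (int q) * Legendre t (int q) * Legendre (a * int A + g) (int q) = 1"
    using Legendre_cong[OF c] by (simp add: S.Legendre_mult_p S.Legendre_2_p mult.assoc)
  hence L: "Legendre t (int q) = Legendre (int A) (int q) * Legendre (a * int A + g) (int q)"
    using Legendre_cases[of "int A" "int q"] Legendre_cases[of t "int q"] Legendre_cases[of "a * int A + g" "int q"]
    by auto
  show thesis
  proof (rule that[OF g L[unfolded t_def]])
    fix l assume l: "prime l" "2 < l" and ld: "int l dvd a * int A + g"
      and lo: "odd (multiplicity (int l) (a * int A + g))"
    let ?F = "(b * int A)\<^sup>2 + (- \<epsilon> * int q) * (int B)\<^sup>2"
    have pl: "prime (int l)" using l by simp
    have l2: "\<not> int l dvd 2" using l(2) by (auto dest!: zdvd_imp_le)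
    have "l \<noteq> q" using ld g(2) by auto
    hence "\<not> l dvd q" using l(1) q primes_dvd_imp_eq by blast
    hence nd: "\<not> int l dvd - \<epsilon> * int q" using ee(2) by auto
    have "int l dvd 2 * ?F" unfolding prodg[symmetric] using ld by (rule dvd_mult2)
    hence lF: "int l dvd ?F" using prime_dvd_multD[OF pl] l2 by blast
    have "Legendre (- (- \<epsilon> * int q)) (int l) = 1"
    proof (cases "int l dvd a * int A - g")
      case True
      hence "int l dvd (a * int A + g) - (a * int A - g)" using dvd_diff[OF ld] by blast
      hence "int l dvd 2 * g" by simp
      hence "int l dvd g" using pl l2 by (simp add: prime_dvd_mult_iff)
      hence "int l dvd int \<gamma>" using g(1) by auto
      hence "\<not> int l dvd int \<beta>" using pairwise(3)[OF l(1)] l(2) by auto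
      hence "\<not> int l dvd int B" using A(2) by auto
      thus ?thesis using Legendre_of_form[OF l nd _ lF] by blast
    next
      case False
      have "a * int A + g \<noteq> 0" using g(2) by auto
      moreover have n2: "a * int A - g \<noteq> 0" using False by auto
      ultimately have "2 * ?F \<noteq> 0" unfolding prodg[symmetric] by simp
      hence F0: "?F \<noteq> 0" by simp
      have "multiplicity (int l) ((a * int A + g) * (a * int A - g)) =
         multiplicity (int l) (a * int A + g) + multiplicity (int l) (a * int A - g)"
        using pl \<open>a * int A + g \<noteq> 0\<close> n2 by (intro prime_elem_multiplicity_mult_distrib) auto
      also have "multiplicity (int l) (a * int A - g) = 0" using False by (rule not_dvd_imp_multiplicity_0)
      finally have m1: "odd (multiplicity (int l) (2 * ?F))" using lo prodg by simp
      have "multiplicity (int l) (2 * ?F) = multiplicity (int l) 2 + multiplicity (int l) ?F"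
        using pl F0 by (intro prime_elem_multiplicity_mult_distrib) auto
      also have "multiplicity (int l) 2 = 0" using l2 by (rule not_dvd_imp_multiplicity_0)
      finally have "odd (multiplicity (int l) ?F)" using m1 by simp
      thus ?thesis using Legendre_of_form_odd_multiplicity[OF l nd F0] by blast
    qed
    thus "Legendre (\<epsilon> * int q) (int l) = 1" by simp
  qed
qed

text \<open>For \<open>\<epsilon> = 1\<close> the prime factors of \<open>a A + g\<close> of odd multiplicity satisfy \<open>(q/l) = 1\<close>, so
  \<open>((a A + g)/q) = 1\<close>.\<close>

lemma Legendre_gamma_q_two: 
  assumes e2: "e = 2" and ab: "a\<^sup>2 - 2 * b\<^sup>2 = int p" and r: "[r\<^sup>2 = 2] (mod int q)"
  shows "Legendre (int \<gamma>) (int q) = quartic_sign (int p) q * Legendre (a + b * r) (int q)"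
proof -
  interpret S: two_primes q p by (rule swap)
  obtain A B where A: "\<alpha> = 2 * A" "\<beta> = 2 * B" "odd \<gamma>" 
    "int p * (int A)\<^sup>2 + e * int q * (int B)\<^sup>2 = (int \<gamma>)\<^sup>2" using halves e2 by metis
  obtain g where g: "\<not> int q dvd a * int A + g"
    "Legendre (a + b * r) (int q) = Legendre (int A) (int q) * Legendre (a * int A + g) (int q)"
    "\<And>l. prime l \<Longrightarrow> 2 < l \<Longrightarrow> int l dvd a * int A + g \<Longrightarrow> odd (multiplicity (int l) (a * int A + g)) \<Longrightarrow>
       Legendre (1 * int q) (int l) = 1"
    using Legendre_norm_form_product[OF _ _ A ab r, of 1] e2 by auto
  define n where "n = nat \<bar>a * int A + g\<bar>"
  have n: "int n = \<bar>a * int A + g\<bar>" by (simp add: n_def)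
  have n1: "\<not> int l dvd 1" if "prime l" for l using prime_gt_1_nat[OF that] by (simp add: zdvd1_eq)
  have nqn: "\<not> q dvd n" using g(1) n by (metis dvd_abs_iff of_nat_dvd_iff)
  hence "n > 0" by (cases n) auto
  have "Legendre (int n) (int q) = odd_Jacobi 1 n"
  proof (rule Legendre_eq_odd_Jacobi[OF q q8 \<open>n > 0\<close> nqn])
    fix l assume l: "prime l" "2 < l" "l dvd n" "odd (multiplicity l n)"
    have "int l dvd a * int A + g" using l(3) n by (metis dvd_abs_iff of_nat_dvd_iff)
    moreover have "multiplicity (int l) (a * int A + g) = multiplicity l n" 
      using multiplicity_int[OF l(1) \<open>n > 0\<close>] multiplicity_normalize_right[of "int l" "a * int A + g"]
      by (simp add: n normalize_int_def)
    ultimately have "Legendre (int q) (int l) = 1" using g(3)[OF l(1,2)] l(4) by simp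
    thus "Legendre (int q) (int l) = Legendre 1 (int l)" using Legendre_square[OF n1 l(1)] l by simp
  qed (use n1 in auto)
  moreover have "Legendre (int n) (int q) = Legendre (a * int A + g) (int q)"
    using S.Legendre_mult_p[of "-1" "a * int A + g"] S.Legendre_neg1_p by (simp add: n abs_if)
  ultimately have "Legendre (a + b * r) (int q) = Legendre (int A) (int q)" using g(2) by simp
  moreover have "Legendre (int \<alpha>) (int q) = Legendre (int A) (int q)"
    by (simp add: A(1) S.Legendre_mult_p S.Legendre_2_p)
  ultimately show ?thesis using Legendre_gamma_q Legendre_alpha by simp
qed

text \<open>For \<open>\<epsilon> = -1\<close> one finds \<open>((a A + g)/q) = (-1/n)\<close> with \<open>n = a A + g > 0\<close>, and
  \<open>(A/q) = (-2/A)\<close>. What is left is the identity \<open>(-1/n) (2/\<gamma>) = (-2/A) (2/p)\<^sub>4\<close>, where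
  \<open>(2/p)\<^sub>4 = (-2/a)\<close>. It only involves residues modulo powers of \<open>2\<close>: the factors
  \<open>N = a A + g\<close> and \<open>M = a A - g\<close> have sum \<open>2 a A\<close> and difference \<open>2 g\<close>, and their product is a power
  of \<open>2\<close> times a number congruent to \<open>1\<close> modulo \<open>4\<close>, which is the situation of
  \<open>two_adic_comparison\<close>.\<close>

lemma Legendre_gamma_q_minus_two: 
  assumes e2: "e = -2" and ab: "a\<^sup>2 - 2 * b\<^sup>2 = int p" "a > 0" and r: "[r\<^sup>2 = 2] (mod int q)"
  shows "Legendre (int \<gamma>) (int q) = quartic_sign (int q) p * Legendre (a + b * r) (int q)"
proof -
  interpret S: two_primes q p by (rule swap)
  obtain A B where A: "\<alpha> = 2 * A" "\<beta> = 2 * B" "odd \<gamma>" 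
    "int p * (int A)\<^sup>2 + e * int q * (int B)\<^sup>2 = (int \<gamma>)\<^sup>2" and oA: "odd A" using halves e2 by metis
  obtain g where g: "\<not> int q dvd a * int A + g"
    "Legendre (a + b * r) (int q) = Legendre (int A) (int q) * Legendre (a * int A + g) (int q)"
    "\<And>l. prime l \<Longrightarrow> 2 < l \<Longrightarrow> int l dvd a * int A + g \<Longrightarrow> odd (multiplicity (int l) (a * int A + g)) \<Longrightarrow>
       Legendre (-1 * int q) (int l) = 1"
    and gg: "g = int \<gamma> \<or> g = - int \<gamma>"
    using Legendre_norm_form_product[OF _ _ A ab(1) r, of "-1"] e2 by auto
  have Bpos: "B > 0" using pos A(2) by simp
  define M where "M = a * int A - g"
  define N where "N = a * int A + g"
  have A0: "int A > 0" using oA by (simp add: odd_pos)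
  have sq: "g\<^sup>2 = (int \<gamma>)\<^sup>2" using gg by auto
  have NM: "N * M = 2 * ((b * int A)\<^sup>2 + int q * (int B)\<^sup>2)"
  proof -
    have "N * M = a\<^sup>2 * (int A)\<^sup>2 - g\<^sup>2" by (simp add: N_def M_def power2_eq_square algebra_simps)
    also have "a\<^sup>2 = int p + 2 * b\<^sup>2" using ab by simp
    finally show ?thesis using A(4) sq e2 by (simp add: power_mult_distrib algebra_simps)
  qed
  have Fpos: "(b * int A)\<^sup>2 + int q * (int B)\<^sup>2 > 0"
    using Bpos q_gt_2 by (intro add_nonneg_pos) auto
  have sum: "N + M = 2 * (a * int A)" by (simp add: N_def M_def)
  have "N > 0 \<and> M > 0"
  proof -
    have "N * M > 0" using NM Fpos by simp
    moreover have "N + M > 0" unfolding sum using ab(2) A0 by simp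
    ultimately show ?thesis by (auto simp: zero_less_mult_iff)
  qed
  hence N0: "N > 0" and M0: "M > 0" by auto
  define n where "n = nat N"
  have n: "int n = N" using N0 by (simp add: n_def)
  have n1: "\<not> int l dvd - 1" if "prime l" for l using prime_gt_1_nat[OF that] by (simp add: zdvd1_eq)
  have nqn: "\<not> q dvd n" using g(1) n unfolding N_def by (metis of_nat_dvd_iff)
  hence "n > 0" by (cases n) auto
  have Ln: "Legendre (int n) (int q) = odd_Jacobi (-1) n"
  proof (rule Legendre_eq_odd_Jacobi[OF q q8 \<open>n > 0\<close> nqn])
    fix l assume l: "prime l" "2 < l" "l dvd n" "odd (multiplicity l n)"
    have "int l dvd a * int A + g" using l(3) n unfolding N_def by (metis of_nat_dvd_iff)
    moreover have "multiplicity (int l) (a * int A + g) = multiplicity l n" 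
      using multiplicity_int[OF l(1) \<open>n > 0\<close>] n unfolding N_def by simp
    ultimately have "Legendre (-1 * int q) (int l) = 1" using g(3)[OF l(1,2)] l(4) by simp
    thus "Legendre (int q) (int l) = Legendre (- 1) (int l)" 
      unfolding Legendre_mult[OF l(1,2)]
      using Legendre_cases[of "- 1" "int l"] Legendre_cases[of "int q" "int l"] by auto
  qed (use n1 in auto)
  have op: "odd (int p)" using p8 by presburger
  have oa: "odd a"
  proof
    assume "even a"
    hence "even (a\<^sup>2 - 2 * b\<^sup>2)" by simp
    thus False using ab(1) op by simp
  qed
  have sq8: "x\<^sup>2 mod 8 = 1" if "odd x" for x :: int
  proof -
    obtain z where "x = 2 * z + 1" using \<open>odd x\<close> by (metis oddE)
    moreover have "even (z * z + z)" by auto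
    then obtain w where "z * z + z = 2 * w" by (metis evenE)
    ultimately have "x\<^sup>2 = 8 * w + 1" by (simp add: power2_eq_square algebra_simps)
    thus ?thesis by presburger
  qed
  have ev: "even x" if "(2 * x\<^sup>2) mod 8 = 0" for x :: int
  proof (rule ccontr)
    assume "odd x"
    hence "x\<^sup>2 mod 8 = 1" by (rule sq8)
    thus False using that by presburger
  qed
  have "int p mod 8 = 1" "int q mod 8 = 1" using p8 q8 by presburger+
  have eb: "even b"
  proof (rule ev)
    have "2 * b\<^sup>2 = a\<^sup>2 - int p" using ab(1) by simp
    thus "(2 * b\<^sup>2) mod 8 = 0" using sq8[OF oa] \<open>int p mod 8 = 1\<close> by presburger
  qed
  have eB: "even (int B)"
  proof (rule ev)
    have "(int p * (int A)\<^sup>2) mod 8 = ((int p mod 8) * ((int A)\<^sup>2 mod 8)) mod 8" by (simp add: mod_mult_eq)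
    hence 1: "(int p * (int A)\<^sup>2) mod 8 = 1" using sq8[of "int A"] oA \<open>int p mod 8 = 1\<close> by simp
    have "(int \<gamma>)\<^sup>2 mod 8 = 1" using sq8[of "int \<gamma>"] A(3) by simp
    moreover have "2 * (int q * (int B)\<^sup>2) = int p * (int A)\<^sup>2 - (int \<gamma>)\<^sup>2" using A(4) e2 by simp
    ultimately have "(2 * (int q * (int B)\<^sup>2)) mod 8 = 0" using 1 by presburger
    moreover have "(int q * (2 * (int B)\<^sup>2)) mod 8 = ((int q mod 8) * ((2 * (int B)\<^sup>2) mod 8)) mod 8" by (simp add: mod_mult_eq)
    ultimately show "(2 * (int B)\<^sup>2) mod 8 = 0" using \<open>int q mod 8 = 1\<close> by (simp add: ac_simps)
  qed
  obtain b' B' where b': "b = 2 * b'" "int B = 2 * B'" using eb eB by (metis evenE)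
  have "B' \<noteq> 0" using b' Bpos by auto
  then obtain k m where km: "(b' * int A)\<^sup>2 + int q * B'\<^sup>2 = 2 ^ k * m" "m mod 4 = 1"
    using odd_part_form[OF \<open>int q mod 8 = 1\<close>] by blast
  have NM': "N * M = 8 * (2 ^ k * m)" unfolding NM b' km(1)[symmetric] by (simp add: power2_eq_square algebra_simps)
  have og: "odd g" using gg A(3) by auto
  have eN: "even N" "even M" using og oa oA by (auto simp: N_def M_def)
  then obtain N1 M1 where N1: "N = 2 * N1" "M = 2 * M1" by (metis evenE)
  have s1: "N1 + M1 = a * int A" using sum N1 by simp
  have p1: "N1 * M1 = 2 ^ Suc k * m" using NM' N1 by (simp add: algebra_simps)
  have om: "odd m" using km(2) by presburger
  have pos1: "N1 > 0" "M1 > 0" using N1 N0 M0 by auto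
  \<comment> \<open>of \<open>N / 2\<close> and \<open>M / 2\<close> one is odd and carries no power of \<open>2\<close>, and the odd parts agree modulo \<open>4\<close>\<close>
  have split: "\<exists>u'. y = 2 ^ Suc k * u' \<and> x mod 4 = u' mod 4 \<and> odd u' \<and> u' > 0"
    if "x * y = 2 ^ Suc k * m" "odd x" "y > 0" for x y
  proof -
    have "coprime (2 ^ Suc k) x" using \<open>odd x\<close> by simp
    moreover have "2 ^ Suc k dvd x * y" using that by simp
    ultimately have "2 ^ Suc k dvd y" by (simp only: coprime_dvd_mult_right_iff)
    then obtain u' where u': "y = 2 ^ Suc k * u'" by blast
    hence xu: "x * u' = m" using that by simp
    hence ou: "odd u'" using om by auto
    have "(x mod 4) * (u' mod 4) mod 4 = 1" using xu km(2) by (simp add: mod_mult_eq)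
    moreover have "x mod 4 = 1 \<or> x mod 4 = 3" "u' mod 4 = 1 \<or> u' mod 4 = 3" using ou that(2) by presburger+
    ultimately have "x mod 4 = u' mod 4" by (elim disjE) simp_all
    moreover have "u' > 0" using u' that(3) by (simp add: zero_less_mult_iff)
    ultimately show ?thesis using u' ou by blast
  qed
  have n4: "nat x mod 4 = nat y mod 4" if "x mod 4 = y mod 4" "x > 0" "y > 0" for x y :: int
    using that by (metis nat_mod_distrib nat_numeral order_less_imp_le zero_le_numeral)
  have key: "odd_Jacobi (-1) (nat N1) * odd_Jacobi 2 \<gamma> = odd_Jacobi (-1) (nat (a * int A)) * odd_Jacobi 2 (nat (a * int A))"
  proof (cases "odd N1")
    case True
    then obtain u' where u': "M1 = 2 ^ Suc k * u'" "N1 mod 4 = u' mod 4" "odd u'" "u' > 0" 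
      using split[OF p1] pos1 by blast
    have "\<bar>g\<bar> = \<bar>N1 - M1\<bar>" using N1 by (simp add: N_def M_def)
    hence "int \<gamma> = \<bar>N1 - 2 ^ Suc k * u'\<bar>" using gg u'(1) by auto
    thus ?thesis using True u' pos1 s1
      by (intro two_adic_comparison[of _ "nat u'" "Suc k"])
         (auto simp: even_nat_iff nat_add_distrib nat_mult_distrib nat_power_eq n4[OF u'(2)] simp flip: s1)
  next
    case False
    hence "odd M1" using s1 oa oA by (metis even_add even_mult_iff even_of_nat)
    moreover have "M1 * N1 = 2 ^ Suc k * m" using p1 by (simp add: mult.commute)
    ultimately obtain u' where u': "N1 = 2 ^ Suc k * u'" "M1 mod 4 = u' mod 4" "odd u'" "u' > 0" 
      using split pos1 by blast
    have "\<bar>g\<bar> = \<bar>M1 - N1\<bar>" using N1 by (simp add: N_def M_def)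
    hence "int \<gamma> = \<bar>M1 - 2 ^ Suc k * u'\<bar>" using gg u'(1) by auto
    hence "odd_Jacobi (-1) (nat M1) * odd_Jacobi 2 \<gamma> = odd_Jacobi (-1) (nat (a * int A)) * odd_Jacobi 2 (nat (a * int A))"
      using \<open>odd M1\<close> u' pos1 s1
      by (intro two_adic_comparison[of _ "nat u'" "Suc k"])
         (auto simp: even_nat_iff nat_add_distrib nat_mult_distrib nat_power_eq n4[OF u'(2)] add.commute simp flip: s1)
    moreover have "odd_Jacobi (-1) (nat N1) = odd_Jacobi (-1) (nat u')"
      using u' by (simp add: nat_mult_distrib nat_power_eq odd_Jacobi_two_power_mult[of "nat u'" "-1" "Suc k", simplified])
    moreover have "nat M1 mod 4 = nat u' mod 4" 
      using u'(2) pos1 u'(4) by (metis nat_mod_distrib nat_numeral order_less_imp_le zero_le_numeral)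
    hence "odd_Jacobi (-1) (nat u') = odd_Jacobi (-1) (nat M1)"
      using \<open>odd M1\<close> u' pos1 by (simp add: odd_Jacobi_neg1 even_nat_iff)
    ultimately show ?thesis by simp
  qed
  have kn: "odd_Jacobi (-1) n = odd_Jacobi (-1) (nat N1)"
    using N1 pos1 by (simp add: n_def nat_mult_distrib)
  have ca: "nat (a * int A) = nat a * A" using ab(2) by (simp add: nat_mult_distrib)
  have k2: "odd_Jacobi (-1) x * odd_Jacobi 2 x = odd_Jacobi (-2) x" if "x > 0" for x 
    using odd_Jacobi_mult_left[OF that, of "-1" 2] by simp
  have a0: "nat a > 0" "A > 0" using ab(2) A0 by auto
  have "odd_Jacobi (-1) n * odd_Jacobi 2 \<gamma> = odd_Jacobi (-2) (nat a) * odd_Jacobi (-2) A"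
  proof -
    have "odd_Jacobi (-1) n * odd_Jacobi 2 \<gamma> = odd_Jacobi (-2) (nat a * A)"
      using key a0 k2[of "nat a * A"] unfolding kn ca by simp
    thus ?thesis using a0 by (simp add: odd_Jacobi_mult)
  qed
  moreover have "odd_Jacobi (-2) (nat a) = quartic_sign 2 p" using quartic_sign_2_eq_odd_Jacobi[OF p p8 ab] by simp
  ultimately have K: "odd_Jacobi (-1) n * odd_Jacobi 2 \<gamma> = quartic_sign 2 p * odd_Jacobi (-2) A" by simp
  have "Legendre (int \<alpha>) (int q) = Legendre (int A) (int q)"
    by (simp add: A(1) S.Legendre_mult_p S.Legendre_2_p)
  moreover have "odd_Jacobi e \<alpha> = odd_Jacobi (-2) A" using a0 by (simp add: A(1) e2)
  ultimately have R: "Legendre (a + b * r) (int q) = odd_Jacobi (-2) A * odd_Jacobi (-1) n"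
    using g(2) Ln n Legendre_alpha by (simp add: N_def)
  have q4e: "quartic_sign e p = quartic_sign 2 p"
  proof -
    have "even ((p - 1) div 4)" using p8 by presburger
    hence "(- 2) ^ ((p - 1) div 4) = (2::int) ^ ((p - 1) div 4)" by simp
    thus ?thesis unfolding e2 quartic_sign_def by simp
  qed
  have G: "quartic_sign 2 p * quartic_sign (int q) p * Legendre (int \<gamma>) (int q) = odd_Jacobi 2 \<gamma>"
    using Legendre_gamma_pq Legendre_gamma_p q4e e2 by simp
  have nd: "\<not> int l dvd -1" "\<not> int l dvd 2" "\<not> int l dvd -2" if "prime l" "l \<noteq> 2" for l
    using not_dvd_twist[of "-1" l] not_dvd_twist[of 2 l] not_dvd_twist[of "-2" l] that by (auto simp: twists_def)
  have "odd_Jacobi (-1) n = 1 \<or> odd_Jacobi (-1) n = -1" "odd_Jacobi 2 \<gamma> = 1 \<or> odd_Jacobi 2 \<gamma> = -1" "odd_Jacobi (-2) A = 1 \<or> odd_Jacobi (-2) A = -1"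
    using odd_Jacobi_cases[of n "-1"] odd_Jacobi_cases[of \<gamma> 2] odd_Jacobi_cases[of A "-2"] nd a0 pos N0 by (auto simp: n_def)
  moreover have "quartic_sign 2 p = 1 \<or> quartic_sign 2 p = -1" "quartic_sign (int q) p = 1 \<or> quartic_sign (int q) p = -1" by (auto simp: quartic_sign_def)
  ultimately show ?thesis using K R G by (elim disjE) simp_all
qed

end

section \<open>The Pfaffians in terms of residue symbols\<close>

lemma solution_as_norm_solution:
  assumes "two_primes p q" "e \<in> twists" "primitive_solution (int p) (e * int q) x y z"
  shows "norm_solution p q e (nat x) (nat y) (nat z)" "int (nat z) = z"
proof -
  have "x > 0" "y > 0" "z > 0" using assms(3) by (simp_all add: primitive_solution_def)
  thus "norm_solution p q e (nat x) (nat y) (nat z)" "int (nat z) = z"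
    using assms by (simp_all add: norm_solution_def norm_solution_axioms_def)
qed

context two_primes
begin

text \<open>Here \<open>- e\<close> is a square, so \<open>(\<gamma>/p) (\<gamma>/q) = 1\<close>, and \<open>(e/p)\<^sub>4 = 1\<close> since \<open>p = 1\<close> modulo
  \<open>8\<close>.\<close>

lemma Legendre_gamma:
  assumes "e \<in> {-1, -4}" "primitive_solution (int p) (e * int q) x y z"
  shows "Legendre z (int q) = quartic_sign (int q) p"
proof -
  have e: "e \<in> twists" using assms(1) by (auto simp: twists_def)
  interpret S: norm_solution p q e "nat x" "nat y" "nat z"
    using solution_as_norm_solution(1)[OF two_primes_axioms e assms(2)] .
  have z: "int (nat z) = z" using solution_as_norm_solution(2)[OF two_primes_axioms e assms(2)] .
  have ev: "even ((p - 1) div 4)" using p8 by presburger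
  have ne: "quartic_sign e p = 1"
  proof -
    have "(p - 1) div 4 * 2 = (p - 1) div 2" using p4 by presburger
    hence "(2::int) ^ ((p - 1) div 2) = (2\<^sup>2) ^ ((p - 1) div 4)" by (metis mult.commute power_mult)
    hence "(4::int) ^ ((p - 1) div 4) = 2 ^ ((p - 1) div 2)" by simp
    hence "[(4::int) ^ ((p - 1) div 4) = 1] (mod int p)"
      using cong_sym[OF euler_criterion[OF p p_gt_2, of 2]] Legendre_2_p by simp
    moreover have "(-4::int) ^ ((p - 1) div 4) = 4 ^ ((p - 1) div 4)" using ev by simp
    ultimately show ?thesis using assms(1) ev by (auto simp: quartic_sign_def)
  qed
  have "odd_Jacobi (- e) (nat z) = 1"
  proof -
    have n1: "\<not> int l dvd 2" if "prime l" "l \<noteq> 2" for l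
      using not_dvd_twist[of 2 l] that by (simp add: twists_def)
    have "odd_Jacobi 4 (nat z) = odd_Jacobi 2 (nat z) * odd_Jacobi 2 (nat z)" using odd_Jacobi_mult_left[of "nat z" 2 2] S.pos by simp
    also have "\<dots> = 1" using odd_Jacobi_cases[of "nat z" 2] n1 S.pos by auto
    finally show ?thesis using assms(1) by auto
  qed
  hence "quartic_sign (int q) p * Legendre z (int q) = 1"
    using S.Legendre_gamma_pq S.Legendre_gamma_p ne z by simp
  thus ?thesis by (auto simp: quartic_sign_def zmult_eq_1_iff split: if_splits)
qed

lemma Legendre_gamma_1:
  assumes "primitive_solution (int p) (int q) x y z"
  shows "Legendre z (int q) = quartic_sign (int p) q" "Legendre z (int p) = quartic_sign (int q) p"
proof -
  have e: "1 \<in> twists" by (auto simp: twists_def)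
  have a: "primitive_solution (int p) (1 * int q) x y z" using assms by simp
  interpret S: norm_solution p q 1 "nat x" "nat y" "nat z"
    using solution_as_norm_solution(1)[OF two_primes_axioms e a] .
  have z: "int (nat z) = z" using solution_as_norm_solution(2)[OF two_primes_axioms e a] .
  show "Legendre z (int q) = quartic_sign (int p) q" using S.Legendre_gamma_q z by simp
  show "Legendre z (int p) = quartic_sign (int q) p" using S.Legendre_gamma_p z by (simp add: quartic_sign_def)
qed

lemma Legendre_gamma_2:
  assumes "primitive_solution (int p) (2 * int q) x y z" "a\<^sup>2 - 2 * b\<^sup>2 = int p" "[r\<^sup>2 = 2] (mod int q)"
  shows "Legendre z (int q) = quartic_sign (int p) q * Legendre (a + b * r) (int q)"
proof -
  have e: "2 \<in> twists" by (auto simp: twists_def)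
  interpret S: norm_solution p q 2 "nat x" "nat y" "nat z"
    using solution_as_norm_solution(1)[OF two_primes_axioms e assms(1)] .
  show ?thesis using S.Legendre_gamma_q_two[OF refl assms(2,3)] solution_as_norm_solution(2)[OF two_primes_axioms e assms(1)] by simp
qed

text \<open>The evaluation above assumes \<open>a > 0\<close>; replacing \<open>(a, b)\<close> by \<open>(-a, -b)\<close> does not change
  \<open>((a + b r)/q)\<close> because \<open>(-1/q) = 1\<close>.\<close>

lemma Legendre_gamma_minus_2:
  assumes "primitive_solution (int p) (- 2 * int q) x y z" "a\<^sup>2 - 2 * b\<^sup>2 = int p" "[r\<^sup>2 = 2] (mod int q)"
  shows "Legendre z (int q) = quartic_sign (int q) p * Legendre (a + b * r) (int q)"
    "Legendre z (int p) = quartic_sign 2 p * quartic_sign (int q) p"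
proof -
  interpret S': two_primes q p by (rule swap)
  have e: "-2 \<in> twists" by (auto simp: twists_def)
  interpret S: norm_solution p q "-2" "nat x" "nat y" "nat z"
    using solution_as_norm_solution(1)[OF two_primes_axioms e assms(1)] .
  have z: "int (nat z) = z" using solution_as_norm_solution(2)[OF two_primes_axioms e assms(1)] .
  have "a \<noteq> 0"
  proof
    assume "a = 0"
    hence "int p = - (2 * b\<^sup>2)" using assms(2) by simp
    moreover have "0 \<le> 2 * b\<^sup>2" by simp
    ultimately show False using p_gt_2 by linarith
  qed
  show "Legendre z (int q) = quartic_sign (int q) p * Legendre (a + b * r) (int q)"
  proof (cases "a > 0")
    case True
    show ?thesis using S.Legendre_gamma_q_minus_two[OF refl assms(2) True assms(3)] z by simp
  next
    case False
    hence "- a > 0" using \<open>a \<noteq> 0\<close> by simp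
    hence "Legendre z (int q) = quartic_sign (int q) p * Legendre (- a + (- b) * r) (int q)"
      using S.Legendre_gamma_q_minus_two[OF refl _ _ assms(3), of "- a" "- b"] assms(2) z by simp
    moreover have "Legendre (- 1 * (a + b * r)) (int q) = Legendre (a + b * r) (int q)"
      by (simp only: S'.Legendre_mult_p S'.Legendre_neg1_p mult_1)
    ultimately show ?thesis by (simp add: algebra_simps)
  qed
  have "even ((p - 1) div 4)" using p8 by presburger
  hence "(- 2) ^ ((p - 1) div 4) = (2::int) ^ ((p - 1) div 4)" by simp
  hence "quartic_sign (- 2) p = quartic_sign 2 p" unfolding quartic_sign_def by simp
  thus "Legendre z (int p) = quartic_sign 2 p * quartic_sign (int q) p" using S.Legendre_gamma_p z by simp
qed

end

text \<open>The symbols are computed multiplicatively; this injective character of the additive group of bits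
  transfers the results to the additive symbols.\<close>

definition sgn_bit :: "bit \<Rightarrow> int" where "sgn_bit x = (if x = 0 then 1 else -1)"

lemma sgn_bit_inj: "sgn_bit x = sgn_bit y \<Longrightarrow> x = y"
  by (cases x; cases y) (simp_all add: sgn_bit_def)

lemma sgn_bit_add: "sgn_bit (x + y) = sgn_bit x * sgn_bit y"
  by (cases x; cases y) (simp_all add: sgn_bit_def)

lemma sgn_bit_add_Jacobi:
  assumes "prime l" "\<not> int l dvd a"
  shows "sgn_bit (add_Jacobi a l) = Legendre a (int l)"
  using Legendre_unit[OF assms(2)] assms(1) by (auto simp: sgn_bit_def add_Jacobi_def Jacobi_prime)

lemma sgn_bit_add_quartic: "sgn_bit (add_quartic a l) = quartic_sign a l"
  by (simp add: sgn_bit_def add_quartic_def quartic_sign_def)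

lemma sgn_bit_of_nat: "sgn_bit (of_nat n) = (-1) ^ n"
proof (induction n)
  case (Suc n)
  have "sgn_bit (of_nat (Suc n)) = sgn_bit 1 * sgn_bit (of_nat n)"
    by (simp only: of_nat_Suc sgn_bit_add)
  thus ?case using Suc by (simp add: sgn_bit_def)
qed (simp add: sgn_bit_def)

context two_primes
begin

lemma c_sym_p: "sgn_bit (c_sym p) * quartic_sign 2 p = sgn_bit (of_nat ((p - 1) div 8))"
proof -
  have "QuadRes (int p) 2" using Legendre_2_p by (simp add: Legendre_def split: if_splits)
  hence ex: "\<exists>r. [r\<^sup>2 = 2] (mod int p)" by (simp add: QuadRes_def)
  define r where "r = (SOME r::int. [r\<^sup>2 = 2] (mod int p))"
  have r: "[r\<^sup>2 = 2] (mod int p)" unfolding r_def using someI_ex[OF ex] .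
  have L: "Legendre (r + 1) (int p) * quartic_sign 2 p = (-1) ^ ((p - 1) div 8)"
    using eighth_root_Legendre[OF p p8 r] .
  hence "Legendre (r + 1) (int p) \<noteq> 0" by auto
  hence "\<not> int p dvd r + 1" by (simp add: Legendre_eq_0_iff)
  hence "sgn_bit (c_sym p) = Legendre (r + 1) (int p)"
    unfolding c_sym_def r_def[symmetric] by (rule sgn_bit_add_Jacobi[OF p])
  thus ?thesis using L by (simp add: sgn_bit_of_nat)
qed

lemma Pf_identities:
  assumes ab: "a\<^sup>2 - 2 * b\<^sup>2 = int p" and r: "[r\<^sup>2 = 2] (mod int q)"
    and R: "sgn_bit R = Legendre (a + b * r) (int q)"
    and sol: "primitive_solution (int p) (int q) \<alpha> \<beta> \<gamma>"
      "primitive_solution (int p) (- int q) \<alpha>' \<beta>' \<gamma>'"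
      "primitive_solution (int p) (- 2 * int q) \<alpha>'' \<beta>'' \<gamma>''"
  shows "add_Jacobi \<gamma> q = add_quartic (int p) q" "add_Jacobi \<gamma> p = add_quartic (int q) p"
    "add_Jacobi (\<gamma>' * \<gamma>'') q = R"
proof -
  interpret S: two_primes q p by (rule swap)
  have nz: "quartic_sign x l \<noteq> 0" "sgn_bit y \<noteq> 0" for x l y by (simp_all add: quartic_sign_def sgn_bit_def)
  have nd: "\<not> int l dvd x" if "Legendre x (int l) \<noteq> 0" for x l using that Legendre_eq_0_iff by blast
  have 1: "Legendre \<gamma> (int q) = quartic_sign (int p) q" "Legendre \<gamma> (int p) = quartic_sign (int q) p"
    using Legendre_gamma_1[OF sol(1)] by auto
  have 2: "Legendre \<gamma>' (int q) = quartic_sign (int q) p" using Legendre_gamma[of "-1"] sol(2) by simp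
  have 3: "Legendre \<gamma>'' (int q) = quartic_sign (int q) p * sgn_bit R"
    using Legendre_gamma_minus_2(1)[OF sol(3) ab r] R by simp
  have 4: "Legendre (\<gamma>' * \<gamma>'') (int q) = sgn_bit R"
    using 2 3 by (simp add: S.Legendre_mult_p quartic_sign_def)
  show "add_Jacobi \<gamma> q = add_quartic (int p) q"
    by (rule sgn_bit_inj) (simp add: sgn_bit_add_quartic sgn_bit_add_Jacobi[OF q nd] 1 nz)
  show "add_Jacobi \<gamma> p = add_quartic (int q) p"
    by (rule sgn_bit_inj) (simp add: sgn_bit_add_quartic sgn_bit_add_Jacobi[OF p nd] 1 nz)
  show "add_Jacobi (\<gamma>' * \<gamma>'') q = R"
    by (rule sgn_bit_inj) (simp add: sgn_bit_add_Jacobi[OF q nd] 4 nz)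
qed

text \<open>The symbols are \<open>u\<^sub>e = U + R\<close>, \<open>v\<^sub>e = V + R\<close>, \<open>\<delta>\<^sub>e = R\<close>, \<open>w\<^sub>p = e\<^sub>p + V\<close> and
  \<open>w\<^sub>q = e\<^sub>q + U\<close>; in the last two the quartic symbol of \<open>2\<close> in \<open>c\<^sub>p\<close> cancels against the one in
  \<open>(\<gamma>\<^sub>p'/p)\<close>. The products \<open>U V\<close> and \<open>R (U + V)\<close> cancel in the sum.\<close>

lemma Pf2_identity:
  assumes ab: "a\<^sup>2 - 2 * b\<^sup>2 = int p" and r: "[r\<^sup>2 = 2] (mod int q)"
    and R: "sgn_bit R = Legendre (a + b * r) (int q)"
    and ab': "a'\<^sup>2 - 2 * b'\<^sup>2 = int q" and r': "[r'\<^sup>2 = 2] (mod int p)"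
    and sol: "primitive_solution (int p) (2 * int q) \<alpha>\<^sub>p \<beta>\<^sub>p \<gamma>\<^sub>p"
      "primitive_solution (int p) (- 2 * int q) \<alpha>\<^sub>p' \<beta>\<^sub>p' \<gamma>\<^sub>p'"
      "primitive_solution (int q) (- 2 * int p) \<alpha>\<^sub>q' \<beta>\<^sub>q' \<gamma>\<^sub>q'"
      "primitive_solution (int p) (- 4 * int q) \<alpha>\<^sub>p'' \<beta>\<^sub>p'' \<gamma>\<^sub>p''"
  shows "Pf2 p q \<gamma>\<^sub>p \<gamma>\<^sub>p' \<gamma>\<^sub>q' \<gamma>\<^sub>p'' = R + of_nat ((p - 1) div 8) * of_nat ((q - 1) div 8)
    + of_nat ((p - 1) div 8) * add_quartic (int p) q + of_nat ((q - 1) div 8) * add_quartic (int q) p"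
proof -
  interpret S: two_primes q p by (rule swap)
  define U V where "U = add_quartic (int p) q" and "V = add_quartic (int q) p"
  have UV: "sgn_bit U = quartic_sign (int p) q" "sgn_bit V = quartic_sign (int q) p"
    by (simp_all add: U_def V_def sgn_bit_add_quartic)
  define ep eq' :: bit where "ep = of_nat ((p - 1) div 8)" and "eq' = of_nat ((q - 1) div 8)"
  have nz: "quartic_sign x l \<noteq> 0" "sgn_bit y \<noteq> 0" for x l y by (simp_all add: quartic_sign_def sgn_bit_def)
  have nd: "\<not> int l dvd x" if "Legendre x (int l) \<noteq> 0" for x l using that Legendre_eq_0_iff by blast
  have sq: "sgn_bit x * sgn_bit x = 1" for x by (simp add: sgn_bit_def)
  have 1: "Legendre \<gamma>\<^sub>p (int q) = sgn_bit (U + R)"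
    unfolding sgn_bit_add using Legendre_gamma_2[OF sol(1) ab r] UV R by simp
  have 2: "Legendre \<gamma>\<^sub>p' (int q) = sgn_bit (V + R)" "Legendre \<gamma>\<^sub>p' (int p) = quartic_sign 2 p * sgn_bit V"
    unfolding sgn_bit_add using Legendre_gamma_minus_2[OF sol(2) ab r] UV R by simp_all
  have 3: "Legendre \<gamma>\<^sub>q' (int q) = quartic_sign 2 q * sgn_bit U"
    using S.Legendre_gamma_minus_2(2)[OF sol(3) ab' r'] UV by simp
  have 4: "Legendre \<gamma>\<^sub>p'' (int q) = sgn_bit V"
    using Legendre_gamma[of "-4"] sol(4) UV by simp
  have u: "add_Jacobi \<gamma>\<^sub>p q = U + R"
    by (rule sgn_bit_inj) (simp add: sgn_bit_add_Jacobi[OF q nd] 1 nz)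
  have v: "add_Jacobi \<gamma>\<^sub>p' q = V + R"
    by (rule sgn_bit_inj) (simp add: sgn_bit_add_Jacobi[OF q nd] 2 nz)
  have "Legendre (\<gamma>\<^sub>p' * \<gamma>\<^sub>p'') (int q) = sgn_bit (V + R + V)"
    unfolding sgn_bit_add by (simp add: S.Legendre_mult_p 2[unfolded sgn_bit_add] 4)
  hence d: "add_Jacobi (\<gamma>\<^sub>p' * \<gamma>\<^sub>p'') q = V + R + V"
    by (intro sgn_bit_inj) (simp add: sgn_bit_add_Jacobi[OF q nd] nz)
  have wp: "c_sym p + add_Jacobi \<gamma>\<^sub>p' p = ep + V"
  proof (rule sgn_bit_inj)
    have "sgn_bit (add_Jacobi \<gamma>\<^sub>p' p) = quartic_sign 2 p * sgn_bit V"
      by (simp add: sgn_bit_add_Jacobi[OF p nd] 2 nz)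
    thus "sgn_bit (c_sym p + add_Jacobi \<gamma>\<^sub>p' p) = sgn_bit (ep + V)"
      unfolding sgn_bit_add using c_sym_p by (simp add: ep_def)
  qed
  have wq: "c_sym q + add_Jacobi \<gamma>\<^sub>q' q = eq' + U"
  proof (rule sgn_bit_inj)
    have "sgn_bit (add_Jacobi \<gamma>\<^sub>q' q) = quartic_sign 2 q * sgn_bit U"
      by (simp add: sgn_bit_add_Jacobi[OF q nd] 3 nz)
    thus "sgn_bit (c_sym q + add_Jacobi \<gamma>\<^sub>q' q) = sgn_bit (eq' + U)"
      unfolding sgn_bit_add using S.c_sym_p by (simp add: eq'_def)
  qed
  have "Pf2 p q \<gamma>\<^sub>p \<gamma>\<^sub>p' \<gamma>\<^sub>q' \<gamma>\<^sub>p'' = (V + R + V) * ((U + R) + (V + R)) + (ep + V) * (eq' + U) + (U + R) * (V + R)"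
    unfolding Pf2_def Let_def u v d wp wq by simp
  also have "\<dots> = R + ep * eq' + ep * U + eq' * V"
    by (cases U; cases V; cases R; cases ep; cases eq'; simp)
  finally show ?thesis by (simp add: U_def V_def ep_def eq'_def)
qed

end

section \<open>Elimination and algebraic integers\<close>

text \<open>A Cayley-Hamilton argument without determinants: if \<open>u\<close> maps a finite set \<open>G\<close> into its span over \<open>S\<close>, then
  eliminating the generators one at a time produces an element that looks like a characteristic
  polynomial in \<open>u\<close> and annihilates \<open>G\<close>. The levels \<open>k\<close> serve the first application, where \<open>S k\<close> is the set
  of values at \<open>x\<close> of integer polynomials of degree less than \<open>k\<close> and \<open>U k\<close> that of monic ones of
  degree \<open>k\<close>. In the second application, Nakayama's lemma, \<open>S\<close> is an ideal and \<open>U\<close> is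
  \<open>1\<close> plus that ideal, for all levels.\<close>

lemma elimination:
  fixes U S :: "nat \<Rightarrow> 'a :: comm_ring_1 set"
  assumes S0: "\<And>k. 0 \<in> S k" and SA: "\<And>k a b. a \<in> S k \<Longrightarrow> b \<in> S k \<Longrightarrow> a + b \<in> S k"
    and SS: "\<And>k a b. a \<in> S k \<Longrightarrow> b \<in> S k \<Longrightarrow> a * b \<in> S (k + k)"
    and US: "\<And>k a b. a \<in> U k \<Longrightarrow> b \<in> S k \<Longrightarrow> a * b \<in> S (k + k)"
    and UU: "\<And>j k a b. a \<in> U j \<Longrightarrow> b \<in> U k \<Longrightarrow> a * b \<in> U (j + k)"
    and UmS: "\<And>k a b. a \<in> U k \<Longrightarrow> b \<in> S k \<Longrightarrow> a - b \<in> U k"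
    and G: "finite G" and u: "u \<in> U k"
    and rel: "\<And>x. x \<in> G \<Longrightarrow> \<exists>c. (\<forall>y\<in>G. c y \<in> S k) \<and> u * x = (\<Sum>y\<in>G. c y * y)"
  shows "\<exists>k'. \<exists>u'\<in>U k'. \<forall>x\<in>G. u' * x = 0"
  using G u rel
proof (induction G arbitrary: u k rule: finite_induct)
  case empty
  thus ?case by blast
next
  case (insert z G)
  obtain c where c: "\<forall>y\<in>insert z G. c y \<in> S k" "u * z = (\<Sum>y\<in>insert z G. c y * y)"
    using insert.prems(2) by blast
  \<comment> \<open>\<open>w\<close> expresses \<open>w * z\<close> by the other generators; multiplying all relations by \<open>w\<close> removes \<open>z\<close>\<close>
  define w where "w = u - c z"
  have w: "w \<in> U k" using UmS insert.prems(1) c(1) unfolding w_def by blast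
  have wz: "w * z = (\<Sum>y\<in>G. c y * y)"
  proof -
    have "u * z = c z * z + (\<Sum>y\<in>G. c y * y)" using c(2) by (simp only: sum.insert[OF insert.hyps])
    thus ?thesis by (simp only: w_def left_diff_distrib add_diff_cancel_left')
  qed
  have rel': "\<exists>d. (\<forall>y\<in>G. d y \<in> S (k + k)) \<and> (w * u) * x = (\<Sum>y\<in>G. d y * y)" if "x \<in> G" for x
  proof -
    from insert.prems(2)[OF insertI2[OF that]] obtain d
      where d: "\<forall>y\<in>insert z G. d y \<in> S k" "u * x = (\<Sum>y\<in>insert z G. d y * y)"
      by (elim exE conjE)
    have "(w * u) * x = w * (d z * z + (\<Sum>y\<in>G. d y * y))"
      by (simp only: mult.assoc d(2) sum.insert[OF insert.hyps])
    also have "\<dots> = d z * (w * z) + w * (\<Sum>y\<in>G. d y * y)" by (simp add: algebra_simps)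
    also have "\<dots> = (\<Sum>y\<in>G. (d z * c y + w * d y) * y)"
      unfolding wz by (simp add: sum_distrib_left sum.distrib algebra_simps)
    finally have e: "(w * u) * x = (\<Sum>y\<in>G. (d z * c y + w * d y) * y)" .
    have "\<forall>y\<in>G. d z * c y + w * d y \<in> S (k + k)"
    proof
      fix y assume "y \<in> G"
      hence "d z * c y \<in> S (k + k)" "w * d y \<in> S (k + k)" using c(1) d(1) w SS US by auto
      thus "d z * c y + w * d y \<in> S (k + k)" by (rule SA)
    qed
    with e show ?thesis by (intro exI[of _ "\<lambda>y. d z * c y + w * d y"]) simp
  qed
  have "w * u \<in> U (k + k)" using UU w insert.prems(1) by blast
  from insert.IH[OF this rel'] obtain k' u' where u': "u' \<in> U k'" "\<forall>x\<in>G. u' * x = 0" by blast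
  have "u' * w * z = (\<Sum>y\<in>G. c y * (u' * y))"
    using wz by (simp add: mult.assoc sum_distrib_left ac_simps)
  also have "\<dots> = 0" using u'(2) by simp
  finally have "u' * w * z = 0" .
  moreover have "u' * w * x = 0" if "x \<in> G" for x
  proof -
    have "u' * w * x = w * (u' * x)" by (simp only: ac_simps)
    thus ?thesis using u'(2) that by simp
  qed
  ultimately have "\<forall>x\<in>insert z G. u' * w * x = 0" by blast
  moreover have "u' * w \<in> U (k' + k)" using UU u'(1) w by blast
  ultimately show ?case by blast
qed

abbreviation ipoly :: "int poly \<Rightarrow> complex \<Rightarrow> complex" where
  "ipoly f x \<equiv> poly (map_poly of_int f) x"

lemma ipoly_simps [simp]:
  "ipoly 0 x = 0" "ipoly (f + g) x = ipoly f x + ipoly g x" "ipoly (f - g) x = ipoly f x - ipoly g x"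
  "ipoly (f * g) x = ipoly f x * ipoly g x" "ipoly [:a:] x = of_int a" "ipoly (pCons a f) x = of_int a + x * ipoly f x"
proof -
  show 1: "ipoly (pCons a f) x = of_int a + x * ipoly f x" for a f
    by (simp add: map_poly_pCons)
  show 2: "ipoly 0 x = 0" by simp
  show "ipoly [:a:] x = of_int a" using 1[of a 0] by simp
  have a: "map_poly of_int (f + g) = (map_poly of_int f + map_poly of_int g :: complex poly)"
    "map_poly of_int (f - g) = (map_poly of_int f - map_poly of_int g :: complex poly)" for f g :: "int poly"
    by (simp_all add: poly_eq_iff coeff_map_poly)
  show "ipoly (f + g) x = ipoly f x + ipoly g x" "ipoly (f - g) x = ipoly f x - ipoly g x"
    using a by simp_all
  have "map_poly of_int (f * g) = (map_poly of_int f * map_poly of_int g :: complex poly)"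
    by (simp add: poly_eq_iff coeff_map_poly coeff_mult)
  thus "ipoly (f * g) x = ipoly f x * ipoly g x" by simp
qed

lemma algebraic_int_ipoly: "algebraic_int (x::complex) \<longleftrightarrow> (\<exists>f. ipoly f x = 0 \<and> lead_coeff f = 1)"
  by (rule algebraic_int_altdef_ipoly)

lemma algebraic_intI_span:
  fixes x :: complex
  assumes G: "finite G" and v: "v \<in> G" "v \<noteq> 0"
    and rel: "\<And>y. y \<in> G \<Longrightarrow> \<exists>c::complex \<Rightarrow> int. x * y = (\<Sum>w\<in>G. of_int (c w) * w)"
  shows "algebraic_int x"
proof -
  define S where "S = (\<lambda>k. {ipoly f x | f. f = 0 \<or> degree f < k})"
  define U where "U = (\<lambda>k. {ipoly f x | f. lead_coeff f = 1 \<and> degree f = k})"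
  have "\<exists>k'. \<exists>u'\<in>U k'. \<forall>y\<in>G. u' * y = 0"
  proof (rule elimination[where S = S and k = 1])
    show "0 \<in> S k" for k unfolding S_def by (auto intro!: exI[of _ 0])
    show "a + b \<in> S k" if ab: "a \<in> S k" "b \<in> S k" for a b k
    proof -
      obtain f g where "a = ipoly f x" "f = 0 \<or> degree f < k" "b = ipoly g x" "g = 0 \<or> degree g < k"
        using ab by (auto simp: S_def)
      moreover have "f + g = 0 \<or> degree (f + g) < k" 
        using calculation degree_add_less[of f k g] by auto
      moreover have "ipoly (f + g) x = ipoly f x + ipoly g x" by simp
      ultimately show ?thesis unfolding S_def by (metis (mono_tags, lifting) mem_Collect_eq)
    qed
    show "a * b \<in> S (k + k)" if ab: "a \<in> S k" "b \<in> S k" for a b k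
    proof -
      obtain f g where "a = ipoly f x" "f = 0 \<or> degree f < k" "b = ipoly g x" "g = 0 \<or> degree g < k"
        using ab by (auto simp: S_def)
      moreover have "f * g = 0 \<or> degree (f * g) < k + k" 
        using calculation degree_mult_le[of f g] by auto
      moreover have "ipoly (f * g) x = ipoly f x * ipoly g x" by simp
      ultimately show ?thesis unfolding S_def by (metis (mono_tags, lifting) mem_Collect_eq)
    qed
    show "a * b \<in> S (k + k)" if ab: "a \<in> U k" "b \<in> S k" for a b k
    proof -
      obtain f g where "a = ipoly f x" "degree f = k" "b = ipoly g x" "g = 0 \<or> degree g < k"
        using ab by (auto simp: S_def U_def)
      moreover have "f * g = 0 \<or> degree (f * g) < k + k" 
        using calculation degree_mult_le[of f g] by auto
      moreover have "ipoly (f * g) x = ipoly f x * ipoly g x" by simp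
      ultimately show ?thesis unfolding S_def by (metis (mono_tags, lifting) mem_Collect_eq)
    qed
    show "a * b \<in> U (j + k)" if ab: "a \<in> U j" "b \<in> U k" for a b j k
    proof -
      obtain f g where "a = ipoly f x" "degree f = j" "lead_coeff f = 1" "b = ipoly g x" "degree g = k" "lead_coeff g = 1"
        using ab by (auto simp: U_def)
      moreover have "f \<noteq> 0" "g \<noteq> 0" using calculation by auto
      hence "degree (f * g) = degree f + degree g" by (simp add: degree_mult_eq)
      moreover have "lead_coeff (f * g) = lead_coeff f * lead_coeff g" by (rule lead_coeff_mult)
      moreover have "ipoly (f * g) x = ipoly f x * ipoly g x" by simp
      ultimately show ?thesis unfolding U_def by (auto intro!: exI[of _ "f * g"])
    qed
    show "a - b \<in> U k" if ab: "a \<in> U k" "b \<in> S k" for a b k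
    proof -
      obtain f g where fg: "a = ipoly f x" "degree f = k" "lead_coeff f = 1" "b = ipoly g x" "g = 0 \<or> degree g < k"
        using ab by (auto simp: S_def U_def)
      have "degree (f - g) = k \<and> lead_coeff (f - g) = 1"
      proof (cases "g = 0")
        case False
        hence d: "degree (- g) < degree f" using fg by simp
        have "degree (f + - g) = degree f" using d by (rule degree_add_eq_left)
        moreover have "lead_coeff (- g + f) = lead_coeff f" using d by (rule lead_coeff_add_le)
        ultimately show ?thesis using fg by simp
      qed (use fg in simp)
      thus ?thesis using fg unfolding U_def by (auto intro!: exI[of _ "f - g"])
    qed
    show "finite G" by fact
    show "x \<in> U 1" unfolding U_def by (auto intro!: exI[of _ "[:0, 1:]"] simp: map_poly_pCons)
    fix y assume "y \<in> G"
    then obtain c :: "complex \<Rightarrow> int" where "x * y = (\<Sum>w\<in>G. of_int (c w) * w)" using rel by blast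
    moreover have "of_int m \<in> S 1" for m unfolding S_def by (auto intro!: exI[of _ "[:m:]"])
    ultimately show "\<exists>c. (\<forall>w\<in>G. c w \<in> S 1) \<and> x * y = (\<Sum>w\<in>G. c w * w)"
      by (intro exI[of _ "\<lambda>w. of_int (c w)"] conjI ballI)
  qed
  then obtain k u where u: "u \<in> U k" "u * v = 0" using v by blast
  hence "u = 0" using v by simp
  thus ?thesis using u(1) unfolding algebraic_int_ipoly U_def by auto
qed

definition zspan :: "complex set \<Rightarrow> complex set" where
  "zspan G = {\<Sum>w\<in>G. of_int (c w) * w | c :: complex \<Rightarrow> int. True}"

lemma zspan_base: "finite G \<Longrightarrow> x \<in> G \<Longrightarrow> x \<in> zspan G"
  unfolding zspan_def
  by (auto intro!: exI[of _ "\<lambda>w. if w = x then 1 else 0"] simp: sum.delta if_distrib[of of_int] if_distrib[of "\<lambda>y. y * _"] cong: if_cong)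

lemma zspan_add: "x \<in> zspan G \<Longrightarrow> y \<in> zspan G \<Longrightarrow> x + y \<in> zspan G"
  unfolding zspan_def
proof clarify
  fix c d :: "complex \<Rightarrow> int"
  show "\<exists>e::complex \<Rightarrow> int. (\<Sum>w\<in>G. of_int (c w) * w) + (\<Sum>w\<in>G. of_int (d w) * w) = (\<Sum>w\<in>G. of_int (e w) * w) \<and> True"
    by (intro exI[of _ "\<lambda>w. c w + d w"]) (simp add: sum.distrib algebra_simps)
qed

lemma zspan_scale: "x \<in> zspan G \<Longrightarrow> of_int m * x \<in> zspan G"
  unfolding zspan_def
proof clarify
  fix c :: "complex \<Rightarrow> int"
  show "\<exists>e::complex \<Rightarrow> int. of_int m * (\<Sum>w\<in>G. of_int (c w) * w) = (\<Sum>w\<in>G. of_int (e w) * w) \<and> True"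
    by (intro exI[of _ "\<lambda>w. m * c w"]) (simp add: sum_distrib_left algebra_simps)
qed

lemma zspan_0: "0 \<in> zspan G"
  unfolding zspan_def by (auto intro!: exI[of _ "\<lambda>_. 0"])

lemma zspan_sum: "(\<And>i. i \<in> I \<Longrightarrow> f i \<in> zspan G) \<Longrightarrow> (\<Sum>i\<in>I. f i) \<in> zspan G"
  by (induction I rule: infinite_finite_induct) (auto intro: zspan_0 zspan_add)

lemma zspan_mult_closed:
  assumes "\<And>w. w \<in> G \<Longrightarrow> a * w \<in> zspan G" "s \<in> zspan G"
  shows "a * s \<in> zspan G"
proof -
  obtain c where "s = (\<Sum>w\<in>G. of_int (c w) * w)" using assms(2) by (auto simp: zspan_def)
  hence "a * s = (\<Sum>w\<in>G. of_int (c w) * (a * w))" by (simp add: sum_distrib_left ac_simps)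
  thus ?thesis using assms(1) by (auto intro!: zspan_sum zspan_scale)
qed

lemma algebraic_int_power_eq:
  assumes "algebraic_int (x::complex)"
  obtains m and a :: "nat \<Rightarrow> int" where "m > 0" "x ^ m = (\<Sum>i<m. of_int (a i) * x ^ i)"
proof -
  obtain f where f: "ipoly f x = 0" "lead_coeff f = 1" using assms algebraic_int_ipoly by blast
  define m where "m = degree f"
  have "m > 0"
  proof (rule ccontr)
    assume "\<not> m > 0"
    hence "degree f = 0" by (simp add: m_def)
    then obtain c where "f = [:c:]" by (rule degree_eq_zeroE)
    thus False using f by simp
  qed
  have "0 = (\<Sum>i\<le>m. of_int (coeff f i) * x ^ i)"
    using f(1) by (simp add: poly_altdef degree_map_poly coeff_map_poly m_def)
  also have "\<dots> = (\<Sum>i<m. of_int (coeff f i) * x ^ i) + x ^ m"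
    using f(2) by (simp add: m_def flip: lessThan_Suc_atMost)
  finally have "x ^ m = - (\<Sum>i<m. of_int (coeff f i) * x ^ i)" by (simp add: eq_neg_iff_add_eq_0 add.commute)
  also have "\<dots> = (\<Sum>i<m. of_int (- coeff f i) * x ^ i)" by (simp add: sum_negf)
  finally have "x ^ m = (\<Sum>i<m. of_int (- coeff f i) * x ^ i)" .
  thus ?thesis by (rule that[OF \<open>m > 0\<close>])
qed

text \<open>The products \<open>x\<^sup>i y\<^sup>j\<close> with bounded exponents span a group that is stable under \<open>x\<close> and \<open>y\<close>,
  hence under \<open>x + y\<close> and \<open>x y\<close>.\<close>

lemma algebraic_int_add_mult:
  fixes x y :: complex
  assumes x: "algebraic_int x" and y: "algebraic_int y"
  shows "algebraic_int (x + y)" "algebraic_int (x * y)"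
proof -
  obtain m a where m: "m > 0" "x ^ m = (\<Sum>i<m. of_int (a i) * x ^ i)" using algebraic_int_power_eq[OF x] .
  obtain n b where n: "n > 0" "y ^ n = (\<Sum>i<n. of_int (b i) * y ^ i)" using algebraic_int_power_eq[OF y] .
  define G where "G = (\<lambda>(i, j). x ^ i * y ^ j) ` ({..<m} \<times> {..<n})"
  have G: "finite G" by (simp add: G_def)
  have inX: "x ^ i * y ^ j \<in> G" if "i < m" "j < n" for i j using that by (auto simp: G_def)
  have Xx: "x * w \<in> zspan G" if w: "w \<in> G" for w
  proof -
    obtain i j where ij: "w = x ^ i * y ^ j" "i < m" "j < n" using w by (auto simp: G_def)
    show ?thesis
    proof (cases "Suc i < m")
      case True
      thus ?thesis using ij inX[of "Suc i" j] zspan_base[OF G] by (simp add: mult.assoc)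
    next
      case False
      hence "Suc i = m" using ij by simp
      hence "x * w = x ^ m * y ^ j" using ij by (auto simp: mult.assoc)
      also have "\<dots> = (\<Sum>i<m. of_int (a i) * (x ^ i * y ^ j))" unfolding m(2) by (simp add: sum_distrib_right mult.assoc)
      also have "\<dots> \<in> zspan G" using ij by (auto intro!: zspan_sum zspan_scale zspan_base G inX)
      finally show ?thesis .
    qed
  qed
  have Xy: "y * w \<in> zspan G" if w: "w \<in> G" for w
  proof -
    obtain i j where ij: "w = x ^ i * y ^ j" "i < m" "j < n" using w by (auto simp: G_def)
    show ?thesis
    proof (cases "Suc j < n")
      case True
      thus ?thesis using ij inX[of i "Suc j"] zspan_base[OF G] by (simp add: ac_simps)
    next
      case False
      hence "Suc j = n" using ij by simp
      hence "y * w = x ^ i * y ^ n" using ij by (auto simp: ac_simps)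
      also have "\<dots> = (\<Sum>j<n. of_int (b j) * (x ^ i * y ^ j))" unfolding n(2) by (simp add: sum_distrib_left ac_simps)
      also have "\<dots> \<in> zspan G" using ij by (auto intro!: zspan_sum zspan_scale zspan_base G inX)
      finally show ?thesis .
    qed
  qed
  have one: "1 \<in> G" using inX[of 0 0] m n by simp
  have "(x + y) * w \<in> zspan G" if "w \<in> G" for w
    using zspan_add[OF Xx Xy] that by (simp add: algebra_simps)
  thus "algebraic_int (x + y)"
    by (intro algebraic_intI_span[OF G one]) (auto simp: zspan_def)
  have "(x * y) * w \<in> zspan G" if "w \<in> G" for w
    using zspan_mult_closed[OF Xx Xy[OF that]] by (simp add: algebra_simps)
  thus "algebraic_int (x * y)"
    by (intro algebraic_intI_span[OF G one]) (auto simp: zspan_def)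
qed

lemmas algebraic_int_add = algebraic_int_add_mult(1)
  and algebraic_int_mult = algebraic_int_add_mult(2)

lemma algebraic_int_diff: "algebraic_int (x::complex) \<Longrightarrow> algebraic_int y \<Longrightarrow> algebraic_int (x - y)"
  using algebraic_int_add[of x "- y"] by auto

lemma algebraic_int_of_int_cx [simp]: "algebraic_int (of_int n :: complex)"
  by (rule int_imp_algebraic_int) simp

lemma algebraic_int_of_nat_cx [simp]: "algebraic_int (of_nat n :: complex)"
  by (rule int_imp_algebraic_int) simp

lemma algebraic_int_numeral_cx [simp]: "algebraic_int (numeral n :: complex)"
  by (rule int_imp_algebraic_int) simp

lemma algebraic_int_sqrtI: "algebraic_int (x\<^sup>2 :: complex) \<Longrightarrow> algebraic_int x"
  using algebraic_int_root[of "x\<^sup>2" "monom 1 2" x] by (simp add: poly_monom degree_monom_eq)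

section \<open>Subfields of the complex numbers\<close>

text \<open>Subfields, homomorphisms, subrings and ideals are described by closure conditions on sets of complex
  numbers, so that the ordinary operations and the simplifier apply; the connection with the algebraic
  structures in the definition of the Redei symbol is made by \<open>subfield_CC_iff\<close>,
  \<open>gal_iff\<close> and \<open>primeideal_Rg_iff\<close>.\<close>

definition fld :: "complex set \<Rightarrow> bool" where
  "fld F \<longleftrightarrow> 1 \<in> F \<and> (\<forall>x\<in>F. \<forall>y\<in>F. x - y \<in> F \<and> x * y \<in> F) \<and> (\<forall>x\<in>F. inverse x \<in> F)"

lemma fld_closed:
  assumes "fld F"
  shows fld_1: "1 \<in> F" and fld_0: "0 \<in> F"
    and fld_diff: "\<And>x y. x \<in> F \<Longrightarrow> y \<in> F \<Longrightarrow> x - y \<in> F"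
    and fld_mult: "\<And>x y. x \<in> F \<Longrightarrow> y \<in> F \<Longrightarrow> x * y \<in> F"
    and fld_minus: "\<And>x. x \<in> F \<Longrightarrow> - x \<in> F"
    and fld_add: "\<And>x y. x \<in> F \<Longrightarrow> y \<in> F \<Longrightarrow> x + y \<in> F"
    and fld_inverse: "\<And>x. x \<in> F \<Longrightarrow> inverse x \<in> F"
    and fld_divide: "\<And>x y. x \<in> F \<Longrightarrow> y \<in> F \<Longrightarrow> x / y \<in> F"
    and fld_power: "\<And>x n. x \<in> F \<Longrightarrow> x ^ n \<in> F"
    and fld_of_nat: "\<And>n. of_nat n \<in> F"
    and fld_of_int: "\<And>n. of_int n \<in> F"
    and fld_numeral: "\<And>n. numeral n \<in> F"
proof -
  show 1: "1 \<in> F" and d: "\<And>x y. x \<in> F \<Longrightarrow> y \<in> F \<Longrightarrow> x - y \<in> F"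
    and m: "\<And>x y. x \<in> F \<Longrightarrow> y \<in> F \<Longrightarrow> x * y \<in> F" and i: "\<And>x. x \<in> F \<Longrightarrow> inverse x \<in> F"
    using assms by (auto simp: fld_def)
  show 0: "0 \<in> F" using d[OF 1 1] by simp
  show mi: "- x \<in> F" if "x \<in> F" for x using d[OF 0 that] by simp
  show a: "x + y \<in> F" if "x \<in> F" "y \<in> F" for x y using d[OF that(1) mi[OF that(2)]] by simp
  show "x / y \<in> F" if "x \<in> F" "y \<in> F" for x y using m[OF that(1) i[OF that(2)]] by (simp add: divide_inverse)
  show "x ^ n \<in> F" if "x \<in> F" for x n by (induction n) (use 1 m that in auto)
  show n: "of_nat n \<in> F" for n by (induction n) (use 0 1 a in auto)
  show "of_int n \<in> F" for n by (cases n) (use n mi in \<open>auto simp del: of_nat_Suc\<close>)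
  show "numeral n \<in> F" for n using n[of "numeral n"] by simp
qed

lemma fld_Rats: "fld \<rat>"
  by (auto simp: fld_def)

lemma Rats_subset_fld: "fld F \<Longrightarrow> \<rat> \<subseteq> F"
  by (auto elim!: Rats_cases' intro!: fld_divide fld_of_int)

definition hom_on :: "complex set \<Rightarrow> (complex \<Rightarrow> complex) \<Rightarrow> bool" where
  "hom_on F \<sigma> \<longleftrightarrow> \<sigma> 1 = 1 \<and> (\<forall>x\<in>F. \<forall>y\<in>F. \<sigma> (x + y) = \<sigma> x + \<sigma> y \<and> \<sigma> (x * y) = \<sigma> x * \<sigma> y)"

lemma hom_on_simps:
  assumes h: "hom_on F \<sigma>" and F: "fld F"
  shows hom_1: "\<sigma> 1 = 1" and hom_0: "\<sigma> 0 = 0"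
    and hom_add: "\<And>x y. x \<in> F \<Longrightarrow> y \<in> F \<Longrightarrow> \<sigma> (x + y) = \<sigma> x + \<sigma> y"
    and hom_mult: "\<And>x y. x \<in> F \<Longrightarrow> y \<in> F \<Longrightarrow> \<sigma> (x * y) = \<sigma> x * \<sigma> y"
    and hom_minus: "\<And>x. x \<in> F \<Longrightarrow> \<sigma> (- x) = - \<sigma> x"
    and hom_diff: "\<And>x y. x \<in> F \<Longrightarrow> y \<in> F \<Longrightarrow> \<sigma> (x - y) = \<sigma> x - \<sigma> y"
    and hom_power: "\<And>x n. x \<in> F \<Longrightarrow> \<sigma> (x ^ n) = \<sigma> x ^ n"
    and hom_of_nat: "\<And>n. \<sigma> (of_nat n) = of_nat n"
    and hom_of_int: "\<And>n. \<sigma> (of_int n) = of_int n"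
    and hom_inverse: "\<And>x. x \<in> F \<Longrightarrow> \<sigma> (inverse x) = inverse (\<sigma> x)"
    and hom_divide: "\<And>x y. x \<in> F \<Longrightarrow> y \<in> F \<Longrightarrow> \<sigma> (x / y) = \<sigma> x / \<sigma> y"
    and hom_eq_0: "\<And>x. x \<in> F \<Longrightarrow> \<sigma> x = 0 \<Longrightarrow> x = 0"
    and hom_Rats: "\<And>x. x \<in> \<rat> \<Longrightarrow> \<sigma> x = x"
proof -
  note c = fld_closed[OF F]
  show 1: "\<sigma> 1 = 1" and a: "\<And>x y. x \<in> F \<Longrightarrow> y \<in> F \<Longrightarrow> \<sigma> (x + y) = \<sigma> x + \<sigma> y"
    and m: "\<And>x y. x \<in> F \<Longrightarrow> y \<in> F \<Longrightarrow> \<sigma> (x * y) = \<sigma> x * \<sigma> y" using h by (auto simp: hom_on_def)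
  show 0: "\<sigma> 0 = 0" using a[OF c(2) c(2)] by simp
  show mi: "\<sigma> (- x) = - \<sigma> x" if "x \<in> F" for x
    using a[OF that fld_minus[OF F that]] 0 by (simp add: eq_neg_iff_add_eq_0 add.commute)
  show "\<sigma> (x - y) = \<sigma> x - \<sigma> y" if "x \<in> F" "y \<in> F" for x y
    using a[OF that(1) fld_minus[OF F that(2)]] mi[OF that(2)] by simp
  show "\<sigma> (x ^ n) = \<sigma> x ^ n" if "x \<in> F" for x n
    by (induction n) (use 1 m that fld_power[OF F that] in auto)
  show n: "\<sigma> (of_nat n) = of_nat n" for n by (induction n) (use 0 1 a fld_1[OF F] fld_of_nat[OF F] in auto)
  show z: "\<sigma> (of_int n) = of_int n" for n
  proof (cases n)
    case (neg k)
    have "of_int n = - (of_nat (Suc k) :: complex)" using neg by simp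
    thus ?thesis using mi[OF fld_of_nat[OF F, of "Suc k"]] n[of "Suc k"] by (simp only:)
  qed (use n in simp)
  have inv: "\<sigma> x * \<sigma> (inverse x) = 1" if "x \<in> F" "x \<noteq> 0" for x
    using m[OF that(1) fld_inverse[OF F that(1)]] 1 that by simp
  show i: "\<sigma> (inverse x) = inverse (\<sigma> x)" if "x \<in> F" for x
    using inv[OF that] 0 by (cases "x = 0") (auto simp: inverse_unique)
  show d: "\<sigma> (x / y) = \<sigma> x / \<sigma> y" if "x \<in> F" "y \<in> F" for x y
    using m[OF that(1) fld_inverse[OF F that(2)]] i[OF that(2)] by (simp add: divide_inverse)
  show "x = 0" if "x \<in> F" "\<sigma> x = 0" for x using inv[OF that(1)] that by auto
  show "\<sigma> x = x" if "x \<in> \<rat>" for x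
    using that by (auto elim!: Rats_cases' simp: d z fld_of_int[OF F])
qed

lemma algebraic_int_hom:
  assumes h: "hom_on F \<sigma>" and F: "fld F" and x: "x \<in> F" "algebraic_int x"
  shows "algebraic_int (\<sigma> x)"
proof -
  obtain f where f: "ipoly f x = 0" "lead_coeff f = 1" using x(2) algebraic_int_ipoly by blast
  have "ipoly g x \<in> F \<and> \<sigma> (ipoly g x) = ipoly g (\<sigma> x)" for g
    by (induction g) (use hom_on_simps[OF h F] fld_closed[OF F] x in auto)
  hence "ipoly f (\<sigma> x) = 0" using f(1) hom_0[OF h F] by metis
  thus ?thesis using f(2) algebraic_int_ipoly by blast
qed

text \<open>For \<open>t\<^sup>2 \<in> L\<close> this is the ring or field obtained by adjoining \<open>t\<close> to \<open>L\<close>.\<close>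

definition adj :: "complex set \<Rightarrow> complex \<Rightarrow> complex set" where
  "adj L t = {x + y * t | x y. x \<in> L \<and> y \<in> L}"

lemma adjI: "x \<in> L \<Longrightarrow> y \<in> L \<Longrightarrow> x + y * t \<in> adj L t"
  by (auto simp: adj_def)

lemma adj_subset: "fld L \<Longrightarrow> L \<subseteq> adj L t"
  using adjI[of _ L 0 t] fld_0 by fastforce

lemma adj_gen: "fld L \<Longrightarrow> t \<in> adj L t"
  using adjI[of 0 L 1 t] fld_0 fld_1 by fastforce

lemma adj_least: "fld M \<Longrightarrow> L \<subseteq> M \<Longrightarrow> t \<in> M \<Longrightarrow> adj L t \<subseteq> M"
  by (auto simp: adj_def intro!: fld_add fld_mult)

lemma fld_adj:
  assumes L: "fld L" and t: "t\<^sup>2 \<in> L"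
  shows "fld (adj L t)"
proof (cases "t \<in> L")
  case True
  hence "adj L t = L" using adj_least[OF L order_refl True] adj_subset[OF L] by blast
  thus ?thesis using L by simp
next
  case False
  show ?thesis unfolding fld_def
  proof (intro conjI ballI)
    show "1 \<in> adj L t" using adj_subset[OF L] fld_1[OF L] by blast
    fix u v assume "u \<in> adj L t" "v \<in> adj L t"
    then obtain a b c d where e: "u = a + b * t" "v = c + d * t" "a \<in> L" "b \<in> L" "c \<in> L" "d \<in> L"
      by (auto simp: adj_def)
    have eq: "u - v = (a - c) + (b - d) * t" by (simp add: e algebra_simps)
    show "u - v \<in> adj L t" unfolding eq using e by (intro adjI fld_diff[OF L])
    have eq: "u * v = (a * c + b * d * t\<^sup>2) + (a * d + b * c) * t"
      by (simp add: e power2_eq_square algebra_simps)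
    show "u * v \<in> adj L t" unfolding eq using e t by (intro adjI fld_add[OF L] fld_mult[OF L])
  next
    fix u assume "u \<in> adj L t"
    then obtain a b where e: "u = a + b * t" "a \<in> L" "b \<in> L" by (auto simp: adj_def)
    define N where "N = a\<^sup>2 - b\<^sup>2 * t\<^sup>2"
    have N: "N = u * (a - b * t)" by (simp add: N_def e power2_eq_square algebra_simps)
    have NL: "N \<in> L" unfolding N_def using e t by (intro fld_diff[OF L] fld_mult[OF L] fld_power[OF L, of a] fld_power[OF L, of b])
    show "inverse u \<in> adj L t"
    proof (cases "N = 0")
      case True
      hence "u = 0 \<or> a = b * t" unfolding N by simp
      moreover have "u = 0" if "a = b * t"
      proof (cases "b = 0")
        case True
        thus ?thesis using that e by simp
      next
        case False
        hence "t = a / b" using that by simp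
        thus ?thesis using \<open>t \<notin> L\<close> fld_divide[OF L e(2,3)] by simp
      qed
      ultimately show ?thesis using subsetD[OF adj_subset[OF L] fld_0[OF L]] by auto
    next
      case False
      hence "inverse u = (a - b * t) / N" unfolding N by (auto simp: field_simps)
      also have "\<dots> = a / N + (- b / N) * t" by (simp add: diff_divide_distrib)
      finally show ?thesis using e NL by (simp only:) (intro adjI fld_closed[OF L])
    qed
  qed
qed

lemma adj_unique:
  assumes L: "fld L" and t: "t \<notin> L" and m: "a \<in> L" "b \<in> L" "c \<in> L" "d \<in> L" and e: "a + b * t = c + d * t"
  shows "a = c \<and> b = d"
proof -
  have "b = d"
  proof (rule ccontr)
    assume "b \<noteq> d"
    hence "t = (c - a) / (b - d)" using e by (simp add: field_simps)
    thus False using t fld_divide[OF L fld_diff[OF L m(3,1)] fld_diff[OF L m(2,4)]] by simp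
  qed
  thus ?thesis using e by simp
qed

text \<open>A homomorphism on \<open>L\<close> extends to the quadratic extension by any choice of a square root of the
  image of \<open>t\<^sup>2\<close>.\<close>

lemma hom_on_adj:
  assumes L: "fld L" and t: "t \<notin> L" "t\<^sup>2 \<in> L" and s: "hom_on L s" and r: "r\<^sup>2 = s (t\<^sup>2)"
  obtains \<sigma> where "hom_on (adj L t) \<sigma>" "\<And>x. x \<in> L \<Longrightarrow> \<sigma> x = s x" "\<sigma> t = r"
    "\<And>x y. x \<in> L \<Longrightarrow> y \<in> L \<Longrightarrow> \<sigma> (x + y * t) = s x + s y * r"
proof -
  define \<sigma> where "\<sigma> = (\<lambda>u. let (x, y) = (THE z. fst z \<in> L \<and> snd z \<in> L \<and> u = fst z + snd z * t) in s x + s y * r)"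
  have f: "\<sigma> (x + y * t) = s x + s y * r" if "x \<in> L" "y \<in> L" for x y
  proof -
    have "(THE z. fst z \<in> L \<and> snd z \<in> L \<and> x + y * t = fst z + snd z * t) = (x, y)"
    proof (rule the_equality)
      fix z assume "fst z \<in> L \<and> snd z \<in> L \<and> x + y * t = fst z + snd z * t"
      thus "z = (x, y)" using adj_unique[OF L t(1) that, of "fst z" "snd z"] by (auto simp: prod_eq_iff)
    qed (use that in auto)
    thus ?thesis by (simp add: \<sigma>_def)
  qed
  note h = hom_on_simps[OF s L]
  have "\<sigma> x = s x" if "x \<in> L" for x using f[OF that fld_0[OF L]] h(2) by simp
  moreover have "\<sigma> t = r" using f[OF fld_0[OF L] fld_1[OF L]] h(1,2) by simp
  moreover have "hom_on (adj L t) \<sigma>"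
    unfolding hom_on_def
  proof (intro conjI ballI)
    show "\<sigma> 1 = 1" using calculation(1)[OF fld_1[OF L]] h(1) by simp
    fix u v assume "u \<in> adj L t" "v \<in> adj L t"
    then obtain a b c d where e: "u = a + b * t" "v = c + d * t" and m: "a \<in> L" "b \<in> L" "c \<in> L" "d \<in> L"
      by (auto simp: adj_def)
    have "u + v = (a + c) + (b + d) * t" by (simp add: e algebra_simps)
    hence "\<sigma> (u + v) = s (a + c) + s (b + d) * r" using f m fld_add[OF L] by metis
    thus "\<sigma> (u + v) = \<sigma> u + \<sigma> v" using m by (simp add: e f h algebra_simps)
    have "u * v = (a * c + b * d * t\<^sup>2) + (a * d + b * c) * t" by (simp add: e power2_eq_square algebra_simps)
    moreover have "a * c + b * d * t\<^sup>2 \<in> L" "a * d + b * c \<in> L" using m t(2) by (auto intro!: fld_add[OF L] fld_mult[OF L])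
    ultimately have "\<sigma> (u * v) = s (a * c + b * d * t\<^sup>2) + s (a * d + b * c) * r" using f by metis
    also have "\<dots> = (s a * s c + s b * s d * r\<^sup>2) + (s a * s d + s b * s c) * r"
      using m t(2) by (simp add: h fld_mult[OF L] r)
    finally show "\<sigma> (u * v) = \<sigma> u * \<sigma> v" using m by (simp add: e f power2_eq_square algebra_simps)
  qed
  ultimately show thesis using that f by blast
qed

section \<open>Ideals and their powers\<close>

definition subr :: "complex set \<Rightarrow> bool" where
  "subr A \<longleftrightarrow> 1 \<in> A \<and> (\<forall>x\<in>A. \<forall>y\<in>A. x - y \<in> A \<and> x * y \<in> A)"

lemma subr_closed:
  assumes "subr A"
  shows subr_1: "1 \<in> A" and subr_0: "0 \<in> A"
    and subr_diff: "\<And>x y. x \<in> A \<Longrightarrow> y \<in> A \<Longrightarrow> x - y \<in> A"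
    and subr_mult: "\<And>x y. x \<in> A \<Longrightarrow> y \<in> A \<Longrightarrow> x * y \<in> A"
    and subr_minus: "\<And>x. x \<in> A \<Longrightarrow> - x \<in> A"
    and subr_add: "\<And>x y. x \<in> A \<Longrightarrow> y \<in> A \<Longrightarrow> x + y \<in> A"
    and subr_power: "\<And>x n. x \<in> A \<Longrightarrow> x ^ n \<in> A"
    and subr_of_nat: "\<And>n. of_nat n \<in> A"
    and subr_of_int: "\<And>n. of_int n \<in> A"
proof -
  show 1: "1 \<in> A" and d: "\<And>x y. x \<in> A \<Longrightarrow> y \<in> A \<Longrightarrow> x - y \<in> A"
    and m: "\<And>x y. x \<in> A \<Longrightarrow> y \<in> A \<Longrightarrow> x * y \<in> A"
    using assms by (auto simp: subr_def)
  show 0: "0 \<in> A" using d[OF 1 1] by simp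
  show mi: "- x \<in> A" if "x \<in> A" for x using d[OF 0 that] by simp
  show a: "x + y \<in> A" if "x \<in> A" "y \<in> A" for x y using d[OF that(1) mi[OF that(2)]] by simp
  show "x ^ n \<in> A" if "x \<in> A" for x n by (induction n) (use 1 m that in auto)
  show n: "of_nat n \<in> A" for n by (induction n) (use 0 1 a in auto)
  show "of_int n \<in> A" for n by (cases n) (use n mi in \<open>auto simp del: of_nat_Suc\<close>)
qed

definition idl :: "complex set \<Rightarrow> complex set \<Rightarrow> bool" where
  "idl A I \<longleftrightarrow> I \<subseteq> A \<and> 0 \<in> I \<and> (\<forall>x\<in>I. \<forall>y\<in>I. x + y \<in> I) \<and> (\<forall>x\<in>A. \<forall>y\<in>I. x * y \<in> I)"

definition prime_idl :: "complex set \<Rightarrow> complex set \<Rightarrow> bool" where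
  "prime_idl A P \<longleftrightarrow> idl A P \<and> 1 \<notin> P \<and> (\<forall>x\<in>A. \<forall>y\<in>A. x * y \<in> P \<longrightarrow> x \<in> P \<or> y \<in> P)"

lemma idl_closed:
  assumes "subr A" "idl A I"
  shows idl_sub: "\<And>x. x \<in> I \<Longrightarrow> x \<in> A" and idl_0: "0 \<in> I"
    and idl_add: "\<And>x y. x \<in> I \<Longrightarrow> y \<in> I \<Longrightarrow> x + y \<in> I"
    and idl_mult: "\<And>x y. x \<in> A \<Longrightarrow> y \<in> I \<Longrightarrow> x * y \<in> I"
    and idl_mult': "\<And>x y. x \<in> I \<Longrightarrow> y \<in> A \<Longrightarrow> x * y \<in> I"
    and idl_minus: "\<And>x. x \<in> I \<Longrightarrow> - x \<in> I"
    and idl_diff: "\<And>x y. x \<in> I \<Longrightarrow> y \<in> I \<Longrightarrow> x - y \<in> I"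
proof -
  show "\<And>x. x \<in> I \<Longrightarrow> x \<in> A" "0 \<in> I" and a: "\<And>x y. x \<in> I \<Longrightarrow> y \<in> I \<Longrightarrow> x + y \<in> I"
    and m: "\<And>x y. x \<in> A \<Longrightarrow> y \<in> I \<Longrightarrow> x * y \<in> I"
    using assms(2) by (auto simp: idl_def)
  show "x * y \<in> I" if "x \<in> I" "y \<in> A" for x y using m[OF that(2,1)] by (simp add: mult.commute)
  show mi: "- x \<in> I" if "x \<in> I" for x
    using m[OF subr_minus[OF assms(1) subr_1[OF assms(1)]] that] by simp
  show "x - y \<in> I" if "x \<in> I" "y \<in> I" for x y using a[OF that(1) mi[OF that(2)]] by simp
qed

lemma prime_idl_idl: "prime_idl A P \<Longrightarrow> idl A P"
  and prime_idl_1: "prime_idl A P \<Longrightarrow> 1 \<notin> P"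
  and prime_idl_prime: "prime_idl A P \<Longrightarrow> x \<in> A \<Longrightarrow> y \<in> A \<Longrightarrow> x * y \<in> P \<Longrightarrow> x \<in> P \<or> y \<in> P"
  by (auto simp: prime_idl_def)

lemma CC_simps [simp]:
  "carrier CC = UNIV" "x \<otimes>\<^bsub>CC\<^esub> y = x * y" "\<one>\<^bsub>CC\<^esub> = 1" "\<zero>\<^bsub>CC\<^esub> = 0" "x \<oplus>\<^bsub>CC\<^esub> y = x + y"
  by (simp_all add: ring_of_type_algebra_def)

lemma field_CC: "field CC"
  by (rule field_from_type_algebra)

abbreviation Rg :: "complex set \<Rightarrow> complex ring" where "Rg A \<equiv> CC\<lparr>carrier := A\<rparr>"

lemma cring_Rg:
  assumes A: "subr A"
  shows "cring (Rg A)"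
proof (intro cringI abelian_groupI comm_monoidI)
  fix x assume "x \<in> carrier (Rg A)"
  hence "- x \<in> carrier (Rg A) \<and> - x \<oplus>\<^bsub>Rg A\<^esub> x = \<zero>\<^bsub>Rg A\<^esub>" using subr_minus[OF A] by simp
  thus "\<exists>y\<in>carrier (Rg A). y \<oplus>\<^bsub>Rg A\<^esub> x = \<zero>\<^bsub>Rg A\<^esub>" by blast
qed (use subr_closed[OF A] in \<open>auto simp: algebra_simps\<close>)

lemma ideal_Rg_iff:
  assumes A: "subr A"
  shows "ideal I (Rg A) \<longleftrightarrow> idl A I"
proof
  interpret R: cring "Rg A" by (rule cring_Rg[OF A])
  assume "ideal I (Rg A)"
  then interpret J: ideal I "Rg A" .
  show "idl A I" unfolding idl_def
    using J.a_subset J.zero_closed J.a_closed J.I_l_closed by auto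
next
  interpret R: cring "Rg A" by (rule cring_Rg[OF A])
  assume I: "idl A I"
  note c = idl_closed[OF A I]
  have inv: "\<ominus>\<^bsub>Rg A\<^esub> x = - x" if "x \<in> A" for x
    using R.minus_equality[of "- x" x] subr_minus[OF A that] that by simp
  show "ideal I (Rg A)"
  proof (rule idealI[OF R.ring_axioms])
    show "subgroup I (add_monoid (Rg A))"
    proof (rule R.add.subgroupI)
      show "I \<subseteq> carrier (Rg A)" using c(1) by auto
      show "I \<noteq> {}" using c(2) by blast
      show "\<ominus>\<^bsub>Rg A\<^esub> x \<in> I" if "x \<in> I" for x using inv c that by simp
      show "x \<oplus>\<^bsub>Rg A\<^esub> y \<in> I" if "x \<in> I" "y \<in> I" for x y using c that by simp
    qed
  qed (use c in simp_all)
qed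

lemma primeideal_Rg_iff:
  assumes A: "subr A"
  shows "primeideal P (Rg A) \<longleftrightarrow> prime_idl A P"
proof
  assume "primeideal P (Rg A)"
  then interpret J: primeideal P "Rg A" .
  have i: "idl A P" using J.is_ideal ideal_Rg_iff[OF A] by blast
  have "1 \<notin> P"
  proof
    assume 1: "1 \<in> P"
    have "A \<subseteq> P" using idl_mult[OF A i _ 1] by force
    thus False using J.I_notcarr idl_sub[OF A i] by auto
  qed
  thus "prime_idl A P" using i J.I_prime by (auto simp: prime_idl_def)
next
  assume P: "prime_idl A P"
  show "primeideal P (Rg A)"
  proof (rule primeidealI)
    show "ideal P (Rg A)" using P ideal_Rg_iff[OF A] prime_idl_idl by blast
    show "cring (Rg A)" by (rule cring_Rg[OF A])
    show "carrier (Rg A) \<noteq> P" using P subr_1[OF A] by (auto simp: prime_idl_def)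
  qed (use P in \<open>auto simp: prime_idl_def\<close>)
qed

text \<open>The ramification index is defined by the extended ideal; for containment in an ideal it may be
  replaced by its generating set.\<close>

lemma genideal_subset_iff:
  assumes A: "subr A" and I: "idl A I" and S: "S \<subseteq> A"
  shows "genideal (Rg A) S \<subseteq> I \<longleftrightarrow> S \<subseteq> I"
proof -
  interpret R: cring "Rg A" by (rule cring_Rg[OF A])
  have "S \<subseteq> genideal (Rg A) S" using R.genideal_self S by simp
  moreover have "genideal (Rg A) S \<subseteq> I" if "S \<subseteq> I"
    using R.genideal_minimal that I ideal_Rg_iff[OF A] by blast
  ultimately show ?thesis by blast
qed

definition ipow :: "complex set \<Rightarrow> complex set \<Rightarrow> nat \<Rightarrow> complex set" where
  "ipow A P e = P [^]\<^bsub>ideals_set (Rg A)\<^esub> e"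

lemma ipow_simps: "ipow A P 0 = A" "ipow A P (Suc e) = ideal_prod (Rg A) (ipow A P e) P"
  by (simp_all add: ipow_def nat_pow_def ideals_set_def)

context
  fixes A P assumes A: "subr A" and P: "idl A P"
begin

lemma ipow_idl: "idl A (ipow A P e)"
proof (induction e)
  case 0
  show ?case using subr_closed[OF A] by (auto simp: ipow_simps idl_def)
next
  case (Suc e)
  interpret R: cring "Rg A" by (rule cring_Rg[OF A])
  show ?case unfolding ipow_simps using R.ideal_prod_is_ideal Suc P ideal_Rg_iff[OF A] by blast
qed

lemma ipow_Suc_subset: "ipow A P (Suc e) \<subseteq> ipow A P e"
proof -
  interpret R: cring "Rg A" by (rule cring_Rg[OF A])
  show ?thesis using R.ideal_prod_inter[of "ipow A P e" P] ipow_idl P ideal_Rg_iff[OF A] by (auto simp: ipow_simps)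
qed

lemma ipow_antimono: "d \<le> e \<Longrightarrow> ipow A P e \<subseteq> ipow A P d"
  by (rule lift_Suc_antimono_le[of "ipow A P"]) (use ipow_Suc_subset in auto)

lemma ipow_1: "ipow A P 1 = P"
proof
  interpret R: cring "Rg A" by (rule cring_Rg[OF A])
  show "ipow A P 1 \<subseteq> P" using R.ideal_prod_inter[of A P] ipow_idl[of 0] P ideal_Rg_iff[OF A] by (auto simp: ipow_simps)
  show "P \<subseteq> ipow A P 1"
  proof
    fix x assume "x \<in> P"
    from ideal_prod.prod[OF subr_1[OF A] this, of "Rg A"] show "x \<in> ipow A P 1" by (simp add: ipow_simps)
  qed
qed

lemma ipow_2_mult: "x \<in> P \<Longrightarrow> y \<in> P \<Longrightarrow> x * y \<in> ipow A P 2"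
  using ideal_prod.prod[of x P y P "Rg A"] ipow_1 by (simp add: numeral_2_eq_2 ipow_simps)

lemma ramification_index_def':
  assumes "A = {x \<in> F. algebraic_int x}"
  shows "ramification_index K F P = (GREATEST e. P \<inter> K \<subseteq> ipow A P e)"
proof -
  have "P \<inter> K \<subseteq> A" using P by (auto simp: idl_def)
  hence "genideal (integers_of F) (P \<inter> K) \<subseteq> P [^]\<^bsub>ideals_set (integers_of F)\<^esub> e \<longleftrightarrow> P \<inter> K \<subseteq> ipow A P e" for e :: nat
    unfolding integers_of_def assms[symmetric] ipow_def[symmetric]
    by (rule genideal_subset_iff[OF A ipow_idl])
  thus ?thesis unfolding ramification_index_def by simp
qed

end

section \<open>Nakayama and Krull\<close>

text \<open>The ring \<open>A\<close> has finitely many classes modulo \<open>n\<close>: a function with finitely many values on \<open>A\<close>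
  separates them. This finiteness replaces the Noetherian property throughout.\<close>

definition fin_mod :: "complex set \<Rightarrow> complex \<Rightarrow> bool" where
  "fin_mod A n \<longleftrightarrow> (\<exists>c :: complex \<Rightarrow> complex. finite (c ` A) \<and> (\<forall>x\<in>A. \<forall>y\<in>A. c x = c y \<longrightarrow> (\<exists>z\<in>A. x - y = n * z)))"

text \<open>Together with \<open>n\<close> itself, representatives of the finitely many classes modulo \<open>n\<close> generate \<open>M\<close>. If
  \<open>M P = M\<close>, elimination yields an element of \<open>1 + P\<close> that annihilates \<open>M\<close>; it is nonzero.\<close>

lemma nakayama:
  assumes A: "subr A" and P: "idl A P" "1 \<notin> P" and M: "idl A M" and n: "n \<in> M" "fin_mod A n"
    and sub: "M \<subseteq> ideal_prod (Rg A) M P"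
  shows "M = {0}"
proof -
  obtain c :: "complex \<Rightarrow> complex" where c: "finite (c ` A)" "\<And>x y. x \<in> A \<Longrightarrow> y \<in> A \<Longrightarrow> c x = c y \<Longrightarrow> \<exists>z\<in>A. x - y = n * z"
    using n(2) unfolding fin_mod_def by blast
  define rep where "rep = (\<lambda>v. SOME x. x \<in> M \<and> c x = v)"
  define G where "G = insert n (rep ` c ` M)"
  have MA: "M \<subseteq> A" using idl_sub[OF A M] by blast
  have fG: "finite G" unfolding G_def using finite_subset[OF image_mono[OF MA] c(1)] by simp
  have rep: "rep (c x) \<in> M \<and> c (rep (c x)) = c x" if "x \<in> M" for x
    unfolding rep_def by (rule someI[of _ x]) (use that in simp)
  have GM: "G \<subseteq> M" using n(1) rep by (auto simp: G_def)
  have gen: "\<exists>d. (\<forall>y\<in>G. d y \<in> A) \<and> x = (\<Sum>y\<in>G. d y * y)" if x: "x \<in> M" for x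
  proof -
    let ?r = "rep (c x)"
    have r: "?r \<in> G" "?r \<in> A" "x \<in> A" using x rep MA by (auto simp: G_def)
    then obtain z where z: "z \<in> A" "x - ?r = n * z" using c(2)[of x ?r] rep[OF x] by auto
    have "x = (\<Sum>y\<in>G. (if y = ?r then 1 else 0) * y) + (\<Sum>y\<in>G. (if y = n then z else 0) * y)"
    proof -
      have d: "(\<Sum>y\<in>G. (if y = w then v else 0) * y) = v * w" if "w \<in> G" for v w
      proof -
        have "(\<Sum>y\<in>G. (if y = w then v else 0) * y) = (\<Sum>y\<in>G. if y = w then v * w else 0)"
          by (rule sum.cong) auto
        thus ?thesis using fG that by (simp add: sum.delta)
      qed
      have "n \<in> G" by (simp add: G_def)
      show ?thesis unfolding d[OF r(1)] d[OF \<open>n \<in> G\<close>] using z(2) by (simp add: algebra_simps)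
    qed
    also have "\<dots> = (\<Sum>y\<in>G. ((if y = ?r then 1 else 0) + (if y = n then z else 0)) * y)"
      by (simp add: sum.distrib algebra_simps)
    finally show ?thesis
      using z subr_closed[OF A]
      by (intro exI[of _ "\<lambda>y. (if y = ?r then 1 else 0) + (if y = n then z else 0)"]) auto
  qed
  have genP: "\<exists>d. (\<forall>y\<in>G. d y \<in> P) \<and> x = (\<Sum>y\<in>G. d y * y)" if "x \<in> ideal_prod (Rg A) M P" for x
    using that
  proof (induction rule: ideal_prod.induct)
    case (prod i j)
    obtain d where d: "\<forall>y\<in>G. d y \<in> A" "i = (\<Sum>y\<in>G. d y * y)" using gen[OF prod(1)] by blast
    have "i \<otimes>\<^bsub>Rg A\<^esub> j = (\<Sum>y\<in>G. (d y * j) * y)" by (simp add: d(2) sum_distrib_left ac_simps)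
    moreover have "\<forall>y\<in>G. d y * j \<in> P" using d(1) prod(2) idl_mult[OF A P(1)] by blast
    ultimately show ?case by (intro exI[of _ "\<lambda>y. d y * j"]) simp
  next
    case (sum s1 s2)
    then obtain d e where "\<forall>y\<in>G. d y \<in> P" "s1 = (\<Sum>y\<in>G. d y * y)" "\<forall>y\<in>G. e y \<in> P" "s2 = (\<Sum>y\<in>G. e y * y)" by blast
    thus ?case using idl_add[OF A P(1)]
      by (intro exI[of _ "\<lambda>y. d y + e y"]) (simp add: sum.distrib algebra_simps)
  qed
  have "\<exists>k'::nat. \<exists>u'\<in>{x. x - 1 \<in> P}. \<forall>x\<in>G. u' * x = 0"
  proof (rule elimination[where S = "\<lambda>_. P" and U = "\<lambda>_. {x. x - 1 \<in> P}" and u = 1])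
    note p = idl_closed[OF A P(1)]
    have UA: "x \<in> A" if "x - 1 \<in> P" for x
      using subr_add[OF A p(1)[OF that] subr_1[OF A]] by simp
    show "0 \<in> P" "\<And>a b. a \<in> P \<Longrightarrow> b \<in> P \<Longrightarrow> a + b \<in> P" "\<And>a b. a \<in> P \<Longrightarrow> b \<in> P \<Longrightarrow> a * b \<in> P"
      using p by auto
    show "a * b \<in> P" if "a \<in> {x. x - 1 \<in> P}" "b \<in> P" for a b using that p UA by auto
    show "a * b \<in> {x. x - 1 \<in> P}" if "a \<in> {x. x - 1 \<in> P}" "b \<in> {x. x - 1 \<in> P}" for a b
    proof -
      have "(a - 1) * b + (b - 1) \<in> P" using that p(3)[OF p(5)] UA by auto
      thus ?thesis by (simp add: algebra_simps)
    qed
    show "a - b \<in> {x. x - 1 \<in> P}" if "a \<in> {x. x - 1 \<in> P}" "b \<in> P" for a b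
    proof -
      have "(a - 1) - b \<in> P" using that p(7) by auto
      thus ?thesis by (simp add: algebra_simps)
    qed
    show "(1::complex) \<in> {x. x - 1 \<in> P}" using p(2) by simp
    fix x assume "x \<in> G"
    hence "x \<in> ideal_prod (Rg A) M P" using GM sub by blast
    from genP[OF this] show "\<exists>c. (\<forall>y\<in>G. c y \<in> P) \<and> 1 * x = (\<Sum>y\<in>G. c y * y)" by simp
  qed (rule fG)
  then obtain u where u: "u - 1 \<in> P" "\<And>x. x \<in> G \<Longrightarrow> u * x = 0" by blast
  have "u \<noteq> 0"
  proof
    assume "u = 0"
    hence "- 1 \<in> P" using u(1) by simp
    from idl_minus[OF A P(1) this] show False using P(2) by simp
  qed
  hence "x = 0" if "x \<in> G" for x using u(2)[OF that] by simp
  hence "x = 0" if "x \<in> M" for x using gen[OF that] by (auto intro!: sum.neutral)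
  thus ?thesis using idl_0[OF A M] by blast
qed

text \<open>If all powers of \<open>P\<close> contained \<open>n\<close>, then modulo \<open>n\<close> the descending chain of powers would become
  stationary; the stationary power satisfies \<open>P\<^sup>e P = P\<^sup>e\<close> and vanishes by Nakayama. This bound makes the greatest
  exponent in the definition of the ramification index meaningful.\<close>

lemma krull:
  assumes A: "subr A" and P: "idl A P" "1 \<notin> P" and n: "n \<noteq> 0" "fin_mod A n"
  shows "\<exists>e. n \<notin> ipow A P e"
proof (rule ccontr)
  assume "\<not> (\<exists>e. n \<notin> ipow A P e)"
  hence all: "n \<in> ipow A P e" for e by blast
  obtain c :: "complex \<Rightarrow> complex" where c: "finite (c ` A)" "\<And>x y. x \<in> A \<Longrightarrow> y \<in> A \<Longrightarrow> c x = c y \<Longrightarrow> \<exists>z\<in>A. x - y = n * z"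
    using n(2) unfolding fin_mod_def by blast
  have sA: "ipow A P e \<subseteq> A" for e using idl_sub[OF A ipow_idl[OF A P(1)]] by blast
  have fin: "finite (c ` ipow A P e)" for e using finite_subset[OF image_mono[OF sA] c(1)] .
  have "\<exists>e. c ` ipow A P (Suc e) = c ` ipow A P e"
  proof (rule ccontr)
    assume "\<nexists>e. c ` ipow A P (Suc e) = c ` ipow A P e"
    hence sub: "c ` ipow A P (Suc e) \<subset> c ` ipow A P e" for e
    proof -
      have "c ` ipow A P (Suc e) \<subseteq> c ` ipow A P e" by (intro image_mono ipow_Suc_subset A P(1))
      thus ?thesis using \<open>\<nexists>e. c ` ipow A P (Suc e) = c ` ipow A P e\<close> by (simp add: psubset_eq)
    qed
    have less: "card (c ` ipow A P (Suc e)) < card (c ` ipow A P e)" for e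
      by (rule psubset_card_mono[OF fin sub])
    have "card (c ` ipow A P e) + e \<le> card (c ` ipow A P 0)" for e
    proof (induction e)
      case (Suc e)
      thus ?case using less[of e] by simp
    qed simp
    from this[of "Suc (card (c ` ipow A P 0))"] show False by simp
  qed
  then obtain e where e: "c ` ipow A P (Suc e) = c ` ipow A P e" by blast
  have "ipow A P e \<subseteq> ipow A P (Suc e)"
  proof
    fix x assume x: "x \<in> ipow A P e"
    then obtain y where y: "y \<in> ipow A P (Suc e)" "c x = c y" using e by (metis imageE imageI)
    then obtain z where "z \<in> A" "x - y = n * z" using c(2) x sA by blast
    moreover have "n * z \<in> ipow A P (Suc e)" using idl_mult'[OF A ipow_idl[OF A P(1)] all \<open>z \<in> A\<close>] .
    ultimately have "y + (x - y) \<in> ipow A P (Suc e)" using idl_add[OF A ipow_idl[OF A P(1)] y(1)] by metis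
    thus "x \<in> ipow A P (Suc e)" by simp
  qed
  hence "ipow A P e = {0}"
    using nakayama[OF A P ipow_idl[OF A P(1)] all n(2)] by (simp add: ipow_simps)
  thus False using all[of e] n(1) by simp
qed

lemma not_subset_ipow_2:
  assumes A: "subr A" and P: "idl A P" "1 \<notin> P" and n: "n \<in> P" "n \<noteq> 0" "fin_mod A n"
  shows "\<not> P \<subseteq> ipow A P 2"
proof
  assume "P \<subseteq> ipow A P 2"
  hence "P \<subseteq> ideal_prod (Rg A) P P" using ipow_1[OF A P(1)] by (simp add: numeral_2_eq_2 ipow_simps)
  hence "P = {0}" using nakayama[OF A P P(1) n(1,3)] by blast
  thus False using n by simp
qed

section \<open>Quadratic steps that do not ramify\<close>

text \<open>Two powers of \<open>u\<close> agree modulo \<open>n\<close>, hence modulo \<open>P\<close>, because there are finitely many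
  classes.\<close>

lemma prime_idl_inverse:
  assumes A: "subr A" and P: "prime_idl A P" and n: "n \<in> P" "fin_mod A n" and u: "u \<in> A" "u \<notin> P"
  shows "\<exists>v\<in>A. u * v - 1 \<in> P"
proof -
  obtain c :: "complex \<Rightarrow> complex" where c: "finite (c ` A)" "\<And>x y. x \<in> A \<Longrightarrow> y \<in> A \<Longrightarrow> c x = c y \<Longrightarrow> \<exists>z\<in>A. x - y = n * z"
    using n(2) unfolding fin_mod_def by blast
  have uA: "u ^ i \<in> A" for i using subr_power[OF A u(1)] .
  have "range (\<lambda>i. c (u ^ i)) \<subseteq> c ` A" using uA by blast
  hence "finite (range (\<lambda>i::nat. c (u ^ i)))" using c(1) finite_subset by blast
  hence "\<not> inj (\<lambda>i::nat. c (u ^ i))" using finite_imageD by blast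
  then obtain i j :: nat where ij: "i < j" "c (u ^ i) = c (u ^ j)"
    by (metis injI linorder_neqE_nat)
  then obtain z where z: "z \<in> A" "u ^ i - u ^ j = n * z" using c(2) uA by blast
  hence P1: "u ^ i - u ^ j \<in> P" using idl_mult'[OF A prime_idl_idl[OF P] n(1)] by simp
  have nP: "u ^ k \<notin> P" for k
  proof (induction k)
    case (Suc k)
    thus ?case using prime_idl_prime[OF P u(1) uA] u(2) by auto
  qed (use prime_idl_1[OF P] in simp)
  obtain k where k: "j = i + Suc k" using ij(1) less_iff_Suc_add by auto
  have "u ^ i - u ^ j = u ^ i * (1 - u * u ^ k)" unfolding k by (simp add: power_add algebra_simps)
  moreover have "1 - u * u ^ k \<in> A" using subr_diff[OF A subr_1[OF A] subr_mult[OF A u(1) uA]] .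
  ultimately have "1 - u * u ^ k \<in> P" using P1 nP prime_idl_prime[OF P uA] by metis
  from idl_minus[OF A prime_idl_idl[OF P] this] have "u * u ^ k - 1 \<in> P" by simp
  thus ?thesis using uA by blast
qed

text \<open>Newton's iteration lifts an inverse modulo \<open>P\<close> to one modulo \<open>P\<^sup>2\<close>.\<close>

lemma prime_idl_inverse_ipow_2:
  assumes A: "subr A" and P: "prime_idl A P" and n: "n \<in> P" "fin_mod A n" and u: "u \<in> A" "u \<notin> P"
  shows "\<exists>v\<in>A. u * v - 1 \<in> ipow A P 2"
proof -
  obtain v where v: "v \<in> A" "u * v - 1 \<in> P" using prime_idl_inverse[OF assms] by blast
  have "(u * v - 1) * (u * v - 1) \<in> ipow A P 2" using ipow_2_mult[OF A prime_idl_idl[OF P]] v(2) by blast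
  hence "- ((u * v - 1) * (u * v - 1)) \<in> ipow A P 2" using idl_minus[OF A ipow_idl[OF A prime_idl_idl[OF P]]] by blast
  moreover have "- ((u * v - 1) * (u * v - 1)) = u * (v * (2 - u * v)) - 1" by (simp add: algebra_simps)
  moreover have "v * (2 - u * v) \<in> A" using subr_closed[OF A] v(1) u(1) subr_of_nat[OF A, of 2] by simp
  ultimately show ?thesis by metis
qed

lemma cancel_mod_ipow_2:
  assumes A: "subr A" and P: "prime_idl A P" and n: "n \<in> P" "fin_mod A n" and u: "u \<in> A" "u \<notin> P"
    and x: "x \<in> A" "u * x \<in> ipow A P 2"
  shows "x \<in> ipow A P 2"
proof -
  note I = idl_closed[OF A ipow_idl[OF A prime_idl_idl[OF P], of 2]]
  obtain v where v: "v \<in> A" "u * v - 1 \<in> ipow A P 2" using prime_idl_inverse_ipow_2[OF A P n u] by blast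
  have "v * (u * x) - (u * v - 1) * x \<in> ipow A P 2"
    using I(7)[OF I(4)[OF v(1) x(2)] I(5)[OF v(2) x(1)]] .
  thus ?thesis by (simp add: algebra_simps)
qed

text \<open>Suppose \<open>x\<close> and \<open>\<sigma> x\<close> lie in \<open>P\<close>. Then \<open>x + \<sigma> x\<close> and \<open>g x + \<sigma> g \<sigma> x\<close> are fixed by \<open>\<sigma>\<close>, hence in
  \<open>P \<inter> L\<close> and so in \<open>P\<^sup>2\<close>; their combination \<open>(g - \<sigma> g) x\<close> then lies in \<open>P\<^sup>2\<close>, and the factor
  \<open>g - \<sigma> g\<close> is invertible modulo \<open>P\<^sup>2\<close>. If some \<open>y\<close> in \<open>P\<close> has \<open>\<sigma> y\<close> outside \<open>P\<close>, one
  applies this to \<open>\<sigma> y x\<close> instead of \<open>x\<close>.\<close>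

lemma unramified_step:
  assumes F: "fld F" and A: "A = {x \<in> F. algebraic_int x}" "subr A" and P: "prime_idl A P" and n: "n \<in> P" "fin_mod A n"
    and M: "fld M" "M \<subseteq> F" and s: "hom_on M \<sigma>" "\<And>x. x \<in> M \<Longrightarrow> \<sigma> x \<in> M" "\<And>x. x \<in> M \<Longrightarrow> \<sigma> (\<sigma> x) = x"
    and L: "\<And>x. x \<in> M \<Longrightarrow> \<sigma> x = x \<Longrightarrow> x \<in> L"
    and g: "g \<in> M" "algebraic_int g" "g - \<sigma> g \<notin> P"
    and PL: "P \<inter> L \<subseteq> ipow A P 2"
  shows "P \<inter> M \<subseteq> ipow A P 2"
proof -
  note p = idl_closed[OF A(2) prime_idl_idl[OF P]] and I = idl_closed[OF A(2) ipow_idl[OF A(2) prime_idl_idl[OF P], of 2]]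
  note h = hom_on_simps[OF s(1) M(1)] and c = fld_closed[OF M(1)]
  have MA: "x \<in> A" if "x \<in> M" "algebraic_int x" for x using that M(2) A(1) by blast
  have sA: "\<sigma> x \<in> A" "algebraic_int (\<sigma> x)" if "x \<in> M" "x \<in> A" for x
    using algebraic_int_hom[OF s(1) M(1) that(1)] that(2) A(1) MA s(2)[OF that(1)] by auto
  have gA: "g \<in> A" "\<sigma> g \<in> A" using MA[OF g(1,2)] sA[OF g(1)] by auto
  have key: "x \<in> ipow A P 2" if x: "x \<in> M" "x \<in> P" "\<sigma> x \<in> P" for x
  proof -
    have 1: "x + \<sigma> x \<in> ipow A P 2"
    proof -
      have "\<sigma> (x + \<sigma> x) = x + \<sigma> x" using x s h by (simp add: add.commute)
      hence "x + \<sigma> x \<in> L" using L[OF c(6)[OF x(1) s(2)[OF x(1)]]] by simp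
      thus ?thesis using PL p(3)[OF x(2,3)] by blast
    qed
    have 2: "g * x + \<sigma> g * \<sigma> x \<in> ipow A P 2"
    proof -
      have "\<sigma> (g * x + \<sigma> g * \<sigma> x) = g * x + \<sigma> g * \<sigma> x"
        using x s h g(1) c by (simp add: add.commute)
      moreover have "g * x + \<sigma> g * \<sigma> x \<in> M"
        using c(6)[OF c(4)[OF g(1) x(1)] c(4)[OF s(2)[OF g(1)] s(2)[OF x(1)]]] .
      ultimately have "g * x + \<sigma> g * \<sigma> x \<in> L" by (intro L)
      moreover have "g * x + \<sigma> g * \<sigma> x \<in> P"
        using p(3)[OF p(4)[OF gA(1) x(2)] p(4)[OF gA(2) x(3)]] .
      ultimately show ?thesis using PL by blast
    qed
    have "g * x + \<sigma> g * \<sigma> x - \<sigma> g * (x + \<sigma> x) \<in> ipow A P 2" using I(7)[OF 2 I(4)[OF gA(2) 1]] .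
    hence "(g - \<sigma> g) * x \<in> ipow A P 2" by (simp add: algebra_simps)
    thus ?thesis using cancel_mod_ipow_2[OF A(2) P n subr_diff[OF A(2) gA] g(3) p(1)[OF x(2)]] by blast
  qed
  show ?thesis
  proof (cases "\<exists>y. y \<in> M \<and> y \<in> P \<and> \<sigma> y \<notin> P")
    case False
    thus ?thesis using key by blast
  next
    case True
    then obtain y where y: "y \<in> M" "y \<in> P" "\<sigma> y \<notin> P" by blast
    have yA: "\<sigma> y \<in> A" using sA y p(1) by blast
    show ?thesis
    proof clarify
      fix x assume x: "x \<in> P" "x \<in> M"
      have "\<sigma> y * x \<in> M" using c(4)[OF s(2)[OF y(1)] x(2)] .
      moreover have "\<sigma> y * x \<in> P" using p(4)[OF yA x(1)] .
      moreover have "\<sigma> (\<sigma> y * x) = y * \<sigma> x" using h x y s by simp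
      moreover have "y * \<sigma> x \<in> P" using p(5)[OF y(2) sA(1)[OF x(2) p(1)[OF x(1)]]] .
      ultimately have "\<sigma> y * x \<in> ipow A P 2" using key by simp
      thus "x \<in> ipow A P 2" using cancel_mod_ipow_2[OF A(2) P n yA y(3) p(1)[OF x(1)]] by blast
    qed
  qed
qed

text \<open>The constant term of an integral equation of \<open>x\<close>, after cancelling powers of \<open>x\<close>.\<close>

lemma integer_in_ideal:
  assumes A: "subr A" and I: "idl A I" and x: "x \<in> I" "x \<noteq> 0" "algebraic_int x"
  shows "\<exists>n::int. n \<noteq> 0 \<and> of_int n \<in> I"
proof -
  have xA: "x \<in> A" using idl_sub[OF A I x(1)] .
  obtain f where f: "ipoly f x = 0" "lead_coeff f = 1" using x(3) algebraic_int_ipoly by blast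
  hence "f \<noteq> 0" by auto
  thus ?thesis using f(1)
  proof (induction f)
    case (pCons a f)
    have fA: "ipoly g x \<in> A" for g
      by (induction g) (use subr_closed[OF A] xA in auto)
    show ?case
    proof (cases "a = 0")
      case True
      hence "f \<noteq> 0" "ipoly f x = 0" using pCons x by auto
      thus ?thesis using pCons by blast
    next
      case False
      have "of_int a = - (ipoly f x * x)" using pCons.prems by (simp add: eq_neg_iff_add_eq_0 mult.commute)
      also have "\<dots> \<in> I" using idl_minus[OF A I idl_mult[OF A I fA x(1)]] .
      finally show ?thesis using False by blast
    qed
  qed simp
qed

text \<open>By Zorn's lemma there is an ideal containing \<open>I\<close> that is maximal among the proper ones; it is prime.\<close>

lemma exists_prime_idl:
  assumes A: "subr A" and I: "idl A I" "1 \<notin> I"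
  shows "\<exists>P. prime_idl A P \<and> I \<subseteq> P"
proof -
  define C where "C = {J. idl A J \<and> 1 \<notin> J \<and> I \<subseteq> J}"
  have "\<exists>M\<in>C. \<forall>J\<in>C. M \<subseteq> J \<longrightarrow> J = M"
  proof (rule subset_Zorn)
    fix D assume D: "subset.chain C D"
    show "\<exists>U\<in>C. \<forall>J\<in>D. J \<subseteq> U"
    proof (cases "D = {}")
      case True
      thus ?thesis using I by (auto simp: C_def)
    next
      case False
      have DC: "J \<in> C" if "J \<in> D" for J using D that by (auto simp: subset.chain_def)
      have lin: "J \<subseteq> K \<or> K \<subseteq> J" if "J \<in> D" "K \<in> D" for J K using D that by (auto simp: subset_chain_def)
      have "\<Union>D \<in> C" unfolding C_def
      proof (intro CollectI conjI)
        show "idl A (\<Union>D)" unfolding idl_def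
        proof (intro conjI ballI)
          have sub: "J \<subseteq> A" "0 \<in> J" if "J \<in> D" for J using DC[OF that] by (auto simp: C_def idl_def)
          thus "\<Union>D \<subseteq> A" "0 \<in> \<Union>D" using False by blast+
          fix x y assume "x \<in> \<Union>D" "y \<in> \<Union>D"
          then obtain J K where "J \<in> D" "K \<in> D" "x \<in> J" "y \<in> K" by blast
          then obtain H where "H \<in> D" "x \<in> H" "y \<in> H" using lin by blast
          thus "x + y \<in> \<Union>D" using DC[of H] by (auto simp: C_def idl_def)
        next
          fix x y assume "x \<in> A" "y \<in> \<Union>D"
          then obtain J where J: "J \<in> D" "y \<in> J" by blast
          hence "x * y \<in> J" using DC[OF J(1)] \<open>x \<in> A\<close> by (auto simp: C_def idl_def)
          thus "x * y \<in> \<Union>D" using J(1) by blast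
        qed
        show "1 \<notin> \<Union>D" "I \<subseteq> \<Union>D" using DC False by (auto simp: C_def)
      qed
      thus ?thesis by blast
    qed
  qed
  then obtain P where P: "idl A P" "1 \<notin> P" "I \<subseteq> P" and max: "\<And>J. idl A J \<Longrightarrow> 1 \<notin> J \<Longrightarrow> P \<subseteq> J \<Longrightarrow> J = P"
    by (auto simp: C_def)
  note p = idl_closed[OF A P(1)] and a = subr_closed[OF A]
  have "prime_idl A P" unfolding prime_idl_def
  proof (intro conjI ballI impI)
    show "idl A P" "1 \<notin> P" by (fact P(1), fact P(2))
    fix x y assume xy: "x \<in> A" "y \<in> A" "x * y \<in> P"
    show "x \<in> P \<or> y \<in> P"
    proof (rule ccontr)
      assume n: "\<not> (x \<in> P \<or> y \<in> P)"
      define J where "J = {u + v * x | u v. u \<in> P \<and> v \<in> A}"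
      have J: "idl A J" unfolding idl_def
      proof (intro conjI ballI)
        show "J \<subseteq> A" using xy p(1) a by (auto simp: J_def)
        show "0 \<in> J" unfolding J_def using p(2) a(2) by force
        fix s t assume "t \<in> J"
        then obtain u v where t: "t = u + v * x" "u \<in> P" "v \<in> A" by (auto simp: J_def)
        show "s * t \<in> J" if "s \<in> A"
        proof -
          have "s * t = s * u + (s * v) * x" by (simp add: t algebra_simps)
          thus ?thesis unfolding J_def using p(4)[OF that t(2)] a(4)[OF that t(3)] by blast
        qed
        show "s + t \<in> J" if "s \<in> J"
        proof -
          from \<open>s \<in> J\<close> obtain u' v' where s: "s = u' + v' * x" "u' \<in> P" "v' \<in> A"
            unfolding J_def by blast
          have "s + t = (u' + u) + (v' + v) * x" by (simp add: s t algebra_simps)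
          thus ?thesis unfolding J_def using p(3)[OF s(2) t(2)] a(6)[OF s(3) t(3)] by blast
        qed
      qed
      have PJ: "P \<subseteq> J" unfolding J_def using a(2) by force
      have "x \<in> J" unfolding J_def using p(2) a(1) by force
      hence "1 \<in> J" using max[OF J _ PJ] n by blast
      then obtain u v where uv: "1 = u + v * x" "u \<in> P" "v \<in> A" by (auto simp: J_def)
      have "y = y * (u + v * x)" using uv(1) by simp
      also have "\<dots> = y * u + v * (x * y)" by (simp add: algebra_simps)
      also have "\<dots> \<in> P" using p(3)[OF p(4)[OF xy(2) uv(2)] p(4)[OF uv(3) xy(3)]] .
      finally show False using n by blast
    qed
  qed
  thus ?thesis using P(3) by blast
qed

section \<open>Degrees and quadratic extensions\<close>

abbreviation Oint :: "complex set \<Rightarrow> complex set" where "Oint F \<equiv> {x \<in> F. algebraic_int x}"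

lemma subr_Oint: "fld F \<Longrightarrow> subr (Oint F)"
  by (auto simp: subr_def fld_1 fld_diff fld_mult algebraic_int_diff algebraic_int_mult)

lemma subfield_CC_iff: "subfield F CC \<longleftrightarrow> fld F"
proof
  interpret C: field CC by (rule field_CC)
  have inv: "inv\<^bsub>CC\<^esub> x = inverse x" if "x \<noteq> 0" for x
    by (rule C.comm_inv_char[symmetric, THEN sym]) (use that in auto)
  have min: "\<ominus>\<^bsub>CC\<^esub> x = - x" for x
    using C.minus_equality[of "- x" x] by simp
  {
    assume F: "subfield F CC"
    note r = subringE[OF subfieldE(1)[OF F]]
    show "fld F" unfolding fld_def
    proof (intro conjI ballI)
      show "1 \<in> F" using r(3) by simp
      fix x assume x: "x \<in> F"
      show "x - y \<in> F" "x * y \<in> F" if "y \<in> F" for y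
        using r(7)[OF x r(5)[OF that]] r(6)[OF x that] min by simp_all
      show "inverse x \<in> F"
      proof (cases "x = 0")
        case False
        thus ?thesis using C.subfield_m_inv(1)[OF F, of x] x inv by simp
      qed (use x in simp)
    qed
  next
    assume F: "fld F"
    note c = fld_closed[OF F]
    show "subfield F CC"
    proof (rule C.subfieldI')
      show "subring F CC"
        by (rule C.subringI) (use c min in auto)
      show "inv\<^bsub>CC\<^esub> k \<in> F" if "k \<in> F - {\<zero>\<^bsub>CC\<^esub>}" for k using that inv c by simp
    qed
  }
qed

lemma generate_field_eqI:
  assumes "fld M" "S \<subseteq> M" "\<And>N. fld N \<Longrightarrow> S \<subseteq> N \<Longrightarrow> M \<subseteq> N"
  shows "generate_field CC S = M"
proof -
  interpret C: field CC by (rule field_CC)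
  show ?thesis
    by (rule C.generate_fieldI[symmetric]) (use assms subfield_CC_iff in auto)
qed

lemma line_extension_CC: "ring.line_extension CC L v E = {x * v + y | x y. x \<in> L \<and> y \<in> E}"
proof -
  interpret C: field CC by (rule field_CC)
  show ?thesis unfolding C.line_extension_def set_add_def' r_coset_def by auto
qed

lemma dimension_adj:
  assumes L: "fld L" and t: "t \<notin> L"
  shows "ring.dimension CC 2 L (adj L t)"
proof -
  interpret C: field CC by (rule field_CC)
  have 0: "C.dimension 0 L {0}" using C.zero_dim[of L] by simp
  have "C.dimension (Suc 0) L (C.line_extension L 1 {0})"
    by (rule C.Suc_dim[OF _ _ 0]) auto
  also have "C.line_extension L 1 {0} = L" by (auto simp: line_extension_CC)
  finally have "C.dimension (Suc (Suc 0)) L (C.line_extension L t L)"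
    by (intro C.Suc_dim) (use t in auto)
  also have "C.line_extension L t L = adj L t" by (auto simp: line_extension_CC adj_def add.commute)
  finally show ?thesis by (simp add: numeral_2_eq_2)
qed

lemma dimension_trans:
  assumes "fld K" "fld L" "ring.dimension CC n K L" "ring.dimension CC m L M"
  shows "ring.dimension CC (n * m) K M"
proof -
  interpret C: field CC by (rule field_CC)
  show ?thesis using C.telescopic_base assms subfield_CC_iff by blast
qed

lemma dimension_unique:
  assumes "fld K" "ring.dimension CC n K M" "ring.dimension CC m K M"
  shows "n = m"
proof -
  interpret C: field CC by (rule field_CC)
  show ?thesis using C.dimension_is_inj assms subfield_CC_iff by blast
qed

lemma finite_dimension_CC: "ring.dimension CC n K M \<Longrightarrow> ring.finite_dimension CC K M"
proof -
  interpret C: field CC by (rule field_CC)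
  show "ring.dimension CC n K M \<Longrightarrow> ring.finite_dimension CC K M" by (rule C.finite_dimensionI)
qed

text \<open>The nontrivial automorphism of \<open>L(t)\<close> over \<open>L\<close>. It is a predicate rather than a function
  because it is used for all three steps of the tower below.\<close>

definition quad_conj :: "complex set \<Rightarrow> complex \<Rightarrow> (complex \<Rightarrow> complex) \<Rightarrow> bool" where
  "quad_conj L t \<sigma> \<longleftrightarrow> hom_on (adj L t) \<sigma> \<and>
     (\<forall>x\<in>adj L t. \<sigma> x \<in> adj L t \<and> \<sigma> (\<sigma> x) = x \<and> (\<sigma> x = x \<longrightarrow> x \<in> L)) \<and>
     (\<forall>x\<in>L. \<forall>y\<in>L. \<sigma> (x + y * t) = x - y * t)"

lemma quadratic_conj:
  assumes L: "fld L" and t: "t \<notin> L" "t\<^sup>2 \<in> L"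
  shows "\<exists>\<sigma>. quad_conj L t \<sigma>"
proof -
  have i: "hom_on L (\<lambda>x. x)" by (simp add: hom_on_def)
  have "(- t)\<^sup>2 = t\<^sup>2" by simp
  from hom_on_adj[OF L t i this] obtain \<sigma> where s: "hom_on (adj L t) \<sigma>" "\<And>x. x \<in> L \<Longrightarrow> \<sigma> x = x" "\<sigma> t = - t"
    "\<And>x y. x \<in> L \<Longrightarrow> y \<in> L \<Longrightarrow> \<sigma> (x + y * t) = x + y * (- t)" by blast
  have f: "\<sigma> (x + y * t) = x + (- y) * t" if "x \<in> L" "y \<in> L" for x y using s(4)[OF that] by simp
  have "quad_conj L t \<sigma>"
    unfolding quad_conj_def
  proof (intro conjI ballI impI)
    show "hom_on (adj L t) \<sigma>" by (rule s(1))
    fix u assume "u \<in> adj L t"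
    then obtain x y where u: "u = x + y * t" "x \<in> L" "y \<in> L" by (auto simp: adj_def)
    have m: "- y \<in> L" using fld_minus[OF L u(3)] .
    show "\<sigma> u \<in> adj L t" unfolding u(1) f[OF u(2,3)] using adjI[OF u(2) m] .
    show "\<sigma> (\<sigma> u) = u" unfolding u(1) f[OF u(2,3)] f[OF u(2) m] by simp
    show "u \<in> L" if "\<sigma> u = u"
    proof -
      have "x + (- y) * t = x + y * t" using that unfolding u(1) f[OF u(2,3)] .
      hence "- y = y" using adj_unique[OF L t(1) u(2) m u(2,3)] by blast
      hence "y = 0" by simp
      thus ?thesis using u by simp
    qed
  qed (use f in simp)
  thus ?thesis by blast
qed

text \<open>The sum of \<open>x + y t\<close> and its conjugate is \<open>2 x\<close>, and \<open>t\<close> times their difference is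
  \<open>2 t\<^sup>2 y\<close>.\<close>

lemma integral_coordinates:
  assumes L: "fld L" and t: "t \<notin> L" "t\<^sup>2 \<in> L" "algebraic_int t"
    and x: "x \<in> L" "y \<in> L" "algebraic_int (x + y * t)"
  shows "algebraic_int (2 * x)" "algebraic_int (2 * t\<^sup>2 * y)"
proof -
  obtain \<sigma> where "quad_conj L t \<sigma>" using quadratic_conj[OF L t(1,2)] by blast
  hence s: "hom_on (adj L t) \<sigma>" "\<And>x y. x \<in> L \<Longrightarrow> y \<in> L \<Longrightarrow> \<sigma> (x + y * t) = x - y * t"
    by (auto simp: quad_conj_def)
  have "algebraic_int (\<sigma> (x + y * t))"
    by (rule algebraic_int_hom[OF s(1) fld_adj[OF L t(2)] adjI[OF x(1,2)] x(3)])
  hence c: "algebraic_int (x - y * t)" using s(2) x by simp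
  have "(x + y * t) + (x - y * t) = 2 * x" by simp
  thus "algebraic_int (2 * x)" using algebraic_int_add[OF x(3) c] by metis
  have "((x + y * t) - (x - y * t)) * t = 2 * t\<^sup>2 * y" by (simp add: power2_eq_square algebra_simps)
  thus "algebraic_int (2 * t\<^sup>2 * y)" using algebraic_int_mult[OF algebraic_int_diff[OF x(3) c] t(3)] by metis
qed

text \<open>The ring \<open>A\<close> has finitely many classes modulo every positive integer, in a form that is evidently
  inherited by \<open>adj A t\<close>.\<close>

definition fin_rep :: "complex set \<Rightarrow> bool" where
  "fin_rep A \<longleftrightarrow> (\<forall>n::int. n > 0 \<longrightarrow> (\<exists>R. finite R \<and> (\<forall>x\<in>A. \<exists>r\<in>R. \<exists>z\<in>A. x = r + of_int n * z)))"

lemma fin_rep_Ints: "fin_rep \<int>"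
  unfolding fin_rep_def
proof (intro allI impI)
  fix n :: int assume n: "n > 0"
  show "\<exists>R::complex set. finite R \<and> (\<forall>x\<in>\<int>. \<exists>r\<in>R. \<exists>z\<in>\<int>. x = r + of_int n * z)"
  proof (intro exI[of _ "of_int ` {0..<n}"] conjI ballI)
    fix x :: complex assume "x \<in> \<int>"
    then obtain k where k: "x = of_int k" by (auto elim: Ints_cases)
    have "x = of_int (k mod n + n * (k div n))" unfolding k by simp
    also have "\<dots> = of_int (k mod n) + of_int n * of_int (k div n)" by (simp only: of_int_add of_int_mult)
    finally show "\<exists>r\<in>of_int ` {0..<n}. \<exists>z\<in>\<int>. x = r + of_int n * z"
      using n by (intro bexI[of _ "of_int (k mod n)"] bexI[of _ "of_int (k div n)"]) auto
  qed auto
qed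

lemma fin_rep_adj:
  assumes "fin_rep A" shows "fin_rep (adj A t)"
  unfolding fin_rep_def
proof (intro allI impI)
  fix n :: int assume n: "n > 0"
  from assms[unfolded fin_rep_def, rule_format, OF n]
  obtain R where R: "finite R" "\<forall>x\<in>A. \<exists>r\<in>R. \<exists>z\<in>A. x = r + of_int n * z"
    by (elim exE conjE)
  show "\<exists>R. finite R \<and> (\<forall>x\<in>adj A t. \<exists>r\<in>R. \<exists>z\<in>adj A t. x = r + of_int n * z)"
  proof (intro exI[of _ "(\<lambda>(r, s). r + s * t) ` (R \<times> R)"] conjI ballI)
    show "finite ((\<lambda>(r, s). r + s * t) ` (R \<times> R))" using R(1) by simp
    fix u assume "u \<in> adj A t"
    then obtain x y where u: "u = x + y * t" "x \<in> A" "y \<in> A" by (auto simp: adj_def)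
    obtain r z where r: "r \<in> R" "z \<in> A" "x = r + of_int n * z" using bspec[OF R(2) u(2)] by blast
    obtain s v where s: "s \<in> R" "v \<in> A" "y = s + of_int n * v" using bspec[OF R(2) u(3)] by blast
    have "u = (r + s * t) + of_int n * (z + v * t)" unfolding u(1) r(3) s(3) by (simp add: algebra_simps)
    thus "\<exists>r\<in>(\<lambda>(r, s). r + s * t) ` (R \<times> R). \<exists>z\<in>adj A t. u = r + of_int n * z"
      using r(1) s(1) adjI[OF r(2) s(2)] by (intro bexI[of _ "r + s * t"] bexI[of _ "z + v * t"]) auto
  qed
qed

text \<open>Representatives for \<open>A\<close> modulo \<open>m n\<close> separate the elements \<open>m x\<close> with \<open>x \<in> B\<close> modulo \<open>m n\<close>,
  hence the elements of \<open>B\<close> modulo \<open>n\<close>.\<close>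

lemma fin_mod_of_order:
  assumes rep: "fin_rep A" and AB: "A \<subseteq> B" and B: "subr B" and m: "m > (0::int)" "\<And>x. x \<in> B \<Longrightarrow> of_int m * x \<in> A"
    and n: "n \<noteq> (0::int)"
  shows "fin_mod B (of_int n)"
proof -
  define n' where "n' = m * \<bar>n\<bar>"
  have n': "n' > 0" using m n by (simp add: n'_def)
  from rep[unfolded fin_rep_def, rule_format, OF n']
  obtain R where R: "finite R" "\<forall>x\<in>A. \<exists>r\<in>R. \<exists>z\<in>A. x = r + of_int n' * z"
    by (elim exE conjE)
  define c where "c = (\<lambda>x. SOME r. r \<in> R \<and> (\<exists>z\<in>A. of_int m * x = r + of_int n' * z))"
  have c: "c x \<in> R \<and> (\<exists>z\<in>A. of_int m * x = c x + of_int n' * z)" if "x \<in> B" for x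
  proof -
    have "of_int m * x \<in> A" by (rule m(2)[OF that])
    then obtain r z where "r \<in> R" "z \<in> A" "of_int m * x = r + of_int n' * z" using R(2) by blast
    hence "r \<in> R \<and> (\<exists>z\<in>A. of_int m * x = r + of_int n' * z)" by blast
    thus ?thesis unfolding c_def by (rule someI)
  qed
  have "c ` B \<subseteq> R" using c by blast
  hence "finite (c ` B)" using R(1) finite_subset by blast
  moreover have "\<exists>z\<in>B. x - y = of_int n * z" if xy: "x \<in> B" "y \<in> B" "c x = c y" for x y
  proof -
    obtain u v where uv: "u \<in> A" "of_int m * x = c x + of_int n' * u" "v \<in> A" "of_int m * y = c y + of_int n' * v"
      using c xy by blast
    have "of_int m * (x - y) = of_int n' * (u - v)" using uv xy(3) by (simp add: algebra_simps)
    also have "\<dots> = of_int m * (of_int n * (of_int (sgn n) * (u - v)))"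
    proof -
      have "n' = m * (n * sgn n)" by (simp add: n'_def abs_sgn)
      thus ?thesis by simp
    qed
    finally have "x - y = of_int n * (of_int (sgn n) * (u - v))" using m(1) by simp
    moreover have "of_int (sgn n) * (u - v) \<in> B" using subr_closed[OF B] uv AB by (meson subsetD)
    ultimately show ?thesis by blast
  qed
  ultimately show ?thesis unfolding fin_mod_def by blast
qed

section \<open>The tower of fields\<close>

lemma Rats_square_int:
  fixes x :: complex
  assumes "x \<in> \<rat>" "x\<^sup>2 = of_nat n"
  shows "\<exists>m::nat. n = m\<^sup>2"
proof -
  have "algebraic_int x" by (rule algebraic_int_sqrtI) (simp add: assms(2))
  hence "x \<in> \<int>" using rational_algebraic_int_is_int assms(1) by blast
  then obtain k where k: "x = of_int k" by (auto elim: Ints_cases)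
  have "(of_int (k\<^sup>2) :: complex) = of_int (int n)" using assms(2) k by simp
  hence "k\<^sup>2 = int n" by (simp only: of_int_eq_iff)
  hence "int n = int ((nat \<bar>k\<bar>)\<^sup>2)" by simp
  thus ?thesis by (metis of_nat_eq_iff)
qed

lemma not_square_prime: "prime (l::nat) \<Longrightarrow> l \<noteq> m\<^sup>2"
  by (metis not_prime_1 power2_eq_square prime_product prime_nat_iff mult.right_neutral nat_mult_1)

lemma csq_square: "(csq n)\<^sup>2 = of_nat n"
  by (simp flip: of_real_power)

lemma algebraic_int_csq: "algebraic_int (csq n)"
  by (rule algebraic_int_sqrtI) (simp add: csq_square)

text \<open>The field studied below is \<open>K(t)\<close> for a square root \<open>t\<close> of \<open>d (a + b \<surd>2)\<close>. The value \<open>d = 1\<close> gives the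
  Redei field; the other values are the competitors in the proof of uniqueness. The congruences modulo \<open>4\<close> say that
  \<open>a + b \<surd>2\<close> is \<open>1\<close> modulo \<open>4\<close>, which makes \<open>(1 + t) / 2\<close> integral when \<open>d = 1\<close>.\<close>

locale redei_data =
  fixes p :: nat and a b d :: int and t :: complex
  assumes p: "prime p" and p8: "p mod 8 = 1" and ab: "a\<^sup>2 - 2 * b\<^sup>2 = int p"
    and a4: "a mod 4 = 1" and b4: "b mod 4 = 0"
    and d0: "d \<noteq> 0" and t: "t\<^sup>2 = of_int d * (of_int a + of_int b * csq 2)"
begin

definition "w = csq 2"
definition "z = csq p"
definition "L1 = adj \<rat> w"
definition "K = adj L1 z"
definition "F = adj K t"
definition "\<pi> = of_int a + of_int b * w"
definition "\<pi>' = of_int a - of_int b * w"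

lemma w2: "w\<^sup>2 = 2" and z2: "z\<^sup>2 = of_nat p"
  using csq_square[of 2] csq_square[of p] by (simp_all add: w_def z_def)

lemma t2: "t\<^sup>2 = of_int d * \<pi>"
  using t by (simp add: \<pi>_def w_def)

lemma pi_mult: "\<pi> * \<pi>' = of_nat p"
proof -
  have "\<pi> * \<pi>' = of_int (a\<^sup>2) - of_int (b\<^sup>2) * w\<^sup>2" by (simp add: \<pi>_def \<pi>'_def power2_eq_square algebra_simps)
  also have "\<dots> = of_int (a\<^sup>2 - 2 * b\<^sup>2)" by (simp add: w2)
  finally show ?thesis by (simp add: ab)
qed

lemma p2: "2 < p" using p p8 prime_ge_2_nat[of p] by (cases "p = 2") auto

lemma pi_nonzero: "\<pi> \<noteq> 0" "\<pi>' \<noteq> 0"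
  using pi_mult p2 by auto

lemma w_notin: "w \<notin> \<rat>"
proof
  assume "w \<in> \<rat>"
  then obtain m :: nat where "2 = m\<^sup>2" using Rats_square_int[of w 2] w2 by auto
  thus False using not_square_prime[of 2 m] by simp
qed

lemma fld_L1: "fld L1" unfolding L1_def by (rule fld_adj[OF fld_Rats]) (simp add: w2)

lemma w_in: "w \<in> L1" unfolding L1_def by (rule adj_gen[OF fld_Rats])

lemma Rats_L1: "\<rat> \<subseteq> L1" by (rule Rats_subset_fld[OF fld_L1])

lemma L1_E: "x \<in> L1 \<Longrightarrow> \<exists>u v. u \<in> \<rat> \<and> v \<in> \<rat> \<and> x = u + v * w"
  by (auto simp: L1_def adj_def)

lemma z_notin: "z \<notin> L1"
proof
  assume "z \<in> L1"
  then obtain u v where uv: "u \<in> \<rat>" "v \<in> \<rat>" "z = u + v * w" using L1_E by blast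
  have "z\<^sup>2 = (u\<^sup>2 + v\<^sup>2 * w\<^sup>2) + (2 * u * v) * w" by (simp add: uv(3) power2_eq_square algebra_simps)
  hence "of_nat p + 0 * w = (u\<^sup>2 + v\<^sup>2 * 2) + (2 * u * v) * w" unfolding w2 z2 by simp
  moreover have "of_nat p \<in> (\<rat> :: complex set)" "(0 :: complex) \<in> \<rat>" "u\<^sup>2 + v\<^sup>2 * 2 \<in> \<rat>" "2 * u * v \<in> \<rat>"
    using uv by auto
  ultimately have eq: "of_nat p = u\<^sup>2 + v\<^sup>2 * 2" "0 = 2 * u * v"
    using adj_unique[OF fld_Rats w_notin] by blast+
  then consider "v = 0" | "u = 0" by auto
  thus False
  proof cases
    case 1
    hence "u\<^sup>2 = of_nat p" using eq by simp
    from Rats_square_int[OF uv(1) this] show False using not_square_prime[OF p] by blast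
  next
    case 2
    hence "(2 * v)\<^sup>2 = of_nat (2 * p)" using eq by (simp add: power_mult_distrib)
    moreover have "2 * v \<in> \<rat>" using uv by simp
    ultimately obtain m :: nat where m: "2 * p = m\<^sup>2" using Rats_square_int by blast
    hence "even (m\<^sup>2)" by (metis dvd_triv_left)
    hence "even m" by simp
    then obtain k where "m = 2 * k" by blast
    hence "p = 2 * k\<^sup>2" using m by (simp add: power_mult_distrib)
    moreover have "odd p" using p8 by presburger
    ultimately show False by simp
  qed
qed

lemma z2_in: "z\<^sup>2 \<in> L1" unfolding z2 by (rule fld_of_nat[OF fld_L1])

lemma fld_K: "fld K" unfolding K_def by (rule fld_adj[OF fld_L1 z2_in])

lemma L1_K: "L1 \<subseteq> K" unfolding K_def by (rule adj_subset[OF fld_L1])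

lemma z_in: "z \<in> K" unfolding K_def by (rule adj_gen[OF fld_L1])

lemma pi_in: "\<pi> \<in> L1" "\<pi>' \<in> L1"
  unfolding \<pi>_def \<pi>'_def by (intro fld_add[OF fld_L1] fld_diff[OF fld_L1] fld_mult[OF fld_L1] fld_of_int[OF fld_L1] w_in)+

definition "\<sigma>\<^sub>1 = (SOME \<sigma>. quad_conj \<rat> w \<sigma>)"

lemma quad_conj_L1: "quad_conj \<rat> w \<sigma>\<^sub>1"
proof -
  have w2r: "w\<^sup>2 \<in> \<rat>" by (simp add: w2)
  show ?thesis unfolding \<sigma>\<^sub>1_def using someI_ex[OF quadratic_conj[OF fld_Rats w_notin w2r]] .
qed

lemma conj_L1:
  shows "hom_on L1 \<sigma>\<^sub>1" "x \<in> L1 \<Longrightarrow> \<sigma>\<^sub>1 x \<in> L1" "x \<in> L1 \<Longrightarrow> \<sigma>\<^sub>1 (\<sigma>\<^sub>1 x) = x"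
    "x \<in> L1 \<Longrightarrow> \<sigma>\<^sub>1 x = x \<Longrightarrow> x \<in> \<rat>"
    "u \<in> \<rat> \<Longrightarrow> v \<in> \<rat> \<Longrightarrow> \<sigma>\<^sub>1 (u + v * w) = u - v * w" "\<sigma>\<^sub>1 w = - w" "\<sigma>\<^sub>1 \<pi> = \<pi>'"
proof -
  note c = quad_conj_L1[unfolded quad_conj_def, folded L1_def]
  show f: "u \<in> \<rat> \<Longrightarrow> v \<in> \<rat> \<Longrightarrow> \<sigma>\<^sub>1 (u + v * w) = u - v * w" for u v using c by blast
  show "hom_on L1 \<sigma>\<^sub>1" "x \<in> L1 \<Longrightarrow> \<sigma>\<^sub>1 x \<in> L1" "x \<in> L1 \<Longrightarrow> \<sigma>\<^sub>1 (\<sigma>\<^sub>1 x) = x" "x \<in> L1 \<Longrightarrow> \<sigma>\<^sub>1 x = x \<Longrightarrow> x \<in> \<rat>"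
    using c by blast+
  show "\<sigma>\<^sub>1 w = - w" using f[of 0 1] by simp
  show "\<sigma>\<^sub>1 \<pi> = \<pi>'" unfolding \<pi>_def \<pi>'_def by (rule f) auto
qed

lemma norm_L1:
  assumes "x \<in> L1"
  obtains n y where "n \<in> \<rat>" "y \<in> L1" "x * y = n" "\<And>c e. c \<in> \<rat> \<Longrightarrow> e \<in> \<rat> \<Longrightarrow> c * x\<^sup>2 = e * \<pi> \<Longrightarrow> c\<^sup>2 * n\<^sup>2 = e\<^sup>2 * of_nat p"
proof -
  note s = conj_L1(1-4,6,7)
  note h = hom_on_simps[OF s(1) fld_L1]
  show thesis
  proof (rule that[of "x * \<sigma>\<^sub>1 x" "\<sigma>\<^sub>1 x"])
    show "x * \<sigma>\<^sub>1 x \<in> \<rat>"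
      by (rule s(4)) (simp_all add: fld_mult[OF fld_L1] h assms s(2,3) mult.commute)
    show "\<sigma>\<^sub>1 x \<in> L1" using s(2) assms by blast
    fix c e assume ce: "c \<in> \<rat>" "e \<in> \<rat>" "c * x\<^sup>2 = e * \<pi>"
    have ceL: "c \<in> L1" "e \<in> L1" using ce Rats_L1 by auto
    have "\<sigma>\<^sub>1 (c * x\<^sup>2) = \<sigma>\<^sub>1 (e * \<pi>)" using ce(3) by simp
    hence "c * (\<sigma>\<^sub>1 x)\<^sup>2 = e * \<pi>'"
      using ceL assms pi_in fld_power[OF fld_L1 assms] by (simp add: h s(6) ce(1,2))
    hence "(c * x\<^sup>2) * (c * (\<sigma>\<^sub>1 x)\<^sup>2) = (e * \<pi>) * (e * \<pi>')" using ce(3) by simp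
    also have "\<dots> = e\<^sup>2 * (\<pi> * \<pi>')" by (simp add: power2_eq_square)
    finally show "c\<^sup>2 * (x * \<sigma>\<^sub>1 x)\<^sup>2 = e\<^sup>2 * of_nat p" unfolding pi_mult by (simp add: power2_eq_square ac_simps)
  qed simp
qed

text \<open>Taking norms to \<open>\<rat>\<close> would make \<open>p\<close> a rational square.\<close>

lemma pi_not_square_multiple:
  assumes "x \<in> L1" "c \<in> \<rat>" "e \<in> \<rat>" "e \<noteq> 0" "c * x\<^sup>2 = e * \<pi>"
  shows False
proof -
  obtain n where n: "n \<in> \<rat>" "c\<^sup>2 * n\<^sup>2 = e\<^sup>2 * of_nat p" using norm_L1[OF assms(1)] assms by metis
  have "(c * n / e)\<^sup>2 = of_nat p" using n(2) assms(4) by (simp add: power_divide power_mult_distrib)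
  moreover have "c * n / e \<in> \<rat>" using n assms by simp
  ultimately show False using Rats_square_int not_square_prime[OF p] by blast
qed

lemma t_notin: "t \<notin> K"
proof
  assume "t \<in> K"
  then obtain x y where xy: "x \<in> L1" "y \<in> L1" "t = x + y * z" by (auto simp: K_def adj_def)
  have "t\<^sup>2 = (x\<^sup>2 + y\<^sup>2 * z\<^sup>2) + (2 * x * y) * z" by (simp add: xy(3) power2_eq_square algebra_simps)
  hence eq0: "of_int d * \<pi> + 0 * z = (x\<^sup>2 + y\<^sup>2 * of_nat p) + (2 * x * y) * z" unfolding t2 z2 by simp
  have m: "of_int d * \<pi> \<in> L1" "0 \<in> L1" "x\<^sup>2 + y\<^sup>2 * of_nat p \<in> L1" "2 * x * y \<in> L1"
    using xy pi_in by (simp_all add: fld_closed[OF fld_L1])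
  have eq: "of_int d * \<pi> = x\<^sup>2 + y\<^sup>2 * of_nat p" "0 = 2 * x * y"
    using adj_unique[OF fld_L1 z_notin m eq0] by auto
  then consider "y = 0" | "x = 0" by auto
  thus False
  proof cases
    case 1
    hence "1 * x\<^sup>2 = of_int d * \<pi>" using eq by simp
    thus False using pi_not_square_multiple[OF xy(1), of 1 "of_int d"] d0 by simp
  next
    case 2
    hence "of_nat p * y\<^sup>2 = of_int d * \<pi>" using eq by simp
    thus False using pi_not_square_multiple[OF xy(2), of "of_nat p" "of_int d"] d0 by simp
  qed
qed

lemma t2_in: "t\<^sup>2 \<in> K" unfolding t2 using pi_in L1_K by (intro fld_mult[OF fld_K] fld_of_int[OF fld_K]) auto

lemma fld_F: "fld F" unfolding F_def by (rule fld_adj[OF fld_K t2_in])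
lemma K_F: "K \<subseteq> F" unfolding F_def by (rule adj_subset[OF fld_K])
lemma t_in: "t \<in> F" unfolding F_def by (rule adj_gen[OF fld_K])

lemma algebraic_int_w: "algebraic_int w" and algebraic_int_z: "algebraic_int z"
  unfolding w_def z_def by (rule algebraic_int_csq)+

lemma algebraic_int_pi: "algebraic_int \<pi>" "algebraic_int \<pi>'"
  unfolding \<pi>_def \<pi>'_def
  by (intro algebraic_int_add algebraic_int_diff algebraic_int_mult algebraic_int_of_int_cx algebraic_int_w)+

lemma algebraic_int_t: "algebraic_int t"
  by (rule algebraic_int_sqrtI) (simp add: t2 algebraic_int_mult algebraic_int_pi)

lemma dims: "ring.dimension CC 2 \<rat> L1" "ring.dimension CC 2 L1 K" "ring.dimension CC 2 K F" "ring.dimension CC 8 \<rat> F"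
proof -
  show 1: "ring.dimension CC 2 \<rat> L1" "ring.dimension CC 2 L1 K" "ring.dimension CC 2 K F"
    unfolding L1_def K_def F_def
    by (rule dimension_adj[OF fld_Rats w_notin], rule dimension_adj[OF fld_L1[unfolded L1_def] z_notin[unfolded L1_def]],
        rule dimension_adj[OF fld_K[unfolded K_def L1_def] t_notin[unfolded K_def L1_def]])
  show "ring.dimension CC 8 \<rat> F"
    using dimension_trans[OF fld_Rats fld_K dimension_trans[OF fld_Rats fld_L1 1(1,2)] 1(3)] by simp
qed

lemma generate_K: "generate_field CC {csq 2, csq p} = K"
  unfolding w_def[symmetric] z_def[symmetric]
proof (rule generate_field_eqI[OF fld_K])
  show "{w, z} \<subseteq> K" using w_in L1_K z_in by auto
  fix N assume N: "fld N" "{w, z} \<subseteq> N"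
  have "L1 \<subseteq> N" unfolding L1_def using adj_least[OF N(1) Rats_subset_fld[OF N(1)]] N(2) by blast
  thus "K \<subseteq> N" unfolding K_def using adj_least[OF N(1)] N(2) by blast
qed

text \<open>The order \<open>\<int>[\<surd>2][\<surd>p][t]\<close> has finitely many classes modulo every integer, and a fixed
  multiple of every integer of \<open>F\<close> lies in it. This suffices for the finiteness of the residue rings
  of the integers of \<open>F\<close>.\<close>

definition "Ord = adj (adj (adj \<int> w) z) t"

lemma Ord_sub: "Ord \<subseteq> Oint F"
proof -
  have "adj \<int> w \<subseteq> Oint L1"
    using w_in fld_L1 Rats_L1 Ints_subset_Rats
    by (auto simp: adj_def int_imp_algebraic_int intro!: fld_add fld_mult algebraic_int_add algebraic_int_mult algebraic_int_w)
  hence 1: "x \<in> K \<and> algebraic_int x" if "x \<in> adj \<int> w" for x using that L1_K by blast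
  have 2: "x \<in> F \<and> algebraic_int x" if "x \<in> adj (adj \<int> w) z" for x
    using that 1 K_F z_in fld_K
    by (auto simp: adj_def[of "adj \<int> w"] intro!: fld_add[OF fld_F] fld_mult[OF fld_F] algebraic_int_add algebraic_int_mult algebraic_int_z)
  show ?thesis
    using 2 t_in
    by (auto simp: Ord_def adj_def[of "adj (adj \<int> w) z"] intro!: fld_add[OF fld_F] fld_mult[OF fld_F] algebraic_int_add algebraic_int_mult algebraic_int_t)
qed

lemma Oint_L1_ord: "x \<in> Oint L1 \<Longrightarrow> 4 * x \<in> adj \<int> w"
proof -
  assume x: "x \<in> Oint L1"
  then obtain u v where uv: "u \<in> \<rat>" "v \<in> \<rat>" "x = u + v * w" using L1_E by blast
  have w2r: "w\<^sup>2 \<in> \<rat>" by (simp add: w2)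
  have "algebraic_int (2 * u)" "algebraic_int (2 * w\<^sup>2 * v)"
    using integral_coordinates[OF fld_Rats w_notin w2r algebraic_int_w uv(1,2)] x uv(3) by auto
  hence "2 * u \<in> \<int>" "4 * v \<in> \<int>" using rational_algebraic_int_is_int[of "2 * u"] rational_algebraic_int_is_int[of "4 * v"] uv by (simp_all add: w2)
  moreover have "4 * x = 2 * (2 * u) + (4 * v) * w" by (simp add: uv(3) algebra_simps)
  moreover have "2 * (2 * u) \<in> \<int>" using \<open>2 * u \<in> \<int>\<close> by (rule Ints_mult[OF Ints_numeral])
  ultimately show ?thesis using adjI[of "2 * (2 * u)" \<int> "4 * v" w] by simp
qed

lemma adj_scale: "of_int n * x \<in> A \<Longrightarrow> of_int n * y \<in> A \<Longrightarrow> of_int n * (x + y * s) \<in> adj A s"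
  using adjI[of "of_int n * x" A "of_int n * y" s] by (simp add: algebra_simps)

lemma int_mult_adj: "(\<And>x. x \<in> A \<Longrightarrow> of_int n * x \<in> A) \<Longrightarrow> x \<in> adj A s \<Longrightarrow> of_int n * x \<in> adj A s"
proof -
  assume n: "\<And>x. x \<in> A \<Longrightarrow> of_int n * x \<in> A" and "x \<in> adj A s"
  then obtain u v where "x = u + v * s" "u \<in> A" "v \<in> A" by (auto simp: adj_def)
  thus ?thesis using adj_scale[OF n n] by simp
qed

lemma Oint_K_ord: "x \<in> Oint K \<Longrightarrow> of_int (8 * int p) * x \<in> adj (adj \<int> w) z"
proof -
  assume x: "x \<in> Oint K"
  then obtain u v where uv: "u \<in> L1" "v \<in> L1" "x = u + v * z" by (auto simp: K_def adj_def)
  have i: "algebraic_int (2 * u)" "algebraic_int (2 * z\<^sup>2 * v)"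
    using integral_coordinates[OF fld_L1 z_notin z2_in algebraic_int_z uv(1,2)] x uv(3) by auto
  hence "2 * u \<in> Oint L1" "2 * of_nat p * v \<in> Oint L1"
    using uv by (auto simp: z2 intro!: fld_closed[OF fld_L1])
  hence o: "4 * (2 * u) \<in> adj \<int> w" "4 * (2 * of_nat p * v) \<in> adj \<int> w" using Oint_L1_ord by blast+
  have im: "of_int n * y \<in> adj \<int> w" if "y \<in> adj \<int> w" for n y
    by (rule int_mult_adj[OF _ that]) auto
  have "of_int (8 * int p) * u \<in> adj \<int> w" using im[OF o(1), of "int p"] by (simp add: algebra_simps)
  moreover have "of_int (8 * int p) * v \<in> adj \<int> w" using o(2) by (simp add: algebra_simps)
  ultimately show ?thesis unfolding uv(3) by (rule adj_scale)
qed

definition "idx = 16 * \<bar>d\<bar> * int p * int p"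

lemma idx_pos: "idx > 0" using d0 p2 by (simp add: idx_def)

lemma Oint_F_ord: "x \<in> Oint F \<Longrightarrow> of_int idx * x \<in> Ord"
proof -
  assume x: "x \<in> Oint F"
  then obtain u v where uv: "u \<in> K" "v \<in> K" "x = u + v * t" by (auto simp: F_def adj_def)
  have i: "algebraic_int (2 * u)" "algebraic_int (2 * t\<^sup>2 * v)"
    using integral_coordinates[OF fld_K t_notin t2_in algebraic_int_t uv(1,2)] x uv(3) by auto
  have eq: "2 * t\<^sup>2 * v * \<pi>' = 2 * of_int d * of_nat p * v" unfolding t2 pi_mult[symmetric] by (simp add: algebra_simps)
  have "algebraic_int (2 * of_int d * of_nat p * v)" using algebraic_int_mult[OF i(2) algebraic_int_pi(2)] by (simp only: eq)
  hence "2 * u \<in> Oint K" "2 * of_int d * of_nat p * v \<in> Oint K"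
    using i(1) uv by (auto intro!: fld_mult[OF fld_K] fld_of_int[OF fld_K] fld_of_nat[OF fld_K] fld_numeral[OF fld_K])
  hence o: "of_int (8 * int p) * (2 * u) \<in> adj (adj \<int> w) z" "of_int (8 * int p) * (2 * of_int d * of_nat p * v) \<in> adj (adj \<int> w) z"
    using Oint_K_ord by blast+
  have im: "of_int n * y \<in> adj (adj \<int> w) z" if "y \<in> adj (adj \<int> w) z" for n y
    by (rule int_mult_adj[OF int_mult_adj that]) auto
  have "of_int idx * u \<in> adj (adj \<int> w) z"
    using im[OF o(1), of "\<bar>d\<bar> * int p"] by (simp add: idx_def algebra_simps)
  moreover have "of_int idx * v = of_int (sgn d) * (of_int (8 * int p) * (2 * of_int d * of_nat p * v))"
  proof -
    have "idx = sgn d * (8 * int p * (2 * d * int p))" by (simp add: idx_def abs_sgn)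
    hence "of_int idx = (of_int (sgn d * (8 * int p * (2 * d * int p))) :: complex)" by (simp only:)
    thus ?thesis by (simp only: of_int_mult of_int_numeral of_int_of_nat_eq mult.assoc)
  qed
  hence "of_int idx * v \<in> adj (adj \<int> w) z" using im[OF o(2), of "sgn d"] by (simp only:)
  ultimately show ?thesis unfolding uv(3) Ord_def by (rule adj_scale)
qed

lemma fin_mod_Oint: "n \<noteq> 0 \<Longrightarrow> fin_mod (Oint F) (of_int n)"
  by (rule fin_mod_of_order[OF _ Ord_sub subr_Oint[OF fld_F] idx_pos Oint_F_ord])
    (simp_all add: Ord_def fin_rep_adj fin_rep_Ints)

end

section \<open>Ramification of the twists\<close>

lemma algebraic_int_half:
  assumes "s\<^sup>2 = 1 + 4 * k" "algebraic_int k"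
  shows "algebraic_int ((1 + s) / 2 :: complex)"
proof (rule algebraic_int_root[OF assms(2), of "[:0, -1, 1:]"])
  have "poly [:0, - 1, 1:] ((1 + s) / 2) = (s\<^sup>2 - 1) / 4" by (simp add: power2_eq_square field_simps)
  thus "poly [:0, - 1, 1:] ((1 + s) / 2) = k" using assms(1) by simp
  show "\<forall>i. coeff [:0, -1, 1:] i \<in> (\<int> :: complex set)" by (auto simp: coeff_pCons split: nat.splits)
qed auto

context redei_data
begin

lemma integers_of_F: "integers_of F = Rg (Oint F)"
  by (simp add: integers_of_def)

lemma prime_idl_integers: "primeideal P (integers_of F) \<longleftrightarrow> prime_idl (Oint F) P"
  unfolding integers_of_F by (rule primeideal_Rg_iff[OF subr_Oint[OF fld_F]])

lemma ramification_index_F: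
  assumes "idl (Oint F) P"
  shows "ramification_index K F P = (GREATEST e. P \<inter> K \<subseteq> ipow (Oint F) P e)"
  by (rule ramification_index_def'[OF subr_Oint[OF fld_F] assms refl])

lemma integer_in_prime:
  assumes "prime_idl (Oint F) P" "P \<noteq> {0}"
  obtains n :: int where "n \<noteq> 0" "of_int n \<in> P"
proof -
  have i: "idl (Oint F) P" using prime_idl_idl[OF assms(1)] .
  obtain x where x: "x \<in> P" "x \<noteq> 0" using idl_0[OF subr_Oint[OF fld_F] i] assms(2) by blast
  have "algebraic_int x" using idl_sub[OF subr_Oint[OF fld_F] i x(1)] by simp
  from integer_in_ideal[OF subr_Oint[OF fld_F] i x this] show thesis using that by blast
qed

lemma odd_p: "odd (int p)" using p8 by presburger

lemma coprime_a_p: "coprime (2 * a) (int p)"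
proof -
  have pp: "prime (int p)" using p by simp
  have "\<not> int p dvd a"
  proof
    assume pa: "int p dvd a"
    hence "int p dvd a\<^sup>2 - int p" by (simp add: power2_eq_square)
    also have "a\<^sup>2 - int p = 2 * b\<^sup>2" using ab by simp
    finally have "int p dvd 2 * b\<^sup>2" .
    moreover have "\<not> int p dvd 2" using p2 by (auto dest!: zdvd_imp_le)
    ultimately have "int p dvd b" using pp by (simp add: prime_dvd_mult_iff prime_dvd_power_iff)
    hence "int p * int p dvd a * a" "int p * int p dvd b * b" using pa mult_dvd_mono by blast+
    hence "int p * int p dvd a\<^sup>2" "int p * int p dvd 2 * b\<^sup>2" by (simp_all only: power2_eq_square dvd_mult)
    hence "int p * int p dvd int p" unfolding ab[symmetric] by (rule dvd_diff)
    hence "int p * int p \<le> int p" using p2 by (intro zdvd_imp_le) auto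
    thus False using p2 by simp
  qed
  hence "coprime (int p) a" using pp by (simp add: prime_imp_coprime)
  moreover have "coprime 2 (int p)" using odd_p by simp
  ultimately show ?thesis by (simp add: coprime_commute)
qed

lemma ideal_coprime_ints:
  assumes P: "idl (Oint F) P" "1 \<notin> P" and mn: "coprime m n" "of_int m \<in> P" "of_int n \<in> P"
  shows False
proof -
  note S = subr_Oint[OF fld_F]
  obtain u v where "u * m + v * n = 1" using mn(1) by (metis bezout_int coprime_imp_gcd_eq_1)
  hence "of_int u * of_int m + of_int v * of_int n = (1 :: complex)" by (metis of_int_1 of_int_add of_int_mult)
  moreover have "of_int u * of_int m + of_int v * of_int n \<in> P"
    by (intro idl_add[OF S P(1)] idl_mult[OF S P(1)] subr_of_int[OF S] mn)
  ultimately show False using P(2) by simp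
qed

lemma in_Oint: 
  shows "w \<in> Oint F" "z \<in> Oint F" "t \<in> Oint F" "\<pi> \<in> Oint F" "\<pi>' \<in> Oint F"
  using w_in z_in t_in pi_in L1_K K_F algebraic_int_w algebraic_int_z algebraic_int_t algebraic_int_pi by auto

text \<open>When \<open>d = 1\<close> this is a square root of the conjugate \<open>\<pi>'\<close> of \<open>\<pi>\<close>, so it plays the role of
  a conjugate of \<open>t\<close>.\<close>

definition "s2 = z / t"

lemma t_nonzero: "t \<noteq> 0"
  using t2 d0 pi_nonzero by auto

lemma s2_square: "d = 1 \<Longrightarrow> s2\<^sup>2 = \<pi>'"
  unfolding s2_def by (simp add: power_divide z2 t2 pi_mult[symmetric] pi_nonzero)

lemma s2_in: "s2 \<in> F" unfolding s2_def using z_in K_F t_in by (intro fld_divide[OF fld_F]) auto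

lemma pi_mod_4: "\<exists>k. algebraic_int k \<and> k \<in> L1 \<and> \<pi> = 1 + 4 * k"
proof -
  obtain a' b' where ab': "a = 1 + 4 * a'" "b = 4 * b'" using a4 b4 by (metis add.commute mult_div_mod_eq add.right_neutral)
  have "of_int a = (1 + 4 * of_int a' :: complex)" "of_int b = (4 * of_int b' :: complex)"
    unfolding ab' by simp_all
  hence "\<pi> = 1 + 4 * (of_int a' + of_int b' * w)" by (simp add: \<pi>_def algebra_simps)
  moreover have "algebraic_int (of_int a' + of_int b' * w)"
    by (intro algebraic_int_add algebraic_int_mult algebraic_int_of_int_cx algebraic_int_w)
  moreover have "of_int a' + of_int b' * w \<in> L1"
    by (intro fld_add[OF fld_L1] fld_mult[OF fld_L1] fld_of_int[OF fld_L1] w_in)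
  ultimately show ?thesis by blast
qed

text \<open>Away from \<open>2\<close> one of \<open>t\<close> and \<open>\<surd>p / t\<close> is a unit at \<open>P\<close>, since a prime containing both
  contains \<open>\<pi> + \<pi>' = 2 a\<close> and \<open>p\<close>, which are coprime; both change sign under \<open>\<sigma>\<close>. Above \<open>2\<close> the
  integer \<open>(1 + t) / 2\<close> differs from its conjugate by \<open>t\<close>, a unit at \<open>P\<close> because \<open>t\<^sup>2\<close> divides \<open>p\<close>.\<close>

lemma separating_element:
  assumes P: "prime_idl (Oint F) P" and d1: "d = 1" and \<sigma>: "quad_conj K t \<sigma>"
  shows "\<exists>g\<in>Oint F. g - \<sigma> g \<notin> P"
proof -
  note S = subr_Oint[OF fld_F] and i = idl_closed[OF subr_Oint[OF fld_F] prime_idl_idl[OF P]]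
  have \<sigma>f: "\<sigma> (x + y * t) = x - y * t" if "x \<in> K" "y \<in> K" for x y using \<sigma> that by (auto simp: quad_conj_def)
  have h: "hom_on F \<sigma>" using \<sigma> by (auto simp: quad_conj_def F_def)
  note hh = hom_on_simps[OF h fld_F]
  have \<sigma>K: "\<sigma> x = x" if "x \<in> K" for x using \<sigma>f[OF that fld_0[OF fld_K]] by simp
  have \<sigma>t: "\<sigma> t = - t" using \<sigma>f[OF fld_0[OF fld_K] fld_1[OF fld_K]] by simp
  show ?thesis
  proof (cases "2 \<in> P")
    case False
    have two: "x - (- x) \<notin> P" if "x \<in> Oint F" "x \<notin> P" for x
    proof
      assume "x - (- x) \<in> P"
      hence "2 * x \<in> P" by simp
      moreover have "2 \<in> Oint F" using fld_numeral[OF fld_F] by simp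
      ultimately show False using prime_idl_prime[OF P _ that(1)] False that(2) by blast
    qed
    show ?thesis
    proof (cases "t \<in> P")
      case False
      thus ?thesis using two[OF in_Oint(3)] \<sigma>t in_Oint(3) by metis
    next
      case True
      have s2O: "s2 \<in> Oint F"
        using s2_in algebraic_int_sqrtI[of s2] s2_square[OF d1] algebraic_int_pi by simp
      have "s2 \<notin> P"
      proof
        assume s: "s2 \<in> P"
        have "t * t \<in> P" "s2 * s2 \<in> P" "t * s2 \<in> P" using i(4)[OF in_Oint(3) True] i(4)[OF s2O s] i(4)[OF in_Oint(3) s] by auto
        hence P1: "\<pi> \<in> P" "\<pi>' \<in> P" "z \<in> P"
          using t2 s2_square[OF d1] d1 t_nonzero by (simp_all add: power2_eq_square s2_def)
        have "\<pi> + \<pi>' = of_int (2 * a)" by (simp add: \<pi>_def \<pi>'_def)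
        hence a2: "of_int (2 * a) \<in> P" using i(3)[OF P1(1,2)] by simp
        have "z * z = of_int (int p)" using z2 by (simp add: power2_eq_square)
        hence "of_int (int p) \<in> P" using i(4)[OF in_Oint(2) P1(3)] by simp
        thus False using ideal_coprime_ints[OF prime_idl_idl[OF P] prime_idl_1[OF P] coprime_a_p a2] by simp
      qed
      moreover have "\<sigma> s2 = - s2"
        unfolding s2_def using hh(11)[of z t] z_in K_F t_in \<sigma>K[OF z_in] \<sigma>t by auto
      ultimately show ?thesis using two[OF s2O] s2O by metis
    qed
  next
    case True
    obtain k where k: "algebraic_int k" "\<pi> = 1 + 4 * k" using pi_mod_4 by blast
    have gi: "algebraic_int ((1 + t) / 2)" using k t2 d1 by (intro algebraic_int_half[of t k]) auto
    have gF: "(1 + t) / 2 \<in> F" using t_in by (intro fld_divide[OF fld_F] fld_add[OF fld_F] fld_1[OF fld_F] fld_numeral[OF fld_F])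
    have "\<sigma> ((1 + t) / 2) = (1 - t) / 2"
    proof -
      have half: "1 / 2 \<in> K" by (intro fld_divide[OF fld_K] fld_1[OF fld_K] fld_numeral[OF fld_K])
      have "(1 + t) / 2 = 1 / 2 + 1 / 2 * t" by (simp add: field_simps)
      thus ?thesis using \<sigma>f[OF half half] by (simp add: field_simps)
    qed
    hence "(1 + t) / 2 - \<sigma> ((1 + t) / 2) = t" by (simp add: field_simps)
    moreover have "t \<notin> P"
    proof
      assume "t \<in> P"
      hence "t * t \<in> P" using i(4)[OF in_Oint(3)] by blast
      hence "\<pi> \<in> P" using t2 d1 by (simp add: power2_eq_square)
      hence "\<pi>' * \<pi> \<in> P" using i(4)[OF in_Oint(5)] by blast
      hence "of_int (int p) \<in> P" using pi_mult by (simp add: mult.commute)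
      moreover have "of_int 2 \<in> P" using True by simp
      moreover have "coprime 2 (int p)" using odd_p by simp
      ultimately show False using ideal_coprime_ints[OF prime_idl_idl[OF P] prime_idl_1[OF P]] by blast
    qed
    ultimately show ?thesis using gi gF by (intro bexI[of _ "(1 + t) / 2"]) auto
  qed
qed

text \<open>Were \<open>P \<inter> K\<close> contained in \<open>P\<^sup>2\<close>, \<open>unramified_step\<close> would give \<open>P \<subseteq> P\<^sup>2\<close>, against Nakayama.\<close>

lemma unramified_F:
  assumes d1: "d = 1"
  shows "unramified_at_finite_primes K F"
  unfolding unramified_at_finite_primes_def prime_idl_integers
proof (intro allI impI, elim conjE)
  fix P assume P: "prime_idl (Oint F) P" "P \<noteq> {0}"
  note S = subr_Oint[OF fld_F]
  have I: "idl (Oint F) P" using prime_idl_idl[OF P(1)] .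
  obtain n where n: "n \<noteq> 0" "of_int n \<in> P" using integer_in_prime[OF P] .
  obtain \<sigma> where \<sigma>: "quad_conj K t \<sigma>" using quadratic_conj[OF fld_K t_notin t2_in] by blast
  hence h: "hom_on F \<sigma>" "\<And>x. x \<in> F \<Longrightarrow> \<sigma> x \<in> F" "\<And>x. x \<in> F \<Longrightarrow> \<sigma> (\<sigma> x) = x" "\<And>x. x \<in> F \<Longrightarrow> \<sigma> x = x \<Longrightarrow> x \<in> K"
    unfolding quad_conj_def F_def[symmetric] by blast+
  obtain g where g: "g \<in> Oint F" "g - \<sigma> g \<notin> P" using separating_element[OF P(1) d1 \<sigma>] by blast
  have "\<not> P \<inter> K \<subseteq> ipow (Oint F) P 2"
  proof
    assume "P \<inter> K \<subseteq> ipow (Oint F) P 2"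
    hence "P \<inter> F \<subseteq> ipow (Oint F) P 2"
      using g by (intro unramified_step[OF fld_F refl S P(1) n(2) fin_mod_Oint[OF n(1)] fld_F order_refl h]) auto
    moreover have "P \<subseteq> F" using idl_sub[OF S I] by auto
    ultimately have "P \<subseteq> ipow (Oint F) P 2" by blast
    thus False using not_subset_ipow_2[OF S I prime_idl_1[OF P(1)] n(2) _ fin_mod_Oint[OF n(1)]] n(1) by simp
  qed
  hence "e \<le> 1" if "P \<inter> K \<subseteq> ipow (Oint F) P e" for e
    using that ipow_antimono[OF S I, of 2 e] by (cases "2 \<le> e") auto
  moreover have "P \<inter> K \<subseteq> ipow (Oint F) P 1" unfolding ipow_1[OF S I] by blast
  ultimately show "ramification_index K F P = 1"
    unfolding ramification_index_F[OF I] by (intro Greatest_equality) auto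
qed

lemma ramified_if:
  assumes P: "prime_idl (Oint F) P" and n: "n \<noteq> 0" "of_int n \<in> P" and sub: "P \<inter> K \<subseteq> ipow (Oint F) P 2"
  shows "\<not> unramified_at_finite_primes K F"
proof
  assume u: "unramified_at_finite_primes K F"
  note S = subr_Oint[OF fld_F]
  have I: "idl (Oint F) P" using prime_idl_idl[OF P] .
  have "P \<noteq> {0}" using n by auto
  hence 1: "(GREATEST e. P \<inter> K \<subseteq> ipow (Oint F) P e) = 1"
    using u P unfolding unramified_at_finite_primes_def prime_idl_integers ramification_index_F[OF I, symmetric] by blast
  obtain e0 where e0: "of_int n \<notin> ipow (Oint F) P e0"
    using krull[OF S I prime_idl_1[OF P] _ fin_mod_Oint[OF n(1)]] n(1) by auto
  have "of_int n \<in> P \<inter> K" using n(2) fld_of_int[OF fld_K] by blast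
  hence "e \<le> e0" if "P \<inter> K \<subseteq> ipow (Oint F) P e" for e
    using that e0 ipow_antimono[OF S I, of e0 e] by (cases "e0 \<le> e") auto
  hence "2 \<le> (GREATEST e. P \<inter> K \<subseteq> ipow (Oint F) P e)" using sub by (intro Greatest_le_nat) auto
  thus False using 1 by simp
qed

text \<open>A prime containing \<open>l\<close> exists because \<open>1 / l\<close> is not an algebraic integer.\<close>

lemma exists_prime_over:
  assumes l: "prime (l::nat)"
  obtains P where "prime_idl (Oint F) P" "of_int (int l) \<in> P"
proof -
  note S = subr_Oint[OF fld_F]
  define I where "I = {of_nat l * x | x. x \<in> Oint F}"
  have i: "idl (Oint F) I" unfolding idl_def
  proof (intro conjI ballI)
    show "I \<subseteq> Oint F" using subr_mult[OF S subr_of_nat[OF S]] by (auto simp: I_def)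
    show "0 \<in> I" unfolding I_def using subr_0[OF S] by force
    fix x y assume y: "y \<in> I"
    then obtain y' where y': "y = of_nat l * y'" "y' \<in> Oint F" by (auto simp: I_def)
    show "x + y \<in> I" if "x \<in> I"
    proof -
      from that obtain x' where x': "x = of_nat l * x'" "x' \<in> Oint F" unfolding I_def by blast
      have "x + y = of_nat l * (x' + y')" by (simp add: x' y' algebra_simps)
      thus ?thesis unfolding I_def using subr_add[OF S x'(2) y'(2)] by blast
    qed
    show "x * y \<in> I" if "x \<in> Oint F"
    proof -
      have "x * y = of_nat l * (x * y')" by (simp add: y' algebra_simps)
      thus ?thesis unfolding I_def using subr_mult[OF S that y'(2)] by blast
    qed
  qed
  have "1 \<notin> I"
  proof
    assume "1 \<in> I"
    then obtain x where "(1::complex) = of_nat l * x" "algebraic_int x" unfolding I_def by blast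
    hence x: "of_nat l * x = 1" "algebraic_int x" by simp_all
    have "x = 1 / of_nat l" using x(1) prime_gt_0_nat[OF l] by (simp add: field_simps)
    hence "x \<in> \<rat>" by simp
    hence "x \<in> \<int>" using x(2) rational_algebraic_int_is_int by blast
    then obtain k where "x = of_int k" by (auto elim: Ints_cases)
    hence "of_int (int l * k) = (1 :: complex)" using x(1) by simp
    hence "int l * k = 1" by (simp only: of_int_eq_1_iff)
    hence "int l dvd 1" by (metis dvd_triv_left)
    thus False using prime_gt_1_nat[OF l] by (simp add: zdvd1_eq)
  qed
  then obtain P where P: "prime_idl (Oint F) P" "I \<subseteq> P" using exists_prime_idl[OF S i] by blast
  have "of_int (int l) \<in> I" unfolding I_def using subr_1[OF S] by force
  thus thesis using that P by blast
qed

lemma prime_mult_notin: "prime_idl (Oint F) P \<Longrightarrow> x \<in> Oint F \<Longrightarrow> y \<in> Oint F \<Longrightarrow> x \<notin> P \<Longrightarrow> y \<notin> P \<Longrightarrow> x * y \<notin> P"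
  using prime_idl_prime by blast

lemma notin_if_coprime:
  assumes P: "prime_idl (Oint F) P" and l: "of_int l \<in> P" "coprime l k"
  shows "of_int k \<notin> P"
  using ideal_coprime_ints[OF prime_idl_idl[OF P] prime_idl_1[OF P] l(2,1)] by blast

lemma z_notin_prime:
  assumes P: "prime_idl (Oint F) P" and l: "of_int l \<in> P" "coprime l (int p)"
  shows "z \<notin> P" "\<pi> \<notin> P"
proof -
  note i = idl_closed[OF subr_Oint[OF fld_F] prime_idl_idl[OF P]]
  have n: "of_nat p \<notin> P" using notin_if_coprime[OF assms] by simp
  show "z \<notin> P" using n i(4)[OF in_Oint(2), of z] z2 by (auto simp: power2_eq_square)
  show "\<pi> \<notin> P" using n i(5)[OF _ in_Oint(5), of \<pi>] pi_mult by auto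
qed

lemma step_to_K:
  assumes P: "prime_idl (Oint F) P" and n: "n \<noteq> 0" "of_int n \<in> P" and sub: "P \<inter> L1 \<subseteq> ipow (Oint F) P 2"
    and g: "g \<in> K" "algebraic_int g" and zg: "\<And>\<sigma>. quad_conj L1 z \<sigma> \<Longrightarrow> g - \<sigma> g \<notin> P"
  shows "P \<inter> K \<subseteq> ipow (Oint F) P 2"
proof -
  obtain \<sigma> where \<sigma>: "quad_conj L1 z \<sigma>" using quadratic_conj[OF fld_L1 z_notin z2_in] by blast
  hence h: "hom_on K \<sigma>" "\<And>x. x \<in> K \<Longrightarrow> \<sigma> x \<in> K" "\<And>x. x \<in> K \<Longrightarrow> \<sigma> (\<sigma> x) = x" "\<And>x. x \<in> K \<Longrightarrow> \<sigma> x = x \<Longrightarrow> x \<in> L1"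
    unfolding quad_conj_def K_def[symmetric] by blast+
  show ?thesis
    by (rule unramified_step[OF fld_F refl subr_Oint[OF fld_F] P n(2) fin_mod_Oint[OF n(1)] fld_K K_F h g zg[OF \<sigma>] sub])
qed

lemma quad_conj_z: "quad_conj L1 z \<sigma> \<Longrightarrow> x \<in> L1 \<Longrightarrow> y \<in> L1 \<Longrightarrow> \<sigma> (x + y * z) = x - y * z"
  by (simp add: quad_conj_def)

text \<open>Let \<open>P\<close> lie over \<open>l\<close>. Since \<open>t\<^sup>2 = d \<pi>\<close> and \<open>l\<close> divides \<open>d\<close> exactly once, \<open>t \<in> P\<close> and
  \<open>l \<in> P\<^sup>2\<close>, so \<open>P \<inter> \<rat> \<subseteq> P\<^sup>2\<close>. The extensions by \<open>\<surd>2\<close> and \<open>\<surd>p\<close> do not ramify at \<open>l\<close>, and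
  \<open>unramified_step\<close> carries the inclusion up to \<open>K\<close>, where it means ramification of \<open>F\<close> over \<open>K\<close>.\<close>

lemma ramified_odd:
  assumes l: "prime (l::nat)" "l \<noteq> 2" "l \<noteq> p" and d: "int l dvd d" "\<not> int l * int l dvd d"
  shows "\<not> unramified_at_finite_primes K F"
proof -
  note S = subr_Oint[OF fld_F]
  have pl: "prime (int l)" using l by simp
  obtain P where P: "prime_idl (Oint F) P" "of_int (int l) \<in> P" using exists_prime_over[OF l(1)] .
  note i = idl_closed[OF S prime_idl_idl[OF P(1)]] and I = idl_closed[OF S ipow_idl[OF S prime_idl_idl[OF P(1)], of 2]]
  obtain d' where d': "d = int l * d'" using d(1) by blast
  have l0: "int l \<noteq> 0" using prime_gt_0_nat[OF l(1)] by simp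
  have "\<not> int l dvd d'" using d(2) l0 unfolding d' by simp
  hence c1: "coprime (int l) d'" using pl by (simp add: prime_imp_coprime)
  have "\<not> l dvd p" using l p primes_dvd_imp_eq by blast
  hence c2: "coprime (int l) (int p)" using pl by (simp add: prime_imp_coprime)
  have "\<not> l dvd 2" using l(1,2) primes_dvd_imp_eq[of l 2] by auto
  hence "\<not> int l dvd 2" by presburger
  hence c3: "coprime (int l) 2" using pl by (intro prime_imp_coprime) auto
  have n2: "2 \<notin> P" using notin_if_coprime[OF P c3] by simp
  have two: "2 \<in> Oint F" using fld_numeral[OF fld_F] by simp
  have tt: "t * t = of_int (int l) * (of_int d' * \<pi>)" using t2 by (simp add: d' power2_eq_square)
  have dO: "of_int d' * \<pi> \<in> Oint F" using subr_mult[OF S subr_of_int[OF S] in_Oint(4)] .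
  have "t * t \<in> P" unfolding tt using i(5)[OF P(2) dO] .
  hence "t \<in> P" using prime_idl_prime[OF P(1) in_Oint(3) in_Oint(3)] by blast
  hence "t * t \<in> ipow (Oint F) P 2" using ipow_2_mult[OF S prime_idl_idl[OF P(1)]] by blast
  hence "(of_int d' * \<pi>) * of_int (int l) \<in> ipow (Oint F) P 2" unfolding tt by (simp only: mult.commute)
  moreover have "of_int d' * \<pi> \<notin> P"
    using prime_mult_notin[OF P(1) subr_of_int[OF S] in_Oint(4) notin_if_coprime[OF P c1] z_notin_prime(2)[OF P c2]] .
  ultimately have lP: "of_int (int l) \<in> ipow (Oint F) P 2"
    using cancel_mod_ipow_2[OF S P(1) P(2) fin_mod_Oint[OF l0] dO _ subr_of_int[OF S]] by blast
  have PQ: "P \<inter> \<rat> \<subseteq> ipow (Oint F) P 2"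
  proof clarify
    fix x assume x: "x \<in> P" "x \<in> \<rat>"
    hence "x \<in> \<int>" using i(1) rational_algebraic_int_is_int by blast
    then obtain k where k: "x = of_int k" by (auto elim: Ints_cases)
    have "int l dvd k"
    proof (rule ccontr)
      assume "\<not> int l dvd k"
      hence "coprime (int l) k" using pl by (simp add: prime_imp_coprime)
      thus False using notin_if_coprime[OF P] x k by blast
    qed
    then obtain k' where "k = int l * k'" by blast
    thus "x \<in> ipow (Oint F) P 2" using I(5)[OF lP subr_of_int[OF S, of k']] k by simp
  qed
  have wP: "w \<notin> P"
  proof
    assume "w \<in> P"
    hence "w * w \<in> P" using i(4)[OF in_Oint(1)] by blast
    thus False using n2 w2 by (simp add: power2_eq_square)
  qed
  have "2 * w \<notin> P" using prime_mult_notin[OF P(1) two in_Oint(1) n2 wP] .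
  hence gw: "w - \<sigma>\<^sub>1 w \<notin> P" by (simp add: conj_L1(6))
  have PL1: "P \<inter> L1 \<subseteq> ipow (Oint F) P 2"
    using unramified_step[OF fld_F refl S P(1) P(2) fin_mod_Oint[OF l0] fld_L1 _ conj_L1(1) conj_L1(2) conj_L1(3) conj_L1(4) w_in algebraic_int_w gw PQ]
      L1_K K_F by blast
  have zz: "z - \<sigma> z \<notin> P" if "quad_conj L1 z \<sigma>" for \<sigma>
  proof -
    have "\<sigma> z = - z" using quad_conj_z[OF that fld_0[OF fld_L1] fld_1[OF fld_L1]] by simp
    thus ?thesis using prime_mult_notin[OF P(1) two in_Oint(2) n2 z_notin_prime(1)[OF P c2]] by simp
  qed
  have "P \<inter> K \<subseteq> ipow (Oint F) P 2" by (rule step_to_K[OF P(1) l0 P(2) PL1 z_in algebraic_int_z]) (rule zz)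
  thus ?thesis using ramified_if[OF P(1) l0 P(2)] by blast
qed

lemma Oint_L1_eq:
  assumes "x \<in> Oint L1"
  obtains m n :: int where "x = of_int m + of_int n * w"
proof -
  obtain u v where uv: "u \<in> \<rat>" "v \<in> \<rat>" "x = u + v * w" using assms L1_E by blast
  have w2r: "w\<^sup>2 \<in> \<rat>" by (simp add: w2)
  have "algebraic_int (2 * u)" "algebraic_int (2 * w\<^sup>2 * v)"
    using integral_coordinates[OF fld_Rats w_notin w2r algebraic_int_w uv(1,2)] assms uv(3) by auto
  hence "2 * u \<in> \<int>" "4 * v \<in> \<int>"
    using rational_algebraic_int_is_int[of "2 * u"] rational_algebraic_int_is_int[of "4 * v"] uv by (simp_all add: w2)
  then obtain A B where AB: "2 * u = of_int A" "4 * v = of_int B" by (auto elim!: Ints_cases)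
  have xc: "x * \<sigma>\<^sub>1 x = u\<^sup>2 - 2 * v\<^sup>2"
  proof -
    have "x * \<sigma>\<^sub>1 x = u\<^sup>2 - v\<^sup>2 * w\<^sup>2" unfolding uv(3) conj_L1(5)[OF uv(1,2)] by (simp add: power2_eq_square algebra_simps)
    thus ?thesis by (simp add: w2)
  qed
  have "algebraic_int (x * \<sigma>\<^sub>1 x)"
    using assms algebraic_int_hom[OF conj_L1(1) fld_L1] by (auto intro: algebraic_int_mult)
  moreover have "x * \<sigma>\<^sub>1 x \<in> \<rat>" unfolding xc using uv by simp
  ultimately obtain N where N: "x * \<sigma>\<^sub>1 x = of_int N" using rational_algebraic_int_is_int by (metis Ints_cases)
  have "2 * (2 * u)\<^sup>2 - (4 * v)\<^sup>2 = 8 * (x * \<sigma>\<^sub>1 x)" unfolding xc by (simp add: power_mult_distrib algebra_simps)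
  hence "of_int (2 * A\<^sup>2 - B\<^sup>2) = (of_int (8 * N) :: complex)" unfolding AB N by simp
  hence e: "2 * A\<^sup>2 - B\<^sup>2 = 8 * N" by (simp only: of_int_eq_iff)
  hence "B\<^sup>2 = 2 * (A\<^sup>2 - 4 * N)" by simp
  hence "even (B\<^sup>2)" by (metis dvd_triv_left)
  then obtain B' where B: "B = 2 * B'" by (metis evenE even_power pos2)
  hence e2: "A\<^sup>2 - 2 * B'\<^sup>2 = 4 * N" using e by (simp add: power_mult_distrib)
  hence "A\<^sup>2 = 2 * (B'\<^sup>2 + 2 * N)" by simp
  hence "even (A\<^sup>2)" by (metis dvd_triv_left)
  then obtain A' where A: "A = 2 * A'" by (metis evenE even_power pos2)
  hence "4 * A'\<^sup>2 - 2 * B'\<^sup>2 = 4 * N" using e2 by (simp add: power_mult_distrib)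
  hence "B'\<^sup>2 = 2 * (A'\<^sup>2 - N)" by simp
  hence "even (B'\<^sup>2)" by (metis dvd_triv_left)
  then obtain B'' where B': "B' = 2 * B''" by (metis evenE even_power pos2)
  have "u = of_int A'" "v = of_int B''" using AB by (simp_all add: A B B')
  thus thesis using that uv(3) by blast
qed

text \<open>Let \<open>P\<close> lie over \<open>2\<close>. With \<open>t\<^sup>2 = - 1 - 4 k\<close> the number \<open>\<Lambda> = (t + 1) / \<surd>2\<close> satisfies
  \<open>\<Lambda>\<^sup>2 = t - 2 k\<close>, so it is integral and a unit at \<open>P\<close>, and \<open>(\<Lambda> - 1)\<^sup>2\<close> is \<open>\<surd>2\<close> times a unit at
  \<open>P\<close>. Hence \<open>\<surd>2 \<in> P\<^sup>2\<close> and \<open>P \<inter> \<rat>(\<surd>2) \<subseteq> P\<^sup>2\<close>; the extension by \<open>\<surd>p\<close> is unramified at \<open>2\<close>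
  because \<open>p = 1\<close> modulo \<open>4\<close>, and \<open>(1 + \<surd>p) / 2\<close> serves as \<open>g\<close> in \<open>unramified_step\<close>.\<close>

lemma ramified_minus_1:
  assumes d: "d = -1"
  shows "\<not> unramified_at_finite_primes K F"
proof -
  note S = subr_Oint[OF fld_F]
  obtain P where P: "prime_idl (Oint F) P" "of_int (int 2) \<in> P" using exists_prime_over[OF two_is_prime_nat] .
  have P2: "of_int 2 \<in> P" "2 \<in> P" using P(2) by simp_all
  note i = idl_closed[OF S prime_idl_idl[OF P(1)]] and I = idl_closed[OF S ipow_idl[OF S prime_idl_idl[OF P(1)], of 2]]
  have c: "coprime 2 (int p)" using odd_p by simp
  have wP: "w \<in> P" using prime_idl_prime[OF P(1) in_Oint(1) in_Oint(1)] w2 P2 by (auto simp: power2_eq_square)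
  obtain k where k: "algebraic_int k" "k \<in> L1" "\<pi> = 1 + 4 * k" using pi_mod_4 by blast
  have kO: "k \<in> Oint F" using k L1_K K_F by blast
  have tt: "t\<^sup>2 = - 1 - 4 * k" using t2 d k by simp
  define \<Lambda> where "\<Lambda> = (t + 1) / w"
  have w0: "w \<noteq> 0" using w2 by auto
  have wL: "w * \<Lambda> = t + 1" using w0 by (simp add: \<Lambda>_def)
  have "\<Lambda>\<^sup>2 = (t\<^sup>2 + 2 * t + 1) / w\<^sup>2" by (simp add: \<Lambda>_def power_divide power2_eq_square algebra_simps)
  moreover have "t\<^sup>2 + 2 * t + 1 = 2 * (t - 2 * k)" unfolding tt by simp
  ultimately have "\<Lambda>\<^sup>2 = 2 * (t - 2 * k) / 2" by (simp only: w2)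
  also have "2 * (t - 2 * k) / 2 = t - 2 * k" by (rule nonzero_mult_div_cancel_left) simp
  finally have L2: "\<Lambda>\<^sup>2 = t - 2 * k" .
  have two: "2 \<in> Oint F" using fld_numeral[OF fld_F] by simp
  have "algebraic_int \<Lambda>"
  proof (rule algebraic_int_sqrtI)
    have "t - 2 * k \<in> Oint F" using subr_diff[OF S in_Oint(3) subr_mult[OF S two kO]] .
    thus "algebraic_int (\<Lambda>\<^sup>2)" unfolding L2 by blast
  qed
  moreover have "\<Lambda> \<in> F" unfolding \<Lambda>_def using in_Oint by (intro fld_divide[OF fld_F] fld_add[OF fld_F] fld_1[OF fld_F]) auto
  ultimately have LO: "\<Lambda> \<in> Oint F" by blast
  have tP: "t \<notin> P"
  proof
    assume "t \<in> P"
    hence "t * t \<in> P" using i(4)[OF in_Oint(3)] by blast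
    hence "- \<pi> \<in> P" using t2 d by (simp add: power2_eq_square)
    hence "\<pi> \<in> P" using i(6)[of "- \<pi>"] by simp
    thus False using z_notin_prime(2)[OF P(1) P2(1) c] by blast
  qed
  have LP: "\<Lambda> \<notin> P"
  proof
    assume "\<Lambda> \<in> P"
    hence "\<Lambda> * \<Lambda> + 2 * k \<in> P" using i(3)[OF i(4)[OF LO] i(5)[OF P2(2) kO]] by blast
    hence "t \<in> P" using L2 by (simp add: power2_eq_square)
    thus False using tP by blast
  qed
  \<comment> \<open>the cofactor of \<open>\<surd>2\<close> in \<open>(\<Lambda> - 1)\<^sup>2\<close>\<close>
  define y where "y = \<Lambda> - w * (k + \<Lambda>)"
  have yO: "y \<in> Oint F" unfolding y_def using subr_diff[OF S LO subr_mult[OF S in_Oint(1) subr_add[OF S kO LO]]] .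
  have ww: "w * w = 2" using w2 by (simp add: power2_eq_square)
  have sq: "(\<Lambda> - 1) * (\<Lambda> - 1) = y * w"
  proof -
    have "(\<Lambda> - 1) * (\<Lambda> - 1) = \<Lambda>\<^sup>2 + 1 - 2 * \<Lambda>" by (simp add: power2_eq_square algebra_simps)
    also have "\<dots> = w * \<Lambda> - 2 * k - 2 * \<Lambda>" unfolding L2 wL by simp
    also have "\<dots> = w * \<Lambda> - (w * w) * (k + \<Lambda>)" unfolding ww by (simp add: algebra_simps)
    finally show ?thesis by (simp add: y_def algebra_simps)
  qed
  have L1O: "\<Lambda> - 1 \<in> Oint F" using subr_diff[OF S LO subr_1[OF S]] .
  have "(\<Lambda> - 1) * (\<Lambda> - 1) \<in> P" unfolding sq using i(4)[OF yO wP] .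
  hence "\<Lambda> - 1 \<in> P" using prime_idl_prime[OF P(1) L1O L1O] by blast
  hence "y * w \<in> ipow (Oint F) P 2" unfolding sq[symmetric] using ipow_2_mult[OF S prime_idl_idl[OF P(1)]] by blast
  moreover have "y \<notin> P"
  proof
    assume "y \<in> P"
    hence "y + w * (k + \<Lambda>) \<in> P" using i(3)[OF _ i(5)[OF wP subr_add[OF S kO LO]]] by blast
    thus False using LP by (simp add: y_def)
  qed
  ultimately have w2P: "w \<in> ipow (Oint F) P 2"
    using cancel_mod_ipow_2[OF S P(1) P2(1) fin_mod_Oint yO _ in_Oint(1)] by simp
  have PL1: "P \<inter> L1 \<subseteq> ipow (Oint F) P 2"
  proof clarify
    fix x assume x: "x \<in> P" "x \<in> L1"
    hence "x \<in> Oint L1" using i(1) by blast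
    then obtain m n where mn: "x = of_int m + of_int n * w" by (rule Oint_L1_eq)
    have "x - of_int n * w \<in> P" using i(7)[OF x(1) i(4)[OF subr_of_int[OF S] wP]] .
    hence mP: "of_int m \<in> P" using mn by simp
    have "even m"
    proof (rule ccontr)
      assume "odd m"
      hence "coprime 2 m" by simp
      thus False using notin_if_coprime[OF P(1) P2(1)] mP by blast
    qed
    then obtain m' where "m = 2 * m'" by blast
    hence "of_int m = of_int m' * w * w" using ww by simp
    moreover have "of_int m' * w * w \<in> ipow (Oint F) P 2"
      using I(4)[OF subr_mult[OF S subr_of_int[OF S] in_Oint(1)] w2P] .
    moreover have "of_int n * w \<in> ipow (Oint F) P 2" using I(4)[OF subr_of_int[OF S] w2P] .
    ultimately show "x \<in> ipow (Oint F) P 2" unfolding mn using I(3) by simp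
  qed
  obtain p' where p': "p = 1 + 4 * p'" 
  proof -
    have "p = 1 + 4 * (2 * (p div 8))" using p8 by presburger
    thus ?thesis using that by blast
  qed
  have z4: "z\<^sup>2 = 1 + 4 * of_nat p'" using z2 p' by simp
  have gi: "algebraic_int ((1 + z) / 2)" by (rule algebraic_int_half[OF z4]) simp
  have gK: "(1 + z) / 2 \<in> K" using z_in by (intro fld_divide[OF fld_K] fld_add[OF fld_K] fld_1[OF fld_K] fld_numeral[OF fld_K])
  have zz: "(1 + z) / 2 - \<sigma> ((1 + z) / 2) \<notin> P" if "quad_conj L1 z \<sigma>" for \<sigma>
  proof -
    have half: "1 / 2 \<in> L1" by (intro fld_divide[OF fld_L1] fld_1[OF fld_L1] fld_numeral[OF fld_L1])
    have e: "(1 + z) / 2 = 1 / 2 + 1 / 2 * z" by (simp add: field_simps)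
    have "(1 + z) / 2 - \<sigma> ((1 + z) / 2) = z" unfolding e quad_conj_z[OF that half half] by (simp add: field_simps)
    thus ?thesis using z_notin_prime(1)[OF P(1) P2(1) c] by simp
  qed
  have "P \<inter> K \<subseteq> ipow (Oint F) P 2" by (rule step_to_K[OF P(1) _ P2(1) PL1 gK gi _]) (simp, rule zz)
  thus ?thesis using ramified_if[OF P(1) _ P2(1)] by simp
qed

end

section \<open>Galois groups and the dihedral group of order 8\<close>

abbreviation "gal k M \<equiv> galois_group k M"

lemma gal_iff:
  assumes "fld M"
  shows "\<sigma> \<in> carrier (gal k M) \<longleftrightarrow> \<sigma> \<in> Bij M \<and> hom_on M \<sigma> \<and> (\<forall>x\<in>k. \<sigma> x = x)"
proof -
  have "\<sigma> \<in> ring_hom (CC\<lparr>carrier := M\<rparr>) (CC\<lparr>carrier := M\<rparr>) \<longleftrightarrow> hom_on M \<sigma>" if "\<sigma> \<in> Bij M"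
    using Bij_imp_funcset[OF that] unfolding ring_hom_def hom_on_def by auto
  thus ?thesis unfolding galois_group_def by auto
qed

lemma gal_mult: "\<sigma> \<in> Bij M \<Longrightarrow> \<tau> \<in> Bij M \<Longrightarrow> \<sigma> \<otimes>\<^bsub>gal k M\<^esub> \<tau> = compose M \<sigma> \<tau>"
  by (simp add: galois_group_def BijGroup_def)

lemma gal_one: "\<one>\<^bsub>gal k M\<^esub> = (\<lambda>x\<in>M. x)"
  by (simp add: galois_group_def BijGroup_def)

lemma hom_on_compose:
  assumes "hom_on M \<sigma>" "hom_on M \<tau>" "\<And>x. x \<in> M \<Longrightarrow> \<tau> x \<in> M" "fld M"
  shows "hom_on M (compose M \<sigma> \<tau>)"
  using assms fld_closed[OF assms(4)] unfolding hom_on_def compose_def by simp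

lemma group_gal:
  assumes M: "fld M" and k: "k \<subseteq> M"
  shows "group (gal k M)"
proof -
  let ?H = "carrier (gal k M)"
  have "subgroup ?H (BijGroup M)"
  proof (rule group.subgroupI[OF group_BijGroup])
    show "?H \<subseteq> carrier (BijGroup M)" using gal_iff[OF M] by (auto simp: BijGroup_def)
    have "(\<lambda>x\<in>M. x) \<in> ?H"
      using id_Bij fld_closed[OF M] k by (auto simp: gal_iff[OF M] hom_on_def)
    thus "?H \<noteq> {}" by blast
  next
    fix f assume f: "f \<in> ?H"
    hence b: "f \<in> Bij M" and h: "hom_on M f" and fx: "\<forall>x\<in>k. f x = x" using gal_iff[OF M] by auto
    have fs: "f \<in> M \<rightarrow> M" by (rule Bij_imp_funcset[OF b])
    have 1: "inv_into M f (x + y) = inv_into M f x + inv_into M f y" if "x \<in> M" "y \<in> M" for x y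
      by (rule Bij_inv_into_lemma[OF _ b _ that]) (use h fld_add[OF M] in \<open>auto simp: hom_on_def\<close>)
    have 2: "inv_into M f (x * y) = inv_into M f x * inv_into M f y" if "x \<in> M" "y \<in> M" for x y
      by (rule Bij_inv_into_lemma[OF _ b _ that]) (use h fld_mult[OF M] in \<open>auto simp: hom_on_def\<close>)
    have inj: "inj_on f M" using b by (simp add: Bij_def bij_betw_def)
    have 3: "inv_into M f x = x" if "x \<in> M" "f x = x" for x using inv_into_f_f[OF inj that(1)] that(2) by simp
    have "f 1 = 1" using h by (simp add: hom_on_def)
    hence "hom_on M (\<lambda>x\<in>M. inv_into M f x)"
      using 1 2 3[OF fld_1[OF M]] fld_closed[OF M] by (simp add: hom_on_def)
    moreover have "\<forall>x\<in>k. (\<lambda>x\<in>M. inv_into M f x) x = x" using 3 fx k by auto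
    ultimately show "inv\<^bsub>BijGroup M\<^esub> f \<in> ?H"
      using restrict_inv_into_Bij[OF b] by (simp add: inv_BijGroup[OF b] gal_iff[OF M])
  next
    fix f g assume "f \<in> ?H" "g \<in> ?H"
    hence fg: "f \<in> Bij M" "g \<in> Bij M" "hom_on M f" "hom_on M g" "\<forall>x\<in>k. f x = x" "\<forall>x\<in>k. g x = x"
      using gal_iff[OF M] by auto
    have gM: "\<And>x. x \<in> M \<Longrightarrow> g x \<in> M" using Bij_imp_funcset[OF fg(2)] by auto
    have "compose M f g \<in> ?H"
      using compose_Bij[OF fg(1,2)] hom_on_compose[OF fg(3,4) gM M] fg k by (auto simp: gal_iff[OF M] compose_def)
    thus "f \<otimes>\<^bsub>BijGroup M\<^esub> g \<in> ?H" using fg by (simp add: BijGroup_def)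
  qed
  from group.subgroup_imp_group[OF group_BijGroup this]
  have "group (BijGroup M\<lparr>carrier := ?H\<rparr>)" .
  moreover have "gal k M = BijGroup M\<lparr>carrier := ?H\<rparr>" unfolding galois_group_def by simp
  ultimately show ?thesis by simp
qed

lemma gal_maps:
  assumes "fld M" "\<sigma> \<in> carrier (gal k M)"
  shows "\<sigma> \<in> Bij M" "hom_on M \<sigma>" "\<And>x. x \<in> M \<Longrightarrow> \<sigma> x \<in> M" "\<And>x. x \<in> k \<Longrightarrow> \<sigma> x = x"
proof -
  show b: "\<sigma> \<in> Bij M" "hom_on M \<sigma>" "\<And>x. x \<in> k \<Longrightarrow> \<sigma> x = x" using assms gal_iff by auto
  show "\<sigma> x \<in> M" if "x \<in> M" for x using Bij_imp_funcset[OF b(1)] that by auto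
qed

lemma gal_mult_apply:
  assumes "fld M" "\<sigma> \<in> carrier (gal k M)" "\<tau> \<in> carrier (gal k M)" "x \<in> M"
  shows "(\<sigma> \<otimes>\<^bsub>gal k M\<^esub> \<tau>) x = \<sigma> (\<tau> x)"
  using gal_mult[OF gal_maps(1)[OF assms(1,2)] gal_maps(1)[OF assms(1,3)]] assms(4) by (simp add: compose_def)

lemma gal_eqI:
  assumes "fld M" "\<sigma> \<in> carrier (gal k M)" "\<tau> \<in> carrier (gal k M)" "\<And>x. x \<in> M \<Longrightarrow> \<sigma> x = \<tau> x"
  shows "\<sigma> = \<tau>"
  by (rule extensionalityI[OF Bij_imp_extensional[OF gal_maps(1)[OF assms(1,2)]]
      Bij_imp_extensional[OF gal_maps(1)[OF assms(1,3)]] assms(4)])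

lemma gal_memI:
  assumes M: "fld M" and h: "hom_on M \<sigma>" and im: "\<sigma> ` M = M" and k: "\<And>x. x \<in> k \<Longrightarrow> \<sigma> x = x" "k \<subseteq> M"
  shows "restrict \<sigma> M \<in> carrier (gal k M)"
proof -
  note hh = hom_on_simps[OF h M] and c = fld_closed[OF M]
  have inj: "inj_on \<sigma> M"
  proof (rule inj_onI)
    fix x y assume xy: "x \<in> M" "y \<in> M" "\<sigma> x = \<sigma> y"
    hence "\<sigma> (x - y) = 0" using hh(6) by simp
    hence "x - y = 0" using hh(12)[OF c(3)[OF xy(1,2)]] by blast
    thus "x = y" by simp
  qed
  have "restrict \<sigma> M \<in> Bij M" using inj im unfolding Bij_def bij_betw_def by (auto simp: inj_on_def)
  moreover have "hom_on M (restrict \<sigma> M)" using h c by (simp add: hom_on_def)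
  ultimately show ?thesis using k by (auto simp: gal_iff[OF M])
qed

lemma dihedral_simps:
  "carrier (dihedral_group n) = {0..<int n} \<times> UNIV"
  "(i, x) \<otimes>\<^bsub>dihedral_group n\<^esub> (j, y) = ((if x then i - j else i + j) mod int n, x \<noteq> y)"
  "\<one>\<^bsub>dihedral_group n\<^esub> = (0, False)"
  by (simp_all add: dihedral_group_def)

lemma int_interval_4: "(i::int) \<in> {0..<4} \<longleftrightarrow> i = 0 \<or> i = 1 \<or> i = 2 \<or> i = 3"
  by auto

text \<open>In the dihedral group of order \<open>8\<close> an element whose square is not trivial is a rotation of
  order \<open>4\<close>, and everything outside the group generated by it is a reflection. Both facts are read off from the
  finite multiplication table.\<close>

lemma dihedral_4_relations:
  fixes G (structure)
  assumes G: "group G" and iso: "G \<cong> dihedral_group 4" and \<tau>: "\<tau> \<in> carrier G" and \<iota>: "\<iota> \<in> carrier G"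
    and t2: "\<tau> \<otimes>\<^bsub>G\<^esub> \<tau> \<noteq> \<one>\<^bsub>G\<^esub>"
    and ni: "\<iota> \<noteq> \<one>\<^bsub>G\<^esub>" "\<iota> \<noteq> \<tau>" "\<iota> \<noteq> \<tau> \<otimes>\<^bsub>G\<^esub> \<tau>" "\<iota> \<noteq> \<tau> \<otimes>\<^bsub>G\<^esub> \<tau> \<otimes>\<^bsub>G\<^esub> \<tau>"
  shows "\<iota> \<otimes>\<^bsub>G\<^esub> \<iota> = \<one>\<^bsub>G\<^esub>" "\<tau> \<otimes>\<^bsub>G\<^esub> \<iota> \<otimes>\<^bsub>G\<^esub> \<tau> = \<iota>"
proof -
  interpret group G by (rule G)
  obtain \<phi> where "\<phi> \<in> iso G (dihedral_group 4)" using iso by (auto simp: is_iso_def)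
  hence h: "\<And>x y. x \<in> carrier G \<Longrightarrow> y \<in> carrier G \<Longrightarrow> \<phi> (x \<otimes> y) = \<phi> x \<otimes>\<^bsub>dihedral_group 4\<^esub> \<phi> y"
    and c: "\<And>x. x \<in> carrier G \<Longrightarrow> \<phi> x \<in> carrier (dihedral_group 4)" and inj: "inj_on \<phi> (carrier G)"
    by (auto simp: iso_def hom_def bij_betw_def)
  have eqI: "x = y" if "x \<in> carrier G" "y \<in> carrier G" "\<phi> x = \<phi> y" for x y using inj that by (auto simp: inj_on_def)
  obtain i0 s0 where 1: "\<phi> \<one> = (i0, s0)" by (cases "\<phi> \<one>")
  have "i0 \<in> {0..<4}" using c[OF one_closed] 1 by (simp add: dihedral_simps)
  moreover have "(i0, s0) = (i0, s0) \<otimes>\<^bsub>dihedral_group 4\<^esub> (i0, s0)" using h[OF one_closed one_closed] 1 by simp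
  ultimately have one: "\<phi> \<one> = (0, False)" using 1 unfolding int_interval_4 by (auto simp: dihedral_simps)
  obtain i s where pt: "\<phi> \<tau> = (i, s)" by (cases "\<phi> \<tau>")
  obtain j r where pi: "\<phi> \<iota> = (j, r)" by (cases "\<phi> \<iota>")
  have ij: "i = 0 \<or> i = 1 \<or> i = 2 \<or> i = 3" "j = 0 \<or> j = 1 \<or> j = 2 \<or> j = 3"
    using c[OF \<tau>] c[OF \<iota>] pt pi unfolding int_interval_4[symmetric] by (simp_all add: dihedral_simps)
  have tt: "\<phi> (\<tau> \<otimes> \<tau>) = (i, s) \<otimes>\<^bsub>dihedral_group 4\<^esub> (i, s)" using h[OF \<tau> \<tau>] pt by simp
  have ttt: "\<phi> (\<tau> \<otimes> \<tau> \<otimes> \<tau>) = (i, s) \<otimes>\<^bsub>dihedral_group 4\<^esub> (i, s) \<otimes>\<^bsub>dihedral_group 4\<^esub> (i, s)"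
    using h[OF m_closed[OF \<tau> \<tau>] \<tau>] pt tt by simp
  have "\<phi> (\<tau> \<otimes> \<tau>) \<noteq> (0, False)" using eqI[OF m_closed[OF \<tau> \<tau>] one_closed] t2 one by auto
  hence si: "\<not> s" "i = 1 \<or> i = 3" using ij(1) unfolding tt by (auto simp: dihedral_simps)
  have nn: "\<phi> \<iota> \<noteq> \<phi> \<one>" "\<phi> \<iota> \<noteq> \<phi> \<tau>" "\<phi> \<iota> \<noteq> \<phi> (\<tau> \<otimes> \<tau>)" "\<phi> \<iota> \<noteq> \<phi> (\<tau> \<otimes> \<tau> \<otimes> \<tau>)"
    using eqI[OF \<iota>] ni \<tau> by auto
  have r: r
  proof (rule ccontr)
    assume "\<not> r"
    thus False using nn si ij(2) unfolding ttt tt one pt pi by (auto simp: dihedral_simps)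
  qed
  have "\<phi> (\<iota> \<otimes> \<iota>) = \<phi> \<one>" using h[OF \<iota> \<iota>] pi r one by (simp add: dihedral_simps)
  thus "\<iota> \<otimes> \<iota> = \<one>" by (rule eqI[OF m_closed[OF \<iota> \<iota>] one_closed])
  have "\<phi> (\<tau> \<otimes> \<iota> \<otimes> \<tau>) = \<phi> \<iota>"
    using h[OF m_closed[OF \<tau> \<iota>] \<tau>] h[OF \<tau> \<iota>] pt pi r si ij by (auto simp: dihedral_simps)
  thus "\<tau> \<otimes> \<iota> \<otimes> \<tau> = \<iota>" by (rule eqI[OF m_closed[OF m_closed[OF \<tau> \<iota>] \<tau>] \<iota>])
qed

lemma group_dihedral: "n > 0 \<Longrightarrow> group (dihedral_group n)"
proof (rule groupI)
  assume n: "n > 0"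
  fix x y z assume x: "x \<in> carrier (dihedral_group n)" and y: "y \<in> carrier (dihedral_group n)" and z: "z \<in> carrier (dihedral_group n)"
  show "x \<otimes>\<^bsub>dihedral_group n\<^esub> y \<in> carrier (dihedral_group n)" using n by (cases x; cases y) (simp add: dihedral_simps)
  show "x \<otimes>\<^bsub>dihedral_group n\<^esub> y \<otimes>\<^bsub>dihedral_group n\<^esub> z = x \<otimes>\<^bsub>dihedral_group n\<^esub> (y \<otimes>\<^bsub>dihedral_group n\<^esub> z)"
    by (cases x; cases y; cases z) (auto simp: dihedral_simps mod_simps algebra_simps)
next
  assume n: "n > 0"
  show "\<one>\<^bsub>dihedral_group n\<^esub> \<in> carrier (dihedral_group n)" using n by (simp add: dihedral_simps)
  fix x assume x: "x \<in> carrier (dihedral_group n)"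
  obtain i s where xx: "x = (i, s)" by (cases x)
  show "\<one>\<^bsub>dihedral_group n\<^esub> \<otimes>\<^bsub>dihedral_group n\<^esub> x = x" using x unfolding xx by (simp add: dihedral_simps)
  show "\<exists>y\<in>carrier (dihedral_group n). y \<otimes>\<^bsub>dihedral_group n\<^esub> x = \<one>\<^bsub>dihedral_group n\<^esub>"
  proof (cases s)
    case True
    thus ?thesis using x n unfolding xx by (intro bexI[of _ "(i, True)"]) (auto simp: dihedral_simps)
  next
    case False
    thus ?thesis using x n unfolding xx by (intro bexI[of _ "((- i) mod int n, False)"]) (auto simp: dihedral_simps mod_simps)
  qed
qed

text \<open>The elements \<open>\<tau>\<^sup>i \<iota>\<^sup>s\<close> multiply according to the rule of the dihedral group because of the
  relation \<open>\<tau> \<iota> \<tau> = \<iota>\<close>.\<close>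

lemma dihedral_isoI:
  fixes G (structure)
  assumes G: "group G" and t: "\<tau> \<in> carrier G" and u: "\<iota> \<in> carrier G"
    and t4: "\<tau> [^]\<^bsub>G\<^esub> (4::int) = \<one>\<^bsub>G\<^esub>" and u2: "\<iota> \<otimes>\<^bsub>G\<^esub> \<iota> = \<one>\<^bsub>G\<^esub>" and tut: "\<tau> \<otimes>\<^bsub>G\<^esub> \<iota> \<otimes>\<^bsub>G\<^esub> \<tau> = \<iota>"
    and inj: "inj_on (\<lambda>(i, s). \<tau> [^]\<^bsub>G\<^esub> i \<otimes>\<^bsub>G\<^esub> (if s then \<iota> else \<one>\<^bsub>G\<^esub>)) ({0..<4::int} \<times> UNIV)"
    and surj: "carrier G \<subseteq> (\<lambda>(i, s). \<tau> [^]\<^bsub>G\<^esub> i \<otimes>\<^bsub>G\<^esub> (if s then \<iota> else \<one>\<^bsub>G\<^esub>)) ` ({0..<4::int} \<times> UNIV)"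
  shows "G \<cong> dihedral_group 4"
proof -
  interpret group G by (rule G)
  define \<psi> where "\<psi> = (\<lambda>(i, s). \<tau> [^] (i::int) \<otimes> (if s then \<iota> else \<one>))"
  have mod4: "\<tau> [^] (k mod 4) = \<tau> [^] k" for k :: int
  proof -
    have "\<tau> [^] k = \<tau> [^] (4 * (k div 4) + k mod 4)" by simp
    also have "\<dots> = (\<tau> [^] (4::int)) [^] (k div 4) \<otimes> \<tau> [^] (k mod 4)" using t by (simp only: int_pow_mult int_pow_pow)
    finally show ?thesis using t4 t by simp
  qed
  have nat_conj: "\<tau> [^] (n::nat) \<otimes> (\<iota> \<otimes> \<tau> [^] n) = \<iota>" for n
  proof (induction n)
    case (Suc n)
    have "\<tau> [^] Suc n \<otimes> (\<iota> \<otimes> \<tau> [^] Suc n) = \<tau> [^] n \<otimes> ((\<tau> \<otimes> \<iota> \<otimes> \<tau>) \<otimes> \<tau> [^] n)"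
      using t u by (simp add: nat_pow_Suc m_assoc nat_pow_Suc2[symmetric] del: nat_pow_Suc)
    thus ?case using Suc tut by simp
  qed (use u in simp)
  have conj: "\<iota> \<otimes> \<tau> [^] i = \<tau> [^] (- i) \<otimes> \<iota>" if "i \<ge> 0" for i :: int
  proof -
    have "\<tau> [^] i \<otimes> (\<iota> \<otimes> \<tau> [^] i) = \<iota>" using nat_conj[of "nat i"] that by (simp add: int_pow_int[symmetric])
    hence "\<tau> [^] (- i) \<otimes> (\<tau> [^] i \<otimes> (\<iota> \<otimes> \<tau> [^] i)) = \<tau> [^] (- i) \<otimes> \<iota>" by simp
    thus ?thesis using t u by (simp add: m_assoc[symmetric] int_pow_mult[symmetric])
  qed
  have "\<psi> \<in> hom (dihedral_group 4) G"
  proof (rule homI)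
    fix x y assume x: "x \<in> carrier (dihedral_group 4)" and y: "y \<in> carrier (dihedral_group 4)"
    obtain i s where xx: "x = (i, s)" by (cases x)
    obtain j r where yy: "y = (j, r)" by (cases y)
    have j: "j \<ge> 0" using y yy by (simp add: dihedral_simps)
    have P: "\<tau> [^] k \<in> carrier G" for k :: int using t by simp
    show "\<psi> x \<in> carrier G" using t u by (auto simp: \<psi>_def xx)
    show "\<psi> (x \<otimes>\<^bsub>dihedral_group 4\<^esub> y) = \<psi> x \<otimes> \<psi> y"
    proof (cases s)
      case False
      thus ?thesis using P u by (auto simp: xx yy dihedral_simps \<psi>_def mod4 int_pow_mult[OF t] m_assoc)
    next
      case True
      have e: "\<tau> [^] i \<otimes> \<iota> \<otimes> \<tau> [^] j = \<tau> [^] (i - j) \<otimes> \<iota>"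
      proof -
        have "\<tau> [^] i \<otimes> \<iota> \<otimes> \<tau> [^] j = \<tau> [^] i \<otimes> (\<tau> [^] (- j) \<otimes> \<iota>)" using P u conj[OF j] by (simp add: m_assoc)
        also have "\<dots> = \<tau> [^] (i + - j) \<otimes> \<iota>" using P u by (simp only: int_pow_mult[OF t] m_assoc)
        finally show ?thesis by simp
      qed
      show ?thesis
      proof (cases r)
        case True
        have "\<psi> x \<otimes> \<psi> y = (\<tau> [^] i \<otimes> \<iota> \<otimes> \<tau> [^] j) \<otimes> \<iota>"
          using P u \<open>s\<close> True by (simp add: \<psi>_def xx yy m_assoc)
        also have "\<dots> = \<tau> [^] (i - j)" unfolding e using P u u2 by (simp add: m_assoc)
        finally show ?thesis using \<open>s\<close> True P by (simp add: \<psi>_def xx yy dihedral_simps mod4)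
      next
        case False
        have "\<psi> x \<otimes> \<psi> y = \<tau> [^] i \<otimes> \<iota> \<otimes> \<tau> [^] j"
          using P u \<open>s\<close> False by (simp add: \<psi>_def xx yy)
        thus ?thesis unfolding e using \<open>s\<close> False by (simp add: \<psi>_def xx yy dihedral_simps mod4)
      qed
    qed
  qed
  moreover have "bij_betw \<psi> (carrier (dihedral_group 4)) (carrier G)"
    unfolding bij_betw_def dihedral_simps using inj surj t u by (auto simp: \<psi>_def)
  ultimately have "\<psi> \<in> iso (dihedral_group 4) G" by (simp add: iso_def)
  hence "dihedral_group 4 \<cong> G" by (auto simp: is_iso_def)
  moreover have "group (dihedral_group 4)" by (rule group_dihedral) simp
  ultimately show ?thesis using group.iso_sym by blast
qed

lemma cyclic_order_4:
  fixes G (structure)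
  assumes G: "group G" and cyc: "cyclic_group G" and ord: "Coset.order G = 4"
  obtains \<tau> where "\<tau> \<in> carrier G" "\<tau> \<otimes>\<^bsub>G\<^esub> \<tau> \<noteq> \<one>\<^bsub>G\<^esub>" "\<tau> \<otimes>\<^bsub>G\<^esub> \<tau> \<otimes>\<^bsub>G\<^esub> \<tau> \<otimes>\<^bsub>G\<^esub> \<tau> = \<one>\<^bsub>G\<^esub>"
    "carrier G = {\<one>\<^bsub>G\<^esub>, \<tau>, \<tau> \<otimes>\<^bsub>G\<^esub> \<tau>, \<tau> \<otimes>\<^bsub>G\<^esub> \<tau> \<otimes>\<^bsub>G\<^esub> \<tau>}"
proof -
  interpret group G by (rule G)
  obtain \<tau> where t: "\<tau> \<in> carrier G" and gen: "carrier G = range (\<lambda>n::int. \<tau> [^] n)" using cyc cyclic_group by blast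
  have p: "\<tau> [^] (2::nat) = \<tau> \<otimes> \<tau>" "\<tau> [^] (3::nat) = \<tau> \<otimes> \<tau> \<otimes> \<tau>" "\<tau> [^] (4::nat) = \<tau> \<otimes> \<tau> \<otimes> \<tau> \<otimes> \<tau>"
    using t by (simp_all add: numeral_eq_Suc)
  have t4: "\<tau> [^] (4::nat) = \<one>" using pow_order_eq_1[OF t] ord by simp
  have modn: "\<tau> [^] (k mod n) = \<tau> [^] k" if "\<tau> [^] n = \<one>" for k n :: int
  proof -
    have "\<tau> [^] k = \<tau> [^] (n * (k div n) + k mod n)" by simp
    also have "\<dots> = (\<tau> [^] n) [^] (k div n) \<otimes> \<tau> [^] (k mod n)" using t by (simp only: int_pow_mult int_pow_pow)
    finally show ?thesis using that t by simp
  qed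
  have i4: "\<tau> [^] (4::int) = \<one>" using t4 int_pow_int[of G \<tau> 4] by simp
  have i: "\<tau> [^] (0::int) = \<one>" "\<tau> [^] (1::int) = \<tau>" "\<tau> [^] (2::int) = \<tau> \<otimes> \<tau>" "\<tau> [^] (3::int) = \<tau> \<otimes> \<tau> \<otimes> \<tau>"
    using t p int_pow_int[of G \<tau> 2] int_pow_int[of G \<tau> 3] by simp_all
  have sub: "carrier G \<subseteq> {\<one>, \<tau>, \<tau> \<otimes> \<tau>, \<tau> \<otimes> \<tau> \<otimes> \<tau>}"
  proof
    fix g assume "g \<in> carrier G"
    then obtain k :: int where "g = \<tau> [^] k" using gen by auto
    hence g: "g = \<tau> [^] (k mod 4)" using modn[OF i4] by simp
    have "k mod 4 = 0 \<or> k mod 4 = 1 \<or> k mod 4 = 2 \<or> k mod 4 = 3" by presburger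
    thus "g \<in> {\<one>, \<tau>, \<tau> \<otimes> \<tau>, \<tau> \<otimes> \<tau> \<otimes> \<tau>}" using g i by auto
  qed
  have "\<tau> \<otimes> \<tau> \<noteq> \<one>"
  proof
    assume tt: "\<tau> \<otimes> \<tau> = \<one>"
    hence "carrier G \<subseteq> {\<one>, \<tau>}" using sub t by auto
    hence "card (carrier G) \<le> card {\<one>, \<tau>}" by (intro card_mono) auto
    also have "\<dots> \<le> 2" by (simp add: card_insert_if)
    finally show False using ord by (simp add: Coset.order_def)
  qed
  moreover have "\<tau> \<otimes> \<tau> \<otimes> \<tau> \<otimes> \<tau> = \<one>" using t4 p(3) by simp
  moreover have "carrier G = {\<one>, \<tau>, \<tau> \<otimes> \<tau>, \<tau> \<otimes> \<tau> \<otimes> \<tau>}"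
  proof
    show "{\<one>, \<tau>, \<tau> \<otimes> \<tau>, \<tau> \<otimes> \<tau> \<otimes> \<tau>} \<subseteq> carrier G" using t by simp
  qed (rule sub)
  ultimately show thesis by (rule that[OF t])
qed

section \<open>The Redei field\<close>

lemma fld_image:
  assumes "fld M" "hom_on M \<sigma>"
  shows "fld (\<sigma> ` M)"
  unfolding fld_def
proof (intro conjI ballI)
  note h = hom_on_simps[OF assms(2,1)] and c = fld_closed[OF assms(1)]
  show "1 \<in> \<sigma> ` M" using h(1) c(1) by (metis imageI)
  fix x assume "x \<in> \<sigma> ` M"
  then obtain x' where x: "x = \<sigma> x'" "x' \<in> M" by blast
  show "inverse x \<in> \<sigma> ` M" using h(10)[OF x(2)] c(7)[OF x(2)] x(1) by (metis imageI)
  fix y assume "y \<in> \<sigma> ` M"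
  then obtain y' where y: "y = \<sigma> y'" "y' \<in> M" by blast
  show "x - y \<in> \<sigma> ` M" using h(6)[OF x(2) y(2)] c(3)[OF x(2) y(2)] x(1) y(1) by (metis imageI)
  show "x * y \<in> \<sigma> ` M" using h(4)[OF x(2) y(2)] c(4)[OF x(2) y(2)] x(1) y(1) by (metis imageI)
qed

definition signed :: "bool \<Rightarrow> complex \<Rightarrow> complex" where "signed e x = (if e then - x else x)"

lemma signed_simps [simp]: "signed False x = x" "signed True x = - x" by (simp_all add: signed_def)

lemma signed_inject: "x \<noteq> 0 \<Longrightarrow> signed b x = signed c x \<longleftrightarrow> b = c"
  by (auto simp: signed_def)

context redei_data
begin

lemma F_least: "fld N \<Longrightarrow> w \<in> N \<Longrightarrow> z \<in> N \<Longrightarrow> t \<in> N \<Longrightarrow> F \<subseteq> N"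
  unfolding F_def K_def L1_def by (intro adj_least Rats_subset_fld)

lemma F_gens: "w \<in> F" "z \<in> F" "t \<in> F" "s2 \<in> F"
  using w_in z_in t_in L1_K K_F s2_in by auto

lemma t_s2: "t * s2 = z"
  using t_nonzero by (simp add: s2_def)

lemma s2_nonzero: "s2 \<noteq> 0"
  using t_s2 z2 p2 by auto

lemma hom_eq_F:
  assumes "hom_on F \<sigma>" "hom_on F \<tau>" "\<sigma> w = \<tau> w" "\<sigma> z = \<tau> z" "\<sigma> t = \<tau> t" "x \<in> F"
  shows "\<sigma> x = \<tau> x"
proof -
  let ?N = "{x \<in> F. \<sigma> x = \<tau> x}"
  note h = hom_on_simps[OF assms(1) fld_F] and h' = hom_on_simps[OF assms(2) fld_F]
  have "fld ?N" unfolding fld_def using h h' fld_closed[OF fld_F] by simp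
  hence "F \<subseteq> ?N" using assms F_gens by (intro F_least) auto
  thus ?thesis using assms(6) by blast
qed

lemma hom_image_F:
  assumes "hom_on F \<sigma>" "\<sigma> w \<in> F" "\<sigma> z \<in> F" "\<sigma> t \<in> F" "x \<in> F"
  shows "\<sigma> x \<in> F"
proof -
  let ?N = "{x \<in> F. \<sigma> x \<in> F}"
  note h = hom_on_simps[OF assms(1) fld_F] and c = fld_closed[OF fld_F]
  have "fld ?N" unfolding fld_def using h c by simp
  hence "F \<subseteq> ?N" using assms F_gens by (intro F_least) auto
  thus ?thesis using assms(5) by blast
qed

text \<open>A homomorphism is extended through the three quadratic steps. Changing the sign of \<open>\<surd>2\<close> turns \<open>\<pi>\<close>
  into \<open>\<pi>'\<close>, so \<open>t\<close> must then go to a square root of \<open>\<pi>'\<close>.\<close>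

lemma exists_hom:
  assumes d1: "d = 1"
  shows "\<exists>\<sigma>. hom_on F \<sigma> \<and> \<sigma> w = signed e1 w \<and> \<sigma> z = signed e2 z \<and> \<sigma> t = signed e3 (if e1 then s2 else t)"
proof -
  have i: "hom_on \<rat> (\<lambda>x. x)" by (simp add: hom_on_def)
  have w2r: "w\<^sup>2 \<in> \<rat>" by (simp add: w2)
  obtain s1 where s1: "hom_on L1 s1" "s1 w = signed e1 w" "\<And>x. x \<in> \<rat> \<Longrightarrow> s1 x = x"
    using hom_on_adj[OF fld_Rats w_notin w2r i, of "signed e1 w"] unfolding L1_def by (metis power2_minus signed_def)
  have "(signed e2 z)\<^sup>2 = s1 (z\<^sup>2)" using s1(3)[of "of_nat p"] by (simp add: z2 signed_def)
  then obtain s where s: "hom_on K s" "s z = signed e2 z" "\<And>x. x \<in> L1 \<Longrightarrow> s x = s1 x"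
    using hom_on_adj[OF fld_L1 z_notin z2_in s1(1), of "signed e2 z"] unfolding K_def by metis
  have sp: "s \<pi> = (if e1 then \<pi>' else \<pi>)"
  proof -
    have "s \<pi> = s1 \<pi>" using s(3) pi_in by blast
    also have "\<dots> = of_int a + of_int b * s1 w"
      unfolding \<pi>_def using hom_on_simps[OF s1(1) fld_L1] fld_closed[OF fld_L1] w_in by simp
    finally show ?thesis by (auto simp: s1(2) \<pi>_def \<pi>'_def)
  qed
  have "(signed e3 (if e1 then s2 else t))\<^sup>2 = s (t\<^sup>2)" using sp s2_square[OF d1] t2 d1 by (auto simp: signed_def)
  then obtain \<sigma> where \<sigma>: "hom_on F \<sigma>" "\<sigma> t = signed e3 (if e1 then s2 else t)" "\<And>x. x \<in> K \<Longrightarrow> \<sigma> x = s x"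
    using hom_on_adj[OF fld_K t_notin t2_in s(1), of "signed e3 (if e1 then s2 else t)"] unfolding F_def by metis
  have "\<sigma> w = signed e1 w" using \<sigma>(3) s(3) s1(2) w_in L1_K by auto
  moreover have "\<sigma> z = signed e2 z" using \<sigma>(3) s(2) z_in by auto
  ultimately show ?thesis using \<sigma> by blast
qed

text \<open>The eight automorphisms of \<open>F\<close>, indexed by the signs of the images of \<open>\<surd>2\<close>, \<open>\<surd>p\<close> and
  \<open>t\<close>.\<close>

definition aut :: "bool \<Rightarrow> bool \<Rightarrow> bool \<Rightarrow> complex \<Rightarrow> complex" where
  "aut e1 e2 e3 = restrict (SOME \<sigma>. hom_on F \<sigma> \<and> \<sigma> w = signed e1 w \<and> \<sigma> z = signed e2 z \<and> \<sigma> t = signed e3 (if e1 then s2 else t)) F"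

context
  assumes d1: "d = 1"
begin

lemma aut_hom: "hom_on F (aut e1 e2 e3)"
  and aut_w: "aut e1 e2 e3 w = signed e1 w" and aut_z: "aut e1 e2 e3 z = signed e2 z"
  and aut_t: "aut e1 e2 e3 t = signed e3 (if e1 then s2 else t)"
proof -
  define \<sigma> where "\<sigma> = (SOME \<sigma>. hom_on F \<sigma> \<and> \<sigma> w = signed e1 w \<and> \<sigma> z = signed e2 z \<and> \<sigma> t = signed e3 (if e1 then s2 else t))"
  have s: "hom_on F \<sigma> \<and> \<sigma> w = signed e1 w \<and> \<sigma> z = signed e2 z \<and> \<sigma> t = signed e3 (if e1 then s2 else t)"
    unfolding \<sigma>_def using someI_ex[OF exists_hom[OF d1]] .
  have e: "aut e1 e2 e3 = restrict \<sigma> F" unfolding aut_def \<sigma>_def ..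
  show "hom_on F (aut e1 e2 e3)" using s fld_closed[OF fld_F] unfolding e hom_on_def by simp
  show "aut e1 e2 e3 w = signed e1 w" "aut e1 e2 e3 z = signed e2 z" "aut e1 e2 e3 t = signed e3 (if e1 then s2 else t)"
    unfolding e using s F_gens by simp_all
qed

lemma aut_s2: "aut e1 e2 e3 s2 = signed (e2 \<noteq> e3) (if e1 then t else s2)"
proof -
  note h = hom_on_simps[OF aut_hom fld_F]
  have "aut e1 e2 e3 s2 = signed e2 z / signed e3 (if e1 then s2 else t)"
    unfolding s2_def using h(11)[OF F_gens(2,3)] by (simp add: aut_z aut_t s2_def)
  also have "\<dots> = signed (e2 \<noteq> e3) (if e1 then t else s2)"
    using t_nonzero s2_nonzero unfolding t_s2[symmetric] by (auto simp: signed_def)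
  finally show ?thesis .
qed

lemma aut_in_gal: "aut e1 e2 e3 \<in> carrier (gal \<rat> F)"
proof -
  let ?s = "aut e1 e2 e3"
  note h = hom_on_simps[OF aut_hom[of e1 e2 e3] fld_F] and c = fld_closed[OF fld_F]
  have sgF: "signed b x \<in> F" if "x \<in> F" for b x using that c(5) by (auto simp: signed_def)
  have sub: "?s x \<in> F" if "x \<in> F" for x
    by (rule hom_image_F[OF aut_hom _ _ _ that]) (simp_all add: aut_w aut_z aut_t sgF F_gens)
  have sgh: "?s (signed b x) = signed b (?s x)" if "x \<in> F" for b x using h(5)[OF that] by (auto simp: signed_def)
  have sgsg: "signed b (signed b x) = x" for b x by (auto simp: signed_def)
  have "w \<in> ?s ` F" by (rule image_eqI[of _ _ "signed e1 w"]) (simp_all add: sgh F_gens aut_w sgsg sgF)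
  moreover have "z \<in> ?s ` F" by (rule image_eqI[of _ _ "signed e2 z"]) (simp_all add: sgh F_gens aut_z sgsg sgF)
  moreover have "t \<in> ?s ` F"
  proof (cases e1)
    case True
    have "?s (signed (e2 \<noteq> e3) s2) = signed (e2 \<noteq> e3) (?s s2)" by (rule sgh[OF F_gens(4)])
    also have "\<dots> = t" unfolding aut_s2 sgsg using True by simp
    finally show ?thesis using sgF[OF F_gens(4)] by (metis imageI)
  next
    case False
    have "?s (signed e3 t) = signed e3 (?s t)" by (rule sgh[OF F_gens(3)])
    also have "\<dots> = t" unfolding aut_t sgsg using False by simp
    finally show ?thesis using sgF[OF F_gens(3)] by (metis imageI)
  qed
  ultimately have "F \<subseteq> ?s ` F" by (intro F_least fld_image[OF fld_F aut_hom])
  hence "?s ` F = F" using sub by blast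
  hence "restrict ?s F \<in> carrier (gal \<rat> F)"
    by (intro gal_memI[OF fld_F aut_hom] Rats_subset_fld[OF fld_F]) (use h(13) in auto)
  moreover have "restrict ?s F = ?s" by (simp add: aut_def)
  ultimately show ?thesis by simp
qed

lemma gal_elements:
  assumes "\<sigma> \<in> carrier (gal \<rat> F)"
  obtains e1 e2 e3 where "\<sigma> = aut e1 e2 e3"
proof -
  note m = gal_maps[OF fld_F assms]
  note h = hom_on_simps[OF m(2) fld_F]
  have sq: "x = y \<or> x = - y" if "x\<^sup>2 = y\<^sup>2" for x y :: complex using that by (simp add: power2_eq_iff)
  have "(\<sigma> w)\<^sup>2 = w\<^sup>2" using h(7)[OF F_gens(1), of 2] h(13)[of 2] by (simp add: w2)
  then obtain e1 where e1: "\<sigma> w = signed e1 w" using sq signed_simps by metis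
  have "(\<sigma> z)\<^sup>2 = z\<^sup>2" using h(7)[OF F_gens(2), of 2] h(8) by (simp add: z2)
  then obtain e2 where e2: "\<sigma> z = signed e2 z" using sq signed_simps by metis
  have "\<sigma> \<pi> = of_int a + of_int b * \<sigma> w"
    unfolding \<pi>_def using h fld_closed[OF fld_F] F_gens by simp
  hence "\<sigma> \<pi> = (if e1 then \<pi>' else \<pi>)" by (auto simp: e1 \<pi>_def \<pi>'_def)
  hence "(\<sigma> t)\<^sup>2 = (if e1 then s2 else t)\<^sup>2" using h(7)[OF F_gens(3), of 2] s2_square[OF d1] t2 d1 by auto
  then obtain e3 where e3: "\<sigma> t = signed e3 (if e1 then s2 else t)" using sq signed_simps by metis
  have "\<sigma> = aut e1 e2 e3"
    by (rule gal_eqI[OF fld_F assms aut_in_gal])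
      (rule hom_eq_F[OF m(2) aut_hom], simp_all add: aut_w aut_z aut_t e1 e2 e3)
  thus thesis using that by blast
qed

lemma nonzero_gens: "w \<noteq> 0" "z \<noteq> 0" "t \<noteq> s2" "t \<noteq> - s2"
proof -
  show "w \<noteq> 0" "z \<noteq> 0" using w2 z2 p2 by auto
  have "t \<noteq> s2 \<and> t \<noteq> - s2"
  proof (rule ccontr)
    assume "\<not> (t \<noteq> s2 \<and> t \<noteq> - s2)"
    hence "t\<^sup>2 = s2\<^sup>2" using power2_eq_iff[of t s2] by blast
    hence "\<pi> = \<pi>'" using t2 d1 s2_square[OF d1] by simp
    hence "of_int b * w = 0" by (auto simp: \<pi>_def \<pi>'_def)
    hence "b = 0" using \<open>w \<noteq> 0\<close> by simp
    hence "int p = a\<^sup>2" using ab by simp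
    hence "p = (nat \<bar>a\<bar>)\<^sup>2" by (metis nat_abs_int_diff nat_int nat_power_eq abs_ge_zero power2_abs)
    thus False using not_square_prime[OF p] by blast
  qed
  thus "t \<noteq> s2" "t \<noteq> - s2" by auto
qed

lemma aut_inject: "aut e1 e2 e3 = aut f1 f2 f3 \<longleftrightarrow> e1 = f1 \<and> e2 = f2 \<and> e3 = f3"
proof
  assume e: "aut e1 e2 e3 = aut f1 f2 f3"
  have "signed e1 w = signed f1 w" "signed e2 z = signed f2 z" using aut_w aut_z e by metis+
  hence 12: "e1 = f1" "e2 = f2" using signed_inject nonzero_gens by auto
  have "signed e3 (if e1 then s2 else t) = signed f3 (if f1 then s2 else t)" using aut_t e by metis
  hence "e3 = f3" using 12 signed_inject t_nonzero s2_nonzero by auto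
  thus "e1 = f1 \<and> e2 = f2 \<and> e3 = f3" using 12 by blast
qed auto

lemma aut_mult:
  "aut e1 e2 e3 \<otimes>\<^bsub>gal \<rat> F\<^esub> aut f1 f2 f3 =
     aut (e1 \<noteq> f1) (e2 \<noteq> f2) (f3 \<noteq> (if f1 then e2 \<noteq> e3 else e3))"
  (is "?l = ?r")
proof -
  interpret group "gal \<rat> F" by (rule group_gal[OF fld_F Rats_subset_fld[OF fld_F]])
  have l: "?l \<in> carrier (gal \<rat> F)" using aut_in_gal by blast
  note h = hom_on_simps[OF aut_hom[of e1 e2 e3] fld_F]
  have ap: "?l x = aut e1 e2 e3 (aut f1 f2 f3 x)" if "x \<in> F" for x
    using gal_mult_apply[OF fld_F aut_in_gal aut_in_gal that] .
  have sgh: "aut e1 e2 e3 (signed b x) = signed b (aut e1 e2 e3 x)" if "x \<in> F" for b x using h(5)[OF that] by (auto simp: signed_def)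
  have sgsg: "signed b (signed c x) = signed (b \<noteq> c) x" for b c x by (auto simp: signed_def)
  show ?thesis
  proof (rule gal_eqI[OF fld_F l aut_in_gal])
    fix x assume "x \<in> F"
    show "?l x = ?r x"
    proof (rule hom_eq_F[OF gal_maps(2)[OF fld_F l] aut_hom _ _ _ \<open>x \<in> F\<close>])
      show "?l w = ?r w" "?l z = ?r z"
        unfolding ap[OF F_gens(1)] ap[OF F_gens(2)] aut_w aut_z sgh[OF F_gens(1)] sgh[OF F_gens(2)] sgsg
        by (auto simp: signed_def)
      show "?l t = ?r t" unfolding ap[OF F_gens(3)] aut_t by (auto simp: sgh F_gens aut_t aut_s2 sgsg)
    qed
  qed
qed

lemma aut_one: "\<one>\<^bsub>gal \<rat> F\<^esub> = aut False False False"
proof -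
  interpret group "gal \<rat> F" by (rule group_gal[OF fld_F Rats_subset_fld[OF fld_F]])
  have "aut False False False \<otimes>\<^bsub>gal \<rat> F\<^esub> aut False False False = aut False False False" by (simp add: aut_mult)
  thus ?thesis using aut_in_gal l_cancel_one by metis
qed

text \<open>The automorphism that changes the signs of \<open>\<surd>2\<close> and \<open>\<surd>p\<close> sends \<open>t\<close> to \<open>\<surd>p / t\<close> and that to
  \<open>- t\<close>, so it has order \<open>4\<close>; the one that only changes the sign of \<open>\<surd>p\<close> is a reflection.\<close>

lemma gal_F_dihedral: "gal \<rat> F \<cong> dihedral_group 4"
proof (rule dihedral_isoI[of _ "aut True True False" "aut False True False"])
  let ?G = "gal \<rat> F" let ?t = "aut True True False"
  show G: "group ?G" by (rule group_gal[OF fld_F Rats_subset_fld[OF fld_F]])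
  interpret group ?G by (rule G)
  show "aut True True False \<in> carrier ?G" "aut False True False \<in> carrier ?G" by (rule aut_in_gal)+
  have p: "?t [^]\<^bsub>?G\<^esub> (0::int) = aut False False False" "?t [^]\<^bsub>?G\<^esub> (1::int) = ?t"
    "?t [^]\<^bsub>?G\<^esub> (2::int) = aut False False True" "?t [^]\<^bsub>?G\<^esub> (3::int) = aut True True True"
    "?t [^]\<^bsub>?G\<^esub> (4::int) = aut False False False"
  proof -
    have n: "?t [^]\<^bsub>?G\<^esub> (2::nat) = aut False False True" "?t [^]\<^bsub>?G\<^esub> (3::nat) = aut True True True"
      "?t [^]\<^bsub>?G\<^esub> (4::nat) = aut False False False" "?t [^]\<^bsub>?G\<^esub> (1::nat) = ?t"
      by (simp_all add: numeral_eq_Suc aut_one aut_mult)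
    show "?t [^]\<^bsub>?G\<^esub> (0::int) = aut False False False" by (simp add: aut_one)
    show "?t [^]\<^bsub>?G\<^esub> (1::int) = ?t" using aut_in_gal by simp
    show "?t [^]\<^bsub>?G\<^esub> (2::int) = aut False False True" "?t [^]\<^bsub>?G\<^esub> (3::int) = aut True True True"
      "?t [^]\<^bsub>?G\<^esub> (4::int) = aut False False False"
      using n int_pow_int[of ?G ?t 2] int_pow_int[of ?G ?t 3] int_pow_int[of ?G ?t 4] by simp_all
  qed
  show "?t [^]\<^bsub>?G\<^esub> (4::int) = \<one>\<^bsub>?G\<^esub>" by (simp add: p aut_one)
  show "aut False True False \<otimes>\<^bsub>?G\<^esub> aut False True False = \<one>\<^bsub>?G\<^esub>" by (simp add: aut_one aut_mult)
  show "?t \<otimes>\<^bsub>?G\<^esub> aut False True False \<otimes>\<^bsub>?G\<^esub> ?t = aut False True False" by (simp add: aut_mult)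
  define \<psi> where "\<psi> = (\<lambda>(i, s). ?t [^]\<^bsub>?G\<^esub> (i::int) \<otimes>\<^bsub>?G\<^esub> (if s then aut False True False else \<one>\<^bsub>?G\<^esub>))"
  have v: "\<psi> (0, False) = aut False False False" "\<psi> (0, True) = aut False True False"
    "\<psi> (1, False) = aut True True False" "\<psi> (1, True) = aut True False False"
    "\<psi> (2, False) = aut False False True" "\<psi> (2, True) = aut False True True"
    "\<psi> (3, False) = aut True True True" "\<psi> (3, True) = aut True False True"
    unfolding \<psi>_def case_prod_conv p by (simp_all add: aut_one aut_mult)
  have dom: "{0..<4::int} \<times> (UNIV :: bool set) = {(0, False), (0, True), (1, False), (1, True), (2, False), (2, True), (3, False), (3, True)}"
    by (auto simp: UNIV_bool int_interval_4)
  have "inj_on \<psi> ({0..<4::int} \<times> UNIV)" unfolding dom by (auto simp: inj_on_def v aut_inject)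
  thus "inj_on (\<lambda>(i, s). ?t [^]\<^bsub>?G\<^esub> i \<otimes>\<^bsub>?G\<^esub> (if s then aut False True False else \<one>\<^bsub>?G\<^esub>)) ({0..<4::int} \<times> UNIV)"
    unfolding \<psi>_def .
  have "carrier ?G \<subseteq> \<psi> ` ({0..<4::int} \<times> UNIV)"
  proof
    fix \<sigma> assume "\<sigma> \<in> carrier ?G"
    then obtain e1 e2 e3 where "\<sigma> = aut e1 e2 e3" by (rule gal_elements)
    thus "\<sigma> \<in> \<psi> ` ({0..<4::int} \<times> UNIV)"
      unfolding dom image_insert image_empty v by (cases e1; cases e2; cases e3) simp_all
  qed
  thus "carrier ?G \<subseteq> (\<lambda>(i, s). ?t [^]\<^bsub>?G\<^esub> i \<otimes>\<^bsub>?G\<^esub> (if s then aut False True False else \<one>\<^bsub>?G\<^esub>)) ` ({0..<4::int} \<times> UNIV)"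
    unfolding \<psi>_def .
qed

end

definition "E = adj \<rat> (w * z)"

lemma wz2: "(w * z)\<^sup>2 = of_nat (2 * p)" by (simp add: power_mult_distrib w2 z2)

lemma fld_E: "fld E" unfolding E_def by (rule fld_adj[OF fld_Rats]) (simp add: wz2)

lemma wz_in: "w * z \<in> E" unfolding E_def by (rule adj_gen[OF fld_Rats])

lemma E_K: "E \<subseteq> K" unfolding E_def
  using w_in L1_K z_in by (intro adj_least[OF fld_K] Rats_subset_fld[OF fld_K] fld_mult[OF fld_K]) auto

lemma w_notin_E: "w \<notin> E"
proof
  assume "w \<in> E"
  then obtain u v where uv: "u \<in> \<rat>" "v \<in> \<rat>" "w = u + v * (w * z)" by (auto simp: E_def adj_def)
  have "(v * w) * z = v * (w * z)" by simp
  hence "w + 0 * z = u + (v * w) * z" using uv(3) by (metis add.right_neutral mult_zero_left)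
  moreover have "u \<in> L1" "v * w \<in> L1" using uv Rats_L1 w_in fld_mult[OF fld_L1] by auto
  ultimately have "w = u" using adj_unique[OF fld_L1 z_notin w_in fld_0[OF fld_L1]] by blast
  thus False using w_notin uv by simp
qed

lemma generate_E: "generate_field CC {csq (2 * p)} = E"
proof (rule generate_field_eqI[OF fld_E])
  have e: "csq (2 * p) = w * z" unfolding w_def z_def by (simp add: real_sqrt_mult)
  show "{csq (2 * p)} \<subseteq> E" using wz_in e by simp
  show "E \<subseteq> N" if "fld N" "{csq (2 * p)} \<subseteq> N" for N
    unfolding E_def using that e by (intro adj_least Rats_subset_fld) auto
qed

lemma K_eq_adj_E: "K = adj E w"
proof
  show "adj E w \<subseteq> K" using adj_least[OF fld_K E_K] w_in L1_K by blast
  have f: "fld (adj E w)" by (rule fld_adj[OF fld_E]) (simp add: w2 fld_numeral[OF fld_E])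
  have w: "w \<in> adj E w" by (rule adj_gen[OF fld_E])
  have "w * z \<in> adj E w" using wz_in adj_subset[OF fld_E] by blast
  hence "(w * z) / w \<in> adj E w" using fld_divide[OF f _ w] by blast
  moreover have "w \<noteq> 0" using w2 by auto
  ultimately have z: "z \<in> adj E w" by simp
  show "K \<subseteq> adj E w" unfolding K_def L1_def using f w z by (intro adj_least Rats_subset_fld)
qed

lemma dim_E_F: "ring.dimension CC 4 E F"
proof -
  have "ring.dimension CC 2 E K" unfolding K_eq_adj_E by (rule dimension_adj[OF fld_E w_notin_E])
  from dimension_trans[OF fld_E fld_K this dims(3)] show ?thesis by simp
qed

context
  assumes d1: "d = 1"
begin

text \<open>For \<open>y = u + v t\<close> the square of the rotation sends \<open>t\<close> to \<open>- t\<close>, so \<open>v = 0\<close>; and on \<open>K\<close> the rotation is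
  the conjugation over \<open>\<rat>(\<surd>(2 p))\<close>.\<close>

lemma fixed_by_tau:
  assumes y: "y \<in> F" "aut True True False y = y"
  shows "y \<in> E"
proof -
  let ?t = "aut True True False"
  note h = hom_on_simps[OF aut_hom[OF d1, of True True False] fld_F]
  obtain u v where uv: "y = u + v * t" "u \<in> K" "v \<in> K" using y(1) by (auto simp: F_def adj_def)
  have KF: "x \<in> F" if "x \<in> K" for x using that K_F by blast
  have K2: "?t (?t x) = x" if "x \<in> K" for x
  proof -
    have "?t (?t x) = (?t \<otimes>\<^bsub>gal \<rat> F\<^esub> ?t) x" using gal_mult_apply[OF fld_F aut_in_gal[OF d1] aut_in_gal[OF d1]] KF[OF that] by simp
    also have "\<dots> = aut False False True x" by (simp add: aut_mult[OF d1])
    also have "\<dots> = x"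
    proof -
      let ?N = "{x \<in> F. aut False False True x = x}"
      note h' = hom_on_simps[OF aut_hom[OF d1, of False False True] fld_F]
      have "fld ?N" unfolding fld_def using h' fld_closed[OF fld_F] by simp
      moreover have "w \<in> ?N" "z \<in> ?N" using F_gens aut_w[OF d1] aut_z[OF d1] by simp_all
      ultimately have "K \<subseteq> ?N" unfolding K_def L1_def by (intro adj_least Rats_subset_fld)
      thus ?thesis using that by blast
    qed
    finally show ?thesis .
  qed
  have "?t (?t y) = u + v * (- t)"
  proof -
    have "?t (?t y) = ?t (?t u) + ?t (?t v) * ?t (?t t)"
      using uv KF F_gens h gal_maps(3)[OF fld_F aut_in_gal[OF d1]] fld_mult[OF fld_F] by simp
    thus ?thesis using K2 uv aut_t[OF d1] aut_s2[OF d1] by simp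
  qed
  hence "u + (- v) * t = u + v * t" using y(2) uv(1) by simp
  hence "- v = v" using adj_unique[OF fld_K t_notin uv(2) fld_minus[OF fld_K uv(3)] uv(2,3)] by blast
  hence yu: "y = u" using uv(1) by simp
  then obtain A B where AB: "y = A + B * z" "A \<in> L1" "B \<in> L1" using uv(2) by (auto simp: K_def adj_def)
  obtain a0 a1 where a: "a0 \<in> \<rat>" "a1 \<in> \<rat>" "A = a0 + a1 * w" using L1_E[OF AB(2)] by blast
  obtain b0 b1 where b: "b0 \<in> \<rat>" "b1 \<in> \<rat>" "B = b0 + b1 * w" using L1_E[OF AB(3)] by blast
  have QF: "x \<in> F" "?t x = x" if "x \<in> \<rat>" for x using that Rats_subset_fld[OF fld_F] h(13) by auto
  have c: "x * y \<in> F" "x + y \<in> F" if "x \<in> F" "y \<in> F" for x y using that fld_closed[OF fld_F] by auto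
  have "?t y = (a0 - a1 * w) + (- b0 + b1 * w) * z"
    unfolding AB(1) a(3) b(3) using a b QF F_gens c h aut_w[OF d1] aut_z[OF d1] by (simp add: algebra_simps)
  hence "(a0 + (- a1) * w) + (- b0 + b1 * w) * z = (a0 + a1 * w) + (b0 + b1 * w) * z"
    using y(2) AB(1) a(3) b(3) by simp
  moreover have "a0 + (- a1) * w \<in> L1" "- b0 + b1 * w \<in> L1" "a0 + a1 * w \<in> L1" "b0 + b1 * w \<in> L1"
    unfolding L1_def using a b
    by (auto simp only: intro!: adjI fld_minus[OF fld_Rats])
  ultimately have "a0 + (- a1) * w = a0 + a1 * w" "- b0 + b1 * w = b0 + b1 * w"
    using adj_unique[OF fld_L1 z_notin] by blast+
  hence "- a1 = a1" "- b0 = b0"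
    using adj_unique[OF fld_Rats w_notin a(1) fld_minus[OF fld_Rats a(2)] a(1,2)] adj_unique[OF fld_Rats w_notin fld_minus[OF fld_Rats b(1)] b(2) b(1,2)] by blast+
  hence "y = a0 + b1 * (w * z)" unfolding AB(1) a(3) b(3) by simp
  thus ?thesis unfolding E_def using a b by (auto intro: adjI)
qed

lemma galois_Q_F: "galois_extension \<rat> F"
  unfolding galois_extension_def subfield_CC_iff
proof (intro conjI)
  show "fld \<rat>" "fld F" "\<rat> \<subseteq> F" by (rule fld_Rats, rule fld_F, rule Rats_subset_fld[OF fld_F])
  show "ring.finite_dimension CC \<rat> F" by (rule finite_dimension_CC[OF dims(4)])
  show "{x \<in> F. \<forall>\<sigma>\<in>carrier (gal \<rat> F). \<sigma> x = x} = \<rat>"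
  proof
    show "\<rat> \<subseteq> {x \<in> F. \<forall>\<sigma>\<in>carrier (gal \<rat> F). \<sigma> x = x}"
      using Rats_subset_fld[OF fld_F] gal_maps(4)[OF fld_F] by blast
    show "{x \<in> F. \<forall>\<sigma>\<in>carrier (gal \<rat> F). \<sigma> x = x} \<subseteq> \<rat>"
    proof clarify
      fix y assume y: "y \<in> F" "\<forall>\<sigma>\<in>carrier (gal \<rat> F). \<sigma> y = y"
      hence "y \<in> E" using fixed_by_tau aut_in_gal[OF d1] by blast
      then obtain u v where uv: "u \<in> \<rat>" "v \<in> \<rat>" "y = u + v * (w * z)" by (auto simp: E_def adj_def)
      let ?i = "aut False True False"
      note h = hom_on_simps[OF aut_hom[OF d1, of False True False] fld_F]
      have QF: "x \<in> F" "?i x = x" if "x \<in> \<rat>" for x using that Rats_subset_fld[OF fld_F] h(13) by auto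
      have c: "x * y \<in> F" "x + y \<in> F" if "x \<in> F" "y \<in> F" for x y using that fld_closed[OF fld_F] by auto
      have "?i y = u - v * (w * z)"
        unfolding uv(3) using uv QF F_gens c h aut_w[OF d1] aut_z[OF d1] by simp
      moreover have "?i y = y" using y(2) aut_in_gal[OF d1] by blast
      ultimately have "v * (w * z) = 0" using uv(3) by auto
      hence "v = 0" using nonzero_gens[OF d1] by simp
      thus "y \<in> \<rat>" using uv by simp
    qed
  qed
qed

lemma gal_E_F_carrier:
  "carrier (gal E F) = {aut False False False, aut True True False, aut False False True, aut True True True}"
proof -
  have "\<sigma> \<in> carrier (gal E F) \<longleftrightarrow> \<sigma> \<in> carrier (gal \<rat> F) \<and> \<sigma> (w * z) = w * z" for \<sigma>
  proof
    assume "\<sigma> \<in> carrier (gal E F)"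
    thus "\<sigma> \<in> carrier (gal \<rat> F) \<and> \<sigma> (w * z) = w * z"
      using wz_in Rats_subset_fld[OF fld_E] by (auto simp: gal_iff[OF fld_F])
  next
    assume s: "\<sigma> \<in> carrier (gal \<rat> F) \<and> \<sigma> (w * z) = w * z"
    hence s': "\<sigma> \<in> carrier (gal \<rat> F)" by blast
    let ?N = "{x \<in> F. \<sigma> x = x}"
    note h = hom_on_simps[OF gal_maps(2)[OF fld_F s'] fld_F]
    have "fld ?N" unfolding fld_def using h fld_closed[OF fld_F] by simp
    moreover have "w * z \<in> ?N" using s F_gens fld_mult[OF fld_F] by simp
    ultimately have "E \<subseteq> ?N" unfolding E_def by (intro adj_least Rats_subset_fld)
    thus "\<sigma> \<in> carrier (gal E F)" using s by (auto simp: gal_iff[OF fld_F])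
  qed
  moreover have "aut e1 e2 e3 (w * z) = w * z \<longleftrightarrow> e1 = e2" for e1 e2 e3
  proof -
    have "aut e1 e2 e3 (w * z) = signed e1 w * signed e2 z"
      using hom_mult[OF aut_hom[OF d1] fld_F F_gens(1,2)] aut_w[OF d1] aut_z[OF d1] by simp
    thus ?thesis using nonzero_gens[OF d1] by (auto simp: signed_def)
  qed
  ultimately have 1: "\<sigma> \<in> carrier (gal E F) \<longleftrightarrow> (\<exists>e e3. \<sigma> = aut e e e3)" for \<sigma>
  proof -
    assume g: "\<And>\<sigma>. \<sigma> \<in> carrier (gal E F) \<longleftrightarrow> \<sigma> \<in> carrier (gal \<rat> F) \<and> \<sigma> (w * z) = w * z"
      and e: "\<And>e1 e2 e3. aut e1 e2 e3 (w * z) = w * z \<longleftrightarrow> e1 = e2"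
    show "\<sigma> \<in> carrier (gal E F) \<longleftrightarrow> (\<exists>e e3. \<sigma> = aut e e e3)"
    proof
      assume "\<sigma> \<in> carrier (gal E F)"
      hence s: "\<sigma> \<in> carrier (gal \<rat> F)" "\<sigma> (w * z) = w * z" using g by auto
      obtain e1 e2 e3 where "\<sigma> = aut e1 e2 e3" by (rule gal_elements[OF d1 s(1)])
      thus "\<exists>e e3. \<sigma> = aut e e e3" using s(2) e by auto
    next
      assume "\<exists>e e3. \<sigma> = aut e e e3"
      thus "\<sigma> \<in> carrier (gal E F)" using g e aut_in_gal[OF d1] by auto
    qed
  qed
  show ?thesis
  proof (rule equalityI; rule subsetI)
    fix \<sigma> assume "\<sigma> \<in> carrier (gal E F)"
    then obtain e e3 where "\<sigma> = aut e e e3" using 1 by blast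
    thus "\<sigma> \<in> {aut False False False, aut True True False, aut False False True, aut True True True}"
      by (cases e; cases e3) auto
  next
    fix \<sigma> assume "\<sigma> \<in> {aut False False False, aut True True False, aut False False True, aut True True True}"
    thus "\<sigma> \<in> carrier (gal E F)" unfolding 1 by auto
  qed
qed

lemma galois_E_F: "galois_extension E F"
  unfolding galois_extension_def subfield_CC_iff
proof (intro conjI)
  show "fld E" "fld F" "E \<subseteq> F" using fld_E fld_F E_K K_F by auto
  show "ring.finite_dimension CC E F" by (rule finite_dimension_CC[OF dim_E_F])
  show "{x \<in> F. \<forall>\<sigma>\<in>carrier (gal E F). \<sigma> x = x} = E"
  proof
    show "E \<subseteq> {x \<in> F. \<forall>\<sigma>\<in>carrier (gal E F). \<sigma> x = x}"
      using E_K K_F gal_maps(4)[OF fld_F] by blast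
    show "{x \<in> F. \<forall>\<sigma>\<in>carrier (gal E F). \<sigma> x = x} \<subseteq> E"
      using fixed_by_tau gal_E_F_carrier by blast
  qed
qed

lemma gal_E_F_mult: "\<sigma> \<in> carrier (gal \<rat> F) \<Longrightarrow> \<tau> \<in> carrier (gal \<rat> F) \<Longrightarrow> \<sigma> \<otimes>\<^bsub>gal E F\<^esub> \<tau> = \<sigma> \<otimes>\<^bsub>gal \<rat> F\<^esub> \<tau>"
  using gal_maps(1)[OF fld_F] by (simp add: gal_mult)

lemma gal_E_F_cyclic: "cyclic_group (gal E F)" "Coset.order (gal E F) = 4"
proof -
  show "Coset.order (gal E F) = 4" unfolding Coset.order_def gal_E_F_carrier by (simp add: aut_inject[OF d1])
  have EF: "E \<subseteq> F" using E_K K_F by blast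
  interpret group "gal E F" by (rule group_gal[OF fld_F EF])
  let ?G = "gal E F" let ?t = "aut True True False"
  have m: "aut e1 e2 e3 \<otimes>\<^bsub>?G\<^esub> aut f1 f2 f3 = aut (e1 \<noteq> f1) (e2 \<noteq> f2) (f3 \<noteq> (if f1 then e2 \<noteq> e3 else e3))" for e1 e2 e3 f1 f2 f3
    using gal_E_F_mult[OF aut_in_gal[OF d1] aut_in_gal[OF d1]] aut_mult[OF d1] by simp
  have o: "\<one>\<^bsub>?G\<^esub> = aut False False False" using aut_one[OF d1] by (simp add: gal_one)
  have t: "?t \<in> carrier ?G" unfolding gal_E_F_carrier by blast
  have n: "?t [^]\<^bsub>?G\<^esub> (0::nat) = aut False False False" "?t [^]\<^bsub>?G\<^esub> (1::nat) = ?t"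
    "?t [^]\<^bsub>?G\<^esub> (2::nat) = aut False False True" "?t [^]\<^bsub>?G\<^esub> (3::nat) = aut True True True"
    by (simp_all add: numeral_eq_Suc o m)
  have "carrier ?G \<subseteq> range (\<lambda>n::int. ?t [^]\<^bsub>?G\<^esub> n)"
  proof -
    have "?t [^]\<^bsub>?G\<^esub> k \<in> range (\<lambda>n::int. ?t [^]\<^bsub>?G\<^esub> n)" for k :: nat
      by (metis int_pow_int rangeI)
    thus ?thesis unfolding gal_E_F_carrier using n by (metis empty_subsetI insert_subset)
  qed
  moreover have "range (\<lambda>n::int. ?t [^]\<^bsub>?G\<^esub> n) \<subseteq> carrier ?G" using t by auto
  ultimately show "cyclic_group ?G" unfolding cyclic_group using t by blast
qed

lemma redei_extension_F: "redei_extension p F"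
  unfolding redei_extension_def Let_def generate_K generate_E subfield_CC_iff
  using fld_F K_F dims(3) galois_Q_F gal_F_dihedral[OF d1] galois_E_F gal_E_F_cyclic unramified_F[OF d1] by blast

end

end

section \<open>Uniqueness of the Redei extension\<close>

context redei_data
begin

text \<open>The generator \<open>\<tau>\<close> of the cyclic group over \<open>E = \<rat>(\<surd>(2 p))\<close> is a rotation; any element that moves
  \<open>\<surd>(2 p)\<close> is a reflection. Composing it with \<open>\<tau>\<close> if necessary gives a reflection \<open>j\<close> that fixes
  \<open>\<surd>2\<close>.\<close>

lemma galois_data:
  assumes R: "redei_extension p M"
  obtains \<tau> j where "fld M" "K \<subseteq> M" "unramified_at_finite_primes K M"
    "hom_on M \<tau>" "\<And>x. x \<in> M \<Longrightarrow> \<tau> x \<in> M" "\<And>x. x \<in> M \<Longrightarrow> \<tau> (\<tau> (\<tau> (\<tau> x))) = x" "\<exists>x\<in>M. \<tau> (\<tau> x) \<noteq> x"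
    "\<And>x. x \<in> M \<Longrightarrow> \<tau> x = x \<Longrightarrow> x \<in> E"
    "hom_on M j" "\<And>x. x \<in> M \<Longrightarrow> j x \<in> M" "\<And>x. x \<in> M \<Longrightarrow> j (j x) = x" "\<And>x. x \<in> M \<Longrightarrow> \<tau> (j (\<tau> x)) = j x"
    "\<tau> w = - w" "\<tau> z = - z" "j w = w" "j z = - z"
proof -
  from R have M: "fld M" and KM: "K \<subseteq> M" and gQ: "galois_extension \<rat> M" and D4: "gal \<rat> M \<cong> dihedral_group 4"
    and gE: "galois_extension E M" and cyc: "cyclic_group (gal E M)" and ord: "Coset.order (gal E M) = 4"
    and unr: "unramified_at_finite_primes K M"
    unfolding redei_extension_def Let_def generate_K generate_E subfield_CC_iff by blast+
  have QM: "\<rat> \<subseteq> M" by (rule Rats_subset_fld[OF M])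
  have EM: "E \<subseteq> M" using E_K KM by blast
  have gens: "w \<in> M" "z \<in> M" "w * z \<in> M" using w_in L1_K z_in KM wz_in EM by auto
  have GE: "group (gal E M)" and GQ: "group (gal \<rat> M)" by (rule group_gal[OF M EM], rule group_gal[OF M QM])
  have EQ: "\<sigma> \<in> carrier (gal \<rat> M)" if "\<sigma> \<in> carrier (gal E M)" for \<sigma>
    using that Rats_subset_fld[OF fld_E] by (auto simp: gal_iff[OF M])
  have mEQ: "\<sigma> \<otimes>\<^bsub>gal E M\<^esub> \<rho> = \<sigma> \<otimes>\<^bsub>gal \<rat> M\<^esub> \<rho>" if "\<sigma> \<in> carrier (gal \<rat> M)" "\<rho> \<in> carrier (gal \<rat> M)" for \<sigma> \<rho>
    using gal_maps(1)[OF M that(1)] gal_maps(1)[OF M that(2)] by (simp add: gal_mult)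
  have oEQ: "\<one>\<^bsub>gal E M\<^esub> = \<one>\<^bsub>gal \<rat> M\<^esub>" by (simp add: gal_one)
  obtain \<tau> where t: "\<tau> \<in> carrier (gal E M)" and t2: "\<tau> \<otimes>\<^bsub>gal E M\<^esub> \<tau> \<noteq> \<one>\<^bsub>gal E M\<^esub>"
    and t4: "\<tau> \<otimes>\<^bsub>gal E M\<^esub> \<tau> \<otimes>\<^bsub>gal E M\<^esub> \<tau> \<otimes>\<^bsub>gal E M\<^esub> \<tau> = \<one>\<^bsub>gal E M\<^esub>"
    and tc: "carrier (gal E M) = {\<one>\<^bsub>gal E M\<^esub>, \<tau>, \<tau> \<otimes>\<^bsub>gal E M\<^esub> \<tau>, \<tau> \<otimes>\<^bsub>gal E M\<^esub> \<tau> \<otimes>\<^bsub>gal E M\<^esub> \<tau>}"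
    by (rule cyclic_order_4[OF GE cyc ord])
  interpret GE: group "gal E M" by (rule GE)
  interpret GQ: group "gal \<rat> M" by (rule GQ)
  note mt = gal_maps[OF M t]
  note tt = GE.m_closed[OF t t] and ttt = GE.m_closed[OF GE.m_closed[OF t t] t]
  have a2: "(\<tau> \<otimes>\<^bsub>gal E M\<^esub> \<tau>) x = \<tau> (\<tau> x)" if "x \<in> M" for x using gal_mult_apply[OF M t t that] .
  have a3: "(\<tau> \<otimes>\<^bsub>gal E M\<^esub> \<tau> \<otimes>\<^bsub>gal E M\<^esub> \<tau>) x = \<tau> (\<tau> (\<tau> x))" if "x \<in> M" for x
    using gal_mult_apply[OF M tt t that] a2[OF mt(3)[OF that]] by simp
  have a4: "\<tau> (\<tau> (\<tau> (\<tau> x))) = x" if "x \<in> M" for x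
    using gal_mult_apply[OF M ttt t that] a3[OF mt(3)[OF that]] t4 that by (simp add: gal_one)
  have ne: "\<exists>x\<in>M. \<tau> (\<tau> x) \<noteq> x"
  proof (rule ccontr)
    assume "\<not> (\<exists>x\<in>M. \<tau> (\<tau> x) \<noteq> x)"
    hence "(\<tau> \<otimes>\<^bsub>gal E M\<^esub> \<tau>) x = \<one>\<^bsub>gal E M\<^esub> x" if "x \<in> M" for x using a2[OF that] that by (simp add: gal_one)
    hence "\<tau> \<otimes>\<^bsub>gal E M\<^esub> \<tau> = \<one>\<^bsub>gal E M\<^esub>" by (rule gal_eqI[OF M tt GE.one_closed])
    thus False using t2 by blast
  qed
  have fE: "x \<in> E" if x: "x \<in> M" "\<tau> x = x" for x
  proof -
    have "\<sigma> x = x" if "\<sigma> \<in> carrier (gal E M)" for \<sigma>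
      using that x a2[OF x(1)] a3[OF x(1)] unfolding tc by (auto simp: gal_one)
    thus ?thesis using gE x(1) unfolding galois_extension_def by blast
  qed
  have sq: "x = y \<or> x = - y" if "x\<^sup>2 = y\<^sup>2" for x y :: complex using that by (simp add: power2_eq_iff)
  have sqw: "\<sigma> w = w \<or> \<sigma> w = - w" and sqz: "\<sigma> z = z \<or> \<sigma> z = - z" if "\<sigma> \<in> carrier (gal \<rat> M)" for \<sigma>
  proof -
    note h = hom_on_simps[OF gal_maps(2)[OF M that] M]
    show "\<sigma> w = w \<or> \<sigma> w = - w" by (rule sq) (use h(7)[OF gens(1), of 2] h(13)[of 2] in \<open>simp add: w2\<close>)
    show "\<sigma> z = z \<or> \<sigma> z = - z" by (rule sq) (use h(7)[OF gens(2), of 2] h(8) in \<open>simp add: z2\<close>)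
  qed
  have w0: "w \<noteq> 0" "z \<noteq> 0" using w2 z2 p2 by auto
  have twz: "\<tau> (w * z) = w * z" using mt(4)[OF wz_in] .
  have tm: "\<tau> (w * z) = \<tau> w * \<tau> z" by (rule hom_mult[OF mt(2) M gens(1,2)])
  have "\<tau> w \<noteq> w" using fE[OF gens(1)] w_notin_E by blast
  hence tw: "\<tau> w = - w" using sqw[OF EQ[OF t]] by blast
  hence tz: "\<tau> z = - z" using twz tm w0 sqz[OF EQ[OF t]] by auto
  have "w * z \<notin> \<rat>"
  proof
    assume "w * z \<in> \<rat>"
    hence "(w * z) / w \<in> L1" using Rats_L1 fld_divide[OF fld_L1 _ w_in] by blast
    thus False using z_notin w0 by simp
  qed
  then obtain \<iota> where i: "\<iota> \<in> carrier (gal \<rat> M)" "\<iota> (w * z) \<noteq> w * z"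
    using gQ gens(3) unfolding galois_extension_def by blast
  note mi = gal_maps[OF M i(1)]
  have wz_fix: "\<one>\<^bsub>gal \<rat> M\<^esub> (w * z) = w * z" "(\<tau> \<otimes>\<^bsub>gal \<rat> M\<^esub> \<tau>) (w * z) = w * z"
    "(\<tau> \<otimes>\<^bsub>gal \<rat> M\<^esub> \<tau> \<otimes>\<^bsub>gal \<rat> M\<^esub> \<tau>) (w * z) = w * z"
    using gens(3) twz gal_mult_apply[OF M EQ[OF t] EQ[OF t]] gal_mult_apply[OF M GQ.m_closed[OF EQ[OF t] EQ[OF t]] EQ[OF t]]
    by (simp_all add: gal_one)
  have "\<tau> \<otimes>\<^bsub>gal \<rat> M\<^esub> \<tau> \<noteq> \<one>\<^bsub>gal \<rat> M\<^esub>" using t2 mEQ[OF EQ[OF t] EQ[OF t]] oEQ by simp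
  moreover have "\<iota> \<noteq> \<one>\<^bsub>gal \<rat> M\<^esub>" "\<iota> \<noteq> \<tau>" "\<iota> \<noteq> \<tau> \<otimes>\<^bsub>gal \<rat> M\<^esub> \<tau>" "\<iota> \<noteq> \<tau> \<otimes>\<^bsub>gal \<rat> M\<^esub> \<tau> \<otimes>\<^bsub>gal \<rat> M\<^esub> \<tau>"
    using i(2) wz_fix twz by auto
  ultimately have rel: "\<iota> \<otimes>\<^bsub>gal \<rat> M\<^esub> \<iota> = \<one>\<^bsub>gal \<rat> M\<^esub>" "\<tau> \<otimes>\<^bsub>gal \<rat> M\<^esub> \<iota> \<otimes>\<^bsub>gal \<rat> M\<^esub> \<tau> = \<iota>"
    using dihedral_4_relations[OF GQ D4 EQ[OF t] i(1)] by blast+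
  have ii: "\<iota> (\<iota> x) = x" if "x \<in> M" for x
    using gal_mult_apply[OF M i(1) i(1) that] rel(1) that by (simp add: gal_one)
  have tit: "\<tau> (\<iota> (\<tau> x)) = \<iota> x" if "x \<in> M" for x
    using gal_mult_apply[OF M GQ.m_closed[OF EQ[OF t] i(1)] EQ[OF t] that]
      gal_mult_apply[OF M EQ[OF t] i(1) mt(3)[OF that]] rel(2) by simp
  have im: "\<iota> (w * z) = \<iota> w * \<iota> z" by (rule hom_mult[OF mi(2) M gens(1,2)])
  show thesis
  proof (cases "\<iota> w = w")
    case True
    hence "\<iota> z = - z" using i(2) im sqz[OF i(1)] by auto
    show thesis
      by (rule that[OF M KM unr mt(2,3) a4 ne fE mi(2,3) ii tit tw tz True \<open>\<iota> z = - z\<close>])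
  next
    case False
    hence iw: "\<iota> w = - w" using sqw[OF i(1)] by blast
    hence iz: "\<iota> z = z" using i(2) im sqz[OF i(1)] by auto
    let ?j = "\<lambda>x. \<tau> (\<iota> x)"
    have jh: "hom_on M ?j" using mt(2,3) mi(2,3) unfolding hom_on_def by simp
    have jm: "?j x \<in> M" if "x \<in> M" for x using mt(3)[OF mi(3)[OF that]] .
    have jj: "?j (?j x) = x" if "x \<in> M" for x using tit[OF mi(3)[OF that]] ii[OF that] by simp
    have tjt: "\<tau> (?j (\<tau> x)) = ?j x" if "x \<in> M" for x using tit[OF that] by simp
    have jw: "?j w = w" using iw tw hom_minus[OF mt(2) M gens(1)] by simp
    have jz: "?j z = - z" using iz tz by simp
    show thesis by (rule that[OF M KM unr mt(2,3) a4 ne fE jh jm jj tjt tw tz jw jz])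
  qed
qed

lemma E_fixed_Rats:
  assumes "y \<in> E" "fld M" "K \<subseteq> M" "hom_on M j" "j w = w" "j z = - z" "j y = y"
  shows "y \<in> \<rat>"
proof -
  obtain u v where uv: "u \<in> \<rat>" "v \<in> \<rat>" "y = u + v * (w * z)" using assms(1) by (auto simp: E_def adj_def)
  note h = hom_on_simps[OF assms(4,2)]
  have QM: "x \<in> M" "j x = x" if "x \<in> \<rat>" for x using that Rats_subset_fld[OF assms(2)] h(13) by auto
  have gens: "w \<in> M" "z \<in> M" using w_in L1_K z_in assms(3) by auto
  have "j y = u - v * (w * z)"
    unfolding uv(3) using uv QM gens h assms(5,6) fld_mult[OF assms(2)] by simp
  hence "v * (w * z) = 0" using assms(7) uv(3) by auto
  moreover have "w \<noteq> 0" "z \<noteq> 0" using w2 z2 p2 by auto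
  ultimately have "v = 0" by simp
  thus ?thesis using uv by simp
qed

text \<open>The generator \<open>m\<close> is chosen with \<open>\<tau>\<^sup>2 m = - m\<close> and \<open>j m = m\<close>. Its square is then fixed by \<open>\<tau>\<^sup>2\<close> and
  \<open>j\<close>, hence lies in \<open>\<rat>(\<surd>2)\<close>, and \<open>m \<tau> m \<surd>p\<close> is fixed by \<open>\<tau>\<close> and \<open>j\<close>, hence rational: the norm of
  \<open>m\<^sup>2\<close> is a rational square up to the factor \<open>p\<close>.\<close>

lemma kummer_generator:
  assumes R: "redei_extension p M"
  obtains m k u v where "m \<noteq> 0" "M = adj K m" "unramified_at_finite_primes K M"
    "u \<in> \<rat>" "v \<in> \<rat>" "m\<^sup>2 = u + v * w" "k \<in> \<rat>" "(u + v * w) * (u - v * w) * of_nat p = k\<^sup>2"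
proof (rule galois_data[OF R])
  fix \<tau> j
  assume M: "fld M" and KM: "K \<subseteq> M" and unr: "unramified_at_finite_primes K M"
    and th: "hom_on M \<tau>" and tm: "\<And>x. x \<in> M \<Longrightarrow> \<tau> x \<in> M" and t4: "\<And>x. x \<in> M \<Longrightarrow> \<tau> (\<tau> (\<tau> (\<tau> x))) = x" and ne: "\<exists>x\<in>M. \<tau> (\<tau> x) \<noteq> x"
    and fE: "\<And>x. x \<in> M \<Longrightarrow> \<tau> x = x \<Longrightarrow> x \<in> E"
    and jh: "hom_on M j" and jm: "\<And>x. x \<in> M \<Longrightarrow> j x \<in> M" and jj: "\<And>x. x \<in> M \<Longrightarrow> j (j x) = x"
    and tjt: "\<And>x. x \<in> M \<Longrightarrow> \<tau> (j (\<tau> x)) = j x"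
    and tw: "\<tau> w = - w" and tz: "\<tau> z = - z" and jw: "j w = w" and jz: "j z = - z"
  note c = fld_closed[OF M] and h = hom_on_simps[OF th M] and g = hom_on_simps[OF jh M]
  have gens: "w \<in> M" "z \<in> M" using w_in L1_K z_in KM by auto
  have w0: "w \<noteq> 0" "z \<noteq> 0" using w2 z2 p2 by auto
  have fQ: "y \<in> \<rat>" if "y \<in> M" "\<tau> y = y" "j y = y" for y
    using E_fixed_Rats[OF fE[OF that(1,2)] M KM jh jw jz that(3)] .
  have jt: "j (\<tau> x) = \<tau> (\<tau> (\<tau> (j x)))" if "x \<in> M" for x
    using t4[OF jm[OF tm[OF that]]] tjt[OF that] by simp
  have jtt: "j (\<tau> (\<tau> x)) = \<tau> (\<tau> (j x))" if "x \<in> M" for x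
    using jt[OF tm[OF that]] jt[OF that] t4[OF tm[OF tm[OF jm[OF that]]]] by simp
  have "\<exists>m\<in>M. m \<noteq> 0 \<and> j m = m \<and> \<tau> (\<tau> m) = - m"
  proof -
    obtain x where x: "x \<in> M" "\<tau> (\<tau> x) \<noteq> x" using ne by blast
    \<comment> \<open>\<open>x1\<close> is in the \<open>-1\<close> eigenspace of \<open>\<tau>\<^sup>2\<close>, on which \<open>j\<close> acts; if \<open>x1\<close> is a \<open>-1\<close> eigenvector of \<open>j\<close> then \<open>\<tau> x1\<close> is fixed by \<open>j\<close>\<close>
    define x1 where "x1 = x - \<tau> (\<tau> x)"
    have x1: "x1 \<in> M" "x1 \<noteq> 0" using x tm c(3) by (auto simp: x1_def)
    have x1t: "\<tau> (\<tau> x1) = - x1" using x(1) tm t4 h by (simp add: x1_def)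
    show ?thesis
    proof (cases "x1 + j x1 = 0")
      case False
      have "j (x1 + j x1) = x1 + j x1"
        using g(3)[OF x1(1) jm[OF x1(1)]] jj[OF x1(1)] by (simp add: add.commute)
      moreover have "\<tau> (\<tau> (x1 + j x1)) = - (x1 + j x1)"
        using h(3)[OF x1(1) jm[OF x1(1)]] h(3)[OF tm[OF x1(1)] tm[OF jm[OF x1(1)]]] g(5)[OF x1(1)]
          jtt[OF x1(1)] x1t by simp
      moreover have "x1 + j x1 \<in> M" using c(6)[OF x1(1) jm[OF x1(1)]] .
      ultimately show ?thesis using False by blast
    next
      case True
      hence jx: "j x1 = - x1" by (simp add: add_eq_0_iff)
      have "j (\<tau> x1) = \<tau> x1" using jt[OF x1(1)] jx h x1(1) tm x1t by simp
      moreover have "\<tau> (\<tau> (\<tau> x1)) = - \<tau> x1" using x1t h x1(1) by simp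
      moreover have "\<tau> x1 \<noteq> 0" using h(12)[OF x1(1)] x1(2) by blast
      ultimately show ?thesis using tm[OF x1(1)] by blast
    qed
  qed
  then obtain m where m: "m \<in> M" "m \<noteq> 0" "j m = m" "\<tau> (\<tau> m) = - m" by blast
  define \<mu> where "\<mu> = m\<^sup>2"
  have mu: "\<mu> \<in> M" using c(9) m by (simp add: \<mu>_def)
  have tm': "\<tau> m \<in> M" using tm m by blast
  have tmu: "\<tau> \<mu> = (\<tau> m)\<^sup>2" "\<tau> (\<tau> \<mu>) = \<mu>" "j \<mu> = \<mu>" 
    using h(7)[OF m(1), of 2] h(7)[OF tm', of 2] g(7)[OF m(1), of 2] m(3,4) by (simp_all add: \<mu>_def)
  have jtm: "j (\<tau> m) = - \<tau> m" by (simp only: jt[OF m(1)] m(3,4) h(5)[OF m(1)])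
  have jtmu: "j (\<tau> \<mu>) = \<tau> \<mu>" using tmu(1) g(7)[OF tm', of 2] jtm by simp
  have tmuM: "\<tau> \<mu> \<in> M" using tm mu by blast
  have A: "\<mu> + \<tau> \<mu> \<in> \<rat>"
    by (rule fQ) (use c(6)[OF mu tmuM] h(3)[OF mu tmuM] g(3)[OF mu tmuM] tmu(2,3) jtmu in \<open>simp_all add: add.commute\<close>)
  have B: "(\<mu> - \<tau> \<mu>) * w \<in> \<rat>"
  proof (rule fQ)
    have d: "\<mu> - \<tau> \<mu> \<in> M" using c(3)[OF mu tmuM] .
    show "(\<mu> - \<tau> \<mu>) * w \<in> M" using c(4)[OF d gens(1)] .
    show "\<tau> ((\<mu> - \<tau> \<mu>) * w) = (\<mu> - \<tau> \<mu>) * w"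
      unfolding h(4)[OF d gens(1)] h(6)[OF mu tmuM] tmu(2) tw by (simp add: algebra_simps)
    show "j ((\<mu> - \<tau> \<mu>) * w) = (\<mu> - \<tau> \<mu>) * w"
      unfolding g(4)[OF d gens(1)] g(6)[OF mu tmuM] tmu(3) jtmu jw by (rule refl)
  qed
  define u v where "u = (\<mu> + \<tau> \<mu>) / 2" and "v = (\<mu> - \<tau> \<mu>) * w / 4"
  have uv: "u \<in> \<rat>" "v \<in> \<rat>" using A B by (simp_all add: u_def v_def)
  have vw: "v * w = (\<mu> - \<tau> \<mu>) / 2"
  proof -
    have "v * w = (\<mu> - \<tau> \<mu>) * w\<^sup>2 / 4" by (simp add: v_def power2_eq_square)
    also have "\<dots> = (\<mu> - \<tau> \<mu>) * 2 / 4" by (simp only: w2)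
    also have "y * 2 / 4 = y / 2" for y :: complex by simp
    finally show ?thesis .
  qed
  have muE: "\<mu> = u + v * w" "\<tau> \<mu> = u - v * w" unfolding vw u_def by (simp_all add: field_simps)
  have k: "m * \<tau> m * z \<in> \<rat>"
  proof (rule fQ)
    have d: "m * \<tau> m \<in> M" using c(4)[OF m(1) tm'] .
    show "m * \<tau> m * z \<in> M" using c(4)[OF d gens(2)] .
    show "\<tau> (m * \<tau> m * z) = m * \<tau> m * z" using h(4)[OF d gens(2)] h(4)[OF m(1) tm'] m(4) tz by simp
    show "j (m * \<tau> m * z) = m * \<tau> m * z" using g(4)[OF d gens(2)] g(4)[OF m(1) tm'] m(3) jtm jz by simp
  qed
  have k2: "(u + v * w) * (u - v * w) * of_nat p = (m * \<tau> m * z)\<^sup>2"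
    unfolding muE[symmetric] by (simp only: tmu(1) power_mult_distrib z2) (simp only: \<mu>_def)
  have fK: "y \<in> K" if y: "y \<in> M" "\<tau> (\<tau> y) = y" for y
  proof -
    have ty: "\<tau> y \<in> M" using tm y by blast
    have 1: "y + \<tau> y \<in> E" by (rule fE) (use y(2) c(6)[OF y(1) ty] h(3)[OF y(1) ty] in \<open>simp_all add: add.commute\<close>)
    have d: "y - \<tau> y \<in> M" using c(3)[OF y(1) ty] .
    have 2: "(y - \<tau> y) * w \<in> E"
    proof (rule fE)
      show "(y - \<tau> y) * w \<in> M" using c(4)[OF d gens(1)] .
      show "\<tau> ((y - \<tau> y) * w) = (y - \<tau> y) * w"
        using h(4)[OF d gens(1)] h(6)[OF y(1) ty] y(2) tw by (simp add: algebra_simps)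
    qed
    have "y = ((y + \<tau> y) + ((y - \<tau> y) * w) / w) / 2" using w0 by (simp add: field_simps)
    also have "\<dots> \<in> K"
      by (rule fld_divide[OF fld_K fld_add[OF fld_K subsetD[OF E_K 1] fld_divide[OF fld_K subsetD[OF E_K 2] subsetD[OF L1_K w_in]]]
            fld_numeral[OF fld_K]])
    finally show ?thesis .
  qed
  have muK: "\<mu> \<in> K" by (rule fK[OF mu tmu(2)])
  have "M \<subseteq> adj K m"
  proof
    fix y assume y: "y \<in> M"
    have ty: "\<tau> y \<in> M" "\<tau> (\<tau> y) \<in> M" using tm y by blast+
    have 1: "y + \<tau> (\<tau> y) \<in> K" 
      by (rule fK) (use c(6)[OF y ty(2)] h(3)[OF y ty(2)] h(3)[OF ty(1) tm[OF ty(2)]] t4[OF y] in \<open>simp_all add: add.commute\<close>)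
    have d: "y - \<tau> (\<tau> y) \<in> M" using c(3)[OF y ty(2)] .
    have 2: "(y - \<tau> (\<tau> y)) * m \<in> K"
    proof (rule fK)
      show "(y - \<tau> (\<tau> y)) * m \<in> M" using c(4)[OF d m(1)] .
      have e: "\<tau> (y - \<tau> (\<tau> y)) = \<tau> y - \<tau> (\<tau> (\<tau> y))" using h(6)[OF y ty(2)] .
      have e1: "\<tau> (\<tau> (y - \<tau> (\<tau> y))) = \<tau> (\<tau> y) - y" unfolding e using h(6)[OF ty(1) tm[OF ty(2)]] t4[OF y] by simp
      have e2: "\<tau> (\<tau> ((y - \<tau> (\<tau> y)) * m)) = \<tau> (\<tau> (y - \<tau> (\<tau> y))) * \<tau> (\<tau> m)"
        using h(4)[OF d m(1)] h(4)[OF tm[OF d] tm'] by simp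
      show "\<tau> (\<tau> ((y - \<tau> (\<tau> y)) * m)) = (y - \<tau> (\<tau> y)) * m"
        unfolding e2 e1 m(4) by (simp add: algebra_simps)
    qed
    have "y = (y + \<tau> (\<tau> y)) / 2 + ((y - \<tau> (\<tau> y)) * m / \<mu> / 2) * m"
      using m(2) by (simp add: \<mu>_def power2_eq_square field_simps)
    moreover have "(y + \<tau> (\<tau> y)) / 2 \<in> K" "(y - \<tau> (\<tau> y)) * m / \<mu> / 2 \<in> K"
      by (rule fld_divide[OF fld_K 1 fld_numeral[OF fld_K]],
          rule fld_divide[OF fld_K fld_divide[OF fld_K 2 muK] fld_numeral[OF fld_K]])
    ultimately show "y \<in> adj K m" by (metis adjI)
  qed
  moreover have "adj K m \<subseteq> M" by (rule adj_least[OF M KM m(1)])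
  ultimately have "M = adj K m" by blast
  show thesis
    by (rule that[OF m(2) \<open>M = adj K m\<close> unr uv _ k k2]) (simp add: muE(1)[symmetric] \<mu>_def)
qed

lemma adj_scaled_generator:
  assumes L: "fld L" and c: "c \<in> L" "c \<noteq> 0"
  shows "adj L (c * m) = adj L m"
proof (intro equalityI subsetI)
  fix x assume "x \<in> adj L (c * m)"
  then obtain u v where "x = u + v * (c * m)" "u \<in> L" "v \<in> L" by (auto simp: adj_def)
  moreover from this have "v * c \<in> L" using fld_mult[OF L] c by blast
  ultimately show "x \<in> adj L m" using adjI[of u L "v * c" m] by (simp add: mult.assoc)
next
  fix x assume "x \<in> adj L m"
  then obtain u v where uv: "x = u + v * m" "u \<in> L" "v \<in> L" by (auto simp: adj_def)
  have "x = u + (v / c) * (c * m)" using uv(1) c(2) by simp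
  moreover have "v / c \<in> L" using fld_divide[OF L uv(3) c(1)] .
  ultimately show "x \<in> adj L (c * m)" using adjI[OF uv(2)] by metis
qed

text \<open>Let \<open>\<mu> = m\<^sup>2\<close>. The element \<open>y = \<mu> \<pi>\<close> of \<open>\<rat>(\<surd>2)\<close> has square norm \<open>k\<^sup>2\<close>, and Hilbert 90 makes
  it a rational multiple of a square: \<open>(y + n)\<^sup>2 = y (y + y' + 2 n)\<close> for \<open>n = \<plusminus>k\<close>, where the sign is chosen
  such that the last factor does not vanish. So \<open>M = K(\<surd>(D \<pi>))\<close> for an integer \<open>D\<close>, and one takes \<open>D\<close> of least absolute
  value. Since \<open>2\<close>, \<open>p\<close> and the squares of integers are squares in \<open>K\<close>, minimality makes \<open>D\<close> squarefree and prime
  to \<open>2 p\<close>; the ramification lemmas leave \<open>D = 1\<close>.\<close>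

lemma redei_extension_unique:
  assumes d1: "d = 1" and R: "redei_extension p M"
  shows "M = F"
proof (rule kummer_generator[OF R])
  fix m k u v
  assume m0: "m \<noteq> 0" and M: "M = adj K m" and unr: "unramified_at_finite_primes K M"
    and uv: "u \<in> \<rat>" "v \<in> \<rat>" and mm: "m\<^sup>2 = u + v * w" and k: "k \<in> \<rat>" and nk: "(u + v * w) * (u - v * w) * of_nat p = k\<^sup>2"
  define \<mu> where "\<mu> = u + v * w"
  have mu0: "\<mu> \<noteq> 0" using mm m0 by (auto simp: \<mu>_def)
  have muL: "\<mu> \<in> L1" unfolding \<mu>_def L1_def using adjI[OF uv] .
  have mu'0: "u - v * w \<noteq> 0"
  proof
    assume "u - v * w = 0"
    hence "u + (- v) * w = 0 + 0 * w" by simp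
    hence "u = 0" "- v = 0"
      using adj_unique[OF fld_Rats w_notin uv(1) fld_minus[OF fld_Rats uv(2)] fld_0[OF fld_Rats] fld_0[OF fld_Rats]] by auto
    thus False using mu0 by (simp add: \<mu>_def)
  qed
  have k0: "k \<noteq> 0" using nk mu0 mu'0 p2 by (auto simp: \<mu>_def)
  define y y' where "y = \<mu> * \<pi>" and "y' = (u - v * w) * \<pi>'"
  have yL: "y \<in> L1" unfolding y_def using fld_mult[OF fld_L1 muL pi_in(1)] .
  have y0: "y \<noteq> 0" using mu0 pi_nonzero by (simp add: y_def)
  have yy: "y * y' = k\<^sup>2"
  proof -
    have "y * y' = (u + v * w) * (u - v * w) * (\<pi> * \<pi>')" by (simp add: y_def y'_def \<mu>_def ac_simps)
    thus ?thesis using nk by (simp add: pi_mult)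
  qed
  have tr: "y + y' \<in> \<rat>"
  proof -
    have "y + y' = 2 * (u * of_int a + v * of_int b * w\<^sup>2)"
      by (simp add: y_def y'_def \<mu>_def \<pi>_def \<pi>'_def power2_eq_square algebra_simps)
    thus ?thesis using uv by (simp add: w2)
  qed
  obtain n where n: "n \<in> \<rat>" "n\<^sup>2 = k\<^sup>2" "y + y' + 2 * n \<noteq> 0"
  proof (cases "y + y' + 2 * k = 0")
    case False
    thus ?thesis using that k by blast
  next
    case True
    have "y + y' + 2 * (- k) \<noteq> 0"
    proof
      assume "y + y' + 2 * (- k) = 0"
      hence "4 * k = 0" using True by (simp add: algebra_simps)
      thus False using k0 by simp
    qed
    moreover have "- k \<in> \<rat>" using fld_minus[OF fld_Rats k] .
    ultimately show ?thesis using that[of "- k"] by simp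
  qed
  define c0 where "c0 = y + y' + 2 * n"
  have c0: "c0 \<in> \<rat>" "c0 \<noteq> 0" using n tr by (simp_all add: c0_def)
  define s where "s = y + n"
  have sL: "s \<in> L1" unfolding s_def using fld_add[OF fld_L1 yL] n(1) Rats_L1 by blast
  have s2: "s\<^sup>2 = y * c0"
  proof -
    have "s\<^sup>2 = y\<^sup>2 + 2 * y * n + n\<^sup>2" by (simp add: s_def power2_eq_square algebra_simps)
    also have "n\<^sup>2 = y * y'" using n(2) yy by simp
    finally show ?thesis by (simp add: c0_def power2_eq_square algebra_simps)
  qed
  have s0: "s \<noteq> 0" using s2 y0 c0 by auto
  obtain A B :: int where AB: "c0 = of_int A / of_int B" "B \<noteq> 0" using c0(1) by (auto elim!: Rats_cases')
  have A0: "A \<noteq> 0" using AB c0 by auto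
  \<comment> \<open>the integers \<open>D\<close> for which \<open>M\<close> is generated over \<open>K\<close> by a square root of \<open>D \<pi>\<close>\<close>
  define good where "good = (\<lambda>D::int. D \<noteq> 0 \<and> (\<exists>c\<in>K. c \<noteq> 0 \<and> (c * m)\<^sup>2 = of_int D * \<pi>))"
  have "good (A * B)" unfolding good_def
  proof (intro conjI bexI[of _ "s * of_int B / \<mu>"])
    show "A * B \<noteq> 0" using A0 AB by simp
    show "s * of_int B / \<mu> \<noteq> 0" using s0 AB mu0 by simp
    show "s * of_int B / \<mu> \<in> K" using sL muL L1_K by (intro fld_divide[OF fld_K] fld_mult[OF fld_K] fld_of_int[OF fld_K]) auto
    have "(s * of_int B / \<mu> * m)\<^sup>2 = s\<^sup>2 * (of_int B)\<^sup>2 / \<mu>"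
    proof -
      have "(s * of_int B / \<mu> * m)\<^sup>2 = (s * of_int B)\<^sup>2 * m\<^sup>2 / \<mu>\<^sup>2"
        by (simp add: power_mult_distrib power_divide)
      also have "m\<^sup>2 = \<mu>" using mm by (simp add: \<mu>_def)
      also have "(s * of_int B)\<^sup>2 * \<mu> / \<mu>\<^sup>2 = (s * of_int B)\<^sup>2 / \<mu>" using mu0 by (simp add: power2_eq_square)
      finally show ?thesis by (simp add: power_mult_distrib)
    qed
    also have "\<dots> = \<pi> * (c0 * (of_int B)\<^sup>2)" unfolding s2 y_def using mu0 by simp
    also have "c0 * (of_int B)\<^sup>2 = of_int (A * B)" using AB by (simp add: power2_eq_square)
    finally show "(s * of_int B / \<mu> * m)\<^sup>2 = of_int (A * B) * \<pi>" by (simp add: mult.commute)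
  qed
  then obtain D where D: "good D" and min: "\<And>D'. good D' \<Longrightarrow> nat \<bar>D\<bar> \<le> nat \<bar>D'\<bar>"
    using ex_has_least_nat[of good "A * B" "\<lambda>D. nat \<bar>D\<bar>"] by blast
  obtain c where c: "c \<in> K" "c \<noteq> 0" "(c * m)\<^sup>2 = of_int D * \<pi>" and D0: "D \<noteq> 0" using D unfolding good_def by blast
  have red: False if e: "e \<in> K" "e \<noteq> 0" "e\<^sup>2 = of_int f" "f > 1" "D = f * D'" for e f D'
  proof -
    have "good D'" unfolding good_def
    proof (intro conjI bexI[of _ "c / e"])
      show "D' \<noteq> 0" using D0 e by auto
      show "c / e \<noteq> 0" "c / e \<in> K" using c e fld_divide[OF fld_K] by auto
      have "(c / e * m)\<^sup>2 = (c * m)\<^sup>2 / e\<^sup>2" by (simp add: power_mult_distrib power_divide)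
      also have "\<dots> = of_int D' * \<pi>" unfolding c(3) e(3) e(5) using e(4) by simp
      finally show "(c / e * m)\<^sup>2 = of_int D' * \<pi>" .
    qed
    hence "\<bar>D\<bar> \<le> \<bar>D'\<bar>" using min by fastforce
    moreover have "\<bar>D\<bar> = f * \<bar>D'\<bar>" "\<bar>D'\<bar> > 0" using e D0 by (auto simp: abs_mult)
    moreover have "1 * \<bar>D'\<bar> < f * \<bar>D'\<bar>" by (rule mult_strict_right_mono) (use e calculation in auto)
    ultimately show False by simp
  qed
  have w0: "w \<noteq> 0" "z \<noteq> 0" using w2 z2 p2 by auto
  have nd: "\<not> 2 dvd D" "\<not> int p dvd D"
  proof -
    show "\<not> 2 dvd D"
    proof
      assume "2 dvd D"
      then obtain D' where D': "D = 2 * D'" by (rule dvdE)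
      show False by (rule red[of w 2, OF _ w0(1) _ _ D']) (use w_in L1_K w2 in auto)
    qed
    show "\<not> int p dvd D"
    proof
      assume "int p dvd D"
      then obtain D' where D': "D = int p * D'" by (rule dvdE)
      show False by (rule red[of z "int p", OF _ w0(2) _ _ D']) (use z_in z2 p2 in auto)
    qed
  qed
  have nsq: "\<not> int l * int l dvd D" if l: "prime l" for l
  proof
    assume "int l * int l dvd D"
    then obtain D' where D': "D = int l * int l * D'" by (rule dvdE)
    have l1: "int l > 1" using prime_gt_1_nat[OF l] by simp
    have "1 * 1 < int l * int l" using l1 by (intro mult_strict_mono) auto
    thus False by (intro red[of "of_nat l" "int l * int l", OF fld_of_nat[OF fld_K] _ _ _ D']) (use l1 in \<open>auto simp: power2_eq_square\<close>)
  qed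
  interpret R: redei_data p a b D "c * m"
    by unfold_locales (use p p8 ab a4 b4 D0 c(3) in \<open>simp_all add: \<pi>_def w_def\<close>)
  have RF: "R.F = M" unfolding R.F_def M using adj_scaled_generator[OF fld_K c(1,2)] .
  have "\<not> int l dvd D" if l: "prime l" for l
  proof
    assume ld: "int l dvd D"
    hence "l \<noteq> 2" "l \<noteq> p" using nd by auto
    thus False using R.ramified_odd[OF l _ _ ld nsq[OF l]] unr RF by simp
  qed
  hence "\<not> l dvd nat \<bar>D\<bar>" if "prime l" for l using that by (metis dvd_abs_iff int_nat_eq abs_ge_zero of_nat_dvd_iff)
  hence "nat \<bar>D\<bar> = 1" using prime_factor_nat by blast
  hence "D = 1 \<or> D = - 1" by linarith
  moreover have "D \<noteq> - 1" using R.ramified_minus_1 unr RF by auto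
  ultimately have "D = 1" by blast
  hence "(c * m)\<^sup>2 = t\<^sup>2" using c(3) t2 d1 by simp
  hence "c * m = t \<or> c * m = - t" by (simp add: power2_eq_iff)
  hence "R.F = F"
  proof
    assume "c * m = - t"
    hence e: "c * m = (- 1) * t" by simp
    have "- 1 \<in> K" using fld_minus[OF fld_K fld_1[OF fld_K]] .
    have "R.F = adj K (c * m)" by (rule R.F_def)
    also have "\<dots> = adj K ((- 1) * t)" by (simp only: e)
    also have "\<dots> = adj K t" by (rule adj_scaled_generator[OF fld_K \<open>- 1 \<in> K\<close>]) simp
    finally show ?thesis by (simp only: F_def)
  qed (simp add: R.F_def F_def)
  thus "M = F" using RF by simp
qed

lemma redei_field_eq:
  assumes "d = 1"
  shows "redei_field p = F"
  unfolding redei_field_def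
  by (rule the_equality[where P = "redei_extension p", OF redei_extension_F[OF assms] redei_extension_unique[OF assms]])

end

section \<open>Splitting of a rational prime\<close>

lemma of_int_signed: "of_int (if e then - k else k) = signed e (of_int k)"
  by simp

lemma card_bool_pairs: "card (UNIV :: (bool \<times> bool) set) = 4"
proof -
  have "card (UNIV \<times> UNIV :: (bool \<times> bool) set) = 2 * 2"
    by (simp only: card_cartesian_product card_UNIV_bool)
  thus ?thesis by simp
qed

lemma card_bool_triples: "card (UNIV :: (bool \<times> bool \<times> bool) set) = 8"
proof -
  have "card (UNIV \<times> UNIV \<times> UNIV :: (bool \<times> bool \<times> bool) set) = 2 * (2 * 2)"
    by (simp only: card_cartesian_product card_UNIV_bool)
  thus ?thesis by simp
qed

context redei_data
begin

definition primes_over :: "nat \<Rightarrow> complex set set" where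
  "primes_over q = {P. prime_idl (Oint F) P \<and> of_int (int q) \<in> P}"

lemma splits_completely_F: "splits_completely q F \<longleftrightarrow> card (primes_over q) = 8"
proof -
  have "splits_completely q F \<longleftrightarrow> ring.dimension CC (card (primes_over q)) \<rat> F"
    unfolding splits_completely_def prime_idl_integers primes_over_def by simp
  thus ?thesis using dims(4) dimension_unique[OF fld_Rats _ dims(4)] by metis
qed

lemma primes_overD:
  assumes "P \<in> primes_over q"
  shows "prime_idl (Oint F) P" "of_int (int q) \<in> P" "idl (Oint F) P"
  using assms prime_idl_idl by (auto simp: primes_over_def)

lemma of_int_in_prime_iff:
  assumes q: "prime q" and P: "P \<in> primes_over q"
  shows "of_int m \<in> P \<longleftrightarrow> int q dvd m"
proof
  note P' = primes_overD[OF P]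
  assume m: "of_int m \<in> P"
  show "int q dvd m"
  proof (rule ccontr)
    assume "\<not> int q dvd m"
    hence "coprime (int q) m" using q prime_imp_coprime[of "int q" m] by simp
    thus False using notin_if_coprime[OF P'(1,2)] m by blast
  qed
next
  note P' = primes_overD[OF P]
  assume "int q dvd m"
  then obtain k where "m = int q * k" by (rule dvdE)
  hence "of_int m = of_int (int q) * (of_int k :: complex)" by (simp only: of_int_mult)
  thus "of_int m \<in> P"
    using idl_mult'[OF subr_Oint[OF fld_F] P'(3,2), of "of_int k"] subr_of_int[OF subr_Oint[OF fld_F]] by simp
qed

lemma sign_of_root:
  assumes P: "P \<in> primes_over q" and y: "y \<in> Oint F" "y\<^sup>2 - of_int (k\<^sup>2) \<in> P"
  shows "\<exists>e. y - signed e (of_int k) \<in> P"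
proof -
  note P' = primes_overD[OF P] and S = subr_Oint[OF fld_F]
  have k: "of_int k \<in> Oint F" by (rule subr_of_int[OF S])
  have "(y - of_int k) * (y + of_int k) \<in> P" using y(2) by (simp add: power2_eq_square algebra_simps)
  hence "y - of_int k \<in> P \<or> y + of_int k \<in> P"
    using prime_idl_prime[OF P'(1) subr_diff[OF S y(1) k] subr_add[OF S y(1) k]] by blast
  thus ?thesis
  proof
    assume "y - of_int k \<in> P"
    thus ?thesis by (intro exI[of _ False]) simp
  next
    assume "y + of_int k \<in> P"
    thus ?thesis by (intro exI[of _ True]) simp
  qed
qed

lemma integer_residues_adj:
  assumes I: "idl (Oint F) I" and A: "A \<subseteq> Oint F" "\<And>x. x \<in> A \<Longrightarrow> \<exists>k. x - of_int k \<in> I"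
    and s: "s \<in> Oint F" "s - of_int m \<in> I" and x: "x \<in> adj A s"
  shows "\<exists>k. x - of_int k \<in> I"
proof -
  note S = subr_Oint[OF fld_F]
  obtain u v where uv: "x = u + v * s" "u \<in> A" "v \<in> A" using x by (auto simp: adj_def)
  obtain i j where ij: "u - of_int i \<in> I" "v - of_int j \<in> I" using A(2)[OF uv(2)] A(2)[OF uv(3)] by blast
  have "(u - of_int i) + ((v - of_int j) * s + of_int j * (s - of_int m)) \<in> I"
    using A(1) s ij
    by (intro idl_add[OF S I] idl_mult'[OF S I ij(2) s(1)] idl_mult[OF S I subr_of_int[OF S] s(2)])
  also have "(u - of_int i) + ((v - of_int j) * s + of_int j * (s - of_int m)) = x - of_int (i + j * m)"
    by (simp add: uv(1) algebra_simps)
  finally show ?thesis by blast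
qed

lemma Ord_subsets: "adj \<int> w \<subseteq> Oint F" "adj (adj \<int> w) z \<subseteq> Oint F"
proof -
  note S = subr_Oint[OF fld_F]
  have i: "\<int> \<subseteq> Oint F" using subr_of_int[OF S] by (auto elim!: Ints_cases)
  have st: "adj A s \<subseteq> Oint F" if "A \<subseteq> Oint F" "s \<in> Oint F" for A s
  proof
    fix x assume "x \<in> adj A s"
    then obtain u v where "x = u + v * s" "u \<in> A" "v \<in> A" by (auto simp: adj_def)
    thus "x \<in> Oint F" using subr_add[OF S _ subr_mult[OF S _ that(2)]] that(1) by blast
  qed
  show "adj \<int> w \<subseteq> Oint F" by (rule st[OF i in_Oint(1)])
  from st[OF this in_Oint(2)] show "adj (adj \<int> w) z \<subseteq> Oint F" .
qed

lemma residues_Ord: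
  assumes I: "idl (Oint F) I" and wz: "w - of_int i \<in> I" "z - of_int j \<in> I" and x: "x \<in> Ord"
  shows "\<exists>k l. x - (of_int k + of_int l * t) \<in> I"
proof -
  note S = subr_Oint[OF fld_F]
  have 0: "\<exists>k. y - of_int k \<in> I" if "y \<in> \<int>" for y
  proof -
    from that obtain n where "y = of_int n" by (rule Ints_cases)
    thus ?thesis using idl_0[OF S I] by (intro exI[of _ n]) simp
  qed
  have Z: "\<int> \<subseteq> Oint F" using subr_of_int[OF S] by (auto elim!: Ints_cases)
  have 1: "\<exists>k. y - of_int k \<in> I" if "y \<in> adj \<int> w" for y
    by (rule integer_residues_adj[OF I Z 0 in_Oint(1) wz(1) that])
  have 2: "\<exists>k. y - of_int k \<in> I" if "y \<in> adj (adj \<int> w) z" for y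
    by (rule integer_residues_adj[OF I Ord_subsets(1) 1 in_Oint(2) wz(2) that])
  obtain u v where uv: "x = u + v * t" "u \<in> adj (adj \<int> w) z" "v \<in> adj (adj \<int> w) z"
    using x unfolding Ord_def adj_def[of "adj (adj \<int> w) z"] by blast
  obtain k l where kl: "u - of_int k \<in> I" "v - of_int l \<in> I" using 2[OF uv(2)] 2[OF uv(3)] by blast
  have "(u - of_int k) + (v - of_int l) * t \<in> I"
    by (rule idl_add[OF S I kl(1) idl_mult'[OF S I kl(2) in_Oint(3)]])
  also have "(u - of_int k) + (v - of_int l) * t = x - (of_int k + of_int l * t)" by (simp add: uv(1) algebra_simps)
  finally show ?thesis by blast
qed

text \<open>Up to the factor \<open>idx\<close>, which is prime to \<open>q\<close>, every integer of \<open>F\<close> lies in the order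
  \<open>\<int>[\<surd>2][\<surd>p][t]\<close> and is congruent to some \<open>k + l t\<close> modulo \<open>P \<inter> P'\<close>; so only elements of this form
  have to be compared.\<close>

lemma prime_le_prime:
  assumes q: "prime q" "\<not> int q dvd idx" and P: "P \<in> primes_over q" and P': "P' \<in> primes_over q"
    and wz: "w - of_int i \<in> P \<inter> P'" "z - of_int j \<in> P \<inter> P'"
    and tr: "\<And>k l. of_int k + of_int l * t \<in> P \<Longrightarrow> of_int k + of_int l * t \<in> P'"
  shows "P \<subseteq> P'"
proof
  fix x assume x: "x \<in> P"
  note S = subr_Oint[OF fld_F] and D = primes_overD[OF P] and D' = primes_overD[OF P']
  have I: "idl (Oint F) (P \<inter> P')" using D(3) D'(3) unfolding idl_def by blast
  have xO: "x \<in> Oint F" using idl_sub[OF S D(3) x] .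
  obtain k l where kl: "of_int idx * x - (of_int k + of_int l * t) \<in> P \<inter> P'"
    using residues_Ord[OF I wz Oint_F_ord[OF xO]] by blast
  have "of_int idx * x - (of_int idx * x - (of_int k + of_int l * t)) \<in> P"
    using idl_diff[OF S D(3) idl_mult[OF S D(3) subr_of_int[OF S] x]] kl by blast
  hence "of_int k + of_int l * t \<in> P'" using tr by simp
  hence "(of_int idx * x - (of_int k + of_int l * t)) + (of_int k + of_int l * t) \<in> P'"
    using idl_add[OF S D'(3)] kl by blast
  hence "of_int idx * x \<in> P'" by simp
  moreover have "of_int idx \<notin> P'" using of_int_in_prime_iff[OF q(1) P'] q(2) by blast
  ultimately show "x \<in> P'" using prime_idl_prime[OF D'(1) subr_of_int[OF S] xO] by blast
qed

lemma sign_data: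
  assumes P: "P \<in> primes_over q" and r: "[r\<^sup>2 = 2] (mod int q)" and s: "[s\<^sup>2 = int p] (mod int q)" and q: "prime q"
  shows "\<exists>e. w - signed e (of_int r) \<in> P" "\<exists>e. z - signed e (of_int s) \<in> P"
proof -
  have i: "of_int m - of_int n \<in> P" if "[n = m] (mod int q)" for m n
    using of_int_in_prime_iff[OF q P, of "m - n"] that by (simp add: cong_iff_dvd_diff dvd_diff_commute)
  show "\<exists>e. w - signed e (of_int r) \<in> P"
    by (rule sign_of_root[OF P in_Oint(1)]) (use i[OF r] in \<open>simp add: w2\<close>)
  show "\<exists>e. z - signed e (of_int s) \<in> P"
    by (rule sign_of_root[OF P in_Oint(2)]) (use i[OF s] in \<open>simp add: z2\<close>)
qed

lemma pi_residue:
  assumes P: "P \<in> primes_over q" and e: "w - signed e (of_int r) \<in> P"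
  shows "\<pi> - of_int (a + b * (if e then - r else r)) \<in> P" "\<pi>' - of_int (a + b * (if e then r else - r)) \<in> P"
proof -
  note S = subr_Oint[OF fld_F] and D = primes_overD[OF P]
  have m: "of_int b * (w - signed e (of_int r)) \<in> P" using idl_mult[OF S D(3) subr_of_int[OF S] e] .
  show "\<pi> - of_int (a + b * (if e then - r else r)) \<in> P"
    using m by (cases e) (simp_all add: \<pi>_def algebra_simps)
  show "\<pi>' - of_int (a + b * (if e then r else - r)) \<in> P"
    using idl_minus[OF S D(3) m] by (cases e) (simp_all add: \<pi>'_def algebra_simps)
qed

text \<open>The residues of \<open>\<surd>2\<close> and \<open>\<surd>p\<close> already determine \<open>P\<close>: if \<open>k + l t \<in> P\<close>, then the norm
  \<open>k\<^sup>2 - l\<^sup>2 \<pi>\<close> is zero modulo \<open>P\<close>, and as \<open>\<pi>\<close> is a nonsquare modulo \<open>q\<close> this forces \<open>q\<close> to divide \<open>k\<close> and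
  \<open>l\<close>.\<close>

lemma card_primes_nonsquare:
  assumes d1: "d = 1" and q: "prime q" "\<not> int q dvd idx"
    and r: "[r\<^sup>2 = 2] (mod int q)" and s: "[s\<^sup>2 = int p] (mod int q)"
    and ns: "\<And>e. \<not> QuadRes (int q) (a + b * (if e then - r else r))"
  shows "card (primes_over q) \<le> 4"
proof -
  note S = subr_Oint[OF fld_F]
  have "\<forall>P\<in>primes_over q. \<exists>x. w - signed (fst x) (of_int r) \<in> P \<and> z - signed (snd x) (of_int s) \<in> P"
    using sign_data[OF _ r s q(1)] by (metis fst_conv snd_conv)
  then obtain f where f: "\<And>P. P \<in> primes_over q \<Longrightarrow> w - signed (fst (f P)) (of_int r) \<in> P \<and> z - signed (snd (f P)) (of_int s) \<in> P"
    by metis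
  have le: "P \<subseteq> P'" if P: "P \<in> primes_over q" and P': "P' \<in> primes_over q" and eq: "f P = f P'" for P P'
  proof (rule prime_le_prime[OF q P P'])
    note D = primes_overD[OF P] and D' = primes_overD[OF P']
    define e where "e = fst (f P)"
    show "w - of_int (if fst (f P) then - r else r) \<in> P \<inter> P'" "z - of_int (if snd (f P) then - s else s) \<in> P \<inter> P'"
      unfolding of_int_signed using f[OF P] f[OF P'] eq by auto
    fix k l assume kl: "of_int k + of_int l * t \<in> P"
    define n where "n = a + b * (if e then - r else r)"
    have "\<pi> - of_int n \<in> P" unfolding n_def by (rule pi_residue(1)[OF P]) (use f[OF P] e_def in auto)
    hence "of_int (l\<^sup>2) * (\<pi> - of_int n) \<in> P" using idl_mult[OF S D(3) subr_of_int[OF S]] by blast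
    moreover have "(of_int k - of_int l * t) * (of_int k + of_int l * t) \<in> P"
      by (rule idl_mult[OF S D(3) _ kl]) (intro subr_diff[OF S] subr_mult[OF S] subr_of_int[OF S] in_Oint(3))
    ultimately have "of_int (l\<^sup>2) * (\<pi> - of_int n) + (of_int k - of_int l * t) * (of_int k + of_int l * t) \<in> P"
      using idl_add[OF S D(3)] by blast
    also have "of_int (l\<^sup>2) * (\<pi> - of_int n) + (of_int k - of_int l * t) * (of_int k + of_int l * t)
        = of_int (k\<^sup>2) - of_int (l\<^sup>2) * t\<^sup>2 + of_int (l\<^sup>2) * (\<pi> - of_int n)"
      by (simp add: power2_eq_square algebra_simps)
    also have "\<dots> = of_int (k\<^sup>2 - l\<^sup>2 * n)" unfolding t2 d1 by (simp add: algebra_simps)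
    finally have dv: "int q dvd k\<^sup>2 - l\<^sup>2 * n" using of_int_in_prime_iff[OF q(1) P] by blast
    have pq: "prime (int q)" using q by simp
    have "int q dvd l"
    proof (rule ccontr)
      assume "\<not> int q dvd l"
      hence "coprime l (int q)" using prime_imp_coprime[OF pq] by (simp add: coprime_commute)
      then obtain m where m: "[l * m = 1] (mod int q)" using cong_solve_coprime_int by blast
      have "[k\<^sup>2 = l\<^sup>2 * n] (mod int q)" using dv by (simp add: cong_iff_dvd_diff)
      hence "[m\<^sup>2 * k\<^sup>2 = m\<^sup>2 * (l\<^sup>2 * n)] (mod int q)" by (rule cong_scalar_left)
      moreover have "[(l * m)\<^sup>2 * n = 1\<^sup>2 * n] (mod int q)" by (intro cong_mult cong_pow m) simp
      ultimately have "[(m * k)\<^sup>2 = n] (mod int q)"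
        by (metis (no_types, opaque_lifting) cong_trans mult.assoc mult.commute mult_1 one_power2 power_mult_distrib)
      hence "QuadRes (int q) n" unfolding QuadRes_def by blast
      thus False using ns n_def by blast
    qed
    moreover from this have "int q dvd l\<^sup>2 * n" by (simp add: power2_eq_square)
    from dvd_add[OF dv this] have "int q dvd k\<^sup>2" by simp
    hence "int q dvd k" using pq prime_dvd_power by blast
    ultimately have "of_int k \<in> P'" "of_int l \<in> P'" using of_int_in_prime_iff[OF q(1) P'] by blast+
    thus "of_int k + of_int l * t \<in> P'"
      by (intro idl_add[OF S D'(3)] idl_mult'[OF S D'(3)] in_Oint(3))
  qed
  have "inj_on f (primes_over q)"
  proof (rule inj_onI)
    fix P P' assume "P \<in> primes_over q" "P' \<in> primes_over q" "f P = f P'"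
    thus "P = P'" using le[of P P'] le[of P' P] by auto
  qed
  hence "card (primes_over q) \<le> card (UNIV :: (bool \<times> bool) set)"
    by (rule card_inj_on_le) auto
  thus ?thesis unfolding card_bool_pairs .
qed

text \<open>The values of \<open>c\<close> are square roots of the residues of \<open>\<pi>\<close> for the two choices of the sign of
  \<open>\<surd>2\<close>.\<close>

lemma sqrt_pi_residue:
  assumes P: "P \<in> primes_over q" and q: "prime q" and e: "w - signed e (of_int r) \<in> P"
    and c: "\<And>e. [(c e)\<^sup>2 = a + b * (if e then - r else r)] (mod int q)"
  shows "y \<in> Oint F \<Longrightarrow> y\<^sup>2 = \<pi> \<Longrightarrow> \<exists>e'. y - signed e' (of_int (c e)) \<in> P"
    and "y \<in> Oint F \<Longrightarrow> y\<^sup>2 = \<pi>' \<Longrightarrow> \<exists>e'. y - signed e' (of_int (c (\<not> e))) \<in> P"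
proof -
  note S = subr_Oint[OF fld_F] and D = primes_overD[OF P]
  have i: "of_int m - of_int n \<in> P" if "[n = m] (mod int q)" for m n
    using of_int_in_prime_iff[OF q P, of "m - n"] that by (simp add: cong_iff_dvd_diff dvd_diff_commute)
  have add: "x - u \<in> P" if "x - v \<in> P" "v - u \<in> P" for x u v
    using idl_add[OF S D(3) that] by simp
  show "y \<in> Oint F \<Longrightarrow> y\<^sup>2 = \<pi> \<Longrightarrow> \<exists>e'. y - signed e' (of_int (c e)) \<in> P"
    using sign_of_root[OF P, of y "c e"] add[OF pi_residue(1)[OF P e] i[OF c[of e]]] by simp
  have "[(c (\<not> e))\<^sup>2 = a + b * (if e then r else - r)] (mod int q)" using c[of "\<not> e"] by (cases e) auto
  from add[OF pi_residue(2)[OF P e] i[OF this]]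
  show "y \<in> Oint F \<Longrightarrow> y\<^sup>2 = \<pi>' \<Longrightarrow> \<exists>e'. y - signed e' (of_int (c (\<not> e))) \<in> P"
    using sign_of_root[OF P, of y "c (\<not> e)"] by simp
qed

lemma card_primes_square_le:
  assumes d1: "d = 1" and q: "prime q" "\<not> int q dvd idx"
    and r: "[r\<^sup>2 = 2] (mod int q)" and s: "[s\<^sup>2 = int p] (mod int q)"
    and c: "\<And>e. [(c e)\<^sup>2 = a + b * (if e then - r else r)] (mod int q)"
  shows "finite (primes_over q)" "card (primes_over q) \<le> 8"
proof -
  note S = subr_Oint[OF fld_F]
  define g where "g = (\<lambda>P. SOME x. w - signed (fst x) (of_int r) \<in> P \<and> z - signed (fst (snd x)) (of_int s) \<in> P \<and>
    t - signed (snd (snd x)) (of_int (c (fst x))) \<in> P)"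
  have f: "w - signed (fst (g P)) (of_int r) \<in> P \<and> z - signed (fst (snd (g P))) (of_int s) \<in> P \<and>
    t - signed (snd (snd (g P))) (of_int (c (fst (g P)))) \<in> P" if P: "P \<in> primes_over q" for P
  proof -
    obtain e1 e2 where e: "w - signed e1 (of_int r) \<in> P" "z - signed e2 (of_int s) \<in> P"
      using sign_data[OF P r s q(1)] by blast
    obtain e3 where e3: "t - signed e3 (of_int (c e1)) \<in> P"
      using sqrt_pi_residue(1)[OF P q(1) e(1) c in_Oint(3)] t2 d1 by auto
    have "\<exists>x. w - signed (fst x) (of_int r) \<in> P \<and> z - signed (fst (snd x)) (of_int s) \<in> P \<and>
      t - signed (snd (snd x)) (of_int (c (fst x))) \<in> P"
      by (rule exI[of _ "(e1, e2, e3)"]) (use e e3 in simp)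
    thus ?thesis unfolding g_def by (rule someI_ex)
  qed
  have le: "P \<subseteq> P'" if P: "P \<in> primes_over q" and P': "P' \<in> primes_over q" and eq: "g P = g P'" for P P'
  proof (rule prime_le_prime[OF q P P'])
    note D = primes_overD[OF P] and D' = primes_overD[OF P']
    show "w - of_int (if fst (g P) then - r else r) \<in> P \<inter> P'" "z - of_int (if fst (snd (g P)) then - s else s) \<in> P \<inter> P'"
      unfolding of_int_signed using f[OF P] f[OF P'] eq by auto
    fix k l assume kl: "of_int k + of_int l * t \<in> P"
    define m where "m = (if snd (snd (g P)) then - c (fst (g P)) else c (fst (g P)))"
    have "of_int m = signed (snd (snd (g P))) (of_int (c (fst (g P))))" by (simp add: m_def)
    hence tm: "t - of_int m \<in> P" "t - of_int m \<in> P'" using f[OF P] f[OF P'] eq by simp_all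
    have "(of_int k + of_int l * t) - of_int l * (t - of_int m) \<in> P"
      by (rule idl_diff[OF S D(3) kl idl_mult[OF S D(3) subr_of_int[OF S] tm(1)]])
    hence "of_int (k + l * m) \<in> P" by (simp add: algebra_simps)
    hence "of_int (k + l * m) \<in> P'" using of_int_in_prime_iff[OF q(1)] P P' by blast
    hence "of_int (k + l * m) + of_int l * (t - of_int m) \<in> P'"
      by (rule idl_add[OF S D'(3) _ idl_mult[OF S D'(3) subr_of_int[OF S] tm(2)]])
    thus "of_int k + of_int l * t \<in> P'" by (simp add: algebra_simps)
  qed
  have inj: "inj_on g (primes_over q)"
  proof (rule inj_onI)
    fix P P' assume "P \<in> primes_over q" "P' \<in> primes_over q" "g P = g P'"
    thus "P = P'" using le[of P P'] le[of P' P] by auto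
  qed
  show "finite (primes_over q)" by (rule inj_on_finite[OF inj subset_UNIV]) simp
  have "card (primes_over q) \<le> card (UNIV :: (bool \<times> bool \<times> bool) set)"
    by (rule card_inj_on_le[OF inj]) auto
  thus "card (primes_over q) \<le> 8" unfolding card_bool_triples .
qed

lemma conjugate_prime:
  assumes d1: "d = 1" and P: "P \<in> primes_over q"
  shows "{x \<in> Oint F. aut e1 e2 e3 x \<in> P} \<in> primes_over q"
proof -
  let ?s = "aut e1 e2 e3" let ?P = "{x \<in> Oint F. aut e1 e2 e3 x \<in> P}"
  note S = subr_Oint[OF fld_F] and D = primes_overD[OF P] and c = idl_closed[OF subr_Oint[OF fld_F] primes_overD(3)[OF P]]
  note hs = aut_hom[OF d1, of e1 e2 e3]
  note h = hom_on_simps[OF hs fld_F]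
  have sF: "?s x \<in> F" if "x \<in> F" for x
    using gal_maps(1)[OF fld_F aut_in_gal[OF d1, of e1 e2 e3]] that by (auto simp: Bij_def bij_betw_def)
  have sO: "?s x \<in> Oint F" if "x \<in> Oint F" for x
    using that sF algebraic_int_hom[OF hs fld_F] by auto
  have "idl (Oint F) ?P" unfolding idl_def
  proof (intro conjI ballI)
    show "?P \<subseteq> Oint F" by blast
    show "0 \<in> ?P" using subr_0[OF S] h(2) c(2) by simp
    fix x y assume y: "y \<in> ?P"
    show "x + y \<in> ?P" if "x \<in> ?P"
      using y that h(3)[of x y] c(3)[of "?s x" "?s y"] subr_add[OF S, of x y] by simp
    show "x * y \<in> ?P" if "x \<in> Oint F"
      using y that h(4)[of x y] c(4)[OF sO[OF that], of "?s y"] subr_mult[OF S, of x y] by simp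
  qed
  moreover have "1 \<notin> ?P" using h(1) prime_idl_1[OF D(1)] by simp
  moreover have "x \<in> ?P \<or> y \<in> ?P" if "x \<in> Oint F" "y \<in> Oint F" "x * y \<in> ?P" for x y
    using prime_idl_prime[OF D(1) sO[OF that(1)] sO[OF that(2)]] that h(4)[of x y] by simp
  moreover have "of_int (int q) \<in> ?P" using h(9)[of "int q"] D(2) subr_of_int[OF S, of "int q"] by simp
  ultimately show ?thesis unfolding primes_over_def prime_idl_def by blast
qed

text \<open>The conjugates of one prime are told apart by the residues of \<open>\<surd>2\<close>, \<open>\<surd>p\<close> and \<open>t\<close>, which are
  nonzero; hence the eight automorphisms give eight primes.\<close>

lemma card_primes_square_ge:
  assumes d1: "d = 1" and q: "prime q" "odd q" "q \<noteq> p" and fin: "finite (primes_over q)"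
    and r: "[r\<^sup>2 = 2] (mod int q)" and s: "[s\<^sup>2 = int p] (mod int q)"
    and c: "\<And>e. [(c e)\<^sup>2 = a + b * (if e then - r else r)] (mod int q)"
  shows "8 \<le> card (primes_over q)"
proof -
  note S = subr_Oint[OF fld_F]
  obtain P where P: "P \<in> primes_over q" using exists_prime_over[OF q(1)] by (auto simp: primes_over_def)
  note D = primes_overD[OF P]
  obtain i j where ij: "w - signed i (of_int r) \<in> P" "z - signed j (of_int s) \<in> P"
    using sign_data[OF P r s q(1)] by blast
  have pq: "prime (int q)" using q by simp
  have q2: "\<not> int q dvd 2"
    using q primes_dvd_imp_eq[of q 2] by (metis even_numeral int_dvd_int_iff of_nat_numeral two_is_prime_nat dvd_refl)
  have qp: "\<not> int q dvd int p" using q(1,3) p primes_dvd_imp_eq[of q p] by auto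
  have nd: "\<not> int q dvd k" if "[k\<^sup>2 = n] (mod int q)" "\<not> int q dvd n" for k n
    using that by (metis cong_dvd_iff dvd_mult power2_eq_square)
  have nr: "\<not> int q dvd r" "\<not> int q dvd s" using nd[OF r q2] nd[OF s qp] by auto
  have nc: "\<not> int q dvd c e" for e
  proof
    assume h: "int q dvd c e"
    have "[(c False)\<^sup>2 * (c True)\<^sup>2 = (a + b * r) * (a + b * - r)] (mod int q)"
      using cong_mult[OF c[of False] c[of True]] by simp
    also have "(a + b * r) * (a + b * - r) = a\<^sup>2 - b\<^sup>2 * r\<^sup>2" by (simp add: power2_eq_square algebra_simps)
    also have "[a\<^sup>2 - b\<^sup>2 * r\<^sup>2 = a\<^sup>2 - b\<^sup>2 * 2] (mod int q)" by (intro cong_diff cong_mult r) auto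
    also have "a\<^sup>2 - b\<^sup>2 * 2 = int p" using ab by simp
    finally have "[(c False)\<^sup>2 * (c True)\<^sup>2 = int p] (mod int q)" .
    moreover have "int q dvd (c False)\<^sup>2 * (c True)\<^sup>2" using h by (cases e) (auto simp: power2_eq_square)
    ultimately show False using qp cong_dvd_iff by blast
  qed
  have sgm: "signed e x - signed e y \<in> I \<longleftrightarrow> x - y \<in> I" if "idl (Oint F) I" for e x y I
    using idl_minus[OF S that, of "x - y"] idl_minus[OF S that, of "y - x"] by (cases e) auto
  \<comment> \<open>the inverse image of \<open>P\<close> under the automorphism with the given signs\<close>
  define Q where "Q = (\<lambda>x. {y \<in> Oint F. aut (fst x) (fst (snd x)) (snd (snd x)) y \<in> P})"
  have Q: "Q x \<in> primes_over q" for x unfolding Q_def by (rule conjugate_prime[OF d1 P])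
  have sep: "e = f" if I: "I \<in> primes_over q" and m: "y - signed e (of_int k) \<in> I" "y - signed f (of_int k) \<in> I" "\<not> int q dvd k" for I y e f k
  proof (rule ccontr)
    assume ne: "e \<noteq> f"
    have "(y - signed e (of_int k)) - (y - signed f (of_int k)) \<in> I"
      using idl_diff[OF S primes_overD(3)[OF I] m(1,2)] .
    hence "of_int (2 * k) \<in> I \<or> of_int (- (2 * k)) \<in> I" using ne by (cases e) auto
    hence "int q dvd 2 * k" using of_int_in_prime_iff[OF q(1) I] by (metis dvd_minus_iff)
    thus False using q2 m(3) pq prime_dvd_mult_iff by blast
  qed
  have inj: "inj_on Q UNIV"
  proof (rule inj_onI)
    fix x y :: "bool \<times> bool \<times> bool"
    obtain e1 e2 e3 where x: "x = (e1, e2, e3)" by (cases x) auto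
    obtain f1 f2 f3 where y: "y = (f1, f2, f3)" by (cases y) auto
    assume eq: "Q x = Q y"
    have sgi: "signed e (of_int k) = of_int (if e then - k else k)" for e k by simp
    have mem: "v - signed g (of_int k) \<in> Q (e, e', e'') \<longleftrightarrow> aut e e' e'' v - signed g (of_int k) \<in> P"
      if "v \<in> Oint F" for v g k e e' e''
      unfolding Q_def sgi
      using that subr_diff[OF S that subr_of_int[OF S]] fld_of_int[OF fld_F] hom_on_simps(6,9)[OF aut_hom[OF d1, of e e' e''] fld_F]
      by simp
    have sgsg: "signed e (signed f u) = signed f (signed e u)" for e f u by (cases e; cases f) auto
    have W: "w - signed e (signed i (of_int r)) \<in> Q (e, e', e'')" for e e' e''
      using mem[OF in_Oint(1), of "e \<noteq> i" r e e' e''] sgm[OF D(3), of e w "signed i (of_int r)"] ij(1)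
      by (simp add: aut_w[OF d1] signed_def split: if_splits)
    have Z: "z - signed e' (signed j (of_int s)) \<in> Q (e, e', e'')" for e e' e''
      using mem[OF in_Oint(2), of "e' \<noteq> j" s e e' e''] sgm[OF D(3), of e' z "signed j (of_int s)"] ij(2)
      by (simp add: aut_z[OF d1] signed_def split: if_splits)
    have ss: "signed e (signed i u) = signed (e \<noteq> i) u" for e i u by (cases e; cases i) auto
    have "(e1 \<noteq> i) = (f1 \<noteq> i)"
      using sep[OF Q[of x], of w "e1 \<noteq> i" r "f1 \<noteq> i"] W[of e1 e2 e3] W[of f1 f2 f3] eq nr(1) unfolding ss x y by simp
    moreover have "(e2 \<noteq> j) = (f2 \<noteq> j)"
      using sep[OF Q[of x], of z "e2 \<noteq> j" s "f2 \<noteq> j"] Z[of e2 e1 e3] Z[of f2 f1 f3] eq nr(2) unfolding ss x y by simp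
    ultimately have 12: "f1 = e1" "f2 = e2" by auto
    have s2O: "s2 \<in> Oint F"
      using s2_in s2_square[OF d1] algebraic_int_pi(2) algebraic_int_sqrtI[of s2] by simp
    define v where "v = (if e1 then s2 else t)"
    have "\<exists>g k. v - signed g (of_int k) \<in> P \<and> \<not> int q dvd k"
    proof (cases e1)
      case True
      show ?thesis using sqrt_pi_residue(2)[OF P q(1) ij(1) c s2O s2_square[OF d1]] nc unfolding v_def by (simp add: True) blast
    next
      case False
      have "t\<^sup>2 = \<pi>" using t2 d1 by simp
      from sqrt_pi_residue(1)[OF P q(1) ij(1) c in_Oint(3) this] show ?thesis using nc unfolding v_def by (simp add: False) blast
    qed
    then obtain g k where gk: "v - signed g (of_int k) \<in> P" "\<not> int q dvd k" by blast
    have T: "t - signed (e'' \<noteq> g) (of_int k) \<in> Q (e1, e2, e'')" for e''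
      using mem[OF in_Oint(3), of "e'' \<noteq> g" k e1 e2 e''] sgm[OF D(3), of e'' v "signed g (of_int k)"] gk(1)
      unfolding aut_t[OF d1] v_def[symmetric] ss by simp
    have "(e3 \<noteq> g) = (f3 \<noteq> g)"
      using sep[OF Q[of x] _ _ gk(2)] T[of e3] T[of f3] eq unfolding x y 12 by simp
    thus "x = y" using 12 x y by auto
  qed
  have "card (UNIV :: (bool \<times> bool \<times> bool) set) \<le> card (primes_over q)"
    by (rule card_inj_on_le[OF inj _ fin]) (use Q in auto)
  thus ?thesis unfolding card_bool_triples .
qed

text \<open>The residues \<open>a + b r\<close> and \<open>a - b r\<close> are squares together, since their product is \<open>p\<close>, a square
  modulo \<open>q\<close>. This gives the choice between eight primes and at most four.\<close>

theorem splits_completely_iff_Legendre: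
  assumes d1: "d = 1" and q: "prime q" "odd q" "q \<noteq> p"
    and r: "[r\<^sup>2 = 2] (mod int q)" and s: "[s\<^sup>2 = int p] (mod int q)"
  shows "splits_completely q F \<longleftrightarrow> Legendre (a + b * r) (int q) = 1"
proof -
  have pq: "prime (int q)" using q by simp
  have qp: "\<not> int q dvd int p" using q(1,3) p primes_dvd_imp_eq[of q p] by auto
  have idx: "\<not> int q dvd idx"
  proof
    assume "int q dvd idx"
    moreover have "idx = int (2 ^ 4 * p * p)" using idx_def d1 by simp
    ultimately have "int q dvd int (2 ^ 4 * p * p)" by simp
    hence "q dvd 2 ^ 4 * p * p" by (simp only: int_dvd_int_iff)
    hence "q dvd 2 \<or> q dvd p" using q(1) by (metis prime_dvd_mult_iff prime_dvd_power)
    thus False using q primes_dvd_imp_eq p two_is_prime_nat by (metis even_numeral dvd_refl)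
  qed
  have prod: "[(a + b * r) * (a - b * r) = int p] (mod int q)"
  proof -
    have "(a + b * r) * (a - b * r) = a\<^sup>2 - b\<^sup>2 * r\<^sup>2" by (simp add: power2_eq_square algebra_simps)
    also have "[a\<^sup>2 - b\<^sup>2 * r\<^sup>2 = a\<^sup>2 - b\<^sup>2 * 2] (mod int q)" by (intro cong_diff cong_mult r) auto
    also have "a\<^sup>2 - b\<^sup>2 * 2 = int p" using ab by simp
    finally show ?thesis .
  qed
  have nz: "\<not> int q dvd a + b * r" "\<not> int q dvd a - b * r"
    using prod qp cong_dvd_iff by (metis dvd_mult2, metis dvd_mult)
  have QR: "Legendre x (int q) = 1 \<longleftrightarrow> QuadRes (int q) x" if "\<not> int q dvd x" for x
    using that by (auto simp: Legendre_def cong_0_iff)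
  have conj: "QuadRes (int q) v" if uv: "QuadRes (int q) u" "[u * v = int p] (mod int q)" for u v
  proof -
    obtain c where c: "[c\<^sup>2 = u] (mod int q)" using uv(1) by (auto simp: QuadRes_def)
    have "\<not> int q dvd c"
    proof
      assume "int q dvd c"
      hence "int q dvd c\<^sup>2" by (simp add: power2_eq_square)
      hence "int q dvd u" using c cong_dvd_iff by blast
      hence "int q dvd u * v" by simp
      thus False using uv(2) qp cong_dvd_iff by blast
    qed
    hence "coprime c (int q)" using prime_imp_coprime[OF pq] by (simp add: coprime_commute)
    then obtain m where m: "[c * m = 1] (mod int q)" using cong_solve_coprime_int by blast
    have "[(s * m)\<^sup>2 = (u * v) * m\<^sup>2] (mod int q)"
      unfolding power_mult_distrib by (intro cong_mult cong_trans[OF s cong_sym[OF uv(2)]]) simp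
    also have "[(u * v) * m\<^sup>2 = (c\<^sup>2 * v) * m\<^sup>2] (mod int q)" by (intro cong_mult cong_sym[OF c]) auto
    also have "(c\<^sup>2 * v) * m\<^sup>2 = (c * m)\<^sup>2 * v" by (simp add: power_mult_distrib)
    also have "[(c * m)\<^sup>2 * v = 1\<^sup>2 * v] (mod int q)" by (intro cong_mult cong_pow m) auto
    finally have "[(s * m)\<^sup>2 = v] (mod int q)" by simp
    thus ?thesis unfolding QuadRes_def by blast
  qed
  show ?thesis
  proof (cases "QuadRes (int q) (a + b * r)")
    case True
    have "QuadRes (int q) (a - b * r)" using conj[OF True prod] .
    hence "\<exists>c. [c\<^sup>2 = a + b * (if e then - r else r)] (mod int q)" for e
      using True unfolding QuadRes_def by (cases e) auto
    then obtain c where c: "\<And>e. [(c e)\<^sup>2 = a + b * (if e then - r else r)] (mod int q)" by metis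
    note le = card_primes_square_le[OF d1 q(1) idx r s c]
    have "card (primes_over q) = 8"
      using le(2) card_primes_square_ge[OF d1 q le(1) r s c] by simp
    thus ?thesis using QR[OF nz(1)] True by (simp add: splits_completely_F)
  next
    case False
    have "\<not> QuadRes (int q) (a - b * r)" using conj[of "a - b * r" "a + b * r"] prod False by (auto simp: mult.commute)
    hence ns: "\<not> QuadRes (int q) (a + b * (if e then - r else r))" for e using False by (cases e) auto
    from card_primes_nonsquare[OF d1 q(1) idx r s ns]
    show ?thesis using QR[OF nz(1)] False by (simp add: splits_completely_F)
  qed
qed

end

section \<open>Representing a prime by x^2 - 2 y^2\<close>

text \<open>By the pigeonhole principle (Thue) there are \<open>x\<close> and \<open>y\<close>, not both zero, of absolute value less
  than \<open>\<surd>p\<close> with \<open>x = r y\<close> modulo \<open>p\<close>. Then \<open>x\<^sup>2 - 2 y\<^sup>2\<close> is a nonzero multiple of \<open>p\<close> strictly between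
  \<open>- 2 p\<close> and \<open>p\<close>, hence equal to \<open>- p\<close>; multiplication by \<open>1 + \<surd>2\<close>, of norm \<open>-1\<close>, changes the sign.\<close>

lemma exists_norm_form:
  assumes p: "prime (p::nat)" and r: "[r\<^sup>2 = 2] (mod int p)"
  obtains a b :: int where "a\<^sup>2 - 2 * b\<^sup>2 = int p"
proof -
  define k where "k = nat \<lfloor>sqrt (real p)\<rfloor>"
  have k1: "k\<^sup>2 \<le> p"
  proof -
    have "real k \<le> sqrt (real p)" by (simp add: k_def)
    hence "(real k)\<^sup>2 \<le> (sqrt (real p))\<^sup>2" by (rule power_mono) simp
    hence "real (k\<^sup>2) \<le> real p" by simp
    thus ?thesis by (simp only: of_nat_le_iff)
  qed
  have k2: "p < (k + 1)\<^sup>2"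
  proof -
    have "sqrt (real p) < real (k + 1)" unfolding k_def by linarith
    hence "(sqrt (real p))\<^sup>2 < (real (k + 1))\<^sup>2" by (rule power_strict_mono) simp_all
    hence "real p < real ((k + 1)\<^sup>2)" by simp
    thus ?thesis by (simp only: of_nat_less_iff)
  qed
  have k3: "k\<^sup>2 < p" using k1 not_square_prime[OF p, of k] by linarith
  define f where "f = (\<lambda>(i, j). (int i - r * int j) mod int p)"
  \<comment> \<open>there are more than \<open>p\<close> pairs, as \<open>k\<close> is the integer part of \<open>\<surd>p\<close>\<close>
  have "card (f ` ({..k} \<times> {..k})) \<le> card {0..<int p}"
    by (rule card_mono) (use prime_gt_0_nat[OF p] in \<open>auto simp: f_def\<close>)
  also have "\<dots> < card ({..k} \<times> {..k})" using k2 by (simp add: card_cartesian_product power2_eq_square)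
  finally have "\<not> inj_on f ({..k} \<times> {..k})" using pigeonhole by blast
  then obtain i j i' j' where ij: "i \<le> k" "j \<le> k" "i' \<le> k" "j' \<le> k" "f (i, j) = f (i', j')" "(i, j) \<noteq> (i', j')"
    unfolding inj_on_def by auto
  define x y where "x = int i - int i'" and "y = int j - int j'"
  have "int p dvd (int i - r * int j) - (int i' - r * int j')" using ij(5) by (simp add: f_def mod_eq_dvd_iff)
  also have "(int i - r * int j) - (int i' - r * int j') = x - r * y" by (simp add: x_def y_def algebra_simps)
  finally have d: "int p dvd x - r * y" .
  have "[x = r * y] (mod int p)" using d by (simp add: cong_iff_dvd_diff)
  hence "[x\<^sup>2 - 2 * y\<^sup>2 = (r * y)\<^sup>2 - 2 * y\<^sup>2] (mod int p)" by (intro cong_diff cong_pow) auto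
  also have "(r * y)\<^sup>2 - 2 * y\<^sup>2 = r\<^sup>2 * y\<^sup>2 - 2 * y\<^sup>2" by (simp add: power_mult_distrib)
  also have "[r\<^sup>2 * y\<^sup>2 - 2 * y\<^sup>2 = 2 * y\<^sup>2 - 2 * y\<^sup>2] (mod int p)" by (intro cong_diff cong_mult r) auto
  finally have dv: "int p dvd x\<^sup>2 - 2 * y\<^sup>2" by (simp add: cong_0_iff)
  have sq: "v\<^sup>2 < int p" if "\<bar>v\<bar> \<le> int k" for v
  proof -
    have "\<bar>v\<bar>\<^sup>2 \<le> (int k)\<^sup>2" using that by (rule power_mono) simp
    also have "\<dots> = int (k\<^sup>2)" by simp
    also have "\<dots> < int p" using k3 by (simp only: of_nat_less_iff)
    finally show ?thesis by simp
  qed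
  have xy: "x\<^sup>2 < int p" "y\<^sup>2 < int p" by (rule sq; use ij in \<open>simp add: x_def y_def\<close>)+
  have ne: "x\<^sup>2 - 2 * y\<^sup>2 \<noteq> 0"
  proof
    assume e: "x\<^sup>2 - 2 * y\<^sup>2 = 0"
    show False
    proof (cases "y = 0")
      case True
      thus False using e ij(6) by (simp add: x_def y_def)
    next
      case False
      have "(of_int (x\<^sup>2) :: complex) = of_int (2 * y\<^sup>2)" using e by simp
      hence "(of_int x / of_int y :: complex)\<^sup>2 = of_nat 2" using False by (simp add: power_divide field_simps)
      then obtain m :: nat where "2 = m\<^sup>2" using Rats_square_int[of "of_int x / of_int y" 2] by auto
      thus False using not_square_prime[of 2 m] by simp
    qed
  qed
  obtain c where c: "x\<^sup>2 - 2 * y\<^sup>2 = int p * c" using dv by (rule dvdE)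
  have p0: "int p > 0" using prime_gt_0_nat[OF p] by simp
  have "int p * c < int p * 1" "int p * (-2) < int p * c" using c xy zero_le_power2[of x] zero_le_power2[of y] by linarith+
  hence "c < 1" "- 2 < c" using p0 by (simp_all only: mult_less_cancel_left_pos)
  moreover have "c \<noteq> 0" using ne c by auto
  ultimately have "c = - 1" by linarith
  hence "(x + 2 * y)\<^sup>2 - 2 * (x + y)\<^sup>2 = int p" using c by (simp add: power2_eq_square algebra_simps)
  thus thesis by (rule that)
qed

text \<open>Modulo \<open>8\<close> the equation forces \<open>a\<close> odd and \<open>b\<close> even. If \<open>b\<close> is not divisible by \<open>4\<close>, multiplication
  by the unit \<open>3 + 2 \<surd>2\<close> of norm \<open>1\<close> makes it so.\<close>

lemma exists_normalized_norm_form: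
  assumes p: "prime (p::nat)" "p mod 8 = 1" and r: "[r\<^sup>2 = 2] (mod int p)"
  obtains a b :: int where "a\<^sup>2 - 2 * b\<^sup>2 = int p" "a mod 4 = 1" "b mod 4 = 0"
proof -
  obtain a b :: int where ab: "a\<^sup>2 - 2 * b\<^sup>2 = int p" using exists_norm_form[OF p(1) r] .
  have p8: "int p mod 8 = 1" using p(2) by presburger
  have oa: "odd a"
  proof
    assume "even a"
    hence "even (a\<^sup>2 - 2 * b\<^sup>2)" by simp
    thus False unfolding ab using p8 by presburger
  qed
  have eb: "even b"
  proof (rule ccontr)
    assume "odd b"
    then obtain m where m: "b = 2 * m + 1" by (rule oddE)
    obtain n where n: "a = 2 * n + 1" using oa by (rule oddE)
    have "int p = 4 * (n * (n + 1)) - 8 * (m * (m + 1)) - 1"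
      unfolding ab[symmetric] m n by (simp add: power2_eq_square algebra_simps)
    moreover have "even (n * (n + 1))" by simp
    ultimately show False using p8 by presburger
  qed
  have "\<exists>a b. a\<^sup>2 - 2 * b\<^sup>2 = int p \<and> odd a \<and> b mod 4 = 0"
  proof (cases "b mod 4 = 0")
    case True
    thus ?thesis using ab oa by (intro exI[of _ a] exI[of _ b]) simp
  next
    case False
    have "(3 * a + 4 * b)\<^sup>2 - 2 * (2 * a + 3 * b)\<^sup>2 = int p"
      unfolding ab[symmetric] by (simp add: power2_eq_square algebra_simps)
    moreover have "odd (3 * a + 4 * b)" using oa by simp
    moreover have "(2 * a + 3 * b) mod 4 = 0" using False eb oa by presburger
    ultimately show ?thesis by (intro exI[of _ "3 * a + 4 * b"] exI[of _ "2 * a + 3 * b"]) simp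
  qed
  then obtain a b :: int where ab: "a\<^sup>2 - 2 * b\<^sup>2 = int p" "odd a" "b mod 4 = 0" by metis
  have "a mod 4 = 1 \<or> (- a) mod 4 = 1" using ab(2) by presburger
  thus thesis using that[of a b] that[of "- a" b] ab by auto
qed

section \<open>The Redei symbol as a residue symbol\<close>

lemma sqrt_mod_if_Legendre_1: "Legendre x (int l) = 1 \<Longrightarrow> \<exists>r. [r\<^sup>2 = x] (mod int l)"
  by (auto simp: Legendre_def QuadRes_def split: if_splits)

theorem redei2_eq_Legendre:
  assumes "two_primes p q"
  obtains a b r :: int
    where "a\<^sup>2 - 2 * b\<^sup>2 = int p" "[r\<^sup>2 = 2] (mod int q)" "sgn_bit (redei2 p q) = Legendre (a + b * r) (int q)"
proof -
  interpret two_primes p q by (rule assms)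
  interpret S: two_primes q p by (rule swap)
  obtain rp where rp: "[rp\<^sup>2 = 2] (mod int p)" using sqrt_mod_if_Legendre_1[OF Legendre_2_p] by blast
  obtain r where r: "[r\<^sup>2 = 2] (mod int q)" using sqrt_mod_if_Legendre_1[OF S.Legendre_2_p] by blast
  obtain s where s: "[s\<^sup>2 = int p] (mod int q)" using sqrt_mod_if_Legendre_1[OF leg_pq] by blast
  obtain a b where ab: "a\<^sup>2 - 2 * b\<^sup>2 = int p" "a mod 4 = 1" "b mod 4 = 0"
    using exists_normalized_norm_form[OF p p8 rp] .
  interpret R: redei_data p a b 1 "csqrt (of_int a + of_int b * csq 2)"
    using p p8 ab by unfold_locales simp_all
  have q2: "odd q" using q8 by presburger
  have nz: "Legendre (a + b * r) (int q) \<noteq> 0"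
  proof
    assume "Legendre (a + b * r) (int q) = 0"
    hence "int q dvd a + b * r" using Legendre_eq_0_iff by blast
    hence "int q dvd (a + b * r) * (a - b * r)" by simp
    also have "(a + b * r) * (a - b * r) = int p + b\<^sup>2 * (2 - r\<^sup>2)"
      unfolding ab(1)[symmetric] by (simp add: power2_eq_square algebra_simps)
    finally have "int q dvd int p + b\<^sup>2 * (2 - r\<^sup>2)" .
    moreover have "int q dvd b\<^sup>2 * (2 - r\<^sup>2)" using cong_sym[OF r] by (simp add: cong_iff_dvd_diff)
    ultimately show False using not_q_dvd_p by (simp add: dvd_add_left_iff)
  qed
  have "redei2 p q = 0 \<longleftrightarrow> Legendre (a + b * r) (int q) = 1"
    using R.splits_completely_iff_Legendre[OF refl q q2 pq[symmetric] r s] R.redei_field_eq[OF refl]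
    by (simp add: redei2_def)
  hence "sgn_bit (redei2 p q) = Legendre (a + b * r) (int q)"
    using nz Legendre_cases[of "a + b * r" "int q"] by (auto simp: sgn_bit_def)
  thus thesis using that ab(1) r by blast
qed

theorem theorem4p10:
  fixes p q :: nat and U V R e\<^sub>p e\<^sub>q :: bit
  assumes "prime p" and "prime q" and "p \<noteq> q"
    and "[p = 1] (mod 8)" and "[q = 1] (mod 8)"
    and "Jacobi (int q) p = 1"
  defines "U \<equiv> add_quartic (int p) q"
    and "V \<equiv> add_quartic (int q) p"
    and "R \<equiv> redei2 p q"
    and "e\<^sub>p \<equiv> of_nat ((p - 1) div 8)"
    and "e\<^sub>q \<equiv> of_nat ((q - 1) div 8)"
  shows "(\<forall>\<alpha> \<beta> \<gamma> \<alpha>' \<beta>' \<gamma>' \<alpha>'' \<beta>'' \<gamma>''.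
            primitive_solution (int p) (int q) \<alpha> \<beta> \<gamma> \<and>
            primitive_solution (int p) (- int q) \<alpha>' \<beta>' \<gamma>' \<and>
            primitive_solution (int p) (- 2 * int q) \<alpha>'' \<beta>'' \<gamma>'' \<longrightarrow>
              add_Jacobi \<gamma> q = U \<and> add_Jacobi \<gamma> p = V \<and> add_Jacobi (\<gamma>' * \<gamma>'') q = R \<and>
              Pf p q \<gamma> \<gamma>' \<gamma>'' = c_sym p * c_sym q + c_sym p * U + c_sym q * V + R * (U + V)) \<and>
         (\<forall>\<alpha>\<^sub>p \<beta>\<^sub>p \<gamma>\<^sub>p \<alpha>\<^sub>q \<beta>\<^sub>q \<gamma>\<^sub>q \<alpha>\<^sub>p' \<beta>\<^sub>p' \<gamma>\<^sub>p' \<alpha>\<^sub>q' \<beta>\<^sub>q' \<gamma>\<^sub>q' \<alpha>\<^sub>p'' \<beta>\<^sub>p'' \<gamma>\<^sub>p''.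
            primitive_solution (int p) (2 * int q) \<alpha>\<^sub>p \<beta>\<^sub>p \<gamma>\<^sub>p \<and>
            primitive_solution (int q) (2 * int p) \<alpha>\<^sub>q \<beta>\<^sub>q \<gamma>\<^sub>q \<and>
            primitive_solution (int p) (- 2 * int q) \<alpha>\<^sub>p' \<beta>\<^sub>p' \<gamma>\<^sub>p' \<and>
            primitive_solution (int q) (- 2 * int p) \<alpha>\<^sub>q' \<beta>\<^sub>q' \<gamma>\<^sub>q' \<and>
            primitive_solution (int p) (- 4 * int q) \<alpha>\<^sub>p'' \<beta>\<^sub>p'' \<gamma>\<^sub>p'' \<longrightarrow>
              Pf2 p q \<gamma>\<^sub>p \<gamma>\<^sub>p' \<gamma>\<^sub>q' \<gamma>\<^sub>p'' = R + e\<^sub>p * e\<^sub>q + e\<^sub>p * U + e\<^sub>q * V)"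
proof -
  have t: "two_primes p q"
    using assms(1-6) by unfold_locales (simp_all add: cong_def Jacobi_prime)
  interpret two_primes p q by (rule t)
  interpret S: two_primes q p by (rule swap)
  obtain a b r where ab: "a\<^sup>2 - 2 * b\<^sup>2 = int p" "[r\<^sup>2 = 2] (mod int q)" "sgn_bit R = Legendre (a + b * r) (int q)"
    using redei2_eq_Legendre[OF t] unfolding R_def .
  obtain r' where r': "[r'\<^sup>2 = 2] (mod int p)" using sqrt_mod_if_Legendre_1[OF Legendre_2_p] by blast
  obtain a' b' where ab': "a'\<^sup>2 - 2 * b'\<^sup>2 = int q" using exists_norm_form[OF q ab(2)] .
  show ?thesis
  proof (intro conjI allI impI; elim conjE)
    fix \<alpha> \<beta> \<gamma> \<alpha>' \<beta>' \<gamma>' \<alpha>'' \<beta>'' \<gamma>''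
    assume "primitive_solution (int p) (int q) \<alpha> \<beta> \<gamma>" "primitive_solution (int p) (- int q) \<alpha>' \<beta>' \<gamma>'"
      "primitive_solution (int p) (- 2 * int q) \<alpha>'' \<beta>'' \<gamma>''"
    note e = Pf_identities[OF ab this, folded U_def V_def]
    show "add_Jacobi \<gamma> q = U" "add_Jacobi \<gamma> p = V" "add_Jacobi (\<gamma>' * \<gamma>'') q = R" by (rule e)+
    show "Pf p q \<gamma> \<gamma>' \<gamma>'' = c_sym p * c_sym q + c_sym p * U + c_sym q * V + R * (U + V)"
      by (simp only: Pf_def Let_def e)
  next
    fix \<alpha>\<^sub>p \<beta>\<^sub>p \<gamma>\<^sub>p \<alpha>\<^sub>q \<beta>\<^sub>q \<gamma>\<^sub>q \<alpha>\<^sub>p' \<beta>\<^sub>p' \<gamma>\<^sub>p' \<alpha>\<^sub>q' \<beta>\<^sub>q' \<gamma>\<^sub>q' \<alpha>\<^sub>p'' \<beta>\<^sub>p'' \<gamma>\<^sub>p''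
    assume s: "primitive_solution (int p) (2 * int q) \<alpha>\<^sub>p \<beta>\<^sub>p \<gamma>\<^sub>p"
      "primitive_solution (int p) (- 2 * int q) \<alpha>\<^sub>p' \<beta>\<^sub>p' \<gamma>\<^sub>p'"
      "primitive_solution (int q) (- 2 * int p) \<alpha>\<^sub>q' \<beta>\<^sub>q' \<gamma>\<^sub>q'"
      "primitive_solution (int p) (- 4 * int q) \<alpha>\<^sub>p'' \<beta>\<^sub>p'' \<gamma>\<^sub>p''"
    show "Pf2 p q \<gamma>\<^sub>p \<gamma>\<^sub>p' \<gamma>\<^sub>q' \<gamma>\<^sub>p'' = R + e\<^sub>p * e\<^sub>q + e\<^sub>p * U + e\<^sub>q * V"
      using Pf2_identity[OF ab ab' r' s] unfolding U_def V_def e\<^sub>p_def e\<^sub>q_def .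
  qed
qed

end
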